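(* Let $u$ be a mild bounded ancient solution to the Navier-Stokes equations in the half space $\mathbb R^2_+$ (in the sense defined in the context). Assume in addition that $u\in L_{2,\infty}(Q_-^+)$. Then $u$ is identically equal to zero.
   Context: Notation. $\mathbb R^2_+=\{x=(x_1,x_2)\in\mathbb R^2: x_2>0\}$, $Q_-^+=\mathbb R^2_+\times\{t<0\}$, $Q_-=\mathbb R^2\times\{t<0\}$. $L_{2,\infty}(Q_-^+)$ is the space of functions on $Q_-^+$ with $\operatorname{ess\,sup}_{t<0}\|u(\cdot,t)\|_{L_2(\mathbb R^2_+)}<\infty$. A comma followed by an index $j$ denotes the partial derivative with respect to $x_j$; $(u\otimes u)_{ij}=u_iu_j$, $A:B=\sum_{i,j}A_{ij}B_{ij}$. Definition. A vector field $u: Q_-^+\to\mathbb R^2$ is a mild bounded ancient solution to the Navier-Stokes equations in the half space (with homogeneous Dirichlet boundary condition) if $u\in L_\infty(Q_-^+)$, normalized so that $|u|\le 1$ a.e. in $Q_-^+$, and there exists a scalar function $p$ on $Q_-^+$ such that, for any $t<0$, $p=p^1+p^2$, where: (i) $\triangle p^1=-\operatorname{div}\operatorname{div}(u\otimes u)$ in $Q_-^+$ with the Neumann boundary condition $p^1_{,2}=0$ on $x_2=0$, and the even extension of $p^1$ in $x_2$ to $\mathbb R^2$ belongs to $L_\infty(-\infty,0;BMO(\mathbb R^2))$; (ii) $p^2(\cdot,t)$ is a harmonic function in $\mathbb R^2_+$ whose gradient satisfies $|\nabla p^2(x,t)|\le c\ln(2+1/x_2)$ for all $(x,t)\in Q_-^+$,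 with a constant $c$, and $\sup_{x_1\in\mathbb R}|\nabla p^2(x,t)|\to 0$ as $x_2\to\infty$; (iii) $u$ and $p$ satisfy the Navier-Stokes system and the boundary condition $u(x_1,0,t)=0$ in the following weak sense: $$\int_{Q_-^+}\Big(u\cdot(\partial_t\varphi+\triangle\varphi)+u\otimes u:\nabla\varphi+p\,\operatorname{div}\varphi\Big)\,dx\,dt=0$$ for any vector-valued $\varphi\in C_0^\infty(Q_-)$ with $\varphi(x_1,0,t)=0$ for all $x_1\in\mathbb R$ (and all $t<0$), and $$\int_{Q_-^+}u\cdot\nabla q\,dx\,dt=0$$ for any scalar $q\in C_0^\infty(Q_-)$. *)

theory Defs
  imports "HOL-Analysis.Analysis" "HOL-Probability.Essential_Supremum"
begin

text \<open>Points of space-time are pairs \<open>(x, t)\<close>. Fields live on the whole space as total functions;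
  only their values on \<open>QmPlus\<close> matter.\<close>

definition half_plane :: "(real^2) set" where
  "half_plane = {x. x $ 2 > 0}"

definition QmPlus :: "((real^2) \<times> real) set" where
  "QmPlus = half_plane \<times> {..<0}"

definition Qm :: "((real^2) \<times> real) set" where
  "Qm = UNIV \<times> {..<0}"


text \<open>\<open>C\<^sup>k\<close> functions on an open set, and the test functions \<open>C\<^sub>0\<^sup>\<infinity>(\<Omega>)\<close>, extended by zero.\<close>

primrec Ck_on :: "nat \<Rightarrow> 'a::euclidean_space set \<Rightarrow> ('a \<Rightarrow> 'b::real_normed_vector) \<Rightarrow> bool" where
  "Ck_on 0 S f \<longleftrightarrow> continuous_on S f"
| "Ck_on (Suc k) S f \<longleftrightarrow> (\<forall>x\<in>S. f differentiable (at x)) \<and>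
     (\<forall>v. Ck_on k S (\<lambda>x. frechet_derivative f (at x) v))"

definition test_function :: "'a::euclidean_space set \<Rightarrow> ('a \<Rightarrow> 'b::real_normed_vector) \<Rightarrow> bool" where
  "test_function \<Omega> f \<longleftrightarrow> (\<forall>k. Ck_on k UNIV f) \<and>
     compact (closure {x. f x \<noteq> 0}) \<and> closure {x. f x \<noteq> 0} \<subseteq> \<Omega>"


text \<open>Spatial differential operators; for space-time functions they are applied to time slices.\<close>

definition partial :: "2 \<Rightarrow> (real^2 \<Rightarrow> 'b::real_normed_vector) \<Rightarrow> real^2 \<Rightarrow> 'b" where
  "partial j f x = frechet_derivative f (at x) (axis j 1)"

definition laplacian :: "(real^2 \<Rightarrow> 'b::real_normed_vector) \<Rightarrow> real^2 \<Rightarrow> 'b" where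
  "laplacian f x = (\<Sum>j\<in>UNIV. partial j (partial j f) x)"

definition grad :: "(real^2 \<Rightarrow> real) \<Rightarrow> real^2 \<Rightarrow> real^2" where
  "grad f x = (\<chi> j. partial j f x)"

definition divergence :: "(real^2 \<Rightarrow> real^2) \<Rightarrow> real^2 \<Rightarrow> real" where
  "divergence f x = (\<Sum>j\<in>UNIV. partial j f x $ j)"

definition harmonic_on :: "(real^2) set \<Rightarrow> (real^2 \<Rightarrow> real) \<Rightarrow> bool" where
  "harmonic_on S h \<longleftrightarrow> Ck_on 2 S h \<and> (\<forall>x\<in>S. laplacian h x = 0)"


definition mean_on :: "(real^2) set \<Rightarrow> (real^2 \<Rightarrow> real) \<Rightarrow> real" where
  "mean_on B f = (LINT y:B|lebesgue. f y) / measure lebesgue B"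

definition bmo_seminorm :: "(real^2 \<Rightarrow> real) \<Rightarrow> ennreal" where
  "bmo_seminorm f = (SUP (x, r) \<in> UNIV \<times> {0<..}.
     (\<integral>\<^sup>+ y\<in>ball x r. ennreal \<bar>f y - mean_on (ball x r) f\<bar> \<partial>lebesgue) / emeasure lebesgue (ball x r))"

definition BMO :: "(real^2 \<Rightarrow> real) set" where
  "BMO = {f. (\<forall>K. compact K \<longrightarrow> set_integrable lebesgue K f) \<and> bmo_seminorm f < \<infinity>}"

definition Linfty_BMO :: "((real^2) \<times> real \<Rightarrow> real) \<Rightarrow> bool" where
  "Linfty_BMO f \<longleftrightarrow> f \<in> borel_measurable (lebesgue_on Qm) \<and>
     (AE t in lebesgue_on {..<0}. (\<lambda>x. f (x, t)) \<in> BMO) \<and>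
     esssup (lebesgue_on {..<0}) (\<lambda>t. bmo_seminorm (\<lambda>x. f (x, t))) < \<infinity>"

definition even_ext :: "((real^2) \<times> real \<Rightarrow> real) \<Rightarrow> (real^2) \<times> real \<Rightarrow> real" where
  "even_ext f = (\<lambda>(x, t). f (vector [x $ 1, \<bar>x $ 2\<bar>], t))"

definition L2_infty :: "((real^2) \<times> real \<Rightarrow> real^2) \<Rightarrow> bool" where
  "L2_infty u \<longleftrightarrow> u \<in> borel_measurable (lebesgue_on QmPlus) \<and>
     esssup (lebesgue_on {..<0})
       (\<lambda>t. \<integral>\<^sup>+ x\<in>half_plane. ennreal ((norm (u (x, t)))\<^sup>2) \<partial>lebesgue) < \<infinity>"


text \<open>Weak form of \<open>\<Delta>p = - div div (u \<otimes> u)\<close> in the half plane with \<open>p\<^sub>,\<^sub>2 = 0\<close> on \<open>x\<^sub>2 = 0\<close>, at a.e. time.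
  Testing with functions whose normal derivative vanishes on the boundary encodes the Neumann
  condition: two integrations by parts leave only \<open>p\<^sub>,\<^sub>2\<close> on the boundary, the boundary terms
  of \<open>u \<otimes> u\<close> being zero because \<open>u\<close> vanishes there.\<close>

definition neumann_pressure :: "((real^2) \<times> real \<Rightarrow> real^2) \<Rightarrow> ((real^2) \<times> real \<Rightarrow> real) \<Rightarrow> bool" where
  "neumann_pressure u p \<longleftrightarrow>
     (AE t in lebesgue_on {..<0}. \<forall>\<phi> :: real^2 \<Rightarrow> real.
        test_function UNIV \<phi> \<and> (\<forall>x. x $ 2 = 0 \<longrightarrow> partial 2 \<phi> x = 0) \<longrightarrow>
        (LINT x:half_plane|lebesgue. p (x, t) * laplacian \<phi> x) =
        - (LINT x:half_plane|lebesgue.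
             (\<Sum>i\<in>UNIV. \<Sum>j\<in>UNIV. u (x, t) $ i * u (x, t) $ j * partial i (partial j \<phi>) x)))"

definition harmonic_pressure :: "((real^2) \<times> real \<Rightarrow> real) \<Rightarrow> bool" where
  "harmonic_pressure p \<longleftrightarrow>
     (\<forall>t<0. harmonic_on half_plane (\<lambda>x. p (x, t))) \<and>
     (\<exists>c. \<forall>(x, t)\<in>QmPlus. norm (grad (\<lambda>y. p (y, t)) x) \<le> c * ln (2 + 1 / x $ 2)) \<and>
     (\<forall>t<0. ((\<lambda>s. SUP x1::real. norm (grad (\<lambda>y. p (y, t)) (vector [x1, s]))) \<longlongrightarrow> 0) at_top)"

text \<open>The test functions below need not vanish near the boundary \<open>x\<^sub>2 = 0\<close>, so \<open>p\<close> has to be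
  integrable up to it; otherwise the integral would be the default value 0.\<close>

definition weak_navier_stokes :: "((real^2) \<times> real \<Rightarrow> real^2) \<Rightarrow> ((real^2) \<times> real \<Rightarrow> real) \<Rightarrow> bool" where
  "weak_navier_stokes u p \<longleftrightarrow>
     (\<forall>K. compact K \<and> K \<subseteq> Qm \<longrightarrow> set_integrable lebesgue (K \<inter> QmPlus) p) \<and>
     (\<forall>\<phi> :: (real^2) \<times> real \<Rightarrow> real^2.
        test_function Qm \<phi> \<and> (\<forall>x t. x $ 2 = 0 \<and> t < 0 \<longrightarrow> \<phi> (x, t) = 0) \<longrightarrow>
        (LINT (x, t):QmPlus|lebesgue.
           u (x, t) \<bullet> (vector_derivative (\<lambda>s. \<phi> (x, s)) (at t) + laplacian (\<lambda>y. \<phi> (y, t)) x)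
           + (\<Sum>i\<in>UNIV. \<Sum>j\<in>UNIV. u (x, t) $ i * u (x, t) $ j * partial j (\<lambda>y. \<phi> (y, t)) x $ i)
           + p (x, t) * divergence (\<lambda>y. \<phi> (y, t)) x) = 0) \<and>
     (\<forall>q :: (real^2) \<times> real \<Rightarrow> real. test_function Qm q \<longrightarrow>
        (LINT (x, t):QmPlus|lebesgue. u (x, t) \<bullet> grad (\<lambda>y. q (y, t)) x) = 0)"

definition mild_bounded_ancient_solution :: "((real^2) \<times> real \<Rightarrow> real^2) \<Rightarrow> bool" where
  "mild_bounded_ancient_solution u \<longleftrightarrow>
     u \<in> borel_measurable (lebesgue_on QmPlus) \<and>
     (AE z in lebesgue_on QmPlus. norm (u z) \<le> 1) \<and>
     (\<exists>p p1 p2. (\<forall>z\<in>QmPlus. p z = p1 z + p2 z) \<and>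
        neumann_pressure u p1 \<and> Linfty_BMO (even_ext p1) \<and>
        harmonic_pressure p2 \<and> weak_navier_stokes u p)"

end

theory Submission
  imports Defs "HOL-Real_Asymp.Real_Asymp"
begin

text \<open>Only the energy bound and divergence free test fields are used, so the pressure plays no role.
  Testing with \<open>(\<partial>\<eta>/\<partial>y, - \<partial>\<eta>/\<partial>x)\<close>, \<open>\<eta> = a(x) c(t) b(y)\<close>, and mollifying in \<open>t\<close> and \<open>x\<close> turns the weak
  equation into a third order ordinary differential equation in \<open>y\<close> whose \<open>L\<^sup>2\<close> solutions are regular
  up to the boundary. This yields an identity for the time derivative of \<open>(U(s), U(\<sigma>))\<close>, \<open>U\<close> being the
  mollified flow. For \<open>s = \<sigma>\<close> it is the energy inequality, which makes the dissipation \<open>D\<close> integrable on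
  \<open>(-\<infinity>, 0)\<close>; hence \<open>\<bar>s\<bar> D(s)\<close> is arbitrarily small at suitable, arbitrarily early times \<open>s\<close>. At such
  times the identity shows that \<open>\<parallel>U(s)\<parallel>\<^sup>2\<close> is close to \<open>(U(t), U(s))\<close> for \<open>-2 \<le> t \<le> -1\<close>; the latter is small
  since \<open>U(s)\<close> is small on every strip \<open>0 < y < L\<close> by Poincare's inequality and \<open>U(t)\<close> is small on
  \<open>y > L\<close>. The energy at later times being controlled by that at \<open>s\<close>, the flow vanishes.\<close>

subsection \<open>Square integrable functions\<close>

text \<open>Mollifying in \<open>y\<close> would mix values across the wall and spoil the boundary
  condition, so \<open>y\<close> is left alone and regularity in \<open>y\<close> has to come out of
  the equation itself. Mollification does not commute with the products u_i u_j, and the resulting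
  error is small only on a time slab fixed beforehand, not on (-\<infinity>, 0). Every estimate is
  therefore kept uniform in the mollifier, and the window in which the early time s is sought is
  fixed before the mollifier is chosen. That |s| D(s) is the right quantity is seen from the rate of
  change of (U(t), U(s)) in t: up to the error it is at most a multiple of D(t)^(1/2) D(s)^(1/2), so
  its integral from s to t is at most a multiple of (integral of D)^(1/2) (|s| D(s))^(1/2). The
  convective part obeys the same bound because in two dimensions the square of the L4 norm is at
  most a multiple of the L2 norm times D^(1/2), and the L2 norm is bounded. Smallness of U(t) far
  from the wall only concerns a bounded time interval, on which the flow is a single square
  integrable function of space-time and so has small tails.\<close>

definition sq_integrable :: "'a measure \<Rightarrow> ('a \<Rightarrow> real) \<Rightarrow> bool" where
  "sq_integrable M f \<longleftrightarrow> f \<in> borel_measurable M \<and> integrable M (\<lambda>x. (f x)\<^sup>2)"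

lemma sq_integrable_measurable [measurable_dest]: "sq_integrable M f \<Longrightarrow> f \<in> borel_measurable M"
  by (simp add: sq_integrable_def)

lemma sq_integrableD:
  assumes "sq_integrable M f"
  shows "f \<in> borel_measurable M" "integrable M (\<lambda>x. (f x)\<^sup>2)"
  using assms by (simp_all add: sq_integrable_def)

lemma sq_integrable_times:
  assumes "sq_integrable M f" "sq_integrable M g"
  shows "integrable M (\<lambda>x. f x * g x)"
proof (rule Bochner_Integration.integrable_bound)
  show "integrable M (\<lambda>x. (f x)\<^sup>2 + (g x)\<^sup>2)"
    using assms[THEN sq_integrableD(1)] assms[THEN sq_integrableD(2)] by auto
  show "(\<lambda>x. f x * g x) \<in> borel_measurable M"
    using assms[THEN sq_integrableD(1)] assms[THEN sq_integrableD(2)] by auto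
  show "AE x in M. norm (f x * g x) \<le> norm ((f x)\<^sup>2 + (g x)\<^sup>2)"
  proof (rule AE_I2)
    fix x
    have "2 * \<bar>f x\<bar> * \<bar>g x\<bar> \<le> (f x)\<^sup>2 + (g x)\<^sup>2" "0 \<le> \<bar>f x\<bar> * \<bar>g x\<bar>"
      using sum_squares_bound[of "\<bar>f x\<bar>" "\<bar>g x\<bar>"] by auto
    then show "norm (f x * g x) \<le> norm ((f x)\<^sup>2 + (g x)\<^sup>2)"
      unfolding real_norm_def abs_mult by linarith
  qed
qed

lemma sq_integrable_bound:
  fixes f g :: "'a \<Rightarrow> real"
  assumes f: "sq_integrable M f" and g: "g \<in> borel_measurable M" and le: "AE x in M. \<bar>g x\<bar> \<le> \<bar>f x\<bar>"
  shows "sq_integrable M g"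
  unfolding sq_integrable_def
proof
  show "integrable M (\<lambda>x. (g x)\<^sup>2)"
  proof (rule Bochner_Integration.integrable_bound)
    show "integrable M (\<lambda>x. (f x)\<^sup>2)" using f by (rule sq_integrableD)
    show "AE x in M. norm ((g x)\<^sup>2) \<le> norm ((f x)\<^sup>2)"
      using le by eventually_elim (simp add: abs_le_square_iff)
    show "(\<lambda>x. (g x)\<^sup>2) \<in> borel_measurable M" using g by measurable
  qed
qed fact

lemma sq_integrable_cmult:
  assumes "sq_integrable M f"
  shows "sq_integrable M (\<lambda>x. c * f x)"
  using assms unfolding sq_integrable_def by (auto simp: power_mult_distrib)

lemma sq_integrable_uminus:
  assumes "sq_integrable M f"
  shows "sq_integrable M (\<lambda>x. - f x)"
  using assms by (simp add: sq_integrable_def)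

lemma sq_integrable_add:
  assumes f: "sq_integrable M f" and g: "sq_integrable M g"
  shows "sq_integrable M (\<lambda>x. f x + g x)"
  unfolding sq_integrable_def
proof
  note [measurable] = sq_integrableD(1)[OF f] sq_integrableD(1)[OF g]
  show "(\<lambda>x. f x + g x) \<in> borel_measurable M" by measurable
  have "(\<lambda>x. (f x + g x)\<^sup>2) = (\<lambda>x. (f x)\<^sup>2 + 2 * (f x * g x) + (g x)\<^sup>2)"
    by (simp add: power2_sum algebra_simps)
  moreover have "integrable M \<dots>"
    using sq_integrableD(2)[OF f] sq_integrableD(2)[OF g] sq_integrable_times[OF f g] by simp
  ultimately show "integrable M (\<lambda>x. (f x + g x)\<^sup>2)" by simp
qed

lemma sq_integrable_diff:
  assumes "sq_integrable M f" "sq_integrable M g"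
  shows "sq_integrable M (\<lambda>x. f x - g x)"
  using sq_integrable_add[OF assms(1) sq_integrable_uminus[OF assms(2)]] by simp

lemma sq_integrable_abs:
  assumes "sq_integrable M f"
  shows "sq_integrable M (\<lambda>x. \<bar>f x\<bar>)"
  using assms unfolding sq_integrable_def by auto

lemma sq_integrable_bounded_times:
  assumes f: "sq_integrable M f" and h: "h \<in> borel_measurable M" "\<And>x. \<bar>h x\<bar> \<le> B"
  shows "sq_integrable M (\<lambda>x. h x * f x)"
proof (rule sq_integrable_bound)
  show "sq_integrable M (\<lambda>x. B * f x)" using f by (rule sq_integrable_cmult)
  show "AE x in M. \<bar>h x * f x\<bar> \<le> \<bar>B * f x\<bar>"
  proof (rule AE_I2)
    fix x
    have "\<bar>h x\<bar> \<le> \<bar>B\<bar>" using h(2)[of x] by linarith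
    then show "\<bar>h x * f x\<bar> \<le> \<bar>B * f x\<bar>" unfolding abs_mult by (intro mult_right_mono) auto
  qed
  show "(\<lambda>x. h x * f x) \<in> borel_measurable M" using h(1) sq_integrableD(1)[OF f] by measurable
qed

lemma integral_square_nonneg [simp]: "0 \<le> (\<integral>x. (f x)\<^sup>2 \<partial>M)" for f :: "'a \<Rightarrow> real"
  by simp

lemma Cauchy_Schwarz_integral_abs:
  assumes f: "sq_integrable M f" and g: "sq_integrable M g"
  shows "(\<integral>x. \<bar>f x * g x\<bar> \<partial>M) \<le> sqrt (\<integral>x. (f x)\<^sup>2 \<partial>M) * sqrt (\<integral>x. (g x)\<^sup>2 \<partial>M)"
proof -
  define a b c where "a = (\<integral>x. (f x)\<^sup>2 \<partial>M)" and "b = (\<integral>x. (g x)\<^sup>2 \<partial>M)"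
    and "c = (\<integral>x. \<bar>f x * g x\<bar> \<partial>M)"
  have [simp]: "0 \<le> a" "0 \<le> b" "0 \<le> c" by (auto simp: a_def b_def c_def)
  have key: "2 * (s * r * c) \<le> s\<^sup>2 * a + r\<^sup>2 * b" for s r :: real
  proof -
    have "2 * (s * r * c) = (\<integral>x. 2 * (s * r * \<bar>f x * g x\<bar>) \<partial>M)"
      by (simp add: c_def)
    also have "\<dots> \<le> (\<integral>x. s\<^sup>2 * (f x)\<^sup>2 + r\<^sup>2 * (g x)\<^sup>2 \<partial>M)"
    proof (rule integral_mono)
      show "integrable M (\<lambda>x. 2 * (s * r * \<bar>f x * g x\<bar>))"
        using sq_integrable_times[OF f g] by simp
      show "integrable M (\<lambda>x. s\<^sup>2 * (f x)\<^sup>2 + r\<^sup>2 * (g x)\<^sup>2)" using sq_integrableD[OF f] sq_integrableD[OF g] by auto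
      fix x
      have "2 * (s * \<bar>f x\<bar>) * (r * \<bar>g x\<bar>) \<le> (s * \<bar>f x\<bar>)\<^sup>2 + (r * \<bar>g x\<bar>)\<^sup>2"
        by (rule sum_squares_bound)
      then show "2 * (s * r * \<bar>f x * g x\<bar>) \<le> s\<^sup>2 * (f x)\<^sup>2 + r\<^sup>2 * (g x)\<^sup>2"
        by (simp add: power_mult_distrib abs_mult algebra_simps)
    qed
    also have "\<dots> = s\<^sup>2 * a + r\<^sup>2 * b"
      using sq_integrableD[OF f] sq_integrableD[OF g] by (auto simp: a_def b_def)
    finally show ?thesis .
  qed
  have "c\<^sup>2 \<le> a * b"
  proof (cases "b = 0")
    case True
    have "c \<le> 0"
    proof (rule ccontr)
      assume "\<not> c \<le> 0"
      then have "2 * (a + 1) \<le> a" using key[of 1 "(a+1)/c"] True by simp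
      then show False using \<open>0 \<le> a\<close> by (simp add: algebra_simps)
    qed
    then show ?thesis using True \<open>0 \<le> c\<close> by simp
  next
    case False
    then have "b > 0" using \<open>0 \<le> b\<close> by linarith
    have "2 * (b * c * c) \<le> b\<^sup>2 * a + c\<^sup>2 * b" by (rule key)
    then have "b * c\<^sup>2 \<le> b * (a * b)" by (simp add: power2_eq_square algebra_simps)
    then show ?thesis using \<open>b > 0\<close> by simp
  qed
  then have "c \<le> sqrt (a * b)" using real_le_rsqrt by blast
  then show ?thesis by (simp add: a_def b_def c_def real_sqrt_mult)
qed

lemma Cauchy_Schwarz_integral:
  assumes "sq_integrable M f" "sq_integrable M g"
  shows "\<bar>\<integral>x. f x * g x \<partial>M\<bar> \<le> sqrt (\<integral>x. (f x)\<^sup>2 \<partial>M) * sqrt (\<integral>x. (g x)\<^sup>2 \<partial>M)"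
  using integral_abs_bound[of M "\<lambda>x. f x * g x"] Cauchy_Schwarz_integral_abs[OF assms] by linarith

lemma integral_square_add_le:
  assumes f: "sq_integrable M f" and g: "sq_integrable M g"
  shows "(\<integral>x. (f x + g x)\<^sup>2 \<partial>M) \<le> 2 * (\<integral>x. (f x)\<^sup>2 \<partial>M) + 2 * (\<integral>x. (g x)\<^sup>2 \<partial>M)"
proof -
  have "(\<integral>x. (f x + g x)\<^sup>2 \<partial>M) \<le> (\<integral>x. 2 * (f x)\<^sup>2 + 2 * (g x)\<^sup>2 \<partial>M)"
  proof (rule integral_mono)
    show "integrable M (\<lambda>x. (f x + g x)\<^sup>2)" using sq_integrableD(2)[OF sq_integrable_add[OF f g]] by auto
    show "integrable M (\<lambda>x. 2 * (f x)\<^sup>2 + 2 * (g x)\<^sup>2)" using sq_integrableD[OF f] sq_integrableD[OF g] by auto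
    show "(f x + g x)\<^sup>2 \<le> 2 * (f x)\<^sup>2 + 2 * (g x)\<^sup>2" for x
      using sum_squares_bound[of "f x" "g x"] by (simp add: power2_sum)
  qed
  also have "\<dots> = 2 * (\<integral>x. (f x)\<^sup>2 \<partial>M) + 2 * (\<integral>x. (g x)\<^sup>2 \<partial>M)"
    using sq_integrableD[OF f] sq_integrableD[OF g] by auto
  finally show ?thesis .
qed

subsection \<open>Primitives of locally bounded functions\<close>

text \<open>Locally Lipschitz functions with a chosen Borel version of the derivative. Classical
  derivatives would be too much to ask: the \<open>y\<close>-derivative \<open>V\<close> of the
  mollified flow may jump at the wall. Fixing one version that is defined everywhere lets products
  and slices be formed pointwise.\<close>

definition primitive :: "(real \<Rightarrow> real) \<Rightarrow> (real \<Rightarrow> real) \<Rightarrow> bool" where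
  "primitive F f \<longleftrightarrow> f \<in> borel_measurable borel \<and> (\<forall>a b. \<exists>B. \<forall>x\<in>{a..b}. \<bar>f x\<bar> \<le> B) \<and>
     (\<forall>a b. a \<le> b \<longrightarrow> F b - F a = (LBINT x. indicator {a..b} x * f x))"

lemma integrable_indicator_Icc:
  fixes f :: "real \<Rightarrow> real"
  assumes "f \<in> borel_measurable borel" "\<And>x. x \<in> {a..b} \<Longrightarrow> \<bar>f x\<bar> \<le> B"
  shows "integrable lborel (\<lambda>x. indicator {a..b} x * f x)"
proof (rule Bochner_Integration.integrable_bound)
  show "integrable lborel (\<lambda>x. indicator {a..b} x * B)"
    by (intro integrable_mult_left) (auto simp: emeasure_lborel_Icc_eq)
  show "AE x in lborel. norm (indicator {a..b} x * f x) \<le> norm (indicator {a..b} x * B)"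
    using assms(2) by (auto simp: indicator_def intro!: order_trans[OF _ abs_ge_self])
qed (use assms in auto)

lemma integrable_indicator_Icc_const:
  "integrable lborel (\<lambda>x::real. indicator {a..b} x * (c::real))"
  by (rule integrable_indicator_Icc[of _ _ _ "\<bar>c\<bar>"]) auto

lemma primitiveD:
  assumes "primitive F f"
  shows "f \<in> borel_measurable borel" "integrable lborel (\<lambda>x. indicator {a..b} x * f x)"
    and "a \<le> b \<Longrightarrow> F b - F a = (LBINT x. indicator {a..b} x * f x)"
proof -
  show "f \<in> borel_measurable borel" using assms by (simp add: primitive_def)
  obtain B where "\<forall>x\<in>{a..b}. \<bar>f x\<bar> \<le> B" using assms unfolding primitive_def by blast
  then show "integrable lborel (\<lambda>x. indicator {a..b} x * f x)"
    using assms by (intro integrable_indicator_Icc[of _ _ _ B]) (auto simp: primitive_def)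
qed (use assms in \<open>simp add: primitive_def\<close>)

lemma primitive_bounded_on:
  assumes "primitive F f"
  obtains B where "\<And>x. a \<le> x \<Longrightarrow> x \<le> b \<Longrightarrow> \<bar>f x\<bar> \<le> B" "0 \<le> B"
proof -
  obtain B where "\<forall>x\<in>{a..b}. \<bar>f x\<bar> \<le> B" using assms unfolding primitive_def by blast
  then have "\<bar>f x\<bar> \<le> \<bar>B\<bar>" if "a \<le> x" "x \<le> b" for x
    using that by (meson abs_ge_self atLeastAtMost_iff order_trans)
  then show thesis by (intro that[of "\<bar>B\<bar>"]) auto
qed

lemma primitiveI:
  assumes "f \<in> borel_measurable borel" "\<And>a b. \<exists>B. \<forall>x\<in>{a..b}. \<bar>f x\<bar> \<le> B"
    and "\<And>a b. a \<le> b \<Longrightarrow> F b - F a = (LBINT x. indicator {a..b} x * f x)"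
  shows "primitive F f"
  using assms by (simp add: primitive_def)

lemma primitive_lipschitz:
  assumes "primitive F f" "\<And>x. a \<le> x \<Longrightarrow> x \<le> b \<Longrightarrow> \<bar>f x\<bar> \<le> B"
    "a \<le> x" "x \<le> y" "y \<le> b"
  shows "\<bar>F y - F x\<bar> \<le> B * (y - x)"
proof -
  have "\<bar>F y - F x\<bar> = \<bar>LBINT z. indicator {x..y} z * f z\<bar>"
    using primitiveD(3)[OF assms(1)] assms by simp
  also have "\<dots> \<le> (LBINT z. \<bar>indicator {x..y} z * f z\<bar>)"
    by (rule integral_abs_bound)
  also have "\<dots> \<le> (LBINT z. indicator {x..y} z * B)"
  proof (rule integral_mono)
    show "integrable lborel (\<lambda>z. \<bar>indicator {x..y} z * f z\<bar>)"
      using primitiveD(2)[OF assms(1)] by auto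
    show "integrable lborel (\<lambda>z. indicator {x..y} z * B)"
      by (intro integrable_mult_left) (auto simp: emeasure_lborel_Icc_eq)
  qed (use assms in \<open>auto simp: indicator_def\<close>)
  also have "\<dots> = B * (y - x)" using assms by simp
  finally show ?thesis .
qed

lemma primitive_continuous:
  assumes "primitive F f"
  shows "continuous_on UNIV F"
proof -
  have "isCont F x" for x
  proof -
    obtain B where B: "\<And>z. x - 1 \<le> z \<Longrightarrow> z \<le> x + 1 \<Longrightarrow> \<bar>f z\<bar> \<le> B" "0 \<le> B"
      using primitive_bounded_on[OF assms, of "x-1" "x+1"] by blast
    have "continuous_on {x-1..x+1} F"
    proof (rule continuous_on_iff[THEN iffD2], intro ballI allI impI)
      fix u e :: real assume u: "u \<in> {x-1..x+1}" "0 < e"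
      have "\<bar>F v - F u\<bar> < e" if "v \<in> {x-1..x+1}" "\<bar>v - u\<bar> < e / (B + 1)" for v
      proof -
        have "\<bar>F v - F u\<bar> \<le> B * \<bar>v - u\<bar>"
          using primitive_lipschitz[OF assms B(1), of "x-1" "x+1" u v]
            primitive_lipschitz[OF assms B(1), of "x-1" "x+1" v u] u that
          by (cases "u \<le> v") (auto simp: abs_minus_commute)
        also have "\<dots> \<le> (B + 1) * \<bar>v - u\<bar>" by (intro mult_right_mono) auto
        also have "\<dots> < e" using that B(2) by (simp add: field_simps)
        finally show ?thesis .
      qed
      then show "\<exists>d>0. \<forall>x'\<in>{x-1..x+1}. dist x' u < d \<longrightarrow> dist (F x') (F u) < e"
        using u B(2) by (intro exI[of _ "e/(B+1)"]) (auto simp: dist_real_def)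
    qed
    then have "continuous_on {x-1<..<x+1} F" by (rule continuous_on_subset) auto
    then show "isCont F x"
      by (subst (asm) continuous_on_eq_continuous_at) auto
  qed
  then show ?thesis by (simp add: continuous_at_imp_continuous_on)
qed

lemma primitive_measurable [measurable_dest]:
  assumes "primitive F f"
  shows "F \<in> borel_measurable borel"
  using primitive_continuous[OF assms] by (rule borel_measurable_continuous_onI)

lemma primitive_locally_bounded:
  assumes "primitive F f"
  shows "\<exists>B. \<forall>x\<in>{a..b}. \<bar>F x\<bar> \<le> B"
proof -
  have "compact (F ` {a..b})"
    by (intro compact_continuous_image continuous_on_subset[OF primitive_continuous[OF assms]]) auto
  then obtain B where "\<forall>y\<in>F ` {a..b}. norm y \<le> B"
    using compact_imp_bounded bounded_iff by blast
  then show ?thesis by auto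
qed

lemma primitive_DERIV:
  assumes "\<And>x. (F has_real_derivative f x) (at x)" "continuous_on UNIV f"
  shows "primitive F f"
proof (rule primitiveI)
  show "f \<in> borel_measurable borel" using assms by (intro borel_measurable_continuous_onI)
  show "\<exists>B. \<forall>x\<in>{a..b}. \<bar>f x\<bar> \<le> B" for a b
  proof -
    have "compact (f ` {a..b})"
      by (intro compact_continuous_image continuous_on_subset[OF assms(2)]) auto
    then obtain B where "\<forall>y\<in>f ` {a..b}. norm y \<le> B"
      using compact_imp_bounded bounded_iff by blast
    then show ?thesis by auto
  qed
  fix a b :: real assume "a \<le> b"
  have "(LBINT x. f x * indicator {a..b} x) = F b - F a"
    by (rule integral_FTC_Icc_real[OF \<open>a \<le> b\<close>])
      (use assms in \<open>auto simp: continuous_on_eq_continuous_at\<close>)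
  then show "F b - F a = (LBINT x. indicator {a..b} x * f x)" by (simp add: mult.commute)
qed

lemma primitive_add:
  assumes "primitive F f" "primitive G g"
  shows "primitive (\<lambda>x. F x + G x) (\<lambda>x. f x + g x)"
proof (rule primitiveI)
  show "(\<lambda>x. f x + g x) \<in> borel_measurable borel" using primitiveD(1) assms by auto
  show "\<exists>B. \<forall>x\<in>{a..b}. \<bar>f x + g x\<bar> \<le> B" for a b
  proof -
    obtain A where A: "\<And>x. a \<le> x \<Longrightarrow> x \<le> b \<Longrightarrow> \<bar>f x\<bar> \<le> A" "0 \<le> A"
      using primitive_bounded_on[OF assms(1), of a b] by blast
    obtain B where B: "\<And>x. a \<le> x \<Longrightarrow> x \<le> b \<Longrightarrow> \<bar>g x\<bar> \<le> B" "0 \<le> B"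
      using primitive_bounded_on[OF assms(2), of a b] by blast
    have "\<bar>f x + g x\<bar> \<le> A + B" if "x \<in> {a..b}" for x
      using A(1)[of x] B(1)[of x] that by auto
    then show ?thesis by blast
  qed
  fix a b :: real assume "a \<le> b"
  then show "F b + G b - (F a + G a) = (LBINT x. indicator {a..b} x * (f x + g x))"
    using primitiveD(2,3)[OF assms(1), of a b] primitiveD(2,3)[OF assms(2), of a b]
    by (simp add: distrib_left)
qed

lemma primitive_cmult:
  assumes "primitive F f"
  shows "primitive (\<lambda>x. c * F x) (\<lambda>x. c * f x)"
proof (rule primitiveI)
  show "(\<lambda>x. c * f x) \<in> borel_measurable borel" using primitiveD(1)[OF assms] by auto
  show "\<exists>B. \<forall>x\<in>{a..b}. \<bar>c * f x\<bar> \<le> B" for a b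
  proof -
    obtain A where A: "\<And>x. a \<le> x \<Longrightarrow> x \<le> b \<Longrightarrow> \<bar>f x\<bar> \<le> A" "0 \<le> A"
      using primitive_bounded_on[OF assms(1), of a b] by blast
    then show ?thesis by (intro exI[of _ "\<bar>c\<bar> * A"]) (auto simp: abs_mult intro: mult_left_mono)
  qed
  fix a b :: real assume "a \<le> b"
  then have "c * F b - c * F a = c * (LBINT x. indicator {a..b} x * f x)"
    using primitiveD(3)[OF assms, of a b] by (simp add: right_diff_distrib[symmetric])
  then show "c * F b - c * F a = (LBINT x. indicator {a..b} x * (c * f x))"
    by (simp add: mult.left_commute)
qed

lemma primitive_uminus: "primitive F f \<Longrightarrow> primitive (\<lambda>x. - F x) (\<lambda>x. - f x)"
  using primitive_cmult[of F f "-1"] by simp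

lemma primitive_diff:
  "primitive F f \<Longrightarrow> primitive G g \<Longrightarrow> primitive (\<lambda>x. F x - G x) (\<lambda>x. f x - g x)"
  using primitive_add[of F f "\<lambda>x. - G x" "\<lambda>x. - g x"] primitive_uminus[of G g] by simp

lemma integrable_pair_mult:
  fixes f :: "'a::euclidean_space \<Rightarrow> real" and g :: "'b::euclidean_space \<Rightarrow> real"
  assumes f: "integrable lborel f" and g: "integrable lborel g"
  shows "integrable (lborel \<Otimes>\<^sub>M lborel) (\<lambda>(x,y). f x * g y)"
proof (rule lborel_pair.Fubini_integrable)
  note [measurable] = borel_measurable_integrable[OF f] borel_measurable_integrable[OF g]
  show "(\<lambda>(x,y). f x * g y) \<in> borel_measurable (lborel \<Otimes>\<^sub>M lborel)" by measurable
  show "AE x in lborel. integrable lborel (\<lambda>y. case (x, y) of (x, y) \<Rightarrow> f x * g y)" using g by simp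
  have "(\<lambda>x. LBINT y. norm (case (x, y) of (x, y) \<Rightarrow> f x * g y)) = (\<lambda>x. \<bar>f x\<bar> * (LBINT y. \<bar>g y\<bar>))"
    by (simp add: abs_mult)
  then show "integrable lborel (\<lambda>x. LBINT y. norm (case (x, y) of (x, y) \<Rightarrow> f x * g y))"
    using f by simp
qed

text \<open>Fubini on the triangle \<open>a \<le> y \<le> x \<le> b\<close> for the product of
  \<open>f y\<close> and \<open>g x\<close>. The factors need not be differentiable everywhere, so
  the classical product rule does not apply.\<close>

lemma primitive_mult:
  assumes F: "primitive F f" and G: "primitive G g"
  shows "primitive (\<lambda>x. F x * G x) (\<lambda>x. f x * G x + F x * g x)"
proof (rule primitiveI)
  note [measurable] = primitiveD(1)[OF F] primitiveD(1)[OF G] primitive_measurable[OF F] primitive_measurable[OF G]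
  show "(\<lambda>x. f x * G x + F x * g x) \<in> borel_measurable borel" by measurable
  show bdd: "\<exists>B. \<forall>x\<in>{a..b}. \<bar>f x * G x + F x * g x\<bar> \<le> B" for a b
  proof -
    obtain A where A: "\<And>x. a \<le> x \<Longrightarrow> x \<le> b \<Longrightarrow> \<bar>f x\<bar> \<le> A" "0 \<le> A"
      using primitive_bounded_on[OF F, of a b] by blast
    obtain B where B: "\<And>x. a \<le> x \<Longrightarrow> x \<le> b \<Longrightarrow> \<bar>g x\<bar> \<le> B" "0 \<le> B"
      using primitive_bounded_on[OF G, of a b] by blast
    obtain A' where A': "\<forall>x\<in>{a..b}. \<bar>F x\<bar> \<le> A'" using primitive_locally_bounded[OF F] by blast
    obtain B' where B': "\<forall>x\<in>{a..b}. \<bar>G x\<bar> \<le> B'" using primitive_locally_bounded[OF G] by blast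
    have "\<bar>f x * G x + F x * g x\<bar> \<le> A * B' + A' * B" if "x \<in> {a..b}" for x
    proof -
      have 1: "\<bar>f x\<bar> \<le> A" "\<bar>g x\<bar> \<le> B" "\<bar>F x\<bar> \<le> A'" "\<bar>G x\<bar> \<le> B'"
        using A B A' B' that by auto
      have "\<bar>f x * G x\<bar> \<le> A * B'" "\<bar>F x * g x\<bar> \<le> A' * B"
        unfolding abs_mult using 1 A(2) by (intro mult_mono; linarith)+
      then show ?thesis by linarith
    qed
    then show ?thesis by blast
  qed
  fix a b :: real assume ab: "a \<le> b"
  define I where "I x = (indicator {a..b} x :: real)" for x
  have [measurable]: "I \<in> borel_measurable borel" by (auto simp: I_def[abs_def])
  have intf: "integrable lborel (\<lambda>x. I x * f x)" and intg: "integrable lborel (\<lambda>x. I x * g x)"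
    using primitiveD(2)[OF F] primitiveD(2)[OF G] by (auto simp: I_def)
  have Fx: "F x - F a = (LBINT y. indicator {a..x} y * f y)" if "a \<le> x" for x
    using primitiveD(3)[OF F that] .
  have Gy: "G b - G y = (LBINT x. indicator {y..b} x * g x)" if "y \<le> b" for y
    using primitiveD(3)[OF G that] .
  have swap: "(LBINT x. I x * ((F x - F a) * g x)) = (LBINT y. I y * (f y * (G b - G y)))"
  proof -
    \<comment> \<open>The part of the square below the diagonal: integrating in \<open>y\<close>
      first produces \<open>F x - F a\<close>, integrating in \<open>x\<close> first produces
      \<open>G b - G y\<close>.\<close>
    define h where "h x y = (if y \<le> x then (I x * g x) * (I y * f y) else 0)" for x y
    have h_int: "integrable (lborel \<Otimes>\<^sub>M lborel) (\<lambda>(x,y). h x y)"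
    proof (rule Bochner_Integration.integrable_bound)
      show "integrable (lborel \<Otimes>\<^sub>M lborel) (\<lambda>(x,y). (I x * g x) * (I y * f y))"
        by (rule integrable_pair_mult[OF intg intf])
      show "(\<lambda>(x,y). h x y) \<in> borel_measurable (lborel \<Otimes>\<^sub>M lborel)"
        unfolding h_def by measurable
    qed (auto simp: h_def)
    have "(LBINT x. I x * ((F x - F a) * g x)) = (LBINT x. (LBINT y. h x y))"
    proof (rule Bochner_Integration.integral_cong[OF refl])
      fix x
      show "I x * ((F x - F a) * g x) = (LBINT y. h x y)"
      proof (cases "x \<in> {a..b}")
        case True
        then have "h x y = (I x * g x) * (indicator {a..x} y * f y)" for y
          by (auto simp: h_def I_def indicator_def)
        then show ?thesis using Fx[of x] True by simp
      next
        case False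
        then have I0: "I x = 0" by (simp add: I_def)
        then have "h x y = 0" for y by (simp add: h_def)
        then show ?thesis using I0 by simp
      qed
    qed
    also have "\<dots> = (LBINT y. (LBINT x. h x y))"
      by (rule lborel_pair.Fubini_integral[OF h_int, symmetric])
    also have "\<dots> = (LBINT y. I y * (f y * (G b - G y)))"
    proof (rule Bochner_Integration.integral_cong[OF refl])
      fix y
      show "(LBINT x. h x y) = I y * (f y * (G b - G y))"
      proof (cases "y \<in> {a..b}")
        case True
        then have "h x y = (I y * f y) * (indicator {y..b} x * g x)" for x
          by (auto simp: h_def I_def indicator_def)
        then show ?thesis using Gy[of y] True by simp
      next
        case False
        then have I0: "I y = 0" by (simp add: I_def)
        then have "h x y = 0" for x by (simp add: h_def)
        then show ?thesis using I0 by simp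
      qed
    qed
    finally show ?thesis .
  qed
  have lb: "\<exists>B. \<forall>x\<in>{a..b}. \<bar>H x * k x\<bar> \<le> B" if "\<exists>B. \<forall>x\<in>{a..b}. \<bar>H x\<bar> \<le> B" "\<exists>B. \<forall>x\<in>{a..b}. \<bar>k x\<bar> \<le> B" for H k :: "real \<Rightarrow> real"
  proof -
    from that obtain A B where "\<forall>x\<in>{a..b}. \<bar>H x\<bar> \<le> A" "\<forall>x\<in>{a..b}. \<bar>k x\<bar> \<le> B" by blast
    then have "\<bar>H x * k x\<bar> \<le> A * B" if "x \<in> {a..b}" for x
    proof -
      have "\<bar>H x\<bar> \<le> A" "\<bar>k x\<bar> \<le> B" using that \<open>\<forall>x\<in>{a..b}. \<bar>H x\<bar> \<le> A\<close> \<open>\<forall>x\<in>{a..b}. \<bar>k x\<bar> \<le> B\<close> by auto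
      then show ?thesis unfolding abs_mult by (intro mult_mono) linarith+
    qed
    then show ?thesis by blast
  qed
  have i1: "integrable lborel (\<lambda>x. I x * (F x * g x))"
  proof -
    obtain B where "\<forall>x\<in>{a..b}. \<bar>F x * g x\<bar> \<le> B"
      using lb[OF primitive_locally_bounded[OF F]] G unfolding primitive_def by blast
    then show ?thesis unfolding I_def
      by (intro integrable_indicator_Icc[of _ _ _ B]) auto
  qed
  have i2: "integrable lborel (\<lambda>x. I x * (f x * G x))"
  proof -
    obtain B where "\<forall>x\<in>{a..b}. \<bar>f x * G x\<bar> \<le> B"
      using lb[OF _ primitive_locally_bounded[OF G]] F unfolding primitive_def by blast
    then show ?thesis unfolding I_def
      by (intro integrable_indicator_Icc[of _ _ _ B]) auto
  qed
  have e1: "(LBINT x. I x * ((F x - F a) * g x)) = (LBINT x. I x * (F x * g x)) - F a * (G b - G a)"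
  proof -
    have "(LBINT x. I x * ((F x - F a) * g x)) = (LBINT x. I x * (F x * g x) - F a * (I x * g x))"
      by (intro Bochner_Integration.integral_cong) (auto simp: algebra_simps)
    also have "\<dots> = (LBINT x. I x * (F x * g x)) - F a * (LBINT x. I x * g x)"
      using i1 intg by simp
    finally show ?thesis using primitiveD(3)[OF G ab] by (simp add: I_def)
  qed
  have e2: "(LBINT y. I y * (f y * (G b - G y))) = G b * (F b - F a) - (LBINT x. I x * (f x * G x))"
  proof -
    have "(LBINT y. I y * (f y * (G b - G y))) = (LBINT x. G b * (I x * f x) - I x * (f x * G x))"
      by (intro Bochner_Integration.integral_cong) (auto simp: algebra_simps)
    also have "\<dots> = G b * (LBINT x. I x * f x) - (LBINT x. I x * (f x * G x))"
      using i2 intf by simp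
    finally show ?thesis using primitiveD(3)[OF F ab] by (simp add: I_def)
  qed
  have "(LBINT x. indicator {a..b} x * (f x * G x + F x * g x))
      = (LBINT x. I x * (f x * G x)) + (LBINT x. I x * (F x * g x))"
    using i1 i2 by (simp add: distrib_left I_def)
  then show "F b * G b - F a * G a = (LBINT x. indicator {a..b} x * (f x * G x + F x * g x))"
    using swap e1 e2 by (simp add: algebra_simps)
qed

lemma not_integrable_bounded_below:
  fixes F :: "real \<Rightarrow> real"
  assumes "integrable lborel F" "0 < c" "\<And>x. N \<le> x \<Longrightarrow> c \<le> \<bar>F x\<bar>"
  shows False
proof -
  obtain n :: nat where n: "(LBINT x. \<bar>F x\<bar>) / c < real n"
    using reals_Archimedean2 by blast
  have "c * real n = (LBINT x. indicator {N..N + real n} x * c)"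
    by simp
  also have "\<dots> \<le> (LBINT x. \<bar>F x\<bar>)"
  proof (rule integral_mono)
    show "integrable lborel (\<lambda>x. indicator {N..N + real n} x * c)"
      by (intro integrable_mult_left) (auto simp: emeasure_lborel_Icc_eq)
  qed (use assms in \<open>auto simp: indicator_def\<close>)
  finally show False using n \<open>0 < c\<close> by (simp add: field_simps)
qed

lemma primitive_reflect:
  assumes "primitive F f"
  shows "primitive (\<lambda>x. F (- x)) (\<lambda>x. - f (- x))"
proof (rule primitiveI)
  note [measurable] = primitiveD(1)[OF assms]
  show "(\<lambda>x. - f (- x)) \<in> borel_measurable borel" by measurable
  show "\<exists>B. \<forall>x\<in>{a..b}. \<bar>- f (- x)\<bar> \<le> B" for a b
  proof -
    obtain A where A: "\<And>x. -b \<le> x \<Longrightarrow> x \<le> -a \<Longrightarrow> \<bar>f x\<bar> \<le> A" "0 \<le> A"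
      using primitive_bounded_on[OF assms, of "-b" "-a"] by blast
    then show ?thesis by (intro exI[of _ A]) auto
  qed
  fix a b :: real assume "a \<le> b"
  have "(LBINT x. indicator {-b..-a} x * f x) = (LBINT x. indicator {a..b} x * f (- x))"
    by (subst lborel_integral_real_affine[of "-1" _ 0])
      (auto intro!: Bochner_Integration.integral_cong simp: indicator_def)
  then show "F (- b) - F (- a) = (LBINT x. indicator {a..b} x * - f (- x))"
    using primitiveD(3)[OF assms, of "-b" "-a"] \<open>a \<le> b\<close> by simp
qed

text \<open>An integrable density makes \<open>F\<close> converge at infinity, and a nonzero limit
  would contradict the integrability of \<open>F\<close>.\<close>

lemma primitive_LIMSEQ:
  assumes F: "primitive F f" and iF: "integrable lborel F" and i: "integrable lborel f"
  shows "(\<lambda>n. F (real n)) \<longlonglongrightarrow> 0"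
proof -
  define G where "G x = F 0 + (LBINT y. indicator {0..x} y * f y)" for x
  have "((\<lambda>x. LBINT y. indicator {0..x} y * f y) \<longlongrightarrow> (LBINT y. indicator {0..} y * f y)) at_top"
  proof (rule integral_dominated_convergence_at_top[where w="\<lambda>x. \<bar>f x\<bar>"])
    have "((\<lambda>x. indicator {0..x} y * f y) \<longlongrightarrow> indicator {0..} y * f y) at_top" for y :: real
      by (rule tendsto_eventually) (auto simp: indicator_def eventually_at_top_linorder intro!: exI[of _ y])
    then show "AE y in lborel. ((\<lambda>x. indicator {0..x} y * f y) \<longlongrightarrow> indicator {0..} y * f y) at_top" by simp
  qed (use i in \<open>auto simp: indicator_def\<close>)
  then have lim: "(G \<longlongrightarrow> F 0 + (LBINT y. indicator {0..} y * f y)) at_top"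
    unfolding G_def by (intro tendsto_add tendsto_const)
  define l where "l = F 0 + (LBINT y. indicator {0..} y * f y)"
  have "\<forall>\<^sub>F x in at_top. F x = G x"
    using eventually_ge_at_top[of 0]
  proof eventually_elim
    case (elim x)
    show ?case using primitiveD(3)[OF F elim] by (simp add: G_def)
  qed
  then have lim: "(F \<longlongrightarrow> l) at_top" using lim tendsto_cong[of F G at_top l] by (simp add: l_def)
  have "l = 0"
  proof (rule ccontr)
    assume "l \<noteq> 0"
    then have "\<forall>\<^sub>F x in at_top. dist (F x) l < \<bar>l\<bar>/2" using lim by (intro tendstoD) auto
    then obtain N where N: "\<And>x. N \<le> x \<Longrightarrow> dist (F x) l < \<bar>l\<bar>/2" by (auto simp: eventually_at_top_linorder)
    then have "\<bar>l\<bar>/2 \<le> \<bar>F x\<bar>" if "N \<le> x" for x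
      using N[OF that] unfolding dist_real_def by linarith
    then show False using not_integrable_bounded_below[OF iF, of "\<bar>l\<bar>/2" N] \<open>l \<noteq> 0\<close> by auto
  qed
  then show ?thesis using filterlim_compose[OF lim filterlim_real_sequentially] by simp
qed

text \<open>Takes the place of decay assumptions in all later integrations by parts: integrability
  of a function and of its density already removes the boundary terms at infinity.\<close>

lemma primitive_integral_eq_0:
  assumes F: "primitive F f" and iF: "integrable lborel F" and i: "integrable lborel f"
  shows "(LBINT x. f x) = 0"
proof -
  have "(\<lambda>n. F (real n)) \<longlonglongrightarrow> 0" by (rule primitive_LIMSEQ[OF assms])
  moreover have "(\<lambda>n. F (- real n)) \<longlonglongrightarrow> 0"
  proof (rule primitive_LIMSEQ[OF primitive_reflect[OF F]])
    show "integrable lborel (\<lambda>x. F (- x))"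
      using lborel_integrable_real_affine[OF iF, of "-1" 0] by simp
    show "integrable lborel (\<lambda>x. - f (- x))"
      using lborel_integrable_real_affine[OF i, of "-1" 0] by simp
  qed
  ultimately have "(\<lambda>n. F (real n) - F (- real n)) \<longlonglongrightarrow> 0 - 0" by (rule tendsto_diff)
  moreover have "(\<lambda>n. F (real n) - F (- real n)) = (\<lambda>n. LBINT x. indicator {-real n..real n} x * f x)"
    using primitiveD(3)[OF F] by auto
  moreover have "((\<lambda>n. LBINT x. indicator {-real n..real n} x * f x) \<longlonglongrightarrow> (LBINT x. f x))"
  proof (rule integral_dominated_convergence[where w="\<lambda>x. \<bar>f x\<bar>"])
    have "(\<lambda>n. indicator {-real n..real n} x * f x) \<longlonglongrightarrow> f x" for x
    proof (rule tendsto_eventually)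
      obtain N where "\<bar>x\<bar> \<le> real N" using real_arch_simple by blast
      then show "\<forall>\<^sub>F n in sequentially. indicator {-real n..real n} x * f x = f x"
        by (intro eventually_sequentiallyI[of N]) (auto simp: indicator_def)
    qed
    then show "AE x in lborel. (\<lambda>n. indicator {-real n..real n} x * f x) \<longlonglongrightarrow> f x" by simp
  qed (use i in \<open>auto simp: indicator_def\<close>)
  ultimately show ?thesis using LIMSEQ_unique[of _ 0 "LBINT x. f x"] by simp
qed

lemma primitive_by_parts:
  assumes F: "primitive F f" and G: "primitive G g"
    and i: "integrable lborel (\<lambda>x. F x * G x)" "integrable lborel (\<lambda>x. f x * G x)" "integrable lborel (\<lambda>x. F x * g x)"
  shows "(LBINT x. f x * G x) = - (LBINT x. F x * g x)"
  using primitive_integral_eq_0[OF primitive_mult[OF F G]] i by simp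

text \<open>Otherwise \<open>(F y)\<^sup>2\<close> would stay above a positive constant to the right
  of \<open>x\<close>, since its variation there is at most twice the integral of
  \<open>\<bar>F y * f y\<bar>\<close>; that contradicts its integrability.\<close>

lemma primitive_square_le:
  assumes F: "primitive F f" and s: "sq_integrable lborel F" "sq_integrable lborel f"
  shows "(F x)\<^sup>2 \<le> 2 * (LBINT y. \<bar>F y * f y\<bar>)"
proof (rule ccontr)
  define c where "c = (F x)\<^sup>2 - 2 * (LBINT y. \<bar>F y * f y\<bar>)"
  assume "\<not> ?thesis"
  then have "0 < c" by (simp add: c_def)
  have i: "integrable lborel (\<lambda>y. F y * f y)" by (rule sq_integrable_times[OF s])
  have "c \<le> \<bar>(F a)\<^sup>2\<bar>" if "x \<le> a" for a
  proof -
    have "(F a)\<^sup>2 - (F x)\<^sup>2 = (LBINT y. indicator {x..a} y * (f y * F y + F y * f y))"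
      using primitiveD(3)[OF primitive_mult[OF F F] that] by (simp add: power2_eq_square)
    also have "\<dots> \<ge> (LBINT y. - (2 * \<bar>F y * f y\<bar>))"
    proof (rule integral_mono)
      show "integrable lborel (\<lambda>y. indicator {x..a} y * (f y * F y + F y * f y))"
        by (rule primitiveD(2)[OF primitive_mult[OF F F]])
      show "integrable lborel (\<lambda>y. - (2 * \<bar>F y * f y\<bar>))" using i by simp
      show "- (2 * \<bar>F y * f y\<bar>) \<le> indicator {x..a} y * (f y * F y + F y * f y)" for y
      proof (cases "y \<in> {x..a}")
        case True
        have "f y * F y + F y * f y = 2 * (F y * f y)" by simp
        then show ?thesis using True abs_ge_minus_self[of "F y * f y"]
          by (metis (no_types) indicator_simps(1) lambda_one mult_minus_right mult_left_mono minus_le_iff zero_le_numeral)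
      qed simp
    qed
    finally show ?thesis by (simp add: c_def)
  qed
  then show False using not_integrable_bounded_below[of "\<lambda>y. (F y)\<^sup>2" c x] \<open>0 < c\<close> sq_integrableD(2)[OF s(1)] by auto
qed

section \<open>Mean square bounds for averages, and convolution along a direction\<close>

text \<open>Cauchy-Schwarz with respect to the weight \<open>\<bar>a r\<bar>\<close> for fixed
  \<open>p\<close>, followed by Fubini. The uniform bound \<open>B\<close> makes the integral in
  \<open>r\<close> exist for every \<open>p\<close>, not just for almost every one.\<close>

lemma Minkowski_square_integral:
  fixes a :: "real \<Rightarrow> real" and g :: "real \<Rightarrow> 'b::euclidean_space \<Rightarrow> real"
  assumes a: "integrable lborel a"
    and g: "(\<lambda>(r,p). g r p) \<in> borel_measurable borel" "\<And>r p. \<bar>g r p\<bar> \<le> B"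
    and K: "\<And>r. sq_integrable lborel (g r)" "\<And>r. (LBINT p. (g r p)\<^sup>2) \<le> K"
  shows "sq_integrable lborel (\<lambda>p. LBINT r. a r * g r p)" (is ?th1)
    and "(LBINT p. (LBINT r. a r * g r p)\<^sup>2) \<le> (LBINT r. \<bar>a r\<bar>)\<^sup>2 * K" (is ?th2)
proof -
  note [measurable] = borel_measurable_integrable[OF a]
  have gm: "(\<lambda>(r,p). g r p) \<in> borel_measurable (lborel \<Otimes>\<^sub>M lborel)"
    using g(1) by (simp add: lborel_prod)
  have gm1 [measurable]: "(\<lambda>z. g (fst z) (snd z)) \<in> borel_measurable (lborel \<Otimes>\<^sub>M lborel)"
    using gm by (simp add: case_prod_beta')
  have gr [measurable]: "g r \<in> borel_measurable borel" for r
    using sq_integrableD(1)[OF K(1)] by simp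
  have gp [measurable]: "(\<lambda>r. g r p) \<in> borel_measurable borel" for p
    using measurable_compose[OF measurable_Pair2'[of p] gm] by simp
  define A where "A = (LBINT r. \<bar>a r\<bar>)"
  have "0 \<le> A" by (simp add: A_def)
  have "0 \<le> K" using K(2)[of 0] integral_square_nonneg[of lborel "g 0"] by linarith
  have B0: "0 \<le> B" using g(2)[of 0 0] by linarith
  have i_ag2: "integrable lborel (\<lambda>r. \<bar>a r\<bar> * (g r p)\<^sup>2)" for p
  proof (rule Bochner_Integration.integrable_bound)
    show "integrable lborel (\<lambda>r. \<bar>a r\<bar> * B\<^sup>2)" using a by simp
    have "(g r p)\<^sup>2 \<le> B\<^sup>2" for r using power_mono[OF g(2)[of r p], of 2] by simp
    then show "AE r in lborel. norm (\<bar>a r\<bar> * (g r p)\<^sup>2) \<le> norm (\<bar>a r\<bar> * B\<^sup>2)"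
      by (auto intro!: mult_left_mono simp: abs_mult)
  qed measurable
  have pw: "(LBINT r. a r * g r p)\<^sup>2 \<le> A * (LBINT r. \<bar>a r\<bar> * (g r p)\<^sup>2)" for p
  proof -
    \<comment> \<open>The weight is split evenly between the two factors, its sign going to the
      second one.\<close>
    define f1 f2 where "f1 r = sqrt \<bar>a r\<bar>" and "f2 r = sgn (a r) * sqrt \<bar>a r\<bar> * g r p" for r
    have 1: "f1 r * f2 r = a r * g r p" for r
    proof -
      have "f1 r * f2 r = (sgn (a r) * (sqrt \<bar>a r\<bar> * sqrt \<bar>a r\<bar>)) * g r p" by (simp add: f1_def f2_def)
      also have "sgn (a r) * (sqrt \<bar>a r\<bar> * sqrt \<bar>a r\<bar>) = a r"
        using real_sqrt_mult_self[of "\<bar>a r\<bar>"] mult_sgn_abs[of "a r"] by simp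
      finally show ?thesis .
    qed
    have 2: "(f1 r)\<^sup>2 = \<bar>a r\<bar>" for r by (simp add: f1_def)
    have 3: "(f2 r)\<^sup>2 = \<bar>a r\<bar> * (g r p)\<^sup>2" for r
      by (cases "a r = 0") (simp_all add: f2_def power_mult_distrib sgn_if)
    have m: "f1 \<in> borel_measurable lborel" "f2 \<in> borel_measurable lborel"
      unfolding f1_def f2_def by measurable
    have s: "sq_integrable lborel f1" "sq_integrable lborel f2"
      using m a i_ag2[of p] by (auto simp: sq_integrable_def 2 3)
    have "\<bar>LBINT r. a r * g r p\<bar> \<le> sqrt A * sqrt (LBINT r. \<bar>a r\<bar> * (g r p)\<^sup>2)"
      using Cauchy_Schwarz_integral[OF s] by (simp add: 1 2 3 A_def)
    then have "\<bar>LBINT r. a r * g r p\<bar>\<^sup>2 \<le> (sqrt A * sqrt (LBINT r. \<bar>a r\<bar> * (g r p)\<^sup>2))\<^sup>2"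
      by (rule power_mono) simp
    then show ?thesis using \<open>0 \<le> A\<close> by (simp add: power_mult_distrib)
  qed
  have int2: "integrable (lborel \<Otimes>\<^sub>M lborel) (\<lambda>(r,p). \<bar>a r\<bar> * (g r p)\<^sup>2)"
  proof (rule lborel_pair.Fubini_integrable)
    show "(\<lambda>(r,p). \<bar>a r\<bar> * (g r p)\<^sup>2) \<in> borel_measurable (lborel \<Otimes>\<^sub>M lborel)"
      unfolding case_prod_beta' by measurable
    show "AE r in lborel. integrable lborel (\<lambda>p. case (r, p) of (r, p) \<Rightarrow> \<bar>a r\<bar> * (g r p)\<^sup>2)"
      using sq_integrableD(2)[OF K(1)] by simp
    show "integrable lborel (\<lambda>r. LBINT p. norm (case (r, p) of (r, p) \<Rightarrow> \<bar>a r\<bar> * (g r p)\<^sup>2))"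
    proof (rule Bochner_Integration.integrable_bound)
      show "integrable lborel (\<lambda>r. \<bar>a r\<bar> * K)" using a by simp
      show "(\<lambda>r. LBINT p. norm (case (r, p) of (r, p) \<Rightarrow> \<bar>a r\<bar> * (g r p)\<^sup>2)) \<in> borel_measurable lborel"
        by (rule lborel.borel_measurable_lebesgue_integral) (unfold case_prod_beta' prod.collapse fst_conv snd_conv, measurable)
      show "AE r in lborel. norm (LBINT p. norm (case (r, p) of (r, p) \<Rightarrow> \<bar>a r\<bar> * (g r p)\<^sup>2)) \<le> norm (\<bar>a r\<bar> * K)"
        using K(2) \<open>0 \<le> K\<close> by (auto simp: abs_mult intro!: mult_left_mono)
    qed
  qed
  have int3: "integrable lborel (\<lambda>p. LBINT r. \<bar>a r\<bar> * (g r p)\<^sup>2)"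
    by (rule lborel_pair.integrable_snd[OF int2])
  have m3: "(\<lambda>p. LBINT r. a r * g r p) \<in> borel_measurable lborel"
  proof (rule lborel.borel_measurable_lebesgue_integral)
    have "(\<lambda>z. a (snd z) * g (snd z) (fst z)) \<in> borel_measurable (lborel \<Otimes>\<^sub>M lborel)"
      using measurable_compose[OF measurable_pair_swap' gm1] by (auto intro!: borel_measurable_times simp: case_prod_beta')
    then show "(\<lambda>(p, r). a r * g r p) \<in> borel_measurable (lborel \<Otimes>\<^sub>M lborel)"
      by (simp add: case_prod_beta')
  qed
  show 1: ?th1
    unfolding sq_integrable_def
  proof
    show "integrable lborel (\<lambda>p. (LBINT r. a r * g r p)\<^sup>2)"
    proof (rule Bochner_Integration.integrable_bound)
      show "integrable lborel (\<lambda>p. A * (LBINT r. \<bar>a r\<bar> * (g r p)\<^sup>2))" using int3 by simp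
      show "(\<lambda>p. (LBINT r. a r * g r p)\<^sup>2) \<in> borel_measurable lborel" using m3 by simp
      show "AE p in lborel. norm ((LBINT r. a r * g r p)\<^sup>2) \<le> norm (A * (LBINT r. \<bar>a r\<bar> * (g r p)\<^sup>2))"
        using pw by (auto intro: order_trans[OF _ abs_ge_self])
    qed
  qed (rule m3)
  have "(LBINT p. (LBINT r. a r * g r p)\<^sup>2) \<le> (LBINT p. A * (LBINT r. \<bar>a r\<bar> * (g r p)\<^sup>2))"
    using sq_integrableD(2)[OF 1] int3 pw by (intro integral_mono) auto
  also have "\<dots> = A * (LBINT r. (LBINT p. \<bar>a r\<bar> * (g r p)\<^sup>2))"
    using lborel_pair.Fubini_integral[OF int2] by simp
  also have "\<dots> \<le> A * (LBINT r. \<bar>a r\<bar> * K)"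
  proof (intro mult_left_mono integral_mono)
    show "integrable lborel (\<lambda>r. LBINT p. \<bar>a r\<bar> * (g r p)\<^sup>2)"
      by (rule lborel_pair.integrable_fst[OF int2])
  qed (use a K(2) \<open>0 \<le> A\<close> in \<open>auto intro!: mult_left_mono\<close>)
  also have "\<dots> = A\<^sup>2 * K" by (simp add: A_def power2_eq_square)
  finally show ?th2 by (simp add: A_def)
qed

text \<open>Convolution with a kernel of one real variable along the direction \<open>v\<close>.
  Time and \<open>x\<close> can thus be smoothed one after the other while \<open>y\<close> is a
  mere parameter; along (0, 0, 1) the same operator serves as the resolvent in
  \<open>y\<close>.\<close>

definition dconv :: "'a::euclidean_space \<Rightarrow> (real \<Rightarrow> real) \<Rightarrow> ('a \<Rightarrow> real) \<Rightarrow> 'a \<Rightarrow> real" where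
  "dconv v a f w = (LBINT r. a r * f (w - r *\<^sub>R v))"

lemma dconv_integrable:
  fixes f :: "'a::euclidean_space \<Rightarrow> real"
  assumes a: "integrable lborel a" and f: "f \<in> borel_measurable borel" "\<And>w. \<bar>f w\<bar> \<le> B"
  shows "integrable lborel (\<lambda>r. a r * f (w - r *\<^sub>R v))"
proof (rule Bochner_Integration.integrable_bound)
  note [measurable] = borel_measurable_integrable[OF a] f(1)
  show "integrable lborel (\<lambda>r. a r * B)" using a by simp
  show "(\<lambda>r. a r * f (w - r *\<^sub>R v)) \<in> borel_measurable lborel" by measurable
  show "AE r in lborel. norm (a r * f (w - r *\<^sub>R v)) \<le> norm (a r * B)"
    using order_trans[OF f(2) abs_ge_self] by (auto simp: abs_mult intro!: mult_left_mono)
qed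

lemma dconv_measurable [measurable]:
  assumes [measurable]: "a \<in> borel_measurable borel" "f \<in> borel_measurable borel"
  shows "dconv v a f \<in> borel_measurable borel"
proof -
  have "(\<lambda>(w, r). a r * f (w - r *\<^sub>R v)) \<in> borel_measurable (borel \<Otimes>\<^sub>M lborel)"
    by measurable
  then have "(\<lambda>w. LBINT r. a r * f (w - r *\<^sub>R v)) \<in> borel_measurable borel"
    by (rule lborel.borel_measurable_lebesgue_integral)
  then show ?thesis by (simp add: dconv_def[abs_def])
qed

lemma dconv_bound:
  assumes a: "integrable lborel a" and f: "f \<in> borel_measurable borel" "\<And>w. \<bar>f w\<bar> \<le> B"
  shows "\<bar>dconv v a f w\<bar> \<le> (LBINT r. \<bar>a r\<bar>) * B"
proof -
  have "\<bar>dconv v a f w\<bar> \<le> (LBINT r. \<bar>a r * f (w - r *\<^sub>R v)\<bar>)"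
    unfolding dconv_def by (rule integral_abs_bound)
  also have "\<dots> \<le> (LBINT r. \<bar>a r\<bar> * B)"
  proof (rule integral_mono)
    show "integrable lborel (\<lambda>r. \<bar>a r * f (w - r *\<^sub>R v)\<bar>)"
      using dconv_integrable[OF a f] by (rule integrable_abs)
  qed (use a f(2) in \<open>auto simp: abs_mult intro!: mult_left_mono\<close>)
  finally show ?thesis by simp
qed

text \<open>By Fubini either mollification can be made the outer one, and it is the outer one that
  \<open>dconv_primitive\<close> differentiates.\<close>

lemma dconv_commute:
  fixes f :: "'a::euclidean_space \<Rightarrow> real"
  assumes a: "integrable lborel a" and b: "integrable lborel b"
    and f: "f \<in> borel_measurable borel" "\<And>w. \<bar>f w\<bar> \<le> B"
  shows "dconv v a (dconv w b f) = dconv w b (dconv v a f)"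
proof
  fix x
  note [measurable] = borel_measurable_integrable[OF a] borel_measurable_integrable[OF b] f(1)
  have int: "integrable (lborel \<Otimes>\<^sub>M lborel) (\<lambda>(r,q). a r * (b q * f (x - r *\<^sub>R v - q *\<^sub>R w)))"
  proof (rule Bochner_Integration.integrable_bound)
    show "integrable (lborel \<Otimes>\<^sub>M lborel) (\<lambda>(r,q). a r * (b q * B))"
      using integrable_pair_mult[OF a integrable_mult_left[OF b, of B]] by simp
    show "AE z in lborel \<Otimes>\<^sub>M lborel. norm (case z of (r,q) \<Rightarrow> a r * (b q * f (x - r *\<^sub>R v - q *\<^sub>R w)))
        \<le> norm (case z of (r,q) \<Rightarrow> a r * (b q * B))"
      using order_trans[OF f(2) abs_ge_self]
      by (intro AE_I2) (auto simp: abs_mult split: prod.split intro!: mult_left_mono)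
  qed measurable
  have "dconv v a (dconv w b f) x = (LBINT r. (LBINT q. a r * (b q * f (x - r *\<^sub>R v - q *\<^sub>R w))))"
    by (simp add: dconv_def)
  also have "\<dots> = (LBINT q. (LBINT r. a r * (b q * f (x - r *\<^sub>R v - q *\<^sub>R w))))"
    by (rule lborel_pair.Fubini_integral[OF int, symmetric])
  also have "\<dots> = (LBINT q. b q * (LBINT r. a r * f (x - q *\<^sub>R w - r *\<^sub>R v)))"
    by (simp add: mult.left_commute algebra_simps flip: integral_mult_right_zero)
  finally show "dconv v a (dconv w b f) x = dconv w b (dconv v a f) x"
    by (simp add: dconv_def)
qed

text \<open>Moves the position \<open>h\<close> from the merely measurable \<open>f\<close> into the
  kernel, where it can be differentiated.\<close>

lemma dconv_reflect: "dconv v a f (x + h *\<^sub>R v) = (LBINT q. a (h - q) * f (x + q *\<^sub>R v))"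
  unfolding dconv_def
  by (subst lborel_integral_real_affine[of "-1" _ h]) (simp_all add: algebra_simps)

text \<open>After \<open>dconv_reflect\<close> the variable \<open>h\<close> occurs in the kernel
  only; the fundamental theorem of calculus is applied there and carried through the integral
  against \<open>f\<close> by Fubini.\<close>

lemma dconv_primitive:
  fixes f :: "'a::euclidean_space \<Rightarrow> real"
  assumes der: "\<And>x. (a has_real_derivative a' x) (at x)" and cont: "continuous_on UNIV a'"
    and supp: "\<And>x. R < \<bar>x\<bar> \<Longrightarrow> a x = 0" "\<And>x. R < \<bar>x\<bar> \<Longrightarrow> a' x = 0"
    and f: "f \<in> borel_measurable borel" "\<And>w. \<bar>f w\<bar> \<le> B"
    and ia: "integrable lborel a" "integrable lborel a'"
  shows "primitive (\<lambda>h. dconv v a f (x + h *\<^sub>R v)) (\<lambda>h. dconv v a' f (x + h *\<^sub>R v))"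
proof (rule primitiveI)
  note [measurable] = borel_measurable_integrable[OF ia(1)] borel_measurable_integrable[OF ia(2)] f(1)
  show "(\<lambda>h. dconv v a' f (x + h *\<^sub>R v)) \<in> borel_measurable borel" by measurable
  show "\<exists>C. \<forall>h\<in>{c..d}. \<bar>dconv v a' f (x + h *\<^sub>R v)\<bar> \<le> C" for c d
    using dconv_bound[OF ia(2) f] by blast
  fix c d :: real assume cd: "c \<le> d"
  have prim: "primitive a a'" by (rule primitive_DERIV[OF der cont])
  have sub: "(LBINT h. indicator {c..d} h * a' (h - q)) = a (d - q) - a (c - q)" for q
  proof -
    have "(LBINT h. indicator {c..d} h * a' (h - q)) = (LBINT h. indicator {c-q..d-q} h * a' h)"
      by (subst lborel_integral_real_affine[of 1 _ q])
        (auto intro!: Bochner_Integration.integral_cong simp: indicator_def)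
    then show ?thesis using primitiveD(3)[OF prim, of "c-q" "d-q"] cd by simp
  qed
  have bnd: "\<exists>M. \<forall>y. \<bar>a' y\<bar> \<le> M"
  proof -
    obtain M where "\<forall>y\<in>{-R..R}. \<bar>a' y\<bar> \<le> M" using prim unfolding primitive_def by metis
    then have "\<bar>a' y\<bar> \<le> \<bar>M\<bar>" for y
    proof (cases "R < \<bar>y\<bar>")
      case True
      then have "a' y = 0" by (rule supp(2))
      then show ?thesis by simp
    next
      case False
      then have "y \<in> {-R..R}" by (auto simp: abs_le_iff)
      then show ?thesis using \<open>\<forall>y\<in>{-R..R}. \<bar>a' y\<bar> \<le> M\<close> by fastforce
    qed
    then show ?thesis by (intro exI[of _ "\<bar>M\<bar>"]) simp
  qed
  then obtain M where M: "\<And>y. \<bar>a' y\<bar> \<le> M" by metis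
  \<comment> \<open>For \<open>h\<close> in \<open>{c..d}\<close> and
    \<open>\<bar>q\<bar> > L\<close> the point \<open>h - q\<close> lies outside the support of
    \<open>a'\<close>.\<close>
  define L where "L = \<bar>c\<bar> + \<bar>d\<bar> + \<bar>R\<bar>"
  have int: "integrable (lborel \<Otimes>\<^sub>M lborel) (\<lambda>(h,q). indicator {c..d} h * (a' (h - q) * f (x + q *\<^sub>R v)))"
  proof (rule Bochner_Integration.integrable_bound)
    show "integrable (lborel \<Otimes>\<^sub>M lborel) (\<lambda>(h,q). indicator {c..d} h * (indicator {-L..L} q * (M * B)))"
      using integrable_pair_mult[OF integrable_indicator_Icc_const[of c d 1] integrable_indicator_Icc_const] by simp
    have "\<bar>a' (h - q) * f (x + q *\<^sub>R v)\<bar> \<le> indicator {-L..L} q * (M * B)" if "h \<in> {c..d}" for h q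
    proof (cases "q \<in> {-L..L}")
      case True
      have "\<bar>a' (h - q)\<bar> * \<bar>f (x + q *\<^sub>R v)\<bar> \<le> M * B"
        using M[of "h - q"] f(2)[of "x + q *\<^sub>R v"] by (intro mult_mono) linarith+
      then show ?thesis using True by (simp add: abs_mult)
    next
      case False
      then have "R < \<bar>h - q\<bar>" using that by (auto simp: L_def)
      then show ?thesis using supp(2) False by simp
    qed
    note that = this
    have "norm (indicator {c..d} h * (a' (h - q) * f (x + q *\<^sub>R v)))
        \<le> norm (indicator {c..d} h * (indicator {-L..L} q * (M * B)))" for h q
    proof (cases "h \<in> {c..d}")
      case True
      then show ?thesis
        using order_trans[OF that[OF True] abs_ge_self] by (simp only: indicator_simps mult_1 real_norm_def)
    qed simp
    then show "AE z in lborel \<Otimes>\<^sub>M lborel. norm (case z of (h,q) \<Rightarrow> indicator {c..d} h * (a' (h - q) * f (x + q *\<^sub>R v)))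
        \<le> norm (case z of (h,q) \<Rightarrow> indicator {c..d} h * (indicator {-L..L} q * (M * B)))"
      by (intro AE_I2) (simp split: prod.split)
  qed measurable
  have ia_h: "integrable lborel (\<lambda>q. a (h - q) * f (x + q *\<^sub>R v))" for h
  proof -
    have "integrable lborel (\<lambda>q. a (h + (-1) * q) * f (x + h *\<^sub>R v - (h + (-1) * q) *\<^sub>R v))"
      by (rule lborel_integrable_real_affine[OF dconv_integrable[OF ia(1) f]]) simp
    then show ?thesis by (simp add: algebra_simps)
  qed
  have "(LBINT h. indicator {c..d} h * dconv v a' f (x + h *\<^sub>R v))
      = (LBINT h. (LBINT q. indicator {c..d} h * (a' (h - q) * f (x + q *\<^sub>R v))))"
    by (simp add: dconv_reflect)
  also have "\<dots> = (LBINT q. (LBINT h. indicator {c..d} h * (a' (h - q) * f (x + q *\<^sub>R v))))"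
    by (rule lborel_pair.Fubini_integral[OF int, symmetric])
  also have "\<dots> = (LBINT q. (a (d - q) - a (c - q)) * f (x + q *\<^sub>R v))"
    by (simp add: sub flip: mult.assoc)
  also have "\<dots> = dconv v a f (x + d *\<^sub>R v) - dconv v a f (x + c *\<^sub>R v)"
    using ia_h by (simp add: dconv_reflect left_diff_distrib)
  finally show "dconv v a f (x + d *\<^sub>R v) - dconv v a f (x + c *\<^sub>R v)
      = (LBINT h. indicator {c..d} h * dconv v a' f (x + h *\<^sub>R v))" ..
qed

subsection \<open>Smooth functions of one variable\<close>

text \<open>The derivative is quantified existentially so that the inductions below can supply it as
  an explicit formula; \<open>smoothD\<close> identifies it with \<open>deriv\<close>
  afterwards.\<close>

primrec times_differentiable :: "nat \<Rightarrow> (real \<Rightarrow> real) \<Rightarrow> bool" where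
  "times_differentiable 0 f \<longleftrightarrow> continuous_on UNIV f"
| "times_differentiable (Suc n) f \<longleftrightarrow>
     (\<exists>f'. (\<forall>x. (f has_real_derivative f' x) (at x)) \<and> times_differentiable n f')"

definition smooth :: "(real \<Rightarrow> real) \<Rightarrow> bool" where
  "smooth f \<longleftrightarrow> (\<forall>n. times_differentiable n f)"

lemma times_differentiable_SucD: "times_differentiable (Suc n) f \<Longrightarrow> times_differentiable n f"
proof (induction n arbitrary: f)
  case 0
  then show ?case by (auto intro!: DERIV_continuous_on continuous_at_imp_continuous_on intro: DERIV_isCont)
next
  case (Suc n)
  then obtain f' where "\<forall>x. (f has_real_derivative f' x) (at x)" "times_differentiable (Suc n) f'"
    by (metis times_differentiable.simps(2))
  then show ?case using Suc.IH by (metis times_differentiable.simps(2))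
qed

lemma smoothD:
  assumes "smooth f"
  shows "(f has_real_derivative deriv f x) (at x)" "smooth (deriv f)" "continuous_on UNIV f"
proof -
  have *: "(\<forall>x. (f has_real_derivative deriv f x) (at x)) \<and> times_differentiable n (deriv f)" for n
  proof -
    have "times_differentiable (Suc n) f" using assms by (simp add: smooth_def del: times_differentiable.simps)
    then obtain f' where f': "\<forall>x. (f has_real_derivative f' x) (at x)" "times_differentiable n f'" by auto
    then have "deriv f = f'" by (auto intro: DERIV_imp_deriv)
    then show ?thesis using f' by simp
  qed
  then show "(f has_real_derivative deriv f x) (at x)" "smooth (deriv f)" by (auto simp: smooth_def)
  show "continuous_on UNIV f" using assms by (metis smooth_def times_differentiable.simps(1))
qed

lemma smooth_DERIV:
  assumes "\<And>x. (f has_real_derivative f' x) (at x)" "smooth f'"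
  shows "smooth f"
  unfolding smooth_def
proof
  fix n
  have "times_differentiable (Suc n) f" using assms by (auto simp: smooth_def)
  then show "times_differentiable n f" by (rule times_differentiable_SucD)
qed

lemma times_differentiable_lincomb:
  "times_differentiable n f \<Longrightarrow> times_differentiable n g \<Longrightarrow> times_differentiable n (\<lambda>x. c * f x + g x)"
proof (induction n arbitrary: f g)
  case (Suc n)
  then obtain f' g' where "\<forall>x. (f has_real_derivative f' x) (at x)" "times_differentiable n f'"
    "\<forall>x. (g has_real_derivative g' x) (at x)" "times_differentiable n g'" by auto
  then show ?case using Suc.IH[of f' g'] by (auto intro!: exI[of _ "\<lambda>x. c * f' x + g' x"] DERIV_add DERIV_cmult)
qed (auto intro!: continuous_intros)

lemma smooth_mult: assumes "smooth f" "smooth g" shows "smooth (\<lambda>x. f x * g x)"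
proof -
  have "times_differentiable n f \<Longrightarrow> times_differentiable n g \<Longrightarrow> times_differentiable n (\<lambda>x. f x * g x)" for n
  proof (induction n arbitrary: f g)
    case (Suc n)
    then obtain f' g' where 1: "\<forall>x. (f has_real_derivative f' x) (at x)" "times_differentiable n f'"
      "\<forall>x. (g has_real_derivative g' x) (at x)" "times_differentiable n g'" by auto
    have "times_differentiable n f" "times_differentiable n g"
      using times_differentiable_SucD[OF Suc.prems(1)] times_differentiable_SucD[OF Suc.prems(2)] by auto
    then have "times_differentiable n (\<lambda>x. f' x * g x + f x * g' x)"
      using Suc.IH 1 times_differentiable_lincomb[of n _ _ 1] by auto
    moreover have "((\<lambda>x. f x * g x) has_real_derivative f' x * g x + f x * g' x) (at x)" for x
      using DERIV_mult'[of f "f' x" x UNIV g "g' x"] 1 by (simp add: algebra_simps)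
    ultimately show ?case by (auto intro!: exI[of _ "\<lambda>x. f' x * g x + f x * g' x"])
  qed (auto intro: continuous_on_mult)
  then show ?thesis using assms by (simp add: smooth_def)
qed

lemma smooth_const [simp]: "smooth (\<lambda>x. c)"
proof -
  have "times_differentiable n (\<lambda>x. c)" for n c
    by (induction n arbitrary: c) (auto intro!: exI[of _ "\<lambda>_. 0"])
  then show ?thesis by (simp add: smooth_def)
qed

lemma smooth_cmult: "smooth f \<Longrightarrow> smooth (\<lambda>x. c * f x)"
  by (intro smooth_mult smooth_const)

lemma smooth_affine: assumes "smooth f" shows "smooth (\<lambda>x. f (c + d * x))"
proof -
  have "times_differentiable n f \<Longrightarrow> times_differentiable n (\<lambda>x. f (c + d * x))" for n
  proof (induction n arbitrary: f)
    case 0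
    then show ?case by (auto intro!: continuous_on_compose2[of UNIV f] continuous_intros)
  next
    case (Suc n)
    then obtain f' where 1: "\<forall>x. (f has_real_derivative f' x) (at x)" "times_differentiable n f'" by auto
    have "((\<lambda>x. f (c + d * x)) has_real_derivative d * f' (c + d * x)) (at x)" for x
    proof -
      have "((\<lambda>x. f (c + d * x)) has_real_derivative f' (c + d * x) * d) (at x)"
        by (rule DERIV_chain2[of f]) (use 1 in \<open>auto intro!: derivative_eq_intros\<close>)
      then show ?thesis by (simp add: mult.commute)
    qed
    moreover have "times_differentiable n (\<lambda>x. d * f' (c + d * x))"  using times_differentiable_lincomb[OF Suc.IH[OF 1(2)], of "\<lambda>_. 0" d] smooth_const[of 0, unfolded smooth_def] by simp
    ultimately show ?case by (auto intro!: exI[of _ "\<lambda>x. d * f' (c + d * x)"])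
  qed
  then show ?thesis using assms by (simp add: smooth_def)
qed

lemma smooth_exp: "smooth exp"
proof -
  have "times_differentiable n exp" for n
    by (induction n) (auto intro!: exI[of _ exp] continuous_intros DERIV_exp)
  then show ?thesis by (simp add: smooth_def)
qed

lemma smooth_antiderivative:
  assumes "smooth f"
  obtains F where "\<And>x. (F has_real_derivative f x) (at x)" "F c = 0" "smooth F"
proof -
  have "isCont f x" for x
    using smoothD(3)[OF assms] by (simp add: continuous_on_eq_continuous_at)
  then obtain F0 where F0: "\<And>x. (F0 has_vector_derivative f x) (at x)"
    using einterval_antiderivative[of "-\<infinity>" "\<infinity>" f] by auto
  have "((\<lambda>x. F0 x - F0 c) has_real_derivative f x) (at x)" for x
    using DERIV_diff[OF F0[of x, unfolded has_real_derivative_iff_has_vector_derivative[symmetric]] DERIV_const[of "F0 c"]]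
    by simp
  then show thesis using smooth_DERIV[OF _ assms] by (intro that[of "\<lambda>x. F0 x - F0 c"]) auto
qed

definition test_fun :: "(real \<Rightarrow> real) \<Rightarrow> bool" where
  "test_fun f \<longleftrightarrow> smooth f \<and> (\<exists>R. \<forall>x. R < \<bar>x\<bar> \<longrightarrow> f x = 0)"

lemma DERIV_eq_on_open:
  assumes "open S" "x \<in> S" "(f has_real_derivative a) (at x)" "(g has_real_derivative b) (at x)"
    "\<And>y. y \<in> S \<Longrightarrow> f y = g y"
  shows "a = b"
proof -
  have "(g has_real_derivative a) (at x)"
    using has_field_derivative_transform_within_open[OF assms(3,1,2,5)] .
  then show ?thesis using assms(4) by (rule DERIV_unique)
qed

lemma test_fun_deriv:
  assumes "test_fun f"
  shows "test_fun (deriv f)"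
proof -
  obtain R where R: "\<And>x. R < \<bar>x\<bar> \<Longrightarrow> f x = 0" and f: "smooth f" using assms by (auto simp: test_fun_def)
  have "deriv f x = 0" if "R < \<bar>x\<bar>" for x
  proof (rule DERIV_eq_on_open[of "{x. R < \<bar>x\<bar>}" x f _ "\<lambda>_. 0"])
    show "open {x. R < \<bar>x\<bar>}" by (intro open_Collect_less continuous_intros)
  qed (use that R smoothD(1)[OF f] in auto)
  then show ?thesis using smoothD(2)[OF f] by (auto simp: test_fun_def)
qed

lemma test_fun_primitive:
  assumes "test_fun f"
  shows "primitive f (deriv f)"
  using assms smoothD by (auto simp: test_fun_def intro!: primitive_DERIV)

lemma test_fun_bounded:
  assumes "test_fun f"
  obtains B R where "\<And>x. \<bar>f x\<bar> \<le> indicator {-R..R} x * B" "0 \<le> B" "0 \<le> R" "\<And>x. R < \<bar>x\<bar> \<Longrightarrow> f x = 0"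
proof -
  obtain R where R: "\<And>x. R < \<bar>x\<bar> \<Longrightarrow> f x = 0" and f: "smooth f" using assms by (auto simp: test_fun_def)
  obtain B where B: "\<forall>x\<in>{-\<bar>R\<bar>..\<bar>R\<bar>}. \<bar>f x\<bar> \<le> B"
    using primitive_locally_bounded[OF test_fun_primitive[OF assms]] by metis
  have "0 \<le> B" using B by (meson abs_ge_zero atLeastAtMost_iff dual_order.refl neg_le_0_iff_le order_trans)
  have "\<bar>f x\<bar> \<le> indicator {-\<bar>R\<bar>..\<bar>R\<bar>} x * B" for x
  proof (cases "x \<in> {-\<bar>R\<bar>..\<bar>R\<bar>}")
    case False
    then have "R < \<bar>x\<bar>" by auto
    then show ?thesis using R[of x] False by simp
  qed (use B in auto)
  moreover have "f x = 0" if "\<bar>R\<bar> < \<bar>x\<bar>" for x using R[of x] that by simp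
  ultimately show thesis using \<open>0 \<le> B\<close> by (intro that[of "\<bar>R\<bar>" B]) auto
qed

lemma test_fun_measurable: "test_fun f \<Longrightarrow> f \<in> borel_measurable borel"
  using smoothD(3) by (auto simp: test_fun_def intro: borel_measurable_continuous_onI)

lemma test_fun_times_integrable:
  assumes "test_fun f" "g \<in> borel_measurable borel" "\<And>a b. \<exists>B. \<forall>x\<in>{a..b}. \<bar>g x\<bar> \<le> B"
  shows "integrable lborel (\<lambda>x. f x * g x)"
proof -
  obtain B R where f: "\<And>x. \<bar>f x\<bar> \<le> indicator {-R..R} x * B" "0 \<le> B" by (rule test_fun_bounded[OF assms(1)]) metis
  obtain C where C: "\<forall>x\<in>{-R..R}. \<bar>g x\<bar> \<le> C" using assms(3) by metis
  note [measurable] = test_fun_measurable[OF assms(1)] assms(2)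
  show ?thesis
  proof (rule Bochner_Integration.integrable_bound[OF integrable_indicator_Icc_const[of "-R" R "B * C"]])
    show "AE x in lborel. norm (f x * g x) \<le> norm (indicator {-R..R} x * (B * C))"
    proof (rule AE_I2)
      fix x
      show "norm (f x * g x) \<le> norm (indicator {-R..R} x * (B * C))"
      proof (cases "x \<in> {-R..R}")
        case True
        then have "\<bar>f x\<bar> * \<bar>g x\<bar> \<le> B * C" using f(1)[of x] f(2) C by (intro mult_mono) auto
        moreover have "0 \<le> C" using C True abs_ge_zero order_trans by blast
        ultimately show ?thesis using True f(2) by (simp add: abs_mult)
      next
        case False
        then have "f x = 0" using f(1)[of x] by simp
        then show ?thesis by simp
      qed
    qed
  qed measurable
qed

lemma test_fun_integrable: "test_fun f \<Longrightarrow> integrable lborel f"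
  using test_fun_times_integrable[of f "\<lambda>_. 1"] by (auto intro: exI[of _ 1])

subsection \<open>A smooth step\<close>

text \<open>The functions x^(-n) exp (-1/x), extended by zero, are closed under differentiation up
  to linear combinations, so that an induction over the order of differentiability handles all n
  simultaneously.\<close>

lemma smooth_exp_inverse: "smooth (\<lambda>x. if x \<le> 0 then 0 else exp (- inverse x))"
proof -
  define g where "g n x = (if x \<le> 0 then 0 else inverse x ^ n * exp (- inverse x))" for n and x :: real
  have lim: "((\<lambda>h. inverse h ^ n * exp (- inverse h)) \<longlongrightarrow> 0) (at_right (0::real))" for n
  proof -
    have "((\<lambda>h. (inverse h) ^ n / exp (inverse h)) \<longlongrightarrow> 0) (at_right (0::real))"
      by (rule filterlim_compose[OF tendsto_power_div_exp_0 filterlim_inverse_at_top_right])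
    then show ?thesis by (simp add: exp_minus divide_inverse)
  qed
  have der: "(g n has_real_derivative (- real n * g (Suc n) x + g (Suc (Suc n)) x)) (at x)" for n x
  proof -
    consider "x < 0" | "x = 0" | "0 < x" by linarith
    then show ?thesis
    proof cases
      case 1
      have "((\<lambda>_. 0) has_real_derivative 0) (at x)" by simp
      then have "(g n has_real_derivative 0) (at x)"
        by (rule has_field_derivative_transform_within_open[where S="{..<0}"]) (use 1 in \<open>auto simp: g_def\<close>)
      then show ?thesis using 1 by (simp add: g_def)
    next
      case 2
      \<comment> \<open>To the right of 0 the difference quotient of \<open>g n\<close> at 0 is
        \<open>g (Suc n)\<close>, which tends to 0 faster than any power.\<close>
      have "((\<lambda>h. (g n h - g n 0) / h) \<longlongrightarrow> 0) (at_right 0)"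
      proof (rule Lim_transform_eventually[OF lim[of "Suc n"]])
        show "\<forall>\<^sub>F h in at_right 0. inverse h ^ Suc n * exp (- inverse h) = (g n h - g n 0) / h"
          by (auto simp: eventually_at_right_field g_def field_simps intro!: exI[of _ 1])
      qed
      moreover have "((\<lambda>h. (g n h - g n 0) / h) \<longlongrightarrow> 0) (at_left 0)"
      proof (rule tendsto_eventually)
        show "\<forall>\<^sub>F h in at_left 0. (g n h - g n 0) / h = 0"
          by (auto simp: eventually_at_left_field g_def intro!: exI[of _ "-1"])
      qed
      ultimately have "((\<lambda>h. (g n h - g n 0) / h) \<longlongrightarrow> 0) (at 0)" by (simp add: filterlim_split_at)
      then have "(g n has_real_derivative 0) (at 0)" by (simp add: DERIV_def)
      then show ?thesis using 2 by (simp add: g_def)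
    next
      case 3
      have "((\<lambda>x. inverse x ^ n * exp (- inverse x)) has_real_derivative
          (- real n * (inverse x ^ Suc n * exp (- inverse x)) + inverse x ^ Suc (Suc n) * exp (- inverse x))) (at x)"
      proof (cases n)
        case 0
        then show ?thesis using 3 by (auto intro!: derivative_eq_intros simp: power2_eq_square field_simps)
      next
        case (Suc m)
        have "(inverse has_real_derivative - (inverse x ^ 2)) (at x)"
          using DERIV_inverse[of x] 3 by (simp add: numeral_2_eq_2)
        then have "((\<lambda>x. inverse x ^ Suc m) has_real_derivative (1 + real m) * (- (inverse x ^ 2) * inverse x ^ m)) (at x)"
          by (rule DERIV_power_Suc)
        moreover have "((\<lambda>x. exp (- inverse x)) has_real_derivative exp (- inverse x) * inverse x ^ 2) (at x)"
          using 3 by (auto intro!: derivative_eq_intros simp: power2_eq_square field_simps)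
        ultimately show ?thesis unfolding Suc
          by (rule DERIV_mult[THEN DERIV_cong]) (simp add: power2_eq_square algebra_simps)
      qed
      then have "(g n has_real_derivative
          (- real n * (inverse x ^ Suc n * exp (- inverse x)) + inverse x ^ Suc (Suc n) * exp (- inverse x))) (at x)"
        by (rule has_field_derivative_transform_within_open[where S="{0<..}"]) (use 3 in \<open>auto simp: g_def\<close>)
      then show ?thesis using 3 by (simp add: g_def)
    qed
  qed
  have "times_differentiable k (g n)" for k n
  proof (induction k arbitrary: n)
    case 0
    show ?case using der[of n] by (auto intro!: continuous_at_imp_continuous_on intro: DERIV_isCont)
  next
    case (Suc k)
    have "times_differentiable k (\<lambda>x. - real n * g (Suc n) x + g (Suc (Suc n)) x)"
      by (intro times_differentiable_lincomb Suc)
    then show ?case using der[of n] by (auto intro!: exI[of _ "\<lambda>x. - real n * g (Suc n) x + g (Suc (Suc n)) x"])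
  qed
  then have "smooth (g 0)" by (simp add: smooth_def)
  moreover have "g 0 = (\<lambda>x. if x \<le> 0 then 0 else exp (- inverse x))" by (auto simp: g_def)
  ultimately show ?thesis by simp
qed

text \<open>The antiderivative of the bump e(x) e(1 - x), normalised to reach 1. Its density
  \<open>\<rho>\<close> is returned as well because, after rescaling, it becomes the
  mollifier.\<close>

lemma smooth_step_exists:
  obtains \<sigma> \<rho> :: "real \<Rightarrow> real" where "smooth \<sigma>" "smooth \<rho>" "\<And>x. (\<sigma> has_real_derivative \<rho> x) (at x)"
    "\<And>x. x \<le> 0 \<Longrightarrow> \<sigma> x = 0" "\<And>x. 1 \<le> x \<Longrightarrow> \<sigma> x = 1" "\<And>x. 0 \<le> \<sigma> x" "\<And>x. \<sigma> x \<le> 1"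
    "\<And>x. 0 \<le> \<rho> x" "\<And>x. x \<le> 0 \<Longrightarrow> \<rho> x = 0" "\<And>x. 1 \<le> x \<Longrightarrow> \<rho> x = 0"
proof -
  define e :: "real \<Rightarrow> real" where "e x = (if x \<le> 0 then 0 else exp (- inverse x))" for x
  have e: "smooth e" using smooth_exp_inverse by (simp add: e_def[abs_def])
  define \<beta> where "\<beta> x = e x * e (1 + (-1) * x)" for x
  have \<beta>: "smooth \<beta>" unfolding \<beta>_def by (intro smooth_mult e smooth_affine)
  have \<beta>0: "0 \<le> \<beta> x" "x \<le> 0 \<Longrightarrow> \<beta> x = 0" "1 \<le> x \<Longrightarrow> \<beta> x = 0" "0 < x \<Longrightarrow> x < 1 \<Longrightarrow> 0 < \<beta> x" for x
    by (auto simp: \<beta>_def e_def)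
  obtain S where S: "\<And>x. (S has_real_derivative \<beta> x) (at x)" "S 0 = 0" "smooth S"
    using smooth_antiderivative[OF \<beta>] by metis
  have mono: "S x \<le> S y" if "x \<le> y" for x y
    using DERIV_nonneg_imp_nondecreasing[OF that, of S] S(1) \<beta>0(1) by metis
  have neg: "S x = 0" if "x \<le> 0" for x
  proof (rule antisym)
    show "S x \<le> 0" using mono[OF that] S(2) by simp
    have "S 0 \<le> S x"
      by (rule DERIV_nonpos_imp_nonincreasing[OF that]) (use S(1) \<beta>0(2) in \<open>metis order_refl\<close>)
    then show "0 \<le> S x" using S(2) by simp
  qed
  have pos: "S x = S 1" if "1 \<le> x" for x
  proof (rule antisym)
    show "S 1 \<le> S x" using mono[OF that] .
    show "S x \<le> S 1"
      by (rule DERIV_nonpos_imp_nonincreasing[OF that]) (use S(1) \<beta>0(3) in \<open>metis order_refl\<close>)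
  qed
  have "0 < S 1"
  proof -
    obtain z where "0 < z" "z < 1" "S 1 - S 0 = (1 - 0) * \<beta> z"
      using MVT2[of 0 1 S \<beta>] S(1) by auto
    then show ?thesis using \<beta>0(4)[of z] S(2) by simp
  qed
  show thesis
  proof (rule that[of "\<lambda>x. inverse (S 1) * S x" "\<lambda>x. inverse (S 1) * \<beta> x"])
    show "((\<lambda>x. inverse (S 1) * S x) has_real_derivative inverse (S 1) * \<beta> x) (at x)" for x
      by (intro DERIV_cmult S)
    show "smooth (\<lambda>x. inverse (S 1) * S x)" "smooth (\<lambda>x. inverse (S 1) * \<beta> x)"
      by (intro smooth_cmult S \<beta>)+
    show "inverse (S 1) * S x \<le> 1" for x
      using \<open>0 < S 1\<close> mono[of x 1] mono[of 1 x] pos[of x] by (cases "x \<le> 1") (simp_all add: field_simps)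
    show "0 \<le> inverse (S 1) * S x" for x
      using \<open>0 < S 1\<close> mono[of 0 x] neg[of x] S(2) by (cases "0 \<le> x") auto
    show "inverse (S 1) * S x = 0" if "x \<le> 0" for x using neg[OF that] by simp
    show "inverse (S 1) * S x = 1" if "1 \<le> x" for x using pos[OF that] \<open>0 < S 1\<close> by simp
    show "0 \<le> inverse (S 1) * \<beta> x" for x using \<open>0 < S 1\<close> \<beta>0(1)[of x] by simp
    show "inverse (S 1) * \<beta> x = 0" if "x \<le> 0" for x using \<beta>0(2)[OF that] by simp
    show "inverse (S 1) * \<beta> x = 0" if "1 \<le> x" for x using \<beta>0(3)[OF that] by simp
  qed
qed

subsection \<open>The fundamental lemma of the calculus of variations\<close>

text \<open>Lebesgue's differentiation theorem: almost everywhere \<open>f\<close> is the limit of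
  its means over shrinking intervals.\<close>

lemma AE_eq_0_if_interval_integrals_eq_0:
  fixes f :: "real \<Rightarrow> real"
  assumes f: "f \<in> borel_measurable borel" "\<And>a b. \<exists>B. \<forall>x\<in>{a..b}. \<bar>f x\<bar> \<le> B"
    and 0: "\<And>a b. a < b \<Longrightarrow> (LBINT x. indicator {a..b} x * f x) = 0"
  shows "AE x in lborel. f x = 0"
proof -
  have si: "set_integrable lborel {a..b} f" for a b
  proof -
    obtain B where "\<forall>x\<in>{a..b}. \<bar>f x\<bar> \<le> B" using f(2) by metis
    then show ?thesis using integrable_indicator_Icc[OF f(1), of a b B] by (simp add: set_integrable_def)
  qed
  have hk: "f integrable_on {a..b}" "integral {a..b} f = 0" if "a < b" for a b
    using set_borel_integral_eq_integral[OF si] 0[OF that] by (auto simp: set_lebesgue_integral_def)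
  have "f integrable_on cbox a b" for a b :: real
    using set_borel_integral_eq_integral(1)[OF si] by simp
  then obtain N where N: "negligible N"
    "\<And>x e. \<lbrakk>x \<notin> N; 0 < e\<rbrakk> \<Longrightarrow> \<exists>d>0. \<forall>h. 0 < h \<and> h < d \<longrightarrow>
        norm (integral (cbox x (x + h *\<^sub>R One)) f /\<^sub>R h ^ DIM(real) - f x) < e"
    by (rule integrable_ccontinuous_explicit) metis
  have "f x = 0" if x: "x \<notin> N" for x
  proof (rule ccontr)
    assume "f x \<noteq> 0"
    then obtain d where d: "d > 0" "\<forall>h. 0 < h \<and> h < d \<longrightarrow>
        norm (integral (cbox x (x + h *\<^sub>R One)) f /\<^sub>R h ^ DIM(real) - f x) < \<bar>f x\<bar>"
      using N(2)[OF x, of "\<bar>f x\<bar>"] by auto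
    then have "norm (integral (cbox x (x + (d/2) *\<^sub>R One)) f /\<^sub>R (d/2) ^ DIM(real) - f x) < \<bar>f x\<bar>"
      using d(1) by (intro d(2)[rule_format]) auto
    then show False using hk(2)[of x "x + d/2"] d(1) by simp
  qed
  then have "AE x in lebesgue. f x = 0"
    using N(1) by (auto simp: negligible_iff_null_sets eventually_ae_filter intro!: exI[of _ N])
  then show ?thesis by (simp add: AE_completion_iff)
qed

text \<open>A rising and a falling step, both steepened by the factor n, multiply to test functions
  that converge boundedly to the indicator of an open interval; this reduces the claim to interval
  integrals.\<close>

lemma fundamental_lemma:
  fixes f :: "real \<Rightarrow> real"
  assumes f: "f \<in> borel_measurable borel" "\<And>a b. \<exists>B. \<forall>x\<in>{a..b}. \<bar>f x\<bar> \<le> B"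
    and 0: "\<And>h. test_fun h \<Longrightarrow> (LBINT x. f x * h x) = 0"
  shows "AE x in lborel. f x = 0"
proof (rule AE_eq_0_if_interval_integrals_eq_0[OF f])
  fix a b :: real assume ab: "a < b"
  obtain \<sigma> \<rho> :: "real \<Rightarrow> real" where \<sigma>: "smooth \<sigma>" "\<And>x. x \<le> 0 \<Longrightarrow> \<sigma> x = 0" "\<And>x. 1 \<le> x \<Longrightarrow> \<sigma> x = 1"
    "\<And>x. 0 \<le> \<sigma> x" "\<And>x. \<sigma> x \<le> 1"
    by (rule smooth_step_exists) metis
  define h where "h n x = \<sigma> (- real n * a + real n * x) * \<sigma> (real n * b + (- real n) * x)" for n x
  obtain B where B: "\<forall>x\<in>{a..b}. \<bar>f x\<bar> \<le> B" using f(2) by metis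
  have h_out: "h n x = 0" if "x \<notin> {a<..<b}" for n x
  proof -
    have "real n * (x - a) \<le> 0 \<or> real n * (b - x) \<le> 0"
      using that by (cases "x \<le> a") (auto intro!: mult_nonneg_nonpos)
    then show ?thesis using \<sigma>(2) by (auto simp: h_def algebra_simps)
  qed
  have h01: "0 \<le> h n x" "h n x \<le> 1" for n x
    using \<sigma>(4,5) by (auto simp: h_def intro: mult_le_one)
  have test: "test_fun (h n)" for n
  proof -
    have "smooth (h n)" unfolding h_def by (intro smooth_mult smooth_affine \<sigma>)
    moreover have "h n x = 0" if "\<bar>a\<bar> + \<bar>b\<bar> < \<bar>x\<bar>" for x
      by (rule h_out) (use that in auto)
    ultimately show ?thesis by (auto simp: test_fun_def)
  qed
  have lim: "(\<lambda>n. f x * h n x) \<longlonglongrightarrow> f x * indicator {a<..<b} x" for x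
  proof (cases "x \<in> {a<..<b}")
    case True
    define d where "d = min (x - a) (b - x)"
    have "0 < d" using True by (auto simp: d_def)
    obtain N where N: "1 / d \<le> real N" using real_arch_simple by blast
    have "h n x = 1" if "N \<le> n" for n
    proof -
      have "1 / d \<le> real n" using N that by (meson of_nat_le_iff order_trans)
      then have "1 \<le> real n * d" using \<open>0 < d\<close> by (simp add: field_simps)
      moreover have "real n * d \<le> real n * (x - a)" "real n * d \<le> real n * (b - x)"
        by (intro mult_left_mono; simp add: d_def)+
      ultimately show ?thesis using \<sigma>(3) by (simp add: h_def algebra_simps)
    qed
    then show ?thesis using True
      by (intro tendsto_eventually eventually_sequentiallyI[of N]) simp
  next
    case False
    then show ?thesis using h_out by simp
  qed
  have "(\<lambda>n. LBINT x. f x * h n x) \<longlonglongrightarrow> (LBINT x. f x * indicator {a<..<b} x)"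
  proof (rule integral_dominated_convergence[where w="\<lambda>x. indicator {a..b} x * B"])
    note [measurable] = f(1) test_fun_measurable[OF test]
    show "(\<lambda>x. f x * h n x) \<in> borel_measurable lborel" for n by measurable
    show "AE x in lborel. norm (f x * h n x) \<le> indicator {a..b} x * B" for n
    proof (rule AE_I2)
      fix x
      show "norm (f x * h n x) \<le> indicator {a..b} x * B"
      proof (cases "x \<in> {a..b}")
        case True
        then have "\<bar>f x\<bar> * \<bar>h n x\<bar> \<le> B * 1" using B h01[of n x] by (intro mult_mono) auto
        then show ?thesis using True by (simp add: abs_mult)
      next
        case False
        then have "h n x = 0" by (intro h_out) auto
        then show ?thesis using False by simp
      qed
    qed
    show "integrable lborel (\<lambda>x. indicator {a..b} x * B)" by (rule integrable_indicator_Icc_const)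
  qed (use f(1) lim in auto)
  then have "(LBINT x. f x * indicator {a<..<b} x) = 0"
    using 0[OF test] by (simp add: LIMSEQ_const_iff)
  moreover have "(LBINT x. f x * indicator {a<..<b} x) = (LBINT x. indicator {a..b} x * f x)"
  proof (rule integral_cong_AE)
    show "AE x in lborel. f x * indicator {a<..<b} x = indicator {a..b} x * f x"
      using AE_lborel_singleton[of a] AE_lborel_singleton[of b]
      by eventually_elim (auto simp: indicator_def)
  qed (use f(1) in measurable)
  ultimately show "(LBINT x. indicator {a..b} x * f x) = 0" by simp
qed

subsection \<open>Primitives vanishing on the negative half line\<close>

text \<open>The condition \<open>F 0 = 0\<close> keeps the truncated function continuous; a jump at
  0 would put a point mass into its derivative.\<close>

lemma primitive_cutoff:
  assumes "primitive F f" "F 0 = 0"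
  shows "primitive (\<lambda>x. if x \<le> 0 then 0 else F x) (\<lambda>x. indicator {0<..} x * f x)"
proof (rule primitiveI)
  note [measurable] = primitiveD(1)[OF assms(1)]
  show "(\<lambda>x. indicator {0<..} x * f x) \<in> borel_measurable borel" by measurable
  show "\<exists>B. \<forall>x\<in>{a..b}. \<bar>indicator {0<..} x * f x\<bar> \<le> B" for a b
  proof -
    obtain B where "\<forall>x\<in>{a..b}. \<bar>f x\<bar> \<le> B" using assms(1) unfolding primitive_def by metis
    then have "\<forall>x\<in>{a..b}. \<bar>indicator {0<..} x * f x\<bar> \<le> \<bar>B\<bar>"
      by (auto simp: indicator_def intro: order_trans[OF _ abs_ge_self])
    then show ?thesis by metis
  qed
  fix a b :: real assume "a \<le> b"
  have *: "(LBINT x. indicator {0..c} x * f x) = (LBINT x. indicator {..c} x * (indicator {0<..} x * f x))" for c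
    by (rule integral_cong_AE)
      (use AE_lborel_singleton[of 0] in \<open>auto elim!: eventually_mono simp: indicator_def\<close>)
  consider "b \<le> 0" | "a \<le> 0" "0 < b" | "0 < a" using \<open>a \<le> b\<close> by linarith
  then show "(if b \<le> 0 then 0 else F b) - (if a \<le> 0 then 0 else F a)
      = (LBINT x. indicator {a..b} x * (indicator {0<..} x * f x))"
  proof cases
    case 1
    then have z: "(\<lambda>x. indicator {a..b} x * (indicator {0<..} x * f x)) = (\<lambda>x. 0)"
      by (auto simp: indicator_def fun_eq_iff)
    show ?thesis unfolding z using 1 \<open>a \<le> b\<close> by simp
  next
    case 2
    have "(LBINT x. indicator {a..b} x * (indicator {0<..} x * f x)) = (LBINT x. indicator {..b} x * (indicator {0<..} x * f x))"
      using 2 by (intro Bochner_Integration.integral_cong) (auto simp: indicator_def)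
    then show ?thesis using 2 primitiveD(3)[OF assms(1), of 0 b] assms(2) *[of b] by simp
  next
    case 3
    have "(LBINT x. indicator {a..b} x * (indicator {0<..} x * f x)) = (LBINT x. indicator {a..b} x * f x)"
      using 3 by (intro Bochner_Integration.integral_cong) (auto simp: indicator_def)
    then show ?thesis using 3 primitiveD(3)[OF assms(1) \<open>a \<le> b\<close>] \<open>a \<le> b\<close> by simp
  qed
qed

lemma primitive_exists:
  assumes "f \<in> borel_measurable borel" "\<And>a b. \<exists>B. \<forall>x\<in>{a..b}. \<bar>f x\<bar> \<le> B" "\<And>x. x \<le> 0 \<Longrightarrow> f x = 0"
  shows "primitive (\<lambda>y. LBINT x. indicator {0..y} x * f x) f"
proof (rule primitiveI[OF assms(1,2)])
  fix a b :: real assume "a \<le> b"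
  have int: "integrable lborel (\<lambda>x. indicator {c..d} x * f x)" for c d
  proof -
    obtain B where "\<forall>x\<in>{c..d}. \<bar>f x\<bar> \<le> B" using assms(2) by metis
    then show ?thesis using integrable_indicator_Icc[OF assms(1), of c d B] by simp
  qed
  have "(LBINT x. indicator {0..b} x * f x) - (LBINT x. indicator {0..a} x * f x)
      = (LBINT x. indicator {0..b} x * f x - indicator {0..a} x * f x)"
    using int by simp
  also have "\<dots> = (LBINT x. indicator {a..b} x * f x)"
  proof (rule integral_cong_AE)
    show "AE x in lborel. indicator {0..b} x * f x - indicator {0..a} x * f x = indicator {a..b} x * f x"
      using AE_lborel_singleton[of a]
    proof eventually_elim
      case (elim x)
      then show ?case using \<open>a \<le> b\<close> assms(3)[of x] by (cases "x \<le> 0") (auto simp: indicator_def)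
    qed
  qed (use assms(1) in measurable)
  finally show "(LBINT x. indicator {0..b} x * f x) - (LBINT x. indicator {0..a} x * f x) = \<dots>" .
qed

text \<open>Integrating \<open>U g'\<close> by parts without a boundary term for arbitrary \<open>g\<close> forces the boundary value
  of \<open>U\<close> at \<open>0\<close> to vanish.\<close>

lemma weak_primitive:
  fixes U V :: "real \<Rightarrow> real"
  assumes U: "U \<in> borel_measurable borel" "\<And>x. \<bar>U x\<bar> \<le> B" "\<And>x. x \<le> 0 \<Longrightarrow> U x = 0"
    and V: "V \<in> borel_measurable borel" "\<And>x. \<bar>V x\<bar> \<le> B" "\<And>x. x \<le> 0 \<Longrightarrow> V x = 0"
    and weak: "\<And>g. test_fun g \<Longrightarrow> (LBINT x. U x * deriv g x + V x * g x) = 0"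
  obtains W where "primitive W V" "\<And>x. x \<le> 0 \<Longrightarrow> W x = 0" "AE x in lborel. U x = W x"
proof -
  define W where "W y = (LBINT x. indicator {0..y} x * V x)" for y
  have W: "primitive W V"
    unfolding W_def[abs_def] by (rule primitive_exists) (use V in auto)
  have W0: "W y = 0" if "y \<le> 0" for y
  proof -
    have z: "(\<lambda>x. indicator {0..y} x * V x) = (\<lambda>x. 0)"
      using that V(3) by (auto simp: indicator_def fun_eq_iff)
    show ?thesis unfolding W_def z by simp
  qed
  obtain \<sigma> \<rho> :: "real \<Rightarrow> real" where \<sigma>: "smooth \<sigma>" "\<And>x. x \<le> 0 \<Longrightarrow> \<sigma> x = 0" "\<And>x. 1 \<le> x \<Longrightarrow> \<sigma> x = 1"
    by (rule smooth_step_exists) metis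
  note [measurable] = U(1) V(1) primitive_measurable[OF W]
  have lbU: "\<exists>C. \<forall>x\<in>{a..b}. \<bar>U x\<bar> \<le> C" for a b using U(2) by metis
  have lbV: "\<exists>C. \<forall>x\<in>{a..b}. \<bar>V x\<bar> \<le> C" for a b using V(2) by metis
  have lbW: "\<exists>C. \<forall>x\<in>{a..b}. \<bar>W x\<bar> \<le> C" for a b by (rule primitive_locally_bounded[OF W])
  have lb: "\<exists>C. \<forall>x\<in>{a..b}. \<bar>U x - W x\<bar> \<le> C" for a b
  proof -
    obtain C D where "\<forall>x\<in>{a..b}. \<bar>U x\<bar> \<le> C" "\<forall>x\<in>{a..b}. \<bar>W x\<bar> \<le> D" using lbU lbW by metis
    then have "\<forall>x\<in>{a..b}. \<bar>U x - W x\<bar> \<le> C + D" by (metis abs_triangle_ineq4 add_mono order_trans)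
    then show ?thesis by metis
  qed
  have g0: "(LBINT x. (U x - W x) * deriv g x) = 0" if g: "test_fun g" for g
  proof -
    have i: "integrable lborel (\<lambda>x. U x * deriv g x)" "integrable lborel (\<lambda>x. W x * deriv g x)"
        "integrable lborel (\<lambda>x. V x * g x)" "integrable lborel (\<lambda>x. W x * g x)"
      using test_fun_times_integrable[OF test_fun_deriv[OF g] _ lbU] test_fun_times_integrable[OF test_fun_deriv[OF g] _ lbW]
        test_fun_times_integrable[OF g _ lbV] test_fun_times_integrable[OF g _ lbW]
      by (simp_all add: mult.commute)
    have "(LBINT x. V x * g x) = - (LBINT x. W x * deriv g x)"
      by (rule primitive_by_parts[OF W test_fun_primitive[OF g]]) (use i in auto)
    moreover have "(LBINT x. U x * deriv g x) + (LBINT x. V x * g x) = 0"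
      using weak[OF g] i by simp
    ultimately show ?thesis using i by (simp add: left_diff_distrib)
  qed
  have "AE x in lborel. U x - W x = 0"
  proof (rule fundamental_lemma[OF _ lb])
    fix h assume h: "test_fun h"
    then obtain R where R: "\<And>x. R < \<bar>x\<bar> \<Longrightarrow> h x = 0" by (auto simp: test_fun_def)
    \<comment> \<open>The constant of integration is chosen so that \<open>G\<close> vanishes to the
      right of the support of \<open>h\<close>. To the left of the support \<open>G\<close> is in
      general a nonzero constant.\<close>
    obtain G where G: "\<And>x. (G has_real_derivative h x) (at x)" "G (\<bar>R\<bar> + 1) = 0" "smooth G"
      using smooth_antiderivative[of h "\<bar>R\<bar> + 1"] h by (auto simp: test_fun_def)
    have G0: "G x = 0" if "\<bar>R\<bar> + 1 \<le> x" for x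
    proof (rule antisym)
      show "G x \<le> 0"
        using DERIV_nonpos_imp_nonincreasing[OF that, of G] G(1,2) R
        by (metis abs_ge_self add_increasing2 dual_order.strict_trans1 less_add_one order_refl order_le_less_trans order_trans)
      show "0 \<le> G x"
        using DERIV_nonneg_imp_nondecreasing[OF that, of G] G(1,2) R
        by (metis abs_ge_self add_increasing2 dual_order.strict_trans1 less_add_one order_refl order_le_less_trans order_trans)
    qed
    \<comment> \<open>The left tail of \<open>G\<close> is removed by a step that rises on
      \<open>{-2..-1}\<close>, where \<open>U\<close> and \<open>W\<close> vanish, so that
      \<open>g\<close> has derivative \<open>h\<close> on the half line that matters. Nothing forces
      \<open>g 0\<close> to be zero, and this freedom pins down the boundary value of
      \<open>U\<close>.\<close>
    define g where "g x = \<sigma> (2 + 1 * x) * G x" for x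
    have g: "test_fun g"
      unfolding test_fun_def
    proof
      show "smooth g" unfolding g_def[abs_def] by (intro smooth_mult smooth_affine \<sigma> G)
      have "g x = 0" if "\<bar>R\<bar> + 2 < \<bar>x\<bar>" for x
        using G0[of x] \<sigma>(2)[of "2 + x"] that by (cases "0 \<le> x") (auto simp: g_def)
      then show "\<exists>R. \<forall>x. R < \<bar>x\<bar> \<longrightarrow> g x = 0" by metis
    qed
    have dg: "deriv g x = h x" if "0 < x" for x
    proof (rule DERIV_eq_on_open[of "{0<..}" x g _ G])
      show "(g has_real_derivative deriv g x) (at x)" using g smoothD(1) by (auto simp: test_fun_def)
      show "(G has_real_derivative h x) (at x)" by (rule G)
      show "g y = G y" if "y \<in> {0<..}" for y using \<sigma>(3)[of "2 + y"] that by (simp add: g_def)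
    qed (use that in auto)
    have z: "(\<lambda>x. (U x - W x) * h x) = (\<lambda>x. (U x - W x) * deriv g x)"
    proof
      fix x
      show "(U x - W x) * h x = (U x - W x) * deriv g x"
        using dg[of x] U(3)[of x] W0[of x] by (cases "0 < x") auto
    qed
    show "(LBINT x. (U x - W x) * h x) = 0" unfolding z by (rule g0[OF g])
  qed measurable
  then show thesis using W W0 by (intro that[of W]) auto
qed

subsection \<open>The resolvent of the half line\<close>

text \<open>With this kernel \<open>dconv 1 exp_kernel A y\<close> is the integral of exp (y - x)
  A(x) over x \<ge> y, that is, the bounded solution F of F - F' = A.\<close>

definition exp_kernel :: "real \<Rightarrow> real" where
  "exp_kernel r = indicator {..0} r * exp r"

text \<open>Test functions will be allowed to decay like exp (- x / 2). The rate lies strictly below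
  1 so that solving b' + b = g preserves it; at rate 1 a factor x would appear.\<close>

lemma exp_half_integrable: "integrable lborel (\<lambda>x::real. indicator {0..} x * exp (- x / 2))"
proof (rule integrableI_nonneg)
  have "(\<integral>\<^sup>+x. ennreal (exp (- x / 2)) * indicator {0..} x \<partial>lborel) = ennreal (0 - (- 2 * exp (- 0 / 2)))"
  proof (rule nn_integral_FTC_atLeast)
    show "((\<lambda>x::real. - 2 * exp (- x / 2)) \<longlongrightarrow> 0) at_top"
      by real_asymp
  qed (auto intro!: derivative_eq_intros)
  then show "(\<integral>\<^sup>+x. ennreal (indicator {0..} x * exp (- x / 2)) \<partial>lborel) < \<infinity>"
    by (simp add: mult.commute indicator_mult_ennreal)
qed auto

lemma exp_kernel_nn_integral: "(\<integral>\<^sup>+r. ennreal (exp_kernel r) \<partial>lborel) = 1"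
proof -
  have "(\<integral>\<^sup>+r. ennreal (exp_kernel r) \<partial>lborel) = (\<integral>\<^sup>+r. ennreal (exp_kernel (0 + (-1) * r)) \<partial>lborel)"
    by (subst nn_integral_real_affine[of _ "-1" 0]) (auto simp: exp_kernel_def)
  also have "\<dots> = (\<integral>\<^sup>+x. ennreal (exp (- x)) * indicator {0..} x \<partial>lborel)"
    by (intro nn_integral_cong) (auto simp: exp_kernel_def indicator_def)
  also have "\<dots> = ennreal (0 - (- exp (- 0)))"
  proof (rule nn_integral_FTC_atLeast)
    show "((\<lambda>x::real. - exp (- x)) \<longlongrightarrow> 0) at_top"
      by real_asymp
  qed (auto intro!: derivative_eq_intros)
  finally show ?thesis by simp
qed

lemma exp_kernel [simp]: "integrable lborel exp_kernel" "(LBINT r. \<bar>exp_kernel r\<bar>) = 1"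
  "exp_kernel \<in> borel_measurable borel"
proof -
  have m [measurable]: "exp_kernel \<in> borel_measurable borel"
    unfolding exp_kernel_def[abs_def] by measurable
  have nn: "0 \<le> exp_kernel r" for r by (simp add: exp_kernel_def)
  show 1: "integrable lborel exp_kernel"
    using exp_kernel_nn_integral nn by (intro integrableI_nonneg) auto
  have "ennreal (LBINT r. exp_kernel r) = 1"
    using nn_integral_eq_integral[OF 1] nn exp_kernel_nn_integral by simp
  then show "(LBINT r. \<bar>exp_kernel r\<bar>) = 1"
    using nn by (simp add: abs_of_nonneg ennreal_eq_1)
  show "exp_kernel \<in> borel_measurable borel" by (rule m)
qed

text \<open>The resolvent is exp y times a tail integral of exp (- x) A(x), so the product rule
  gives its derivative.\<close>

lemma resolvent_primitive:
  fixes A :: "real \<Rightarrow> real"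
  assumes A: "A \<in> borel_measurable borel" "\<And>x. \<bar>A x\<bar> \<le> B"
  shows "primitive (dconv 1 exp_kernel A) (\<lambda>y. dconv 1 exp_kernel A y - A y)"
proof -
  note [measurable] = A(1)
  define P where "P y = (LBINT x. indicator {y..} x * (exp (- x) * A x))" for y
  have eq: "dconv 1 exp_kernel A y = exp y * P y" for y
  proof -
    have "dconv 1 exp_kernel A y = (LBINT q. exp_kernel (y - q) * A q)"
      using dconv_reflect[of "1::real" exp_kernel A 0 y] by simp
    also have "\<dots> = (LBINT x. exp y * (indicator {y..} x * (exp (- x) * A x)))"
      by (intro Bochner_Integration.integral_cong) (auto simp: exp_kernel_def indicator_def exp_diff exp_minus field_simps)
    finally show ?thesis by (simp add: P_def)
  qed
  have int: "integrable lborel (\<lambda>x. indicator {y..} x * (exp (- x) * A x))" for y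
  proof -
    have "integrable lborel (\<lambda>q. exp_kernel (y + (-1) * q) * A (y - (y + (-1) * q)))"
      using lborel_integrable_real_affine[OF dconv_integrable[OF exp_kernel(1) A, of y "1::real"], of "-1" y] by simp
    then have i: "integrable lborel (\<lambda>q. exp (- y) * (exp_kernel (y + (-1) * q) * A (y - (y + (-1) * q))))"
      by (rule integrable_mult_right)
    have z: "(\<lambda>q. exp (- y) * (exp_kernel (y + (-1) * q) * A (y - (y + (-1) * q)))) = (\<lambda>q. indicator {y..} q * (exp (- q) * A q))"
      by (auto simp: exp_kernel_def indicator_def exp_diff exp_minus field_simps fun_eq_iff)
    show ?thesis using i unfolding z .
  qed
  have "primitive (\<lambda>y. - P y) (\<lambda>y. exp (- y) * A y)"
  proof (rule primitiveI)
    show "\<exists>C. \<forall>x\<in>{a..b}. \<bar>exp (- x) * A x\<bar> \<le> C" for a b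
    proof -
      have "\<bar>exp (- x) * A x\<bar> \<le> exp (- a) * B" if "x \<in> {a..b}" for x
      proof -
        have "\<bar>exp (- x)\<bar> * \<bar>A x\<bar> \<le> exp (- a) * B" using that A(2)[of x] by (intro mult_mono) auto
        then show ?thesis by (simp add: abs_mult)
      qed
      then show ?thesis by metis
    qed
    fix a b :: real assume "a \<le> b"
    have "- P b - - P a = (LBINT x. indicator {a..} x * (exp (- x) * A x) - indicator {b..} x * (exp (- x) * A x))"
      using int[of a] int[of b] by (simp add: P_def)
    also have "\<dots> = (LBINT x. indicator {a..b} x * (exp (- x) * A x))"
    proof (rule integral_cong_AE)
      show "AE x in lborel. indicator {a..} x * (exp (- x) * A x) - indicator {b..} x * (exp (- x) * A x) = indicator {a..b} x * (exp (- x) * A x)"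
        using AE_lborel_singleton[of b] by eventually_elim (use \<open>a \<le> b\<close> in \<open>auto simp: indicator_def\<close>)
    qed measurable
    finally show "- P b - - P a = \<dots>" .
  qed measurable
  then have "primitive P (\<lambda>y. - (exp (- y) * A y))" using primitive_uminus by fastforce
  moreover have "primitive exp exp"
    by (rule primitive_DERIV) (auto intro: DERIV_exp continuous_intros)
  ultimately have p: "primitive (\<lambda>y. exp y * P y) (\<lambda>y. exp y * P y + exp y * - (exp (- y) * A y))"
    using primitive_mult by fastforce
  have "(\<lambda>y. exp y * P y + exp y * - (exp (- y) * A y)) = (\<lambda>y. dconv 1 exp_kernel A y - A y)"
    by (simp add: eq exp_minus fun_eq_iff)
  moreover have "dconv 1 exp_kernel A = (\<lambda>y. exp y * P y)" by (simp add: eq fun_eq_iff)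
  ultimately show ?thesis using p by simp
qed

lemma resolvent_bound:
  assumes A: "A \<in> borel_measurable borel" "\<And>x. \<bar>A x\<bar> \<le> B"
  shows "\<bar>dconv v exp_kernel A y\<bar> \<le> B"
  using dconv_bound[OF exp_kernel(1) A] by simp

lemma decaying_integrable:
  fixes b A :: "real \<Rightarrow> real"
  assumes "b \<in> borel_measurable borel" "\<And>x. 0 \<le> x \<Longrightarrow> \<bar>b x\<bar> \<le> C * exp (- x / 2)"
    and "A \<in> borel_measurable borel" "\<And>x. \<bar>A x\<bar> \<le> B"
  shows "integrable lborel (\<lambda>x. indicator {0<..} x * (b x * A x))"
proof (rule Bochner_Integration.integrable_bound)
  show "integrable lborel (\<lambda>x. (indicator {0..} x * exp (- x / 2)) * (C * B))"
    using exp_half_integrable by simp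
  show "AE x in lborel. norm (indicator {0<..} x * (b x * A x)) \<le> norm (indicator {0..} x * exp (- x / 2) * (C * B))"
  proof (rule AE_I2)
    fix x
    show "norm (indicator {0<..} x * (b x * A x)) \<le> norm (indicator {0..} x * exp (- x / 2) * (C * B))"
    proof (cases "0 < x")
      case True
      have "\<bar>b x\<bar> * \<bar>A x\<bar> \<le> (C * exp (- x / 2)) * B"
        using assms(2)[of x] assms(4)[of x] True by (intro mult_mono) linarith+
      also have "\<dots> \<le> \<bar>exp (- x / 2) * (C * B)\<bar>" by (metis abs_ge_self mult.assoc mult.commute)
      finally show ?thesis using True by (simp add: abs_mult)
    qed simp
  qed
  note [measurable] = assms(1,3)
  show "(\<lambda>x. indicator {0<..} x * (b x * A x)) \<in> borel_measurable lborel" by measurable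
qed

text \<open>Integrate (b F)' = g F - b A over the half line, where F is the resolvent of
  \<open>A\<close>: the boundary term at 0 vanishes since \<open>b 0 = 0\<close>, the one at
  infinity by decay.\<close>

lemma resolvent_duality:
  fixes b g A :: "real \<Rightarrow> real"
  assumes A: "A \<in> borel_measurable borel" "\<And>x. \<bar>A x\<bar> \<le> B"
    and b: "\<And>x. (b has_real_derivative g x - b x) (at x)" "b 0 = 0" "\<And>x. 0 \<le> x \<Longrightarrow> \<bar>b x\<bar> \<le> C * exp (- x / 2)"
    and g: "continuous_on UNIV g" "\<And>x. 0 \<le> x \<Longrightarrow> \<bar>g x\<bar> \<le> D * exp (- x / 2)"
  shows "(LBINT x. indicator {0<..} x * (b x * A x)) = (LBINT x. indicator {0<..} x * (g x * dconv 1 exp_kernel A x))"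
proof -
  let ?R = "dconv 1 exp_kernel A"
  have cb: "continuous_on UNIV b" using b(1) by (meson DERIV_isCont continuous_at_imp_continuous_on)
  note [measurable] = A(1) borel_measurable_continuous_onI[OF cb] borel_measurable_continuous_onI[OF g(1)]
  have R: "primitive ?R (\<lambda>y. ?R y - A y)" by (rule resolvent_primitive[OF A])
  have mR [measurable]: "?R \<in> borel_measurable borel" by (rule primitive_measurable[OF R])
  have bR: "\<bar>?R y\<bar> \<le> B" for y by (rule resolvent_bound[OF A])
  have pb: "primitive b (\<lambda>x. g x - b x)"
    by (rule primitive_DERIV[OF b(1)]) (intro continuous_on_diff g(1) cb)
  have "primitive (\<lambda>x. b x * ?R x) (\<lambda>x. (g x - b x) * ?R x + b x * (?R x - A x))"
    by (rule primitive_mult[OF pb R])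
  moreover have "(\<lambda>x. (g x - b x) * ?R x + b x * (?R x - A x)) = (\<lambda>x. g x * ?R x - b x * A x)"
    by (simp add: algebra_simps fun_eq_iff)
  ultimately have "primitive (\<lambda>x. b x * ?R x) (\<lambda>x. g x * ?R x - b x * A x)" by simp
  then have p: "primitive (\<lambda>x. if x \<le> 0 then 0 else b x * ?R x) (\<lambda>x. indicator {0<..} x * (g x * ?R x - b x * A x))"
    by (rule primitive_cutoff) (simp add: b(2))
  have i1: "integrable lborel (\<lambda>x. indicator {0<..} x * (b x * ?R x))"
    by (rule decaying_integrable[OF _ b(3) _ bR]) measurable
  have i2: "integrable lborel (\<lambda>x. indicator {0<..} x * (g x * ?R x))"
    by (rule decaying_integrable[OF _ g(2) _ bR]) measurable
  have i3: "integrable lborel (\<lambda>x. indicator {0<..} x * (b x * A x))"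
    by (rule decaying_integrable[OF _ b(3) _ A(2)]) measurable
  have "(\<lambda>x. if x \<le> 0 then 0 else b x * ?R x) = (\<lambda>x. indicator {0<..} x * (b x * ?R x))"
    by (auto simp: indicator_def)
  then have "(LBINT x. indicator {0<..} x * (g x * ?R x - b x * A x)) = 0"
    using i1 i2 i3 by (intro primitive_integral_eq_0[OF p]) (auto simp: right_diff_distrib)
  then show ?thesis using i2 i3 by (simp add: right_diff_distrib)
qed

text \<open>Variation of constants, b = exp (- x) P with P' = exp x g. The bound on \<open>P\<close>
  is a comparison with plus and minus 2 C exp (x / 2), whose derivative C exp (x / 2) dominates that
  of \<open>P\<close>.\<close>

lemma resolvent_test_exists:
  assumes g: "smooth g" "\<And>x. 0 \<le> x \<Longrightarrow> \<bar>g x\<bar> \<le> C * exp (- x / 2)"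
  obtains b where "smooth b" "\<And>x. (b has_real_derivative g x - b x) (at x)" "b 0 = 0"
    "\<And>x. 0 \<le> x \<Longrightarrow> \<bar>b x\<bar> \<le> 2 * C * exp (- x / 2)"
proof -
  have "0 \<le> C" using g(2)[of 0] by simp
  obtain P where P: "\<And>x. (P has_real_derivative exp x * g x) (at x)" "P 0 = 0" "smooth P"
    using smooth_antiderivative[OF smooth_mult[OF smooth_exp g(1)], of 0] by metis
  define b where "b x = exp (0 + (-1) * x) * P x" for x
  have b: "(b has_real_derivative g x - b x) (at x)" for x
  proof -
    have "(b has_real_derivative - exp (-x) * P x + exp (-x) * (exp x * g x)) (at x)"
      unfolding b_def[abs_def] by (auto intro!: derivative_eq_intros P(1))
    moreover have "- exp (-x) * P x + exp (-x) * (exp x * g x) = g x - b x"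
      by (simp add: b_def exp_minus)
    ultimately show ?thesis by simp
  qed
  have "\<bar>P x\<bar> \<le> 2 * C * exp (x / 2)" if "0 \<le> x" for x
  proof -
    have d: "((\<lambda>x. 2 * C * exp (x / 2)) has_real_derivative C * exp (x / 2)) (at x)" for x
      by (auto intro!: derivative_eq_intros)
    have le: "\<bar>exp x * g x\<bar> \<le> C * exp (x / 2)" if "0 \<le> x" for x
    proof -
      have "\<bar>exp x * g x\<bar> \<le> exp x * (C * exp (- x / 2))"
        using g(2)[OF that] by (simp add: abs_mult)
      also have "\<dots> = C * exp (x / 2)" by (simp add: mult.left_commute flip: exp_add)
      finally show ?thesis .
    qed
    have "P x - 2 * C * exp (x / 2) \<le> P 0 - 2 * C * exp (0 / 2)"
    proof (rule DERIV_nonpos_imp_nonincreasing[OF \<open>0 \<le> x\<close>])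
      fix y assume "0 \<le> y" "y \<le> x"
      show "\<exists>D. ((\<lambda>x. P x - 2 * C * exp (x / 2)) has_real_derivative D) (at y) \<and> D \<le> 0"
        using DERIV_diff[OF P(1)[of y] d[of y]] le[OF \<open>0 \<le> y\<close>] by (intro exI conjI) auto
    qed
    moreover have "P 0 + 2 * C * exp (0 / 2) \<le> P x + 2 * C * exp (x / 2)"
    proof (rule DERIV_nonneg_imp_nondecreasing[OF \<open>0 \<le> x\<close>])
      fix y assume "0 \<le> y" "y \<le> x"
      show "\<exists>D. ((\<lambda>x. P x + 2 * C * exp (x / 2)) has_real_derivative D) (at y) \<and> 0 \<le> D"
        using DERIV_add[OF P(1)[of y] d[of y]] le[OF \<open>0 \<le> y\<close>] by (intro exI conjI) auto
    qed
    ultimately show ?thesis using P(2) \<open>0 \<le> C\<close> by (auto simp: abs_le_iff)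
  qed
  then have "\<bar>b x\<bar> \<le> 2 * C * exp (- x / 2)" if "0 \<le> x" for x
  proof -
    have "\<bar>b x\<bar> \<le> exp (- x) * (2 * C * exp (x / 2))"
      using \<open>0 \<le> x \<Longrightarrow> \<bar>P x\<bar> \<le> 2 * C * exp (x / 2)\<close>[OF that] by (simp add: b_def abs_mult)
    also have "\<dots> = 2 * C * exp (- x / 2)" by (simp add: mult.left_commute flip: exp_add)
    finally show ?thesis .
  qed
  moreover have "smooth b"
    unfolding b_def[abs_def] by (intro smooth_mult P(3) smooth_affine[OF smooth_exp])
  ultimately show thesis using b P(2) by (intro that[of b]) (auto simp: b_def)
qed

subsection \<open>Regularity for a third order weak equation on the half line\<close>

lemma deriv3_eq_on_open:
  assumes "open S"
    and b: "\<And>x. (b has_real_derivative b1 x) (at x)" "\<And>x. (b1 has_real_derivative b2 x) (at x)" "\<And>x. (b2 has_real_derivative b3 x) (at x)"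
    and c: "\<And>x. (c has_real_derivative c1 x) (at x)" "\<And>x. (c1 has_real_derivative c2 x) (at x)" "\<And>x. (c2 has_real_derivative c3 x) (at x)"
    and eq: "\<And>x. x \<in> S \<Longrightarrow> b x = c x" and x: "x \<in> S"
  shows "b1 x = c1 x" "b2 x = c2 x" "b3 x = c3 x"
proof -
  have 1: "b1 x = c1 x" if "x \<in> S" for x by (rule DERIV_eq_on_open[OF assms(1) that b(1) c(1) eq])
  have 2: "b2 x = c2 x" if "x \<in> S" for x by (rule DERIV_eq_on_open[OF assms(1) that b(2) c(2) 1])
  have 3: "b3 x = c3 x" if "x \<in> S" for x by (rule DERIV_eq_on_open[OF assms(1) that b(3) c(3) 2])
  show "b1 x = c1 x" "b2 x = c2 x" "b3 x = c3 x" using 1 2 3 x by auto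
qed

lemma DERIV_affine:
  assumes "\<And>x. (f has_real_derivative f' x) (at x)"
  shows "((\<lambda>x. f (c + d * x)) has_real_derivative d * f' (c + d * x)) (at x)"
proof -
  have "((\<lambda>x. f (c + d * x)) has_real_derivative f' (c + d * x) * d) (at x)"
    by (rule DERIV_chain2[of f]) (use assms in \<open>auto intro!: derivative_eq_intros\<close>)
  then show ?thesis by (simp add: mult.commute)
qed

text \<open>Solving b' + b = g twice yields test functions that decay but have no compact support.
  They are cut off near n with derivatives of the cutoff bounded uniformly in n, and the exponential
  weight provides the dominating function.\<close>

lemma weak_ode_decaying:
  fixes U H2 H1 H0 :: "real \<Rightarrow> real"
  assumes m: "U \<in> borel_measurable borel" "H2 \<in> borel_measurable borel" "H1 \<in> borel_measurable borel" "H0 \<in> borel_measurable borel"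
    and bd: "\<And>x. \<bar>U x\<bar> \<le> K" "\<And>x. \<bar>H2 x\<bar> \<le> K" "\<And>x. \<bar>H1 x\<bar> \<le> K" "\<And>x. \<bar>H0 x\<bar> \<le> K"
    and z: "\<And>x. x \<le> 0 \<Longrightarrow> U x = 0" "\<And>x. x \<le> 0 \<Longrightarrow> H2 x = 0" "\<And>x. x \<le> 0 \<Longrightarrow> H1 x = 0" "\<And>x. x \<le> 0 \<Longrightarrow> H0 x = 0"
    and weak: "\<And>b b1 b2 b3. test_fun b \<Longrightarrow> (\<And>x. (b has_real_derivative b1 x) (at x)) \<Longrightarrow>
        (\<And>x. (b1 has_real_derivative b2 x) (at x)) \<Longrightarrow> (\<And>x. (b2 has_real_derivative b3 x) (at x)) \<Longrightarrow>
        b 0 = 0 \<Longrightarrow> b1 0 = 0 \<Longrightarrow> (LBINT x. U x * b3 x + H2 x * b2 x + H1 x * b1 x + H0 x * b x) = 0"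
    and b: "smooth b" "\<And>x. (b has_real_derivative b1 x) (at x)" "\<And>x. (b1 has_real_derivative b2 x) (at x)"
      "\<And>x. (b2 has_real_derivative b3 x) (at x)" "continuous_on UNIV b3" "b 0 = 0" "b1 0 = 0"
    and dec: "\<And>x. 0 \<le> x \<Longrightarrow> \<bar>b x\<bar> \<le> C * exp (- x / 2)" "\<And>x. 0 \<le> x \<Longrightarrow> \<bar>b1 x\<bar> \<le> C * exp (- x / 2)"
      "\<And>x. 0 \<le> x \<Longrightarrow> \<bar>b2 x\<bar> \<le> C * exp (- x / 2)" "\<And>x. 0 \<le> x \<Longrightarrow> \<bar>b3 x\<bar> \<le> C * exp (- x / 2)"
  shows "(LBINT x. U x * b3 x + H2 x * b2 x + H1 x * b1 x + H0 x * b x) = 0"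
proof -
  obtain \<sigma> \<rho> :: "real \<Rightarrow> real" where \<sigma>: "smooth \<sigma>" "smooth \<rho>" "\<And>x. (\<sigma> has_real_derivative \<rho> x) (at x)"
    "\<And>x. x \<le> 0 \<Longrightarrow> \<sigma> x = 0" "\<And>x. 1 \<le> x \<Longrightarrow> \<sigma> x = 1" "\<And>x. 0 \<le> \<sigma> x" "\<And>x. \<sigma> x \<le> 1"
    "\<And>x. x \<le> 0 \<Longrightarrow> \<rho> x = 0" "\<And>x. 1 \<le> x \<Longrightarrow> \<rho> x = 0"
    by (rule smooth_step_exists) metis
  define \<rho>1 \<rho>2 where "\<rho>1 = deriv \<rho>" and "\<rho>2 = deriv \<rho>1"
  have t: "test_fun \<rho>" unfolding test_fun_def using \<sigma>(2,8,9) by (auto intro!: exI[of _ 1] simp: abs_if split: if_splits)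
  then have t1: "test_fun \<rho>1" and t2: "test_fun \<rho>2" by (auto simp: \<rho>1_def \<rho>2_def intro: test_fun_deriv)
  obtain M0 where M0: "\<And>x. \<bar>\<rho> x\<bar> \<le> M0" "0 \<le> M0"
    using test_fun_bounded[OF t] by (metis indicator_simps mult_1 mult_zero_left order_trans order_refl)
  obtain M1 where M1: "\<And>x. \<bar>\<rho>1 x\<bar> \<le> M1" "0 \<le> M1"
    using test_fun_bounded[OF t1] by (metis indicator_simps mult_1 mult_zero_left order_trans order_refl)
  obtain M2 where M2: "\<And>x. \<bar>\<rho>2 x\<bar> \<le> M2" "0 \<le> M2"
    using test_fun_bounded[OF t2] by (metis indicator_simps mult_1 mult_zero_left order_trans order_refl)
  have d\<rho>: "(\<rho> has_real_derivative \<rho>1 x) (at x)" "(\<rho>1 has_real_derivative \<rho>2 x) (at x)" for x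
    using smoothD(1) t t1 by (auto simp: \<rho>1_def \<rho>2_def test_fun_def)
  have \<rho>1_0: "\<rho>1 x = 0" and \<rho>2_0: "\<rho>2 x = 0" if "1 < x" for x
  proof -
    have 1: "\<rho>1 x = 0" if "1 < x" for x
      by (rule DERIV_eq_on_open[of "{1<..}" x \<rho> _ "\<lambda>_. 0"]) (use that d\<rho> \<sigma>(9) in auto)
    have 2: "\<rho>2 x = 0" if "1 < x" for x
      by (rule DERIV_eq_on_open[of "{1<..}" x \<rho>1 _ "\<lambda>_. 0"]) (use that d\<rho> 1 in auto)
    show "\<rho>1 x = 0" "\<rho>2 x = 0" using 1 2 that by auto
  qed
  \<comment> \<open>The cutoff is 1 for x \<le> n - 1 and 0 for x \<ge> n; the reflection is the
    source of the alternating signs of its derivatives.\<close>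
  define s s1 s2 s3 where "s n x = \<sigma> (real n + (-1) * x)" and "s1 n x = - \<rho> (real n + (-1) * x)"
    and "s2 n x = \<rho>1 (real n + (-1) * x)" and "s3 n x = - \<rho>2 (real n + (-1) * x)" for n x
  have ds: "(s n has_real_derivative s1 n x) (at x)" "(s1 n has_real_derivative s2 n x) (at x)" "(s2 n has_real_derivative s3 n x) (at x)" for n x
    unfolding s_def[abs_def] s1_def[abs_def] s2_def[abs_def] s3_def
    using DERIV_affine[OF \<sigma>(3), of "real n" "-1" x] DERIV_minus[OF DERIV_affine[OF d\<rho>(1), of "real n" "-1" x]]
      DERIV_affine[OF d\<rho>(2), of "real n" "-1" x] by simp_all
  define d d1 d2 d3 where "d n x = s n x * b x" and "d1 n x = s1 n x * b x + s n x * b1 x"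
    and "d2 n x = s2 n x * b x + 2 * (s1 n x * b1 x) + s n x * b2 x"
    and "d3 n x = s3 n x * b x + 3 * (s2 n x * b1 x) + 3 * (s1 n x * b2 x) + s n x * b3 x" for n x
  have dd: "(d n has_real_derivative d1 n x) (at x)" "(d1 n has_real_derivative d2 n x) (at x)" "(d2 n has_real_derivative d3 n x) (at x)" for n x
    unfolding d_def[abs_def] d1_def[abs_def] d2_def[abs_def] d3_def
    by (auto intro!: derivative_eq_intros ds b(2,3,4) simp: algebra_simps)
  have int0: "(LBINT x. U x * d3 n x + H2 x * d2 n x + H1 x * d1 n x + H0 x * d n x) = 0" for n
  proof -
    \<comment> \<open>The factor \<open>\<sigma> (2 + 1 * x)\<close> makes the support compact on
      the left. It equals 1 on \<open>{-1<..}\<close>, so it changes neither the values at 0 nor the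
      integrand, whose coefficients vanish for x \<le> 0.\<close>
    define c where "c x = \<sigma> (2 + 1 * x) * d n x" for x
    have sc: "smooth c" unfolding c_def d_def s_def by (intro smooth_mult smooth_affine \<sigma> b)
    have tc: "test_fun c"
      unfolding test_fun_def
    proof
      have "c x = 0" if "real n + 2 < \<bar>x\<bar>" for x
        using \<sigma>(4)[of "2 + x"] \<sigma>(4)[of "real n - x"] that by (cases "0 \<le> x") (auto simp: c_def d_def s_def)
      then show "\<exists>R. \<forall>x. R < \<bar>x\<bar> \<longrightarrow> c x = 0" by metis
    qed (rule sc)
    define c1 c2 c3 where "c1 = deriv c" and "c2 = deriv c1" and "c3 = deriv c2"
    have dc: "(c has_real_derivative c1 x) (at x)" "(c1 has_real_derivative c2 x) (at x)" "(c2 has_real_derivative c3 x) (at x)" for x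
      using smoothD[OF sc] smoothD[OF smoothD(2)[OF sc]] smoothD[OF smoothD(2)[OF smoothD(2)[OF sc]]]
      by (auto simp: c1_def c2_def c3_def)
    have eq: "c x = d n x" if "x \<in> {-1<..}" for x
      using \<sigma>(5)[of "2 + x"] that by (simp add: c_def)
    have e: "c1 x = d1 n x" "c2 x = d2 n x" "c3 x = d3 n x" if "x \<in> {-1<..}" for x
      using deriv3_eq_on_open[OF _ dc(1,2,3) dd(1,2,3) eq that] by auto
    have "c 0 = 0" "c1 0 = 0"
      using eq[of 0] e(1)[of 0] b(6,7) by (auto simp: d_def d1_def)
    then have "(LBINT x. U x * c3 x + H2 x * c2 x + H1 x * c1 x + H0 x * c x) = 0"
      by (intro weak[OF tc dc(1,2,3)])
    moreover have "(\<lambda>x. U x * c3 x + H2 x * c2 x + H1 x * c1 x + H0 x * c x)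
        = (\<lambda>x. U x * d3 n x + H2 x * d2 n x + H1 x * d1 n x + H0 x * d n x)"
    proof
      fix x
      show "U x * c3 x + H2 x * c2 x + H1 x * c1 x + H0 x * c x = U x * d3 n x + H2 x * d2 n x + H1 x * d1 n x + H0 x * d n x"
        using z[of x] e[of x] eq[of x] by (cases "x \<le> 0") auto
    qed
    ultimately show ?thesis by simp
  qed
  have K0: "0 \<le> K" using bd(1)[of 0] by linarith
  have C0: "0 \<le> C" using dec(1)[of 0] by simp
  \<comment> \<open>The Leibniz coefficients 1, 3, 3, 1 of the third derivative, weighted with the
    bounds for the cutoff and its derivatives; the lower orders are dominated as well.\<close>
  define L where "L = M2 + 3 * M1 + 3 * M0 + 1"
  have L: "1 \<le> L" using M0 M1 M2 by (simp add: L_def)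
  have bs: "\<bar>s n x\<bar> \<le> 1" "\<bar>s1 n x\<bar> \<le> M0" "\<bar>s2 n x\<bar> \<le> M1" "\<bar>s3 n x\<bar> \<le> M2" for n x
    using M0 M1 M2 \<sigma>(6,7) by (auto simp: s_def s1_def s2_def s3_def)
  have ld: "\<bar>d n x\<bar> \<le> L * (C * exp (- x / 2))" "\<bar>d1 n x\<bar> \<le> L * (C * exp (- x / 2))"
     "\<bar>d2 n x\<bar> \<le> L * (C * exp (- x / 2))" "\<bar>d3 n x\<bar> \<le> L * (C * exp (- x / 2))" if "0 \<le> x" for n x
  proof -
    define E where "E = C * exp (- x / 2)"
    have E0: "0 \<le> E" using C0 by (simp add: E_def)
    have mm: "\<bar>p * q\<bar> \<le> m * E" if "\<bar>p\<bar> \<le> m" "\<bar>q\<bar> \<le> E" for p q m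
      unfolding abs_mult using that E0 by (intro mult_mono) linarith+
    have bb: "\<bar>b x\<bar> \<le> E" "\<bar>b1 x\<bar> \<le> E" "\<bar>b2 x\<bar> \<le> E" "\<bar>b3 x\<bar> \<le> E"
      using dec that by (auto simp: E_def)
    have LE: "L * E = M2 * E + 3 * (M1 * E) + 3 * (M0 * E) + 1 * E" by (simp add: L_def algebra_simps)
    have nn: "0 \<le> M2 * E" "0 \<le> M1 * E" "0 \<le> M0 * E" using M0 M1 M2 E0 by auto
    have "\<bar>s n x * b x\<bar> \<le> 1 * E" by (rule mm[OF bs(1) bb(1)])
    then show "\<bar>d n x\<bar> \<le> L * (C * exp (- x / 2))" unfolding d_def E_def[symmetric] LE using nn by linarith
    have "\<bar>s1 n x * b x\<bar> \<le> M0 * E" "\<bar>s n x * b1 x\<bar> \<le> 1 * E" by (rule mm[OF bs(2) bb(1)] mm[OF bs(1) bb(2)])+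
    then show "\<bar>d1 n x\<bar> \<le> L * (C * exp (- x / 2))" unfolding d1_def E_def[symmetric] LE using nn by linarith
    have "\<bar>s2 n x * b x\<bar> \<le> M1 * E" "\<bar>s1 n x * b1 x\<bar> \<le> M0 * E" "\<bar>s n x * b2 x\<bar> \<le> 1 * E"
      by (rule mm[OF bs(3) bb(1)] mm[OF bs(2) bb(2)] mm[OF bs(1) bb(3)])+
    then show "\<bar>d2 n x\<bar> \<le> L * (C * exp (- x / 2))" unfolding d2_def E_def[symmetric] LE using nn by linarith
    have "\<bar>s3 n x * b x\<bar> \<le> M2 * E" "\<bar>s2 n x * b1 x\<bar> \<le> M1 * E" "\<bar>s1 n x * b2 x\<bar> \<le> M0 * E" "\<bar>s n x * b3 x\<bar> \<le> 1 * E"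
      by (rule mm[OF bs(4) bb(1)] mm[OF bs(3) bb(2)] mm[OF bs(2) bb(3)] mm[OF bs(1) bb(4)])+
    then show "\<bar>d3 n x\<bar> \<le> L * (C * exp (- x / 2))" unfolding d3_def E_def[symmetric] LE using nn by linarith
  qed
  have cont: "continuous_on UNIV (b)" "continuous_on UNIV b1" "continuous_on UNIV b2"
    using b(2,3,4) by (meson DERIV_isCont continuous_at_imp_continuous_on)+
  have cond: "continuous_on UNIV (s n)" "continuous_on UNIV (s1 n)" "continuous_on UNIV (s2 n)" "continuous_on UNIV (s3 n)" for n
  proof -
    show "continuous_on UNIV (s n)" "continuous_on UNIV (s1 n)" "continuous_on UNIV (s2 n)"
      using ds by (meson DERIV_isCont continuous_at_imp_continuous_on)+
    have "smooth \<rho>2" using t2 by (simp add: test_fun_def)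
    then show "continuous_on UNIV (s3 n)"
      unfolding s3_def[abs_def] by (intro continuous_on_minus smoothD(3) smooth_affine)
  qed
  note [measurable] = m cont[THEN borel_measurable_continuous_onI] b(5)[THEN borel_measurable_continuous_onI]
    cond[THEN borel_measurable_continuous_onI]
  have [measurable]: "d n \<in> borel_measurable borel" "d1 n \<in> borel_measurable borel" "d2 n \<in> borel_measurable borel" "d3 n \<in> borel_measurable borel" for n
    unfolding d_def d1_def d2_def d3_def by measurable
  have "(\<lambda>n. LBINT x. U x * d3 n x + H2 x * d2 n x + H1 x * d1 n x + H0 x * d n x)
      \<longlonglongrightarrow> (LBINT x. U x * b3 x + H2 x * b2 x + H1 x * b1 x + H0 x * b x)"
  proof (rule integral_dominated_convergence[where w="\<lambda>x. indicator {0..} x * exp (- x / 2) * (4 * K * L * C)"])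
    show "integrable lborel (\<lambda>x. indicator {0..} x * exp (- x / 2) * (4 * K * L * C))"
      using exp_half_integrable by simp
    show "AE x in lborel. norm (U x * d3 n x + H2 x * d2 n x + H1 x * d1 n x + H0 x * d n x) \<le> indicator {0..} x * exp (- x / 2) * (4 * K * L * C)" for n
    proof (rule AE_I2)
      fix x
      show "norm (U x * d3 n x + H2 x * d2 n x + H1 x * d1 n x + H0 x * d n x) \<le> indicator {0..} x * exp (- x / 2) * (4 * K * L * C)"
      proof (cases "x \<le> 0")
        case True
        then show ?thesis using z[of x] K0 C0 L by simp
      next
        case False
        have mm: "\<bar>p * q\<bar> \<le> K * (L * (C * exp (- x / 2)))" if "\<bar>p\<bar> \<le> K" "\<bar>q\<bar> \<le> L * (C * exp (- x / 2))" for p q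
          unfolding abs_mult using that K0 by (intro mult_mono) linarith+
        have "\<bar>U x * d3 n x\<bar> \<le> K * (L * (C * exp (- x / 2)))" "\<bar>H2 x * d2 n x\<bar> \<le> K * (L * (C * exp (- x / 2)))"
          "\<bar>H1 x * d1 n x\<bar> \<le> K * (L * (C * exp (- x / 2)))" "\<bar>H0 x * d n x\<bar> \<le> K * (L * (C * exp (- x / 2)))"
          using False by (intro mm ld bd; linarith)+
        moreover have "indicator {0..} x * exp (- x / 2) * (4 * K * L * C) = 4 * (K * (L * (C * exp (- x / 2))))"
          using False by simp
        ultimately show ?thesis unfolding real_norm_def by linarith
      qed
    qed
    have "(\<lambda>n. U x * d3 n x + H2 x * d2 n x + H1 x * d1 n x + H0 x * d n x) \<longlonglongrightarrow> U x * b3 x + H2 x * b2 x + H1 x * b1 x + H0 x * b x" for x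
    proof -
      obtain N where N: "x + 2 \<le> real N" using real_arch_simple by blast
      have "U x * d3 n x + H2 x * d2 n x + H1 x * d1 n x + H0 x * d n x = U x * b3 x + H2 x * b2 x + H1 x * b1 x + H0 x * b x" if "N \<le> n" for n
      proof -
        have n: "1 < real n - x" using N that by linarith
        then have "s n x = 1" "s1 n x = 0" "s2 n x = 0" "s3 n x = 0"
          using \<sigma>(5,9) \<rho>1_0 \<rho>2_0 by (auto simp: s_def s1_def s2_def s3_def)
        then show ?thesis by (simp add: d_def d1_def d2_def d3_def)
      qed
      then show ?thesis by (intro tendsto_eventually eventually_sequentiallyI[of N])
    qed
    then show "AE x in lborel. (\<lambda>n. U x * d3 n x + H2 x * d2 n x + H1 x * d1 n x + H0 x * d n x) \<longlonglongrightarrow> U x * b3 x + H2 x * b2 x + H1 x * b1 x + H0 x * b x"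
      by simp
  qed measurable
  then show ?thesis using int0 by (simp add: LIMSEQ_const_iff)
qed

text \<open>Weak equations determine their solutions only up to null sets, hence the representatives
  \<open>F\<close> and \<open>G\<close>. The set \<open>S\<close> is there for quantities governed
  by an equation on the open half line only, whose values for y \<le> 0 need not fit.\<close>

definition has_primitive_on :: "real set \<Rightarrow> (real \<Rightarrow> real) \<Rightarrow> (real \<Rightarrow> real) \<Rightarrow> bool" where
  "has_primitive_on S f g \<longleftrightarrow> (\<exists>F G. primitive F G \<and> (AE y in lborel. y \<in> S \<longrightarrow> F y = f y \<and> G y = g y))"

text \<open>Let \<open>T\<close> be the inverse of \<open>d/dy + 1\<close> with zero initial value; its adjoint is \<open>R\<close>. Testing with
  \<open>b = T (T g)\<close> for arbitrary \<open>g\<close> turns the hypothesis into \<open>\<integral> U g' + V g = 0\<close>, so that \<open>V = U'\<close>.\<close>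

lemma weak_ode_regularity:
  fixes U H2 H1 H0 :: "real \<Rightarrow> real"
  assumes m: "U \<in> borel_measurable borel" "H2 \<in> borel_measurable borel" "H1 \<in> borel_measurable borel" "H0 \<in> borel_measurable borel"
    and bd: "\<And>x. \<bar>U x\<bar> \<le> K" "\<And>x. \<bar>H2 x\<bar> \<le> K" "\<And>x. \<bar>H1 x\<bar> \<le> K" "\<And>x. \<bar>H0 x\<bar> \<le> K"
    and z: "\<And>x. x \<le> 0 \<Longrightarrow> U x = 0" "\<And>x. x \<le> 0 \<Longrightarrow> H2 x = 0" "\<And>x. x \<le> 0 \<Longrightarrow> H1 x = 0" "\<And>x. x \<le> 0 \<Longrightarrow> H0 x = 0"
    and weak: "\<And>b b1 b2 b3. test_fun b \<Longrightarrow> (\<And>x. (b has_real_derivative b1 x) (at x)) \<Longrightarrow>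
        (\<And>x. (b1 has_real_derivative b2 x) (at x)) \<Longrightarrow> (\<And>x. (b2 has_real_derivative b3 x) (at x)) \<Longrightarrow>
        b 0 = 0 \<Longrightarrow> b1 0 = 0 \<Longrightarrow> (LBINT x. U x * b3 x + H2 x * b2 x + H1 x * b1 x + H0 x * b x) = 0"
  defines "R \<equiv> dconv 1 exp_kernel"
    and "A \<equiv> \<lambda>y. 3 * U y - 2 * H2 y + H1 y"
    and "D \<equiv> \<lambda>y. - U y + H2 y - H1 y + H0 y"
  defines "V \<equiv> \<lambda>y. indicator {0<..} y * (H2 y - 2 * U y + R A y + R (R D) y)"
    and "N \<equiv> \<lambda>y. U y - R A y - R (R D) y - R D y"
  shows "has_primitive_on UNIV U V"
    and "has_primitive_on {0<..} (\<lambda>y. V y - H2 y) (\<lambda>y. N y - H1 y)"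
    and "has_primitive_on {0<..} N H0"
proof -
  note [measurable] = m
  have K0: "0 \<le> K" using bd(1)[of 0] by linarith
  have mA [measurable]: "A \<in> borel_measurable borel" and mD [measurable]: "D \<in> borel_measurable borel"
    unfolding A_def D_def by measurable
  have bA: "\<bar>A x\<bar> \<le> 6 * K" for x
    unfolding A_def using bd(1)[of x] bd(2)[of x] bd(3)[of x] by linarith
  have bD: "\<bar>D x\<bar> \<le> 6 * K" for x
    unfolding D_def using bd(1)[of x] bd(2)[of x] bd(3)[of x] bd(4)[of x] by linarith
  have pRA: "primitive (R A) (\<lambda>y. R A y - A y)" unfolding R_def by (rule resolvent_primitive[OF mA bA])
  have pRD: "primitive (R D) (\<lambda>y. R D y - D y)" unfolding R_def by (rule resolvent_primitive[OF mD bD])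
  have mRA [measurable]: "R A \<in> borel_measurable borel" by (rule primitive_measurable[OF pRA])
  have mRD [measurable]: "R D \<in> borel_measurable borel" by (rule primitive_measurable[OF pRD])
  have bRA: "\<bar>R A x\<bar> \<le> 6 * K" for x unfolding R_def by (rule resolvent_bound[OF mA bA])
  have bRD: "\<bar>R D x\<bar> \<le> 6 * K" for x unfolding R_def by (rule resolvent_bound[OF mD bD])
  have pRRD: "primitive (R (R D)) (\<lambda>y. R (R D) y - R D y)" unfolding R_def
    by (rule resolvent_primitive[OF mRD[unfolded R_def] bRD[unfolded R_def]])
  have mRRD [measurable]: "R (R D) \<in> borel_measurable borel" by (rule primitive_measurable[OF pRRD])
  have bRRD: "\<bar>R (R D) x\<bar> \<le> 6 * K" for x unfolding R_def
    by (rule resolvent_bound[OF mRD[unfolded R_def] bRD[unfolded R_def]])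
  have bV0: "\<bar>H2 x - 2 * U x + R A x + R (R D) x\<bar> \<le> 15 * K" for x
    using bd(1)[of x] bd(2)[of x] bRA[of x] bRRD[of x] by linarith
  have mV [measurable]: "V \<in> borel_measurable borel" unfolding V_def by measurable
  have bV: "\<bar>V x\<bar> \<le> 15 * K" for x using bV0[of x] K0 by (auto simp: V_def indicator_def)
  have zV: "V x = 0" if "x \<le> 0" for x using that by (simp add: V_def)
  have weakUV: "(LBINT x. U x * deriv g x + V x * g x) = 0" if g: "test_fun g" for g
  proof -
    have sg: "smooth g" and dg: "(g has_real_derivative deriv g x) (at x)" for x
      using g smoothD(1) by (auto simp: test_fun_def)
    define g1 where "g1 = deriv g"
    have g1: "test_fun g1" unfolding g1_def by (rule test_fun_deriv[OF g])
    have dec: "\<exists>C. \<forall>x\<ge>0. \<bar>f x\<bar> \<le> C * exp (- x / 2)" if f: "test_fun f" for f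
    proof -
      obtain B Q where B: "\<And>x. \<bar>f x\<bar> \<le> indicator {-Q..Q} x * B" "0 \<le> B" "0 \<le> Q"
        using test_fun_bounded[OF f] by metis
      have "\<bar>f x\<bar> \<le> (B * exp (Q / 2)) * exp (- x / 2)" if "0 \<le> x" for x
      proof (cases "x \<le> Q")
        case True
        have "\<bar>f x\<bar> \<le> B * 1" using B(1)[of x] B(2) by (cases "x \<in> {-Q..Q}") auto
        also have "\<dots> \<le> B * exp (Q / 2 + - x / 2)" using True B(2) by (intro mult_left_mono) auto
        also have "exp (Q / 2 + - x / 2) = exp (Q / 2) * exp (- x / 2)" by (rule exp_add)
        finally show ?thesis by (simp only: mult.assoc)
      next
        case False
        then show ?thesis using B(1)[of x] B(2) by simp
      qed
      then show ?thesis by metis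
    qed
    obtain C0 where C0: "\<forall>x\<ge>0. \<bar>g x\<bar> \<le> C0 * exp (- x / 2)" using dec[OF g] by metis
    obtain C1 where C1: "\<forall>x\<ge>0. \<bar>g1 x\<bar> \<le> C1 * exp (- x / 2)" using dec[OF g1] by metis
    obtain b1 where b1: "smooth b1" "\<And>x. (b1 has_real_derivative g x - b1 x) (at x)" "b1 0 = 0"
      "\<And>x. 0 \<le> x \<Longrightarrow> \<bar>b1 x\<bar> \<le> 2 * C0 * exp (- x / 2)"
      using resolvent_test_exists[OF sg, of C0] C0 by metis
    obtain b where b: "smooth b" "\<And>x. (b has_real_derivative b1 x - b x) (at x)" "b 0 = 0"
      "\<And>x. 0 \<le> x \<Longrightarrow> \<bar>b x\<bar> \<le> 2 * (2 * C0) * exp (- x / 2)"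
      using resolvent_test_exists[OF b1(1), of "2 * C0"] b1(4) by metis
    have C00: "0 \<le> C0" using C0[rule_format, of 0] by simp
    have C10: "0 \<le> C1" using C1[rule_format, of 0] by simp
    define C where "C = C1 + 12 * C0"
    \<comment> \<open>From b' = b1 - b and b1' = g - b1 the three derivatives of \<open>b\<close>
      are b1 - b, g - 2 b1 + b and g' - 2 g + 3 b1 - b.\<close>
    have "(LBINT x. U x * (g1 x - 2 * g x + 3 * b1 x - b x) + H2 x * (g x - 2 * b1 x + b x) + H1 x * (b1 x - b x) + H0 x * b x) = 0"
    proof (rule weak_ode_decaying[OF m bd z weak, where C=C])
      show "smooth b" by (rule b)
      show "(b has_real_derivative b1 x - b x) (at x)" for x by (rule b)
      show "((\<lambda>x. b1 x - b x) has_real_derivative g x - 2 * b1 x + b x) (at x)" for x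
        by (rule DERIV_cong[OF DERIV_diff[OF b1(2) b(2)]]) simp
      show "((\<lambda>x. g x - 2 * b1 x + b x) has_real_derivative g1 x - 2 * g x + 3 * b1 x - b x) (at x)" for x
        by (rule DERIV_cong[OF DERIV_add[OF DERIV_diff[OF dg DERIV_cmult[OF b1(2), of 2]] b(2)]]) (simp add: g1_def)
      show "continuous_on UNIV (\<lambda>x. g1 x - 2 * g x + 3 * b1 x - b x)"
        using smoothD(3)[of g1] smoothD(3)[OF sg] smoothD(3)[OF b1(1)] smoothD(3)[OF b(1)] g1
        by (intro continuous_intros) (auto simp: test_fun_def)
      fix x :: real assume x: "0 \<le> x"
      define E where "E = exp (- x / 2)"
      have E0: "0 \<le> C0 * E" "0 \<le> C1 * E" using C00 C10 by (auto simp: E_def)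
      have CE: "C * E = C1 * E + 12 * (C0 * E)" by (simp add: C_def algebra_simps)
      have bbs: "\<bar>g x\<bar> \<le> C0 * E" "\<bar>g1 x\<bar> \<le> C1 * E" "\<bar>b1 x\<bar> \<le> 2 * (C0 * E)" "\<bar>b x\<bar> \<le> 4 * (C0 * E)"
        using C0[rule_format, OF x] C1[rule_format, OF x] b1(4)[OF x] b(4)[OF x] by (auto simp: E_def mult.assoc)
      show "\<bar>b x\<bar> \<le> C * exp (- x / 2)" "\<bar>b1 x - b x\<bar> \<le> C * exp (- x / 2)" "\<bar>g x - 2 * b1 x + b x\<bar> \<le> C * exp (- x / 2)"
        "\<bar>g1 x - 2 * g x + 3 * b1 x - b x\<bar> \<le> C * exp (- x / 2)"
        unfolding E_def[symmetric] CE using bbs E0 by linarith+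
    qed (use b b1 in auto)
    \<comment> \<open>Sorted by g', g, b1 and b. This is the origin of \<open>A\<close> and
      \<open>D\<close>: they are the coefficients that accompany \<open>b1\<close> and
      \<open>b\<close>.\<close>
    also have "(\<lambda>x. U x * (g1 x - 2 * g x + 3 * b1 x - b x) + H2 x * (g x - 2 * b1 x + b x) + H1 x * (b1 x - b x) + H0 x * b x)
       = (\<lambda>x. U x * g1 x + indicator {0<..} x * (g x * (H2 x - 2 * U x)) + indicator {0<..} x * (b1 x * A x) + indicator {0<..} x * (b x * D x))"
    proof
      fix x
      show "U x * (g1 x - 2 * g x + 3 * b1 x - b x) + H2 x * (g x - 2 * b1 x + b x) + H1 x * (b1 x - b x) + H0 x * b x
       = U x * g1 x + indicator {0<..} x * (g x * (H2 x - 2 * U x)) + indicator {0<..} x * (b1 x * A x) + indicator {0<..} x * (b x * D x)"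
      proof (cases "0 < x")
        case True
        then show ?thesis by (simp add: A_def D_def algebra_simps)
      next
        case False
        then show ?thesis using z[of x] by simp
      qed
    qed
    finally have eq0: "(LBINT x. U x * g1 x + indicator {0<..} x * (g x * (H2 x - 2 * U x)) + indicator {0<..} x * (b1 x * A x) + indicator {0<..} x * (b x * D x)) = 0" .
    have cg: "continuous_on UNIV g" and cb1: "continuous_on UNIV b1" and cb: "continuous_on UNIV b"
      using smoothD(3) sg b b1 by auto
    note [measurable] = borel_measurable_continuous_onI[OF cg] borel_measurable_continuous_onI[OF cb1] borel_measurable_continuous_onI[OF cb]
    have mR2 [measurable]: "R (R D) \<in> borel_measurable borel" by fact
    have e1: "(LBINT x. indicator {0<..} x * (b1 x * A x)) = (LBINT x. indicator {0<..} x * (g x * R A x))"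
      unfolding R_def by (rule resolvent_duality[OF mA bA b1(2,3,4) cg C0[rule_format]])
    have e2: "(LBINT x. indicator {0<..} x * (b x * D x)) = (LBINT x. indicator {0<..} x * (b1 x * R D x))"
      unfolding R_def by (rule resolvent_duality[OF mD bD b(2,3,4) cb1 b1(4)])
    have e3: "(LBINT x. indicator {0<..} x * (b1 x * R D x)) = (LBINT x. indicator {0<..} x * (g x * R (R D) x))"
      unfolding R_def by (rule resolvent_duality[OF mRD[unfolded R_def] bRD[unfolded R_def] b1(2,3,4) cg C0[rule_format]])
    have i0: "integrable lborel (\<lambda>x. U x * g1 x)"
      using test_fun_times_integrable[OF g1 m(1)] bd(1) by (metis (no_types, lifting) mult.commute Bochner_Integration.integrable_cong)
    have i1: "integrable lborel (\<lambda>x. indicator {0<..} x * (g x * (H2 x - 2 * U x)))"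
    proof (rule decaying_integrable)
      show "\<bar>g x\<bar> \<le> C0 * exp (- x / 2)" if "0 \<le> x" for x using C0 that by simp
      show "\<bar>H2 x - 2 * U x\<bar> \<le> 3 * K" for x using bd(1)[of x] bd(2)[of x] by linarith
    qed measurable
    have i2: "integrable lborel (\<lambda>x. indicator {0<..} x * (b1 x * A x))"
      by (rule decaying_integrable[OF _ b1(4) _ bA]) measurable
    have i3: "integrable lborel (\<lambda>x. indicator {0<..} x * (b x * D x))"
      by (rule decaying_integrable[OF _ b(4) _ bD]) measurable
    have i4: "integrable lborel (\<lambda>x. indicator {0<..} x * (g x * R A x))"
      by (rule decaying_integrable[OF _ C0[rule_format] _ bRA]) measurable
    have i5: "integrable lborel (\<lambda>x. indicator {0<..} x * (g x * R (R D) x))"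
      by (rule decaying_integrable[OF _ C0[rule_format] _ bRRD]) measurable
    have "(\<lambda>x. U x * deriv g x + V x * g x) = (\<lambda>x. U x * g1 x + indicator {0<..} x * (g x * (H2 x - 2 * U x)) + indicator {0<..} x * (g x * R A x) + indicator {0<..} x * (g x * R (R D) x))"
      by (auto simp: V_def g1_def algebra_simps fun_eq_iff)
    then show ?thesis using eq0 i0 i1 i2 i3 i4 i5 e1 e2 e3 by simp
  qed
  obtain W where W: "primitive W V" "\<And>x. x \<le> 0 \<Longrightarrow> W x = 0" "AE x in lborel. U x = W x"
  proof (rule weak_primitive[OF m(1) _ z(1) mV _ zV weakUV])
    show "\<bar>U x\<bar> \<le> 15 * K" for x using bd(1)[of x] K0 by linarith
    show "\<bar>V x\<bar> \<le> 15 * K" for x by (rule bV)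
  qed (assumption | rule that)+
  show "has_primitive_on UNIV U V"
    unfolding has_primitive_on_def
    by (rule exI[of _ W], rule exI[of _ V]) (use W(1,3) in \<open>auto elim!: eventually_mono\<close>)
  \<comment> \<open>With \<open>R\<close> eliminated, the three conclusions form the system U' = V,
    (V - H2)' = N - H1, N' = H0. This is the adjoint equation U''' - H2'' + H1' - H0 = 0 in first
    order form, \<open>N\<close> standing for U'' - H2' + H1.\<close>
  have pM: "primitive (\<lambda>y. (-2) * W y + R A y + R (R D) y) (\<lambda>y. (-2) * V y + (R A y - A y) + (R (R D) y - R D y))"
    by (intro primitive_add primitive_cmult W pRA pRRD)
  show "has_primitive_on {0<..} (\<lambda>y. V y - H2 y) (\<lambda>y. N y - H1 y)"
    unfolding has_primitive_on_def
  proof (intro exI conjI, rule pM)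
    show "AE y in lborel. y \<in> {0<..} \<longrightarrow> (-2) * W y + R A y + R (R D) y = V y - H2 y \<and>
        (-2) * V y + (R A y - A y) + (R (R D) y - R D y) = N y - H1 y"
      using W(3) by eventually_elim (simp add: V_def N_def A_def)
  qed
  have pN: "primitive (\<lambda>y. W y - R A y - R (R D) y - R D y) (\<lambda>y. V y - (R A y - A y) - (R (R D) y - R D y) - (R D y - D y))"
    by (intro primitive_diff W pRA pRRD pRD)
  show "has_primitive_on {0<..} N H0"
    unfolding has_primitive_on_def
  proof (intro exI conjI, rule pN)
    show "AE y in lborel. y \<in> {0<..} \<longrightarrow> W y - R A y - R (R D) y - R D y = N y \<and>
        V y - (R A y - A y) - (R (R D) y - R D y) - (R D y - D y) = H0 y"
      using W(3) by eventually_elim (simp add: V_def N_def A_def D_def)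
  qed
qed

subsection \<open>Functions on the plane\<close>

lemma integral_lborel_pair:
  fixes h :: "'a::euclidean_space \<times> 'b::euclidean_space \<Rightarrow> real"
  assumes "integrable lborel h"
  shows "(LBINT p. h p) = (LBINT x. (LBINT y. h (x, y)))"
    and "(LBINT p. h p) = (LBINT y. (LBINT x. h (x, y)))"
    and "AE x in lborel. integrable lborel (\<lambda>y. h (x, y))"
    and "AE y in lborel. integrable lborel (\<lambda>x. h (x, y))"
    and "integrable lborel (\<lambda>x. LBINT y. h (x, y))"
    and "integrable lborel (\<lambda>y. LBINT x. h (x, y))"
proof -
  have i: "integrable (lborel \<Otimes>\<^sub>M lborel) (case_prod (\<lambda>x y. h (x, y)))"
    using assms by (simp add: lborel_prod)
  show "(LBINT p. h p) = (LBINT x. (LBINT y. h (x, y)))"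
    using lborel_pair.integral_fst[OF i] by (simp add: lborel_prod)
  show "(LBINT p. h p) = (LBINT y. (LBINT x. h (x, y)))"
    using lborel_pair.integral_snd[OF i] by (simp add: lborel_prod)
  show "AE x in lborel. integrable lborel (\<lambda>y. h (x, y))" by (rule lborel_pair.AE_integrable_fst[OF i])
  show "AE y in lborel. integrable lborel (\<lambda>x. h (x, y))" by (rule lborel_pair.AE_integrable_snd[OF i])
  show "integrable lborel (\<lambda>x. LBINT y. h (x, y))" by (rule lborel_pair.integrable_fst[OF i])
  show "integrable lborel (\<lambda>y. LBINT x. h (x, y))" by (rule lborel_pair.integrable_snd[OF i])
qed

lemma slice_measurable:
  fixes f :: "'a::euclidean_space \<times> 'b::euclidean_space \<Rightarrow> real"
  assumes "f \<in> borel_measurable borel"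
  shows "(\<lambda>y. f (x, y)) \<in> borel_measurable borel" "(\<lambda>x. f (x, y)) \<in> borel_measurable borel"
  using assms by measurable

lemma sq_integrable_slices:
  fixes f :: "'a::euclidean_space \<times> 'b::euclidean_space \<Rightarrow> real"
  assumes "sq_integrable lborel f"
  shows "AE x in lborel. sq_integrable lborel (\<lambda>y. f (x, y))"
    and "AE y in lborel. sq_integrable lborel (\<lambda>x. f (x, y))"
proof -
  have m: "f \<in> borel_measurable borel" using sq_integrableD(1)[OF assms] by simp
  show "AE x in lborel. sq_integrable lborel (\<lambda>y. f (x, y))"
    using integral_lborel_pair(3)[OF sq_integrableD(2)[OF assms]] slice_measurable[OF m]
    by (auto simp: sq_integrable_def)
  show "AE y in lborel. sq_integrable lborel (\<lambda>x. f (x, y))"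
    using integral_lborel_pair(4)[OF sq_integrableD(2)[OF assms]] slice_measurable[OF m]
    by (auto simp: sq_integrable_def)
qed

lemma measurable_fst_snd_borel [measurable]:
  "fst \<in> borel_measurable (borel :: ('a::euclidean_space \<times> 'b::euclidean_space) measure)"
  "snd \<in> borel_measurable (borel :: ('a::euclidean_space \<times> 'b::euclidean_space) measure)"
  by (auto intro!: borel_measurable_continuous_onI continuous_intros)

lemma AE_lborel_pairI:
  fixes P :: "'a::euclidean_space \<Rightarrow> 'b::euclidean_space \<Rightarrow> bool"
  assumes meas: "Measurable.pred borel (\<lambda>p. P (fst p) (snd p))"
  shows "(AE x in lborel. AE y in lborel. P x y) \<Longrightarrow> AE p in lborel. P (fst p) (snd p)"
    and "(AE y in lborel. AE x in lborel. P x y) \<Longrightarrow> AE p in lborel. P (fst p) (snd p)"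
proof -
  have assms: "{p. P (fst p) (snd p)} \<in> sets borel" using meas by (simp add: pred_def)
  have s: "{p \<in> space (lborel \<Otimes>\<^sub>M lborel). P (fst p) (snd p)} \<in> sets (lborel \<Otimes>\<^sub>M lborel)"
    using assms unfolding lborel_prod by simp
  assume "AE x in lborel. AE y in lborel. P x y"
  then show "AE p in lborel. P (fst p) (snd p)"
    using lborel_pair.AE_pair_measure[OF s] unfolding lborel_prod by simp
next
  have assms: "{p. P (fst p) (snd p)} \<in> sets borel" using meas by (simp add: pred_def)
  have s: "{p \<in> space (lborel \<Otimes>\<^sub>M lborel). P (fst p) (snd p)} \<in> sets (lborel \<Otimes>\<^sub>M lborel)"
    using assms unfolding lborel_prod by simp
  have s': "{x \<in> space (lborel \<Otimes>\<^sub>M lborel). (\<lambda>x y. P x y) (fst x) (snd x)} \<in> sets (lborel \<Otimes>\<^sub>M lborel)"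
    using s by simp
  assume "AE y in lborel. AE x in lborel. P x y"
  then have "AE x in lborel. AE y in lborel. P x y"
    using lborel_pair.AE_commute[of P] s by simp
  then show "AE p in lborel. P (fst p) (snd p)"
    using lborel_pair.AE_pair_measure[OF s] unfolding lborel_prod by simp
qed

text \<open>In \<open>x\<close> the functions are mollified, so the relation holds on every
  horizontal line for the functions as they are. In \<open>y\<close> only representatives off a null
  set are available, whence the weaker notion in \<open>has_y_primitive\<close>.\<close>

definition has_x_primitive :: "(real \<times> real \<Rightarrow> real) \<Rightarrow> (real \<times> real \<Rightarrow> real) \<Rightarrow> bool" where
  "has_x_primitive f g \<longleftrightarrow> (\<forall>y. primitive (\<lambda>x. f (x, y)) (\<lambda>x. g (x, y)))"

definition has_y_primitive :: "real set \<Rightarrow> (real \<times> real \<Rightarrow> real) \<Rightarrow> (real \<times> real \<Rightarrow> real) \<Rightarrow> bool" where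
  "has_y_primitive S f g \<longleftrightarrow> (\<forall>x. has_primitive_on S (\<lambda>y. f (x, y)) (\<lambda>y. g (x, y)))"

lemma by_parts_x:
  assumes f: "sq_integrable lborel f" "sq_integrable lborel f'" "has_x_primitive f f'"
    and g: "sq_integrable lborel g" "sq_integrable lborel g'" "has_x_primitive g g'"
  shows "(LBINT p. f' p * g p) = - (LBINT p. f p * g' p)"
proof -
  have i: "integrable lborel (\<lambda>p. f' p * g p)" "integrable lborel (\<lambda>p. f p * g' p)"
    by (rule sq_integrable_times; fact)+
  have "AE y in lborel. (LBINT x. f' (x, y) * g (x, y) + f (x, y) * g' (x, y)) = 0"
    using sq_integrable_slices(2)[OF f(1)] sq_integrable_slices(2)[OF f(2)]
      sq_integrable_slices(2)[OF g(1)] sq_integrable_slices(2)[OF g(2)]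
  proof eventually_elim
    case (elim y)
    have "primitive (\<lambda>x. f (x, y)) (\<lambda>x. f' (x, y))" "primitive (\<lambda>x. g (x, y)) (\<lambda>x. g' (x, y))"
      using f(3) g(3) by (auto simp: has_x_primitive_def)
    then have "primitive (\<lambda>x. f (x, y) * g (x, y)) (\<lambda>x. f' (x, y) * g (x, y) + f (x, y) * g' (x, y))"
      by (rule primitive_mult)
    then show ?case
      by (rule primitive_integral_eq_0) (use elim in \<open>auto intro!: sq_integrable_times\<close>)
  qed
  then have "(LBINT y. (LBINT x. f' (x, y) * g (x, y) + f (x, y) * g' (x, y))) = 0"
    by (rule integral_eq_zero_AE)
  moreover have "(LBINT p. f' p * g p + f p * g' p) = (LBINT y. (LBINT x. f' (x, y) * g (x, y) + f (x, y) * g' (x, y)))"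
    using integral_lborel_pair(2)[of "\<lambda>p. f' p * g p + f p * g' p"] i by simp
  ultimately show ?thesis using i by simp
qed

text \<open>For y \<le> 0 both products are killed by \<open>f\<close> and \<open>f'\<close>, so
  \<open>g\<close> may be replaced by a continuous representative that agrees with it for y > 0
  only. No boundary term arises at 0 because \<open>f\<close> vanishes there.\<close>

lemma has_primitive_on_mult_integral_eq_0:
  assumes f: "has_primitive_on UNIV f f'" "\<And>y. y \<le> 0 \<Longrightarrow> f y = 0" "\<And>y. y \<le> 0 \<Longrightarrow> f' y = 0"
    and g: "has_primitive_on {0<..} g g'"
    and s: "sq_integrable lborel f" "sq_integrable lborel f'" "sq_integrable lborel g" "sq_integrable lborel g'"
  shows "(LBINT y. f' y * g y + f y * g' y) = 0"
proof -
  obtain F F' where F: "primitive F F'" "AE y in lborel. F y = f y \<and> F' y = f' y"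
    using f(1) by (auto simp: has_primitive_on_def)
  obtain G G' where G: "primitive G G'" "AE y in lborel. y \<in> {0<..} \<longrightarrow> G y = g y \<and> G' y = g' y"
    using g by (auto simp: has_primitive_on_def)
  note [measurable] = sq_integrableD(1)[OF s(1)] sq_integrableD(1)[OF s(2)] sq_integrableD(1)[OF s(3)] sq_integrableD(1)[OF s(4)]
    primitiveD(1)[OF F(1)] primitiveD(1)[OF G(1)] primitive_measurable[OF F(1)] primitive_measurable[OF G(1)]
  have e1: "AE y in lborel. f y * g y = F y * G y"
    using F(2) G(2)
  proof eventually_elim
    case (elim y)
    then show ?case using f(2)[of y] by (cases "y \<le> 0") auto
  qed
  have e2: "AE y in lborel. f' y * g y + f y * g' y = F' y * G y + F y * G' y"
    using F(2) G(2)
  proof eventually_elim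
    case (elim y)
    then show ?case using f(2,3)[of y] by (cases "y \<le> 0") auto
  qed
  have i1: "integrable lborel (\<lambda>y. F y * G y)"
    using sq_integrable_times[OF s(1,3)] by (rule integrable_cong_AE_imp) (use e1 in \<open>auto elim: eventually_mono\<close>)
  have i2: "integrable lborel (\<lambda>y. F' y * G y + F y * G' y)"
    using Bochner_Integration.integrable_add[OF sq_integrable_times[OF s(2,3)] sq_integrable_times[OF s(1,4)]]
    by (rule integrable_cong_AE_imp) (use e2 in \<open>auto elim: eventually_mono\<close>)
  have "(LBINT y. f' y * g y + f y * g' y) = (LBINT y. F' y * G y + F y * G' y)"
    using e2 by (intro integral_cong_AE) auto
  also have "\<dots> = 0" by (rule primitive_integral_eq_0[OF primitive_mult[OF F(1) G(1)] i1 i2])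
  finally show ?thesis .
qed

lemma by_parts_y:
  assumes f: "sq_integrable lborel f" "sq_integrable lborel f'" "has_y_primitive UNIV f f'"
      "\<And>x y. y \<le> 0 \<Longrightarrow> f (x, y) = 0" "\<And>x y. y \<le> 0 \<Longrightarrow> f' (x, y) = 0"
    and g: "sq_integrable lborel g" "sq_integrable lborel g'" "has_y_primitive {0<..} g g'"
  shows "(LBINT p. f' p * g p) = - (LBINT p. f p * g' p)"
proof -
  have i: "integrable lborel (\<lambda>p. f' p * g p)" "integrable lborel (\<lambda>p. f p * g' p)"
    by (rule sq_integrable_times; fact)+
  have "AE x in lborel. (LBINT y. f' (x, y) * g (x, y) + f (x, y) * g' (x, y)) = 0"
    using sq_integrable_slices(1)[OF f(1)] sq_integrable_slices(1)[OF f(2)]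
      sq_integrable_slices(1)[OF g(1)] sq_integrable_slices(1)[OF g(2)]
  proof eventually_elim
    case (elim x)
    show ?case
      by (rule has_primitive_on_mult_integral_eq_0) (use f g elim in \<open>auto simp: has_y_primitive_def\<close>)
  qed
  then have "(LBINT x. (LBINT y. f' (x, y) * g (x, y) + f (x, y) * g' (x, y))) = 0"
    by (rule integral_eq_zero_AE)
  moreover have "(LBINT p. f' p * g p + f p * g' p) = (LBINT x. (LBINT y. f' (x, y) * g (x, y) + f (x, y) * g' (x, y)))"
    using integral_lborel_pair(1)[of "\<lambda>p. f' p * g p + f p * g' p"] i by simp
  ultimately show ?thesis using i by simp
qed

section \<open>The inequalities of Ladyzhenskaya and Poincare\<close>

lemma has_primitive_on_square_le:
  assumes f: "has_primitive_on UNIV f f'" and s: "sq_integrable lborel f" "sq_integrable lborel f'"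
  shows "AE x in lborel. (f x)\<^sup>2 \<le> 2 * (LBINT y. \<bar>f y * f' y\<bar>)"
proof -
  obtain F F' where F: "primitive F F'" "AE y in lborel. F y = f y \<and> F' y = f' y"
    using f(1) by (auto simp: has_primitive_on_def)
  note [measurable] = sq_integrableD(1)[OF s(1)] sq_integrableD(1)[OF s(2)] primitiveD(1)[OF F(1)] primitive_measurable[OF F(1)]
  have sF: "sq_integrable lborel F"
    by (rule sq_integrable_bound[OF s(1)]) (use F(2) in \<open>auto elim: eventually_mono\<close>)
  have sF': "sq_integrable lborel F'"
    by (rule sq_integrable_bound[OF s(2)]) (use F(2) in \<open>auto elim: eventually_mono\<close>)
  have eq: "(LBINT y. \<bar>f y * f' y\<bar>) = (LBINT y. \<bar>F y * F' y\<bar>)"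
    by (rule integral_cong_AE) (use F(2) in \<open>auto elim: eventually_mono\<close>)
  show ?thesis
    using F(2)
  proof eventually_elim
    case (elim x)
    then show ?case using eq primitive_square_le[OF F(1) sF sF', of x] by simp
  qed
qed

text \<open>Along horizontal lines \<open>(f p)\<^sup>2\<close> is bounded by a function of
  \<open>y\<close> alone, along vertical lines by a function of \<open>x\<close> alone, and the
  integral of the product of the two bounds factorises. The constant 4 is the square of the 2 in
  \<open>primitive_square_le\<close>.\<close>

lemma Ladyzhenskaya:
  assumes f: "sq_integrable lborel f" and x: "sq_integrable lborel fx" "has_x_primitive f fx"
    and y: "sq_integrable lborel fy" "has_y_primitive UNIV f fy"
  shows "integrable lborel (\<lambda>p. f p ^ 4)"
    and "(LBINT p. f p ^ 4) \<le> 4 * (LBINT p. (f p)\<^sup>2) * sqrt (LBINT p. (fx p)\<^sup>2) * sqrt (LBINT p. (fy p)\<^sup>2)"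
proof -
  note [measurable] = sq_integrableD(1)[OF f, simplified] sq_integrableD(1)[OF x(1), simplified] sq_integrableD(1)[OF y(1), simplified]
  define a where "a y = 2 * (LBINT x. \<bar>f (x, y) * fx (x, y)\<bar>)" for y
  define b where "b x = 2 * (LBINT y. \<bar>f (x, y) * fy (x, y)\<bar>)" for x
  have ia0: "integrable lborel (\<lambda>p. \<bar>f p * fx p\<bar>)" and ib0: "integrable lborel (\<lambda>p. \<bar>f p * fy p\<bar>)"
    using sq_integrable_times[OF f x(1)] sq_integrable_times[OF f y(1)] by auto
  have ia: "integrable lborel a" unfolding a_def using integral_lborel_pair(6)[OF ia0] by simp
  have ib: "integrable lborel b" unfolding b_def using integral_lborel_pair(5)[OF ib0] by simp
  note [measurable] = borel_measurable_integrable[OF ia, simplified] borel_measurable_integrable[OF ib, simplified]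
  have "(LBINT y. a y) = 2 * (LBINT p. \<bar>f p * fx p\<bar>)"
    unfolding a_def using integral_lborel_pair(2)[OF ia0] by simp
  also have "\<dots> \<le> 2 * (sqrt (LBINT p. (f p)\<^sup>2) * sqrt (LBINT p. (fx p)\<^sup>2))"
    using Cauchy_Schwarz_integral_abs[OF f x(1)] by simp
  finally have a_le: "(LBINT y. a y) \<le> 2 * (sqrt (LBINT p. (f p)\<^sup>2) * sqrt (LBINT p. (fx p)\<^sup>2))" .
  have "(LBINT x. b x) = 2 * (LBINT p. \<bar>f p * fy p\<bar>)"
    unfolding b_def using integral_lborel_pair(1)[OF ib0] by simp
  also have "\<dots> \<le> 2 * (sqrt (LBINT p. (f p)\<^sup>2) * sqrt (LBINT p. (fy p)\<^sup>2))"
    using Cauchy_Schwarz_integral_abs[OF f y(1)] by simp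
  finally have b_le: "(LBINT x. b x) \<le> 2 * (sqrt (LBINT p. (f p)\<^sup>2) * sqrt (LBINT p. (fy p)\<^sup>2))" .
  have a0: "0 \<le> a y" and b0: "0 \<le> b x" for x y by (auto simp: a_def b_def)
  have "AE y in lborel. AE x in lborel. (f (x, y))\<^sup>2 \<le> a y"
    using sq_integrable_slices(2)[OF f] sq_integrable_slices(2)[OF x(1)]
  proof eventually_elim
    case (elim y)
    have "primitive (\<lambda>x. f (x, y)) (\<lambda>x. fx (x, y))" using x(2) by (simp add: has_x_primitive_def)
    from primitive_square_le[OF this elim] show ?case by (auto simp: a_def)
  qed
  note that = this
  have A: "AE p in lborel. (f p)\<^sup>2 \<le> a (snd p)"
  proof -
    have "Measurable.pred borel (\<lambda>p. (f p)\<^sup>2 \<le> a (snd p))" by measurable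
    then show ?thesis using AE_lborel_pairI(2)[of "\<lambda>x y. (f (x, y))\<^sup>2 \<le> a y"] that by simp
  qed
  have "AE x in lborel. AE y in lborel. (f (x, y))\<^sup>2 \<le> b x"
    using sq_integrable_slices(1)[OF f] sq_integrable_slices(1)[OF y(1)]
  proof eventually_elim
    case (elim x)
    have "has_primitive_on UNIV (\<lambda>y. f (x, y)) (\<lambda>y. fy (x, y))" using y(2) by (simp add: has_y_primitive_def)
    from has_primitive_on_square_le[OF this elim] show ?case by (simp add: b_def)
  qed
  note that = this
  have B: "AE p in lborel. (f p)\<^sup>2 \<le> b (fst p)"
  proof -
    have "Measurable.pred borel (\<lambda>p. (f p)\<^sup>2 \<le> b (fst p))" by measurable
    then show ?thesis using AE_lborel_pairI(1)[of "\<lambda>x y. (f (x, y))\<^sup>2 \<le> b x"] that by simp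
  qed
  have iab: "integrable lborel (\<lambda>p. b (fst p) * a (snd p))"
    using integrable_pair_mult[OF ib ia] by (simp add: lborel_prod case_prod_beta')
  have le: "AE p in lborel. f p ^ 4 \<le> b (fst p) * a (snd p)"
    using A B
  proof eventually_elim
    case (elim p)
    have "f p ^ 4 = (f p)\<^sup>2 * (f p)\<^sup>2" by (simp add: power2_eq_square power4_eq_xxxx)
    also have "\<dots> \<le> b (fst p) * a (snd p)" using elim b0 by (intro mult_mono) auto
    finally show ?case .
  qed
  show i4: "integrable lborel (\<lambda>p. f p ^ 4)"
  proof (rule Bochner_Integration.integrable_bound[OF iab])
    show "AE p in lborel. norm (f p ^ 4) \<le> norm (b (fst p) * a (snd p))"
      using le by eventually_elim (simp add: a0 b0)
  qed measurable
  have "(LBINT p. f p ^ 4) \<le> (LBINT p. b (fst p) * a (snd p))"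
    using i4 iab le by (rule integral_mono_AE)
  also have "\<dots> = (LBINT x. b x) * (LBINT y. a y)"
    using integral_lborel_pair(1)[OF iab] by simp
  also have "\<dots> \<le> (2 * (sqrt (LBINT p. (f p)\<^sup>2) * sqrt (LBINT p. (fy p)\<^sup>2))) *
      (2 * (sqrt (LBINT p. (f p)\<^sup>2) * sqrt (LBINT p. (fx p)\<^sup>2)))"
    using a_le b_le a0 b0 by (intro mult_mono) auto
  also have "\<dots> = 4 * (sqrt (LBINT p. (f p)\<^sup>2) * sqrt (LBINT p. (f p)\<^sup>2)) * sqrt (LBINT p. (fx p)\<^sup>2) * sqrt (LBINT p. (fy p)\<^sup>2)"
    by (simp only: mult_ac)
  finally show "(LBINT p. f p ^ 4) \<le> 4 * (LBINT p. (f p)\<^sup>2) * sqrt (LBINT p. (fx p)\<^sup>2) * sqrt (LBINT p. (fy p)\<^sup>2)"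
    by simp
qed

lemma primitive_square_le_length:
  assumes F: "primitive F f" "F 0 = 0" and s: "sq_integrable lborel f" and y: "0 \<le> y"
  shows "(F y)\<^sup>2 \<le> y * (LBINT x. (f x)\<^sup>2)"
proof -
  have i: "sq_integrable lborel (indicator {0..y} :: real \<Rightarrow> real)"
  proof -
    have "(\<lambda>x. (indicator {0..y} x :: real)\<^sup>2) = (\<lambda>x. indicator {0..y} x * 1)" by (auto simp: indicator_def)
    then show ?thesis using integrable_indicator_Icc_const[of 0 y 1] by (simp add: sq_integrable_def)
  qed
  have "(LBINT x. (indicator {0..y} x :: real)\<^sup>2) = (LBINT x. indicator {0..y} x * 1)"
    by (intro Bochner_Integration.integral_cong) (auto simp: indicator_def)
  also have "\<dots> = y" using y by simp
  finally have n: "(LBINT x. (indicator {0..y} x :: real)\<^sup>2) = y" .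
  have "F y = (LBINT x. indicator {0..y} x * f x)" using primitiveD(3)[OF F(1) y] F(2) by simp
  then have "\<bar>F y\<bar> \<le> sqrt y * sqrt (LBINT x. (f x)\<^sup>2)"
    using Cauchy_Schwarz_integral[OF i s] n by simp
  then have "\<bar>F y\<bar>\<^sup>2 \<le> (sqrt y * sqrt (LBINT x. (f x)\<^sup>2))\<^sup>2" by (rule power_mono) simp
  then show ?thesis using y by (simp add: power_mult_distrib)
qed

text \<open>Gives the condition at the wall a pointwise meaning: the continuous representative
  vanishes almost everywhere to the left of 0, hence at 0.\<close>

lemma primitive_eq_0_at_0:
  assumes "primitive F F'" "AE y in lborel. F y = f y" "\<And>y. y \<le> 0 \<Longrightarrow> f y = 0"
  shows "F 0 = 0"
proof (rule ccontr)
  assume "F 0 \<noteq> 0"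
  have "continuous_on UNIV F" by (rule primitive_continuous[OF assms(1)])
  then have "open {y. F y \<noteq> 0}" by (intro open_Collect_neq continuous_intros)
  then obtain e where e: "e > 0" "ball 0 e \<subseteq> {y. F y \<noteq> 0}" using \<open>F 0 \<noteq> 0\<close> open_contains_ball by blast
  have "AE y in lborel. y \<notin> {-e<..<0}"
    using assms(2)
  proof eventually_elim
    case (elim y)
    show ?case
    proof
      assume y: "y \<in> {-e<..<0}"
      then have "y \<in> ball 0 e" by (simp add: dist_real_def)
      then have "F y \<noteq> 0" using e(2) by blast
      then show False using elim assms(3)[of y] y by simp
    qed
  qed
  then have "emeasure lborel {-e<..<0} = 0" by (subst (asm) AE_iff_measurable[of "{-e<..<0}"]) auto
  then show False using e(1) by simp
qed

text \<open>Cauchy-Schwarz on the segment from the wall up to height y bounds f(x, y)^2 by y times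
  the integral of fy^2 over the vertical line; integrating over 0 < y \<le> L costs a second factor
  L.\<close>

lemma Poincare_strip:
  assumes f: "f \<in> borel_measurable borel" "has_y_primitive UNIV f fy" "\<And>x y. y \<le> 0 \<Longrightarrow> f (x, y) = 0"
    and s: "sq_integrable lborel fy" and L: "0 \<le> L"
  shows "sq_integrable lborel (\<lambda>p. indicator {..L} (snd p) * f p)"
    and "(LBINT p. (indicator {..L} (snd p) * f p)\<^sup>2) \<le> L\<^sup>2 * (LBINT p. (fy p)\<^sup>2)"
proof -
  have mfy [measurable]: "fy \<in> borel_measurable borel" using sq_integrableD(1)[OF s] by simp
  note [measurable] = f(1)
  define e where "e x = (LBINT y. (fy (x, y))\<^sup>2)" for x
  have ie: "integrable lborel e" unfolding e_def by (rule integral_lborel_pair(5)[OF sq_integrableD(2)[OF s]])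
  note [measurable] = borel_measurable_integrable[OF ie, simplified]
  have e0: "0 \<le> e x" for x by (simp add: e_def)
  have iL: "integrable lborel (\<lambda>y::real. indicator {0..L} y * L)" by (rule integrable_indicator_Icc_const)
  have "AE x in lborel. AE y in lborel. (indicator {..L} y * f (x, y))\<^sup>2 \<le> e x * (indicator {0..L} y * L)"
    using sq_integrable_slices(1)[OF s]
  proof eventually_elim
    case (elim x)
    obtain F F' where F: "primitive F F'" "AE y in lborel. F y = f (x, y) \<and> F' y = fy (x, y)"
      using f(2)[unfolded has_y_primitive_def, rule_format, of x] by (auto simp: has_primitive_on_def)
    note [measurable] = primitiveD(1)[OF F(1)] slice_measurable(1)[OF mfy]
    have F0: "F 0 = 0"
      by (rule primitive_eq_0_at_0[OF F(1), of "\<lambda>y. f (x, y)"]) (use F(2) f(3) in \<open>auto elim: eventually_mono\<close>)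
    have sF': "sq_integrable lborel F'"
      by (rule sq_integrable_bound[OF elim]) (use F(2) in \<open>auto elim: eventually_mono\<close>)
    have eF: "(LBINT y. (F' y)\<^sup>2) = e x"
      unfolding e_def by (rule integral_cong_AE) (use F(2) in \<open>auto elim: eventually_mono\<close>)
    show ?case
      using F(2)
    proof eventually_elim
      case (elim y)
      show ?case
      proof (cases "0 < y \<and> y \<le> L")
        case True
        then have "(f (x, y))\<^sup>2 \<le> y * e x"
          using primitive_square_le_length[OF F(1) F0 sF', of y] elim eF by simp
        also have "\<dots> \<le> e x * L" using True e0[of x] by (simp add: mult.commute[of "e x"] mult_right_mono)
        finally show ?thesis using True by simp
      next
        case False
        then have 0: "indicator {..L} y * f (x, y) = 0" using f(3)[of y x] by auto
        show ?thesis unfolding 0 using e0[of x] L by simp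
      qed
    qed
  qed
  note that = this
  have le: "AE p in lborel. (indicator {..L} (snd p) * f p)\<^sup>2 \<le> e (fst p) * (indicator {0..L} (snd p) * L)"
  proof -
    have "Measurable.pred borel (\<lambda>p. (indicator {..L} (snd p) * f p)\<^sup>2 \<le> e (fst p) * (indicator {0..L} (snd p) * L))" by measurable
    then show ?thesis
      using AE_lborel_pairI(1)[of "\<lambda>x y. (indicator {..L} y * f (x, y))\<^sup>2 \<le> e x * (indicator {0..L} y * L)"] that by simp
  qed
  have ieL: "integrable lborel (\<lambda>p. e (fst p) * (indicator {0..L} (snd p) * L))"
    using integrable_pair_mult[OF ie iL] by (simp add: lborel_prod case_prod_beta')
  have i: "integrable lborel (\<lambda>p. (indicator {..L} (snd p) * f p)\<^sup>2)"
  proof (rule Bochner_Integration.integrable_bound[OF ieL])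
    show "AE p in lborel. norm ((indicator {..L} (snd p) * f p)\<^sup>2) \<le> norm (e (fst p) * (indicator {0..L} (snd p) * L))"
      using le by eventually_elim (simp add: e0 L)
  qed measurable
  then show "sq_integrable lborel (\<lambda>p. indicator {..L} (snd p) * f p)" by (simp add: sq_integrable_def)
  have "(LBINT p. (indicator {..L} (snd p) * f p)\<^sup>2) \<le> (LBINT p. e (fst p) * (indicator {0..L} (snd p) * L))"
    using i ieL le by (rule integral_mono_AE)
  also have "\<dots> = (LBINT x. e x) * (LBINT y. indicator {0..L} y * L)"
    using integral_lborel_pair(1)[OF ieL] by simp
  also have "\<dots> = L\<^sup>2 * (LBINT p. (fy p)\<^sup>2)"
    using L integral_lborel_pair(1)[OF sq_integrableD(2)[OF s]] by (simp add: e_def power2_eq_square)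
  finally show "(LBINT p. (indicator {..L} (snd p) * f p)\<^sup>2) \<le> L\<^sup>2 * (LBINT p. (fy p)\<^sup>2)" .
qed

section \<open>Orthogonality of curl free and divergence free fields\<close>

lemma cutoff_exists:
  obtains \<theta> \<theta>' :: "real \<Rightarrow> real" and M where "\<And>x. (\<theta> has_real_derivative \<theta>' x) (at x)" "continuous_on UNIV \<theta>'"
    "\<And>x. 0 \<le> \<theta> x" "\<And>x. \<theta> x \<le> 1" "\<And>x. \<bar>x\<bar> \<le> 1 \<Longrightarrow> \<theta> x = 1" "\<And>x. 2 \<le> \<bar>x\<bar> \<Longrightarrow> \<theta> x = 0"
    "\<And>x. \<bar>x\<bar> < 1 \<Longrightarrow> \<theta>' x = 0" "\<And>x. \<bar>\<theta>' x\<bar> \<le> M"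
proof -
  obtain \<sigma> \<rho> :: "real \<Rightarrow> real" where \<sigma>: "smooth \<sigma>" "\<And>x. x \<le> 0 \<Longrightarrow> \<sigma> x = 0" "\<And>x. 1 \<le> x \<Longrightarrow> \<sigma> x = 1"
    "\<And>x. 0 \<le> \<sigma> x" "\<And>x. \<sigma> x \<le> 1"
    by (rule smooth_step_exists) metis
  define \<theta> where "\<theta> x = \<sigma> (2 + 1 * x) * \<sigma> (2 + (-1) * x)" for x
  have s: "smooth \<theta>" unfolding \<theta>_def[abs_def] by (intro smooth_mult smooth_affine \<sigma>)
  have 0: "\<theta> x = 0" if "2 \<le> \<bar>x\<bar>" for x using that \<sigma>(2) by (cases "0 \<le> x") (auto simp: \<theta>_def)
  have 1: "\<theta> x = 1" if "\<bar>x\<bar> \<le> 1" for x using that \<sigma>(3) by (auto simp: \<theta>_def)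
  have t: "test_fun \<theta>" unfolding test_fun_def using s 0 by (auto intro!: exI[of _ 2])
  obtain M R where M: "\<And>x. \<bar>deriv \<theta> x\<bar> \<le> indicator {-R..R} x * M" "0 \<le> M"
    using test_fun_bounded[OF test_fun_deriv[OF t]] by metis
  have "\<bar>deriv \<theta> x\<bar> \<le> M" for x using M(1)[of x] M(2) by (cases "x \<in> {-R..R}") auto
  moreover have "deriv \<theta> x = 0" if "\<bar>x\<bar> < 1" for x
  proof (rule DERIV_eq_on_open[of "{-1<..<1}" x \<theta> _ "\<lambda>_. 1"])
    show "(\<theta> has_real_derivative deriv \<theta> x) (at x)" by (rule smoothD(1)[OF s])
  qed (use that 1 in auto)
  moreover have "0 \<le> \<theta> x" "\<theta> x \<le> 1" for x
    using \<sigma>(4,5) by (auto simp: \<theta>_def intro: mult_le_one)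
  ultimately show thesis
    using that[of \<theta> "deriv \<theta>" M] smoothD(1)[OF s] smoothD(3)[OF smoothD(2)[OF s]] 0 1 by metis
qed

text \<open>The field \<open>(N, G)\<close> is curl free and \<open>(U1, U2)\<close> is divergence free and tangential at \<open>y = 0\<close>; the stream
  function \<open>\<psi>\<close> of the latter need not be square integrable, so that the integration by parts is done with a cutoff.\<close>

lemma Helmholtz_orthogonality:
  fixes U1 U2 U1x N G H :: "real \<times> real \<Rightarrow> real"
  assumes U1: "sq_integrable lborel U1" "\<And>p. \<bar>U1 p\<bar> \<le> K" "\<And>x y. y \<le> 0 \<Longrightarrow> U1 (x, y) = 0"
    and U1x: "U1x \<in> borel_measurable borel" "\<And>p. \<bar>U1x p\<bar> \<le> K" "\<And>x y. y \<le> 0 \<Longrightarrow> U1x (x, y) = 0" "has_x_primitive U1 U1x"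
    and U2: "sq_integrable lborel U2" "\<And>x y. y \<le> 0 \<Longrightarrow> U2 (x, y) = 0" "has_y_primitive UNIV U2 (\<lambda>p. - U1x p)"
    and N: "sq_integrable lborel N" "has_y_primitive {0<..} N H"
    and G: "sq_integrable lborel G" "has_x_primitive G H"
    and H: "sq_integrable lborel H"
  shows "(LBINT p. N p * U1 p + G p * U2 p) = 0"
proof -
  have [measurable]: "U1 \<in> borel_measurable borel" "U2 \<in> borel_measurable borel" "N \<in> borel_measurable borel"
    "G \<in> borel_measurable borel" "H \<in> borel_measurable borel" "U1x \<in> borel_measurable borel"
    using sq_integrableD(1)[OF U1(1)] sq_integrableD(1)[OF U2(1)] sq_integrableD(1)[OF N(1)]
      sq_integrableD(1)[OF G(1)] sq_integrableD(1)[OF H] U1x(1) by simp_all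
  have K0: "0 \<le> K" using U1(2)[of 0] by linarith
  have lb: "\<exists>B. \<forall>y\<in>{a..b}. \<bar>f y\<bar> \<le> B" if "\<And>y. \<bar>f y\<bar> \<le> K" for a b and f :: "real \<Rightarrow> real"
    using that by metis
  \<comment> \<open>Integrating \<open>U1\<close> upwards from the wall gives \<psi>_y = U1; that
    \<psi>_x = - U2 will follow from incompressibility. The \<open>x\<close>-derivative is given by
    its own integral, so that it is defined everywhere.\<close>
  define \<psi> where "\<psi> p = (LBINT \<eta>. indicator {0..snd p} \<eta> * U1 (fst p, \<eta>))" for p
  define \<psi>x where "\<psi>x p = (LBINT \<eta>. indicator {0..snd p} \<eta> * U1x (fst p, \<eta>))" for p
  have pu: "primitive (\<lambda>y. \<psi> (x, y)) (\<lambda>y. U1 (x, y))" for x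
    unfolding \<psi>_def fst_conv snd_conv
    by (rule primitive_exists) (use U1 slice_measurable in \<open>auto intro!: lb\<close>)
  have pux: "primitive (\<lambda>y. \<psi>x (x, y)) (\<lambda>y. U1x (x, y))" for x
    unfolding \<psi>x_def fst_conv snd_conv
    by (rule primitive_exists) (use U1x slice_measurable in \<open>auto intro!: lb\<close>)
  have \<psi>0: "\<psi> (x, y) = 0" "\<psi>x (x, y) = 0" if "y \<le> 0" for x y
  proof -
    have "(\<lambda>\<eta>. indicator {0..y} \<eta> * U1 (x, \<eta>)) = (\<lambda>\<eta>. 0)" "(\<lambda>\<eta>. indicator {0..y} \<eta> * U1x (x, \<eta>)) = (\<lambda>\<eta>. 0)"
      using that U1(3) U1x(3) by (auto simp: fun_eq_iff indicator_def)
    then show "\<psi> (x, y) = 0" "\<psi>x (x, y) = 0" by (auto simp: \<psi>_def \<psi>x_def)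
  qed
  have m\<psi> [measurable]: "\<psi> \<in> borel_measurable borel" "\<psi>x \<in> borel_measurable borel"
  proof -
    have 1: "(\<lambda>(p, \<eta>). indicator {0..snd p} \<eta> * U1 (fst p, \<eta>)) \<in> borel_measurable ((borel :: (real \<times> real) measure) \<Otimes>\<^sub>M lborel)"
      and 2: "(\<lambda>(p, \<eta>). indicator {0..snd p} \<eta> * U1x (fst p, \<eta>)) \<in> borel_measurable ((borel :: (real \<times> real) measure) \<Otimes>\<^sub>M lborel)"
    proof -
      have a: "(\<lambda>x. fst (fst x)) \<in> borel_measurable ((borel :: (real \<times> real) measure) \<Otimes>\<^sub>M (lborel :: real measure))"
        "(\<lambda>x. snd (fst x)) \<in> borel_measurable ((borel :: (real \<times> real) measure) \<Otimes>\<^sub>M (lborel :: real measure))"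
        by (rule measurable_compose[OF measurable_fst measurable_fst_snd_borel(1)]
              measurable_compose[OF measurable_fst measurable_fst_snd_borel(2)])+
      have b: "(\<lambda>x. snd x) \<in> borel_measurable ((borel :: (real \<times> real) measure) \<Otimes>\<^sub>M (lborel :: real measure))"
        using measurable_snd[of "borel :: (real \<times> real) measure" "lborel :: real measure"] by simp
      note [measurable] = a b
      have c: "(\<lambda>x. indicator {0..snd (fst x)} (snd x) :: real) = (\<lambda>x. if 0 \<le> snd x \<and> snd x \<le> snd (fst x) then 1 else 0)"
        by (auto simp: indicator_def)
      have d: "(\<lambda>x. indicator {0..snd (fst x)} (snd x) :: real) \<in> borel_measurable ((borel :: (real \<times> real) measure) \<Otimes>\<^sub>M (lborel :: real measure))"
        unfolding c by measurable
      have e: "(\<lambda>x. (fst (fst x), snd x)) \<in> borel_measurable ((borel :: (real \<times> real) measure) \<Otimes>\<^sub>M (lborel :: real measure))"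
        by (intro borel_measurable_Pair a b)
      show "(\<lambda>(p, \<eta>). indicator {0..snd p} \<eta> * U1 (fst p, \<eta>)) \<in> borel_measurable ((borel :: (real \<times> real) measure) \<Otimes>\<^sub>M lborel)"
        "(\<lambda>(p, \<eta>). indicator {0..snd p} \<eta> * U1x (fst p, \<eta>)) \<in> borel_measurable ((borel :: (real \<times> real) measure) \<Otimes>\<^sub>M lborel)"
        unfolding case_prod_beta'
        by (intro borel_measurable_times d measurable_compose[OF e]; measurable)+
    qed
    show "\<psi> \<in> borel_measurable borel" "\<psi>x \<in> borel_measurable borel"
      unfolding \<psi>_def[abs_def] \<psi>x_def[abs_def]
      using lborel.borel_measurable_lebesgue_integral[OF 1] lborel.borel_measurable_lebesgue_integral[OF 2] by auto
  qed
  have px: "has_x_primitive \<psi> \<psi>x"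
    unfolding has_x_primitive_def
  proof
    fix y
    show "primitive (\<lambda>x. \<psi> (x, y)) (\<lambda>x. \<psi>x (x, y))"
    proof (rule primitiveI)
      show "(\<lambda>x. \<psi>x (x, y)) \<in> borel_measurable borel" by measurable
      have bnd: "\<bar>\<psi>x (x, y)\<bar> \<le> K * \<bar>y\<bar>" for x
      proof (cases "0 \<le> y")
        case True
        then have "\<bar>\<psi>x (x, y) - \<psi>x (x, 0)\<bar> \<le> K * (y - 0)"
          by (intro primitive_lipschitz[OF pux]) (use U1x in auto)
        then show ?thesis using True \<psi>0 by simp
      qed (use \<psi>0 K0 in \<open>simp add: mult_nonneg_nonpos\<close>)
      then show "\<exists>B. \<forall>x\<in>{a..b}. \<bar>\<psi>x (x, y)\<bar> \<le> B" for a b by metis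
      fix a b :: real assume ab: "a \<le> b"
      have iy: "integrable lborel (\<lambda>\<eta>. indicator {0..y} \<eta> * U1 (x, \<eta>))" for x
        by (rule integrable_indicator_Icc[of _ _ _ K]) (use U1(2) in auto)
      have int: "integrable (lborel \<Otimes>\<^sub>M lborel) (\<lambda>(x, \<eta>). indicator {a..b} x * (indicator {0..y} \<eta> * U1x (x, \<eta>)))"
      proof (rule Bochner_Integration.integrable_bound)
        show "integrable (lborel \<Otimes>\<^sub>M lborel) (\<lambda>(x, \<eta>). (indicator {a..b} x * K) * (indicator {0..y} \<eta> * 1))"
          by (rule integrable_pair_mult[OF integrable_indicator_Icc_const integrable_indicator_Icc_const])
        show "AE z in lborel \<Otimes>\<^sub>M lborel. norm (case z of (x, \<eta>) \<Rightarrow> indicator {a..b} x * (indicator {0..y} \<eta> * U1x (x, \<eta>)))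
            \<le> norm (case z of (x, \<eta>) \<Rightarrow> (indicator {a..b} x * K) * (indicator {0..y} \<eta> * (1::real)))"
          using U1x(2) K0 by (intro AE_I2) (auto simp: indicator_def abs_mult)
      qed measurable
      have "\<psi> (b, y) - \<psi> (a, y) = (LBINT \<eta>. indicator {0..y} \<eta> * (U1 (b, \<eta>) - U1 (a, \<eta>)))"
        unfolding \<psi>_def using iy by (simp add: right_diff_distrib)
      also have "\<dots> = (LBINT \<eta>. (LBINT x. indicator {a..b} x * (indicator {0..y} \<eta> * U1x (x, \<eta>))))"
      proof (rule Bochner_Integration.integral_cong[OF refl])
        fix \<eta>
        have "U1 (b, \<eta>) - U1 (a, \<eta>) = (LBINT x. indicator {a..b} x * U1x (x, \<eta>))"
          using U1x(4) ab by (intro primitiveD(3)) (auto simp: has_x_primitive_def)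
        then show "indicator {0..y} \<eta> * (U1 (b, \<eta>) - U1 (a, \<eta>)) = (LBINT x. indicator {a..b} x * (indicator {0..y} \<eta> * U1x (x, \<eta>)))"
          by (simp add: mult.left_commute)
      qed
      also have "\<dots> = (LBINT x. (LBINT \<eta>. indicator {a..b} x * (indicator {0..y} \<eta> * U1x (x, \<eta>))))"
        by (rule lborel_pair.Fubini_integral[OF int])
      also have "\<dots> = (LBINT x. indicator {a..b} x * \<psi>x (x, y))"
        by (simp add: \<psi>x_def)
      finally show "\<psi> (b, y) - \<psi> (a, y) = \<dots>" .
    qed
  qed
  \<comment> \<open>Both \<open>\<psi>x\<close> and \<open>- U2\<close> have the
    \<open>y\<close>-derivative \<open>U1x\<close> and vanish at the wall.\<close>
  have \<psi>x_eq: "AE p in lborel. \<psi>x p = - U2 p"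
  proof -
    have "AE x in lborel. AE y in lborel. \<psi>x (x, y) = - U2 (x, y)"
    proof (rule AE_I2)
      fix x
      obtain F F' where F: "primitive F F'" "AE y in lborel. F y = U2 (x, y) \<and> F' y = - U1x (x, y)"
        using U2(3)[unfolded has_y_primitive_def, rule_format, of x] by (auto simp: has_primitive_on_def)
      note [measurable] = primitiveD(1)[OF F(1)]
      have F0: "F 0 = 0"
        by (rule primitive_eq_0_at_0[OF F(1), of "\<lambda>y. U2 (x, y)"]) (use F(2) U2(2) in \<open>auto elim: eventually_mono\<close>)
      have "F y = - \<psi>x (x, y)" if "0 \<le> y" for y
      proof -
        have "F y = (LBINT \<eta>. indicator {0..y} \<eta> * F' \<eta>)" using primitiveD(3)[OF F(1) that] F0 by simp
        also have "\<dots> = (LBINT \<eta>. - (indicator {0..y} \<eta> * U1x (x, \<eta>)))"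
          by (rule integral_cong_AE) (use F(2) in \<open>auto elim: eventually_mono\<close>)
        finally show ?thesis by (simp add: \<psi>x_def)
      qed
      show "AE y in lborel. \<psi>x (x, y) = - U2 (x, y)"
        using F(2)
      proof eventually_elim
        case (elim y)
        then show ?case using \<open>0 \<le> y \<Longrightarrow> F y = - \<psi>x (x, y)\<close> \<psi>0(2)[of y x] U2(2)[of y x] by (cases "0 \<le> y") auto
      qed
    qed
    moreover have "Measurable.pred borel (\<lambda>p. \<psi>x p = - U2 p)" by measurable
    ultimately show ?thesis using AE_lborel_pairI(1)[of "\<lambda>x y. \<psi>x (x, y) = - U2 (x, y)"] by simp
  qed
  obtain \<theta> \<theta>' :: "real \<Rightarrow> real" and M where \<theta>: "\<And>x. (\<theta> has_real_derivative \<theta>' x) (at x)" "continuous_on UNIV \<theta>'"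
    "\<And>x. 0 \<le> \<theta> x" "\<And>x. \<theta> x \<le> 1" "\<And>x. \<bar>x\<bar> \<le> 1 \<Longrightarrow> \<theta> x = 1" "\<And>x. 2 \<le> \<bar>x\<bar> \<Longrightarrow> \<theta> x = 0"
    "\<And>x. \<bar>x\<bar> < 1 \<Longrightarrow> \<theta>' x = 0" "\<And>x. \<bar>\<theta>' x\<bar> \<le> M"
    by (rule cutoff_exists) metis
  have M0: "0 \<le> M" using \<theta>(8)[of 0] by linarith
  have cont\<theta>: "continuous_on UNIV \<theta>" using \<theta>(1) by (meson DERIV_isCont continuous_at_imp_continuous_on)
  note [measurable] = borel_measurable_continuous_onI[OF cont\<theta>] borel_measurable_continuous_onI[OF \<theta>(2)]
  define r where "r n = inverse (real n + 1)" for n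
  have r: "0 < r n" "r n * (real n + 1) = 1" for n by (auto simp: r_def)
  define c where "c n x = \<theta> (0 + r n * x)" for n x
  define c' where "c' n x = r n * \<theta>' (0 + r n * x)" for n x
  have m_c [measurable]: "c n \<in> borel_measurable borel" "c' n \<in> borel_measurable borel" for n
    unfolding c_def c'_def by measurable
  have pc: "primitive (c n) (c' n)" for n
  proof (rule primitive_DERIV)
    show "(c n has_real_derivative c' n x) (at x)" for x
      unfolding c_def[abs_def] c'_def by (rule DERIV_affine[OF \<theta>(1)])
    show "continuous_on UNIV (c' n)"
      unfolding c'_def[abs_def]
      by (intro continuous_on_mult continuous_on_const continuous_on_compose2[OF \<theta>(2)] continuous_intros) auto
  qed
  have c01: "\<bar>c n x\<bar> \<le> 1" for n x using \<theta>(3,4) by (simp add: c_def)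
  have c'b: "\<bar>c' n x\<bar> \<le> r n * M" for n x using \<theta>(8) r(1)[of n] by (simp add: c'_def abs_mult)
  have c0: "c n x = 0" if "2 * (real n + 1) < \<bar>x\<bar>" for n x
  proof -
    have "2 = 2 * (r n * (real n + 1))" using r(2)[of n] by simp
    also have "\<dots> = r n * (2 * (real n + 1))" by (simp only: mult_ac)
    also have "\<dots> \<le> r n * \<bar>x\<bar>" using that r(1)[of n] by (intro mult_left_mono) auto
    finally show ?thesis using \<theta>(6)[of "r n * x"] r(1)[of n] by (simp add: c_def abs_mult)
  qed
  have c'0: "c' n x = 0" if "\<bar>x\<bar> < real n + 1" for n x
  proof -
    have "r n * \<bar>x\<bar> < r n * (real n + 1)" using that r(1)[of n] by (intro mult_strict_left_mono) auto
    then show ?thesis using \<theta>(7)[of "r n * x"] r[of n] by (simp add: c'_def abs_mult)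
  qed
  have c'0': "c' n x = 0" if "2 * (real n + 1) < \<bar>x\<bar>" for n x
  proof (rule DERIV_eq_on_open[of "{x. 2 * (real n + 1) < \<bar>x\<bar>}" x "c n" _ "\<lambda>_. 0"])
    show "open {x. 2 * (real n + 1) < \<bar>x\<bar>}" by (intro open_Collect_less continuous_intros)
    show "(c n has_real_derivative c' n x) (at x)"
      unfolding c_def[abs_def] c'_def by (rule DERIV_affine[OF \<theta>(1)])
  qed (use that c0 in auto)
  have c1: "c n x = 1" if "\<bar>x\<bar> \<le> real n + 1" for n x
  proof -
    have "r n * \<bar>x\<bar> \<le> r n * (real n + 1)" using that r(1)[of n] by (intro mult_left_mono) auto
    then show ?thesis using \<theta>(5)[of "r n * x"] r[of n] by (simp add: c_def abs_mult)
  qed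
  have hu: "has_y_primitive UNIV \<psi> U1"
    unfolding has_y_primitive_def has_primitive_on_def
  proof (intro allI exI conjI)
    show "primitive (\<lambda>y. \<psi> (x, y)) (\<lambda>y. U1 (x, y))" for x by (rule pu)
  qed auto
  \<comment> \<open>The stream function on a strip that contains the support of the cutoff. By
    \<open>Poincare_strip\<close> its norm grows at most linearly in \<open>n\<close>, which the
    size \<open>r n\<close> of the derivative of the cutoff compensates exactly.\<close>
  define S where "S n p = indicator {..2 * (real n + 1)} (snd p) * \<psi> p" for n p
  have S: "sq_integrable lborel (S n)" "(LBINT p. (S n p)\<^sup>2) \<le> (2 * (real n + 1))\<^sup>2 * (LBINT p. (U1 p)\<^sup>2)" for n
    unfolding S_def by (rule Poincare_strip[OF m\<psi>(1) hu _ U1(1)]; use \<psi>0 in simp)+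
  \<comment> \<open>The derivative of the cutoff vanishes on the inner square, so it only meets the
    outer parts of \<open>N\<close> and \<open>G\<close>, and these tend to 0 in mean square. Growth
    of \<open>\<psi>\<close> is thus balanced and the product still tends to 0.\<close>
  define T where "T n p = (if \<bar>fst p\<bar> < real n + 1 \<and> \<bar>snd p\<bar> < real n + 1 then 0 else \<bar>N p\<bar> + \<bar>G p\<bar>)" for n p
  have mT [measurable]: "T n \<in> borel_measurable borel" for n unfolding T_def by measurable
  have sNG: "sq_integrable lborel (\<lambda>p. \<bar>N p\<bar> + \<bar>G p\<bar>)"
    by (intro sq_integrable_add sq_integrable_abs N G)
  have sT: "sq_integrable lborel (T n)" for n
    by (rule sq_integrable_bound[OF sNG]) (auto simp: T_def)
  have T0: "(\<lambda>n. LBINT p. (T n p)\<^sup>2) \<longlonglongrightarrow> (\<integral>p. 0 \<partial>(lborel :: (real \<times> real) measure))"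
  proof (rule integral_dominated_convergence[where w="\<lambda>p. (\<bar>N p\<bar> + \<bar>G p\<bar>)\<^sup>2"])
    show "integrable lborel (\<lambda>p. (\<bar>N p\<bar> + \<bar>G p\<bar>)\<^sup>2)" by (rule sq_integrableD(2)[OF sNG])
    show "AE p in lborel. norm ((T n p)\<^sup>2) \<le> (\<bar>N p\<bar> + \<bar>G p\<bar>)\<^sup>2" for n by (auto simp: T_def)
    have "(\<lambda>n. (T n p)\<^sup>2) \<longlonglongrightarrow> 0" for p
    proof -
      obtain n0 where n0: "\<bar>fst p\<bar> + \<bar>snd p\<bar> \<le> real n0" using real_arch_simple by blast
      show ?thesis
      proof (rule tendsto_eventually, rule eventually_sequentiallyI[of n0])
        fix n assume "n0 \<le> n"
        then have "real n0 \<le> real n" by simp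
        then show "(T n p)\<^sup>2 = 0" using n0 by (auto simp: T_def)
      qed
    qed
    then show "AE p in lborel. (\<lambda>n. (T n p)\<^sup>2) \<longlonglongrightarrow> 0" by simp
  qed measurable
  define I where "I n = (LBINT p. c n (fst p) * c n (snd p) * (N p * U1 p + G p * U2 p))" for n
  have I_bound: "\<bar>I n\<bar> \<le> sqrt (LBINT p. (T n p)\<^sup>2) * (2 * M * sqrt (LBINT p. (U1 p)\<^sup>2))" for n
  proof -
    define f where "f p = c n (fst p) * c n (snd p) * \<psi> p" for p
    define fx where "fx p = c' n (fst p) * c n (snd p) * \<psi> p + c n (fst p) * c n (snd p) * \<psi>x p" for p
    define fy where "fy p = c n (fst p) * c' n (snd p) * \<psi> p + c n (fst p) * c n (snd p) * U1 p" for p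
    have mf [measurable]: "f \<in> borel_measurable borel" "fx \<in> borel_measurable borel" "fy \<in> borel_measurable borel"
      unfolding f_def fx_def fy_def by measurable
    have dom: "\<bar>a * b * \<psi> p\<bar> \<le> \<bar>m * S n p\<bar>"
      if "\<bar>a\<bar> \<le> 1 \<and> \<bar>b\<bar> \<le> m \<or> \<bar>a\<bar> \<le> m \<and> \<bar>b\<bar> \<le> 1" "2 * (real n + 1) < \<bar>snd p\<bar> \<Longrightarrow> b = 0" for a b m p
    proof (cases "snd p \<le> 2 * (real n + 1)")
      case True
      have "\<bar>a\<bar> * \<bar>b\<bar> \<le> \<bar>m\<bar>"
        using that(1) mult_mono[of "\<bar>a\<bar>" 1 "\<bar>b\<bar>" m] mult_mono[of "\<bar>a\<bar>" m "\<bar>b\<bar>" 1] by auto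
      then show ?thesis using True by (simp add: S_def abs_mult mult_right_mono)
    next
      case False
      then show ?thesis using that(2) by simp
    qed
    have sf: "sq_integrable lborel f"
    proof (rule sq_integrable_bound[OF S(1)[of n]])
      show "AE p in lborel. \<bar>f p\<bar> \<le> \<bar>S n p\<bar>"
      proof (rule AE_I2)
        fix p show "\<bar>f p\<bar> \<le> \<bar>S n p\<bar>"
          using dom[of "c n (fst p)" "c n (snd p)" 1 p] c01 c0 by (simp add: f_def)
      qed
    qed measurable
    have s1: "sq_integrable lborel (\<lambda>p. c' n (fst p) * c n (snd p) * \<psi> p)"
      by (rule sq_integrable_bound[OF sq_integrable_cmult[OF S(1)[of n], of "r n * M"]])
        (auto intro!: dom c01 c'b c0)
    have s2: "sq_integrable lborel (\<lambda>p. c n (fst p) * c' n (snd p) * \<psi> p)"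
      by (rule sq_integrable_bound[OF sq_integrable_cmult[OF S(1)[of n], of "r n * M"]])
        (auto intro!: dom c01 c'b c'0')
    have cc: "\<bar>c n (fst p) * c n (snd p)\<bar> \<le> 1" for p
      unfolding abs_mult by (intro mult_le_one c01) auto
    have s3: "sq_integrable lborel (\<lambda>p. c n (fst p) * c n (snd p) * U1 p)"
      by (rule sq_integrable_bounded_times[OF U1(1) _ cc]) measurable
    have s\<psi>x: "sq_integrable lborel \<psi>x"
      by (rule sq_integrable_bound[OF U2(1)]) (use \<psi>x_eq in \<open>auto elim: eventually_mono\<close>)
    have s4: "sq_integrable lborel (\<lambda>p. c n (fst p) * c n (snd p) * \<psi>x p)"
      by (rule sq_integrable_bounded_times[OF s\<psi>x _ cc]) measurable
    have sfx: "sq_integrable lborel fx" unfolding fx_def by (rule sq_integrable_add[OF s1 s4])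
    have sfy: "sq_integrable lborel fy" unfolding fy_def by (rule sq_integrable_add[OF s2 s3])
    have pfx: "has_x_primitive f fx"
      unfolding has_x_primitive_def
    proof
      fix y
      have "primitive (\<lambda>x. c n y * (c n x * \<psi> (x, y))) (\<lambda>x. c n y * (c' n x * \<psi> (x, y) + c n x * \<psi>x (x, y)))"
        using px by (intro primitive_cmult primitive_mult pc) (simp add: has_x_primitive_def)
      then show "primitive (\<lambda>x. f (x, y)) (\<lambda>x. fx (x, y))" by (simp add: f_def fx_def algebra_simps)
    qed
    have pfy: "has_y_primitive UNIV f fy"
      unfolding has_y_primitive_def has_primitive_on_def
    proof (intro allI exI conjI)
      fix x
      have "primitive (\<lambda>y. c n x * (c n y * \<psi> (x, y))) (\<lambda>y. c n x * (c' n y * \<psi> (x, y) + c n y * U1 (x, y)))"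
        using pu by (intro primitive_cmult primitive_mult pc)
      then show "primitive (\<lambda>y. f (x, y)) (\<lambda>y. fy (x, y))" by (simp add: f_def fy_def algebra_simps)
    qed auto
    \<comment> \<open>This is where the field being curl free enters: the integrations by parts in
      \<open>y\<close> and in \<open>x\<close> produce the same integral of
      \<open>f p * H p\<close>, which cancels in the difference.\<close>
    have ey: "(LBINT p. fy p * N p) = - (LBINT p. f p * H p)"
      by (rule by_parts_y[OF sf sfy pfy _ _ N(1) H N(2)]) (use \<psi>0 U1(3) in \<open>auto simp: f_def fy_def\<close>)
    have ex: "(LBINT p. fx p * G p) = - (LBINT p. f p * H p)"
      by (rule by_parts_x[OF sf sfx pfx G(1) H G(2)])
    have i: "integrable lborel (\<lambda>p. fy p * N p)" "integrable lborel (\<lambda>p. fx p * G p)"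
      by (rule sq_integrable_times[OF sfy N(1)] sq_integrable_times[OF sfx G(1)])+
    have "(LBINT p. fy p * N p - fx p * G p) = 0" using ex ey i by simp
    have i1: "integrable lborel (\<lambda>p. c n (fst p) * c n (snd p) * (N p * U1 p + G p * U2 p))"
    proof -
      have "integrable lborel (\<lambda>p. (c n (fst p) * c n (snd p) * U1 p) * N p)" by (rule sq_integrable_times[OF s3 N(1)])
      moreover have "integrable lborel (\<lambda>p. (c n (fst p) * c n (snd p) * U2 p) * G p)"
        by (rule sq_integrable_times[OF sq_integrable_bounded_times[OF U2(1) _ cc] G(1)]) measurable
      ultimately have "integrable lborel (\<lambda>p. (c n (fst p) * c n (snd p) * U1 p) * N p + (c n (fst p) * c n (snd p) * U2 p) * G p)"
        by (rule Bochner_Integration.integrable_add)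
      then show ?thesis by (simp add: algebra_simps)
    qed
    \<comment> \<open>The terms in which a derivative has fallen on the cutoff.\<close>
    define J where "J p = c n (fst p) * c' n (snd p) * \<psi> p * N p - c' n (fst p) * c n (snd p) * \<psi> p * G p" for p
    have iJ: "integrable lborel J"
      unfolding J_def by (intro Bochner_Integration.integrable_diff sq_integrable_times[OF s2 N(1)] sq_integrable_times[OF s1 G(1)])
    note [measurable] = borel_measurable_integrable[OF iJ]
    have "(LBINT p. fy p * N p - fx p * G p) = (LBINT p. c n (fst p) * c n (snd p) * (N p * U1 p + G p * U2 p) + J p)"
    proof (rule integral_cong_AE)
      show "AE p in lborel. fy p * N p - fx p * G p = c n (fst p) * c n (snd p) * (N p * U1 p + G p * U2 p) + J p"
        using \<psi>x_eq by eventually_elim (simp add: fy_def fx_def J_def algebra_simps)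
    qed measurable
    also have "\<dots> = I n + (LBINT p. J p)" unfolding I_def using i1 iJ by simp
    finally have "\<bar>I n\<bar> = \<bar>LBINT p. J p\<bar>" using \<open>(LBINT p. fy p * N p - fx p * G p) = 0\<close> by simp
    also have "\<dots> \<le> (LBINT p. \<bar>J p\<bar>)" by (rule integral_abs_bound)
    also have "\<dots> \<le> (LBINT p. (r n * M) * \<bar>T n p * S n p\<bar>)"
    proof (rule integral_mono)
      show "integrable lborel (\<lambda>p. \<bar>J p\<bar>)" using iJ by simp
      show "integrable lborel (\<lambda>p. (r n * M) * \<bar>T n p * S n p\<bar>)"
        using sq_integrable_times[OF sT S(1), of n n] by simp
      fix p
      have rM: "0 \<le> r n * M" using r(1)[of n] M0 by simp
      have abs_eq: "\<bar>r n * M * S n p\<bar> = r n * M * \<bar>S n p\<bar>"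
        by (simp only: abs_mult[of "r n * M" "S n p"] abs_of_nonneg[OF rM])
      have b2: "\<bar>c n (fst p) * c' n (snd p) * \<psi> p\<bar> \<le> r n * M * \<bar>S n p\<bar>"
        unfolding abs_eq[symmetric] by (rule dom) (use c01 c'b c'0' in auto)
      have b1: "\<bar>c' n (fst p) * c n (snd p) * \<psi> p\<bar> \<le> r n * M * \<bar>S n p\<bar>"
        unfolding abs_eq[symmetric] by (rule dom) (use c01 c'b c0 in auto)
      show "\<bar>J p\<bar> \<le> (r n * M) * \<bar>T n p * S n p\<bar>"
      proof (cases "\<bar>fst p\<bar> < real n + 1 \<and> \<bar>snd p\<bar> < real n + 1")
        case True
        then show ?thesis using c'0 rM by (simp add: J_def)
      next
        case False
        have "\<bar>J p\<bar> \<le> \<bar>c n (fst p) * c' n (snd p) * \<psi> p\<bar> * \<bar>N p\<bar> + \<bar>c' n (fst p) * c n (snd p) * \<psi> p\<bar> * \<bar>G p\<bar>"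
          unfolding J_def abs_mult[symmetric] by (rule abs_triangle_ineq4)
        also have "\<dots> \<le> (r n * M * \<bar>S n p\<bar>) * \<bar>N p\<bar> + (r n * M * \<bar>S n p\<bar>) * \<bar>G p\<bar>"
          by (intro add_mono mult_right_mono b1 b2) auto
        also have "\<dots> = (r n * M) * \<bar>T n p * S n p\<bar>"
          using False by (auto simp: T_def abs_mult algebra_simps)
        finally show ?thesis .
      qed
    qed
    also have "\<dots> = (r n * M) * (LBINT p. \<bar>T n p * S n p\<bar>)" by simp
    also have "\<dots> \<le> (r n * M) * (sqrt (LBINT p. (T n p)\<^sup>2) * sqrt (LBINT p. (S n p)\<^sup>2))"
      using Cauchy_Schwarz_integral_abs[OF sT S(1), of n n] r(1)[of n] M0 by (intro mult_left_mono) auto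
    also have "\<dots> \<le> (r n * M) * (sqrt (LBINT p. (T n p)\<^sup>2) * sqrt ((2 * (real n + 1))\<^sup>2 * (LBINT p. (U1 p)\<^sup>2)))"
      using r(1)[of n] M0 S(2)[of n] by (intro mult_left_mono) auto
    also have "sqrt ((2 * (real n + 1))\<^sup>2 * (LBINT p. (U1 p)\<^sup>2)) = 2 * (real n + 1) * sqrt (LBINT p. (U1 p)\<^sup>2)"
      by (simp add: real_sqrt_mult)
    also have "(r n * M) * (sqrt (LBINT p. (T n p)\<^sup>2) * (2 * (real n + 1) * sqrt (LBINT p. (U1 p)\<^sup>2)))
        = (r n * (real n + 1)) * (sqrt (LBINT p. (T n p)\<^sup>2) * (2 * M * sqrt (LBINT p. (U1 p)\<^sup>2)))"
      by (simp only: mult_ac)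
    finally show ?thesis using r(2)[of n] by simp
  qed
  have "(\<lambda>n. sqrt (LBINT p. (T n p)\<^sup>2) * (2 * M * sqrt (LBINT p. (U1 p)\<^sup>2))) \<longlonglongrightarrow> sqrt 0 * (2 * M * sqrt (LBINT p. (U1 p)\<^sup>2))"
    using T0 by (intro tendsto_intros) simp
  then have "I \<longlonglongrightarrow> 0"
    using I_bound by (intro Lim_null_comparison[of I]) (auto intro: always_eventually)
  have iNU: "integrable lborel (\<lambda>p. N p * U1 p + G p * U2 p)"
    by (intro Bochner_Integration.integrable_add sq_integrable_times N G U1 U2)
  have "I \<longlonglongrightarrow> (LBINT p. N p * U1 p + G p * U2 p)"
    unfolding I_def
  proof (rule integral_dominated_convergence[where w="\<lambda>p. \<bar>N p * U1 p + G p * U2 p\<bar>"])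
    show "integrable lborel (\<lambda>p. \<bar>N p * U1 p + G p * U2 p\<bar>)" using iNU by simp
    show "AE p in lborel. norm (c n (fst p) * c n (snd p) * (N p * U1 p + G p * U2 p)) \<le> \<bar>N p * U1 p + G p * U2 p\<bar>" for n
    proof (rule AE_I2)
      fix p
      have "\<bar>c n (fst p) * c n (snd p)\<bar> \<le> 1" unfolding abs_mult by (intro mult_le_one c01) auto
      then show "norm (c n (fst p) * c n (snd p) * (N p * U1 p + G p * U2 p)) \<le> \<bar>N p * U1 p + G p * U2 p\<bar>"
        unfolding real_norm_def abs_mult[of _ "N p * U1 p + G p * U2 p"] by (rule mult_left_le_one_le[rotated 2]) auto
    qed
    have "(\<lambda>n. c n (fst p) * c n (snd p) * (N p * U1 p + G p * U2 p)) \<longlonglongrightarrow> N p * U1 p + G p * U2 p" for p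
    proof -
      obtain n0 where n0: "\<bar>fst p\<bar> + \<bar>snd p\<bar> \<le> real n0" using real_arch_simple by blast
      show ?thesis
      proof (rule tendsto_eventually, rule eventually_sequentiallyI[of n0])
        fix n assume "n0 \<le> n"
        then have "real n0 \<le> real n" by simp
        then show "c n (fst p) * c n (snd p) * (N p * U1 p + G p * U2 p) = N p * U1 p + G p * U2 p"
          using n0 c1 by simp
      qed
    qed
    then show "AE p in lborel. (\<lambda>n. c n (fst p) * c n (snd p) * (N p * U1 p + G p * U2 p)) \<longlonglongrightarrow> N p * U1 p + G p * U2 p"
      by simp
  qed measurable
  then show ?thesis using LIMSEQ_unique[OF \<open>I \<longlonglongrightarrow> 0\<close>] by simp
qed

subsection \<open>Time dependent functions with square integrable slices\<close>

text \<open>The bounds are demanded for every point and every time, not almost every one, so that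
  individual times can be selected and slices formed freely. The uniform bound on the slices
  expresses bounded energy.\<close>

definition slicewise :: "(real \<times> real \<times> real \<Rightarrow> real) \<Rightarrow> bool" where
  "slicewise f \<longleftrightarrow> f \<in> borel_measurable borel \<and> (\<exists>K. \<forall>w. \<bar>f w\<bar> \<le> K) \<and>
     (\<exists>C. \<forall>t. sq_integrable lborel (\<lambda>p. f (t, p)) \<and> (LBINT p. (f (t, p))\<^sup>2) \<le> C)"

lemma slicewiseD:
  assumes "slicewise f"
  shows "f \<in> borel_measurable borel" "sq_integrable lborel (\<lambda>p. f (t, p))"
  using assms by (auto simp: slicewise_def)

lemma slicewise_bounded:
  assumes "slicewise f"
  obtains K where "\<And>w. \<bar>f w\<bar> \<le> K" "0 \<le> K"
proof -
  obtain K where K: "\<forall>w. \<bar>f w\<bar> \<le> K" using assms unfolding slicewise_def by metis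
  moreover have "0 \<le> K" using K[rule_format, of undefined] by linarith
  ultimately show thesis using that by metis
qed

lemma slicewise_energy:
  assumes "slicewise f"
  obtains C where "\<And>t. (LBINT p. (f (t, p))\<^sup>2) \<le> C" "0 \<le> C"
proof -
  obtain C where C: "\<forall>t. (LBINT p. (f (t, p))\<^sup>2) \<le> C" using assms unfolding slicewise_def by metis
  moreover have "0 \<le> C" using C[rule_format, of 0] integral_square_nonneg[of lborel "\<lambda>p. f (0, p)"] by linarith
  ultimately show thesis using that by metis
qed

lemma slicewise_add:
  assumes f: "slicewise f" and g: "slicewise g"
  shows "slicewise (\<lambda>w. f w + g w)"
  unfolding slicewise_def
proof (intro conjI)
  note [measurable] = slicewiseD(1)[OF f] slicewiseD(1)[OF g]
  show "(\<lambda>w. f w + g w) \<in> borel_measurable borel" by measurable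
  obtain K where K: "\<And>w. \<bar>f w\<bar> \<le> K" using slicewise_bounded[OF f] by metis
  obtain L where L: "\<And>w. \<bar>g w\<bar> \<le> L" using slicewise_bounded[OF g] by metis
  have "\<bar>f w + g w\<bar> \<le> K + L" for w using K[of w] L[of w] by linarith
  then show "\<exists>K. \<forall>w. \<bar>f w + g w\<bar> \<le> K" by metis
  obtain C where C: "\<And>t. (LBINT p. (f (t, p))\<^sup>2) \<le> C" using slicewise_energy[OF f] by metis
  obtain D where D: "\<And>t. (LBINT p. (g (t, p))\<^sup>2) \<le> D" using slicewise_energy[OF g] by metis
  have "sq_integrable lborel (\<lambda>p. f (t, p) + g (t, p)) \<and> (LBINT p. (f (t, p) + g (t, p))\<^sup>2) \<le> 2 * C + 2 * D" for t
    using sq_integrable_add[OF slicewiseD(2)[OF f, of t] slicewiseD(2)[OF g, of t]]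
      integral_square_add_le[OF slicewiseD(2)[OF f, of t] slicewiseD(2)[OF g, of t]] C[of t] D[of t] by simp
  then show "\<exists>C. \<forall>t. sq_integrable lborel (\<lambda>p. f (t, p) + g (t, p)) \<and> (LBINT p. (f (t, p) + g (t, p))\<^sup>2) \<le> C"
    by metis
qed

lemma slicewise_bounded_times:
  assumes f: "slicewise f" and h: "h \<in> borel_measurable borel" "\<And>w. \<bar>h w\<bar> \<le> B"
  shows "slicewise (\<lambda>w. h w * f w)"
  unfolding slicewise_def
proof (intro conjI)
  note [measurable] = slicewiseD(1)[OF f] h(1)
  show "(\<lambda>w. h w * f w) \<in> borel_measurable borel" by measurable
  obtain K where K: "\<And>w. \<bar>f w\<bar> \<le> K" "0 \<le> K" using slicewise_bounded[OF f] by metis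
  have B0: "0 \<le> B" using h(2)[of undefined] by linarith
  have "\<bar>h w * f w\<bar> \<le> B * K" for w
    unfolding abs_mult using K h(2) B0 by (intro mult_mono) auto
  then show "\<exists>K. \<forall>w. \<bar>h w * f w\<bar> \<le> K" by metis
  obtain C where C: "\<And>t. (LBINT p. (f (t, p))\<^sup>2) \<le> C" using slicewise_energy[OF f] by metis
  have "sq_integrable lborel (\<lambda>p. h (t, p) * f (t, p)) \<and> (LBINT p. (h (t, p) * f (t, p))\<^sup>2) \<le> B\<^sup>2 * C" for t
  proof
    have m: "(\<lambda>p. h (t, p)) \<in> borel_measurable lborel" by measurable
    show s: "sq_integrable lborel (\<lambda>p. h (t, p) * f (t, p))"
      using sq_integrable_bounded_times[OF slicewiseD(2)[OF f] m h(2)] by simp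
    have "(LBINT p. (h (t, p) * f (t, p))\<^sup>2) \<le> (LBINT p. B\<^sup>2 * (f (t, p))\<^sup>2)"
    proof (rule integral_mono)
      show "integrable lborel (\<lambda>p. B\<^sup>2 * (f (t, p))\<^sup>2)" using sq_integrableD(2)[OF slicewiseD(2)[OF f]] by simp
      show "(h (t, p) * f (t, p))\<^sup>2 \<le> B\<^sup>2 * (f (t, p))\<^sup>2" for p
        using power_mono[OF h(2)[of "(t, p)"], of 2] by (simp add: power_mult_distrib mult_right_mono)
    qed (rule sq_integrableD(2)[OF s])
    also have "\<dots> \<le> B\<^sup>2 * C" using C[of t] by (simp add: mult_left_mono)
    finally show "(LBINT p. (h (t, p) * f (t, p))\<^sup>2) \<le> B\<^sup>2 * C" .
  qed
  then show "\<exists>C. \<forall>t. sq_integrable lborel (\<lambda>p. h (t, p) * f (t, p)) \<and> (LBINT p. (h (t, p) * f (t, p))\<^sup>2) \<le> C"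
    by metis
qed

lemma slicewise_times:
  assumes f: "slicewise f" and g: "slicewise g"
  shows "slicewise (\<lambda>w. f w * g w)"
proof -
  obtain K where "\<And>w. \<bar>f w\<bar> \<le> K" using slicewise_bounded[OF f] by metis
  then show ?thesis by (rule slicewise_bounded_times[OF g slicewiseD(1)[OF f]])
qed

lemma slicewise_cmult: "slicewise f \<Longrightarrow> slicewise (\<lambda>w. c * f w)"
  by (rule slicewise_bounded_times[of f "\<lambda>_. c" "\<bar>c\<bar>"]) auto

lemma slicewise_uminus: "slicewise f \<Longrightarrow> slicewise (\<lambda>w. - f w)"
  using slicewise_cmult[of f "-1"] by simp

lemma slicewise_diff: "slicewise f \<Longrightarrow> slicewise g \<Longrightarrow> slicewise (\<lambda>w. f w - g w)"
  using slicewise_add[of f "\<lambda>w. - g w"] slicewise_uminus[of g] by simp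

lemma integral_lborel_translate:
  fixes f :: "'a::euclidean_space \<Rightarrow> real"
  assumes [measurable]: "f \<in> borel_measurable borel"
  shows "(LBINT x. f (x - c)) = (LBINT x. f x)"
    and "integrable lborel (\<lambda>x. f (x - c)) \<longleftrightarrow> integrable lborel f"
proof -
  have d: "distr lborel borel ((+) (- c)) = (lborel :: 'a measure)" by (rule lborel_distr_plus)
  have "(\<integral>x. f x \<partial>distr lborel borel ((+) (- c))) = (LBINT x. f (- c + x))"
    by (rule integral_distr) measurable
  then show "(LBINT x. f (x - c)) = (LBINT x. f x)" unfolding d by simp
  have "integrable (distr lborel borel ((+) (- c))) f \<longleftrightarrow> integrable lborel (\<lambda>x. f (- c + x))"
    by (rule integrable_distr_eq) measurable
  then show "integrable lborel (\<lambda>x. f (x - c)) \<longleftrightarrow> integrable lborel f" unfolding d by simp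
qed

text \<open>A shift in time leads to another slice, a shift in space preserves the norm of a slice;
  all translates therefore obey the same bound and \<open>Minkowski_square_integral\<close> applies,
  whatever the direction \<open>v\<close>.\<close>

lemma dconv_slice:
  fixes f :: "real \<times> real \<times> real \<Rightarrow> real"
  assumes a: "integrable lborel a" and f: "f \<in> borel_measurable borel" "\<And>w. \<bar>f w\<bar> \<le> K"
    and C: "\<And>t. sq_integrable lborel (\<lambda>p. f (t, p))" "\<And>t. (LBINT p. (f (t, p))\<^sup>2) \<le> C"
  shows "sq_integrable lborel (\<lambda>p. dconv v a f (t, p))"
    and "(LBINT p. (dconv v a f (t, p))\<^sup>2) \<le> (LBINT r. \<bar>a r\<bar>)\<^sup>2 * C"
proof -
  note [measurable] = f(1)
  define g where "g r p = f ((t, p) - r *\<^sub>R v)" for r p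
  have g: "g r p = f (t - r * fst v, p - r *\<^sub>R snd v)" for r p
    by (cases v) (simp add: g_def)
  have m: "(\<lambda>(r, p). g r p) \<in> borel_measurable borel"
    unfolding g_def case_prod_beta' by measurable
  have mt: "(\<lambda>p. f (t, p)) \<in> borel_measurable borel" for t by measurable
  have s: "sq_integrable lborel (g r)" for r
  proof -
    have m: "(\<lambda>p. (f (t - r * fst v, p))\<^sup>2) \<in> borel_measurable borel" by measurable
    show ?thesis
      using sq_integrableD(2)[OF C(1), of "t - r * fst v"] integral_lborel_translate(2)[OF m, of "r *\<^sub>R snd v"]
      by (simp add: sq_integrable_def g[abs_def])
  qed
  have k: "(LBINT p. (g r p)\<^sup>2) \<le> C" for r
  proof -
    have m: "(\<lambda>p. (f (t - r * fst v, p))\<^sup>2) \<in> borel_measurable borel" by measurable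
    show ?thesis
      using integral_lborel_translate(1)[OF m, of "r *\<^sub>R snd v"] C(2)[of "t - r * fst v"] by (simp add: g)
  qed
  have "\<bar>g r p\<bar> \<le> K" for r p using f(2) by (simp add: g_def)
  from Minkowski_square_integral[OF a m this s k]
  show "sq_integrable lborel (\<lambda>p. dconv v a f (t, p))"
    and "(LBINT p. (dconv v a f (t, p))\<^sup>2) \<le> (LBINT r. \<bar>a r\<bar>)\<^sup>2 * C"
    by (auto simp: dconv_def g_def)
qed

lemma slicewise_dconv:
  assumes a: "integrable lborel a" and f: "slicewise f"
  shows "slicewise (dconv v a f)"
proof -
  obtain K where K: "\<And>w. \<bar>f w\<bar> \<le> K" using slicewise_bounded[OF f] by metis
  obtain C where C: "\<And>t. (LBINT p. (f (t, p))\<^sup>2) \<le> C" using slicewise_energy[OF f] by metis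
  have "dconv v a f \<in> borel_measurable borel"
    using slicewiseD(1)[OF f] borel_measurable_integrable[OF a] by measurable
  moreover have "\<bar>dconv v a f w\<bar> \<le> (LBINT r. \<bar>a r\<bar>) * K" for w
    by (rule dconv_bound[OF a slicewiseD(1)[OF f] K])
  ultimately show ?thesis
    unfolding slicewise_def using dconv_slice[OF a slicewiseD(1)[OF f] K slicewiseD(2)[OF f] C] by metis
qed

subsection \<open>Mollified flows\<close>

text \<open>Points of space-time are ordered as \<open>(t, x, y)\<close>, the half plane being \<open>y > 0\<close>. The last assumption is
  the weak momentum equation tested with the divergence free field
  \<open>(\<partial>\<eta>/\<partial>y, - \<partial>\<eta>/\<partial>x)\<close>, where \<open>\<eta> = a(x) c(t) b(y)\<close>.\<close>

locale half_plane_flow =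
  fixes u1 u2 :: "real \<times> real \<times> real \<Rightarrow> real"
  assumes slicewise_u: "slicewise u1" "slicewise u2"
    and u_le_1: "\<And>w. \<bar>u1 w\<bar> \<le> 1" "\<And>w. \<bar>u2 w\<bar> \<le> 1"
    and u_eq_0: "\<And>t x y. y \<le> 0 \<Longrightarrow> u1 (t, x, y) = 0" "\<And>t x y. y \<le> 0 \<Longrightarrow> u2 (t, x, y) = 0"
    and weak_divergence: "\<And>a c b R. test_fun a \<Longrightarrow> test_fun c \<Longrightarrow> test_fun b \<Longrightarrow> R < 0 \<Longrightarrow> (\<And>t. R \<le> t \<Longrightarrow> c t = 0) \<Longrightarrow>
      (LBINT (t, x, y). u1 (t, x, y) * (deriv a x * c t * b y) + u2 (t, x, y) * (a x * c t * deriv b y)) = 0"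
    and weak_momentum: "\<And>a a1 a2 a3 c c1 b b1 b2 b3 R. test_fun a \<Longrightarrow> test_fun c \<Longrightarrow> test_fun b \<Longrightarrow> R < 0 \<Longrightarrow>
      (\<And>t. R \<le> t \<Longrightarrow> c t = 0) \<Longrightarrow>
      (\<And>x. (a has_real_derivative a1 x) (at x)) \<Longrightarrow> (\<And>x. (a1 has_real_derivative a2 x) (at x)) \<Longrightarrow>
      (\<And>x. (a2 has_real_derivative a3 x) (at x)) \<Longrightarrow> (\<And>t. (c has_real_derivative c1 t) (at t)) \<Longrightarrow>
      (\<And>y. (b has_real_derivative b1 y) (at y)) \<Longrightarrow> (\<And>y. (b1 has_real_derivative b2 y) (at y)) \<Longrightarrow>
      (\<And>y. (b2 has_real_derivative b3 y) (at y)) \<Longrightarrow> b 0 = 0 \<Longrightarrow> b1 0 = 0 \<Longrightarrow>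
      (LBINT (t, x, y). u1 (t, x, y) * (a x * c1 t * b1 y + a2 x * c t * b1 y + a x * c t * b3 y)
        - u2 (t, x, y) * (a1 x * c1 t * b y + a3 x * c t * b y + a1 x * c t * b2 y)
        + ((u1 (t, x, y))\<^sup>2 - (u2 (t, x, y))\<^sup>2) * (a1 x * c t * b1 y)
        + u1 (t, x, y) * u2 (t, x, y) * (a x * c t * b2 y - a2 x * c t * b y)) = 0"

section \<open>Mollification through the choice of test functions\<close>

lemma test_fun_affine:
  assumes "test_fun f" "d \<noteq> 0"
  shows "test_fun (\<lambda>x. f (c + d * x))"
proof -
  obtain R where R: "\<And>x. R < \<bar>x\<bar> \<Longrightarrow> f x = 0" and f: "smooth f" using assms by (auto simp: test_fun_def)
  have "f (c + d * x) = 0" if "(\<bar>R\<bar> + \<bar>c\<bar>) / \<bar>d\<bar> < \<bar>x\<bar>" for x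
  proof (rule R)
    have "\<bar>R\<bar> + \<bar>c\<bar> < \<bar>d * x\<bar>" using that assms(2) by (simp add: field_simps abs_mult)
    then show "R < \<bar>c + d * x\<bar>" by linarith
  qed
  then show ?thesis using smooth_affine[OF f] by (auto simp: test_fun_def)
qed

text \<open>With reflected kernels as test factors, pairing \<open>f\<close> with a tensor product
  amounts to mollifying at (s, z) and pairing with \<open>b\<close> in \<open>y\<close>. In this way
  the weak equation becomes an equation in \<open>y\<close> for each fixed \<open>s\<close> and
  \<open>z\<close>.\<close>

lemma integral_tensor_dconv:
  fixes f :: "real \<times> real \<times> real \<Rightarrow> real"
  assumes f: "f \<in> borel_measurable borel" "\<And>w. \<bar>f w\<bar> \<le> K"
    and a: "integrable lborel a" and c: "integrable lborel c" and b: "integrable lborel b"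
  shows "integrable lborel (\<lambda>(t, x, y). f (t, x, y) * (a (z - x) * c (s - t) * b y))"
    and "(LBINT (t, x, y). f (t, x, y) * (a (z - x) * c (s - t) * b y))
       = (LBINT y. dconv (0, 1, 0) a (dconv (1, 0, 0) c f) (s, z, y) * b y)"
    and "integrable lborel (\<lambda>y. dconv (0, 1, 0) a (dconv (1, 0, 0) c f) (s, z, y) * b y)"
proof -
  have ia: "integrable lborel (\<lambda>x. a (z - x))" using lborel_integrable_real_affine[OF a, of "-1" z] by simp
  have ic: "integrable lborel (\<lambda>t. c (s - t))" using lborel_integrable_real_affine[OF c, of "-1" s] by simp
  note [measurable] = f(1) borel_measurable_integrable[OF a, simplified] borel_measurable_integrable[OF b, simplified]
    borel_measurable_integrable[OF c, simplified]
  define h where "h w = f w * (a (z - fst (snd w)) * c (s - fst w) * b (snd (snd w)))" for w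
  have ixy: "integrable lborel (\<lambda>p. a (z - fst p) * b (snd p))"
    using integrable_pair_mult[OF ia b] by (simp add: lborel_prod case_prod_beta')
  have iprod: "integrable lborel (\<lambda>w. c (s - fst w) * (a (z - fst (snd w)) * b (snd (snd w))))"
    using integrable_pair_mult[OF ic ixy] by (simp add: lborel_prod case_prod_beta')
  have ih: "integrable lborel h"
  proof (rule Bochner_Integration.integrable_bound)
    show "integrable lborel (\<lambda>w. K * (c (s - fst w) * (a (z - fst (snd w)) * b (snd (snd w)))))"
      using iprod by simp
    show "h \<in> borel_measurable lborel" unfolding h_def by measurable
    show "AE w in lborel. norm (h w) \<le> norm (K * (c (s - fst w) * (a (z - fst (snd w)) * b (snd (snd w)))))"
    proof (rule AE_I2)
      fix w
      have "\<bar>f w\<bar> * \<bar>c (s - fst w) * (a (z - fst (snd w)) * b (snd (snd w)))\<bar> \<le> \<bar>K\<bar> * \<bar>c (s - fst w) * (a (z - fst (snd w)) * b (snd (snd w)))\<bar>"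
        using f(2)[of w] by (intro mult_right_mono) auto
      then show "norm (h w) \<le> norm (K * (c (s - fst w) * (a (z - fst (snd w)) * b (snd (snd w)))))"
        by (simp add: h_def abs_mult mult_ac)
    qed
  qed
  have heq: "h = (\<lambda>(t, x, y). f (t, x, y) * (a (z - x) * c (s - t) * b y))"
    by (auto simp: h_def)
  show "integrable lborel (\<lambda>(t, x, y). f (t, x, y) * (a (z - x) * c (s - t) * b y))"
    using ih by (simp add: heq)
  have inner: "dconv (0, 1, 0) a (dconv (1, 0, 0) c f) (s, z, y) * b y = (LBINT x. (LBINT t. h (t, x, y)))" for y
  proof -
    have "dconv (0, 1, 0) a (dconv (1, 0, 0) c f) (s, z, y) = (LBINT x. a (z - x) * dconv (1, 0, 0) c f (s, x, y))"
      using dconv_reflect[of "(0,1,0)" a "dconv (1, 0, 0) c f" "(s, 0, y)" z] by simp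
    also have "\<dots> = (LBINT x. a (z - x) * (LBINT t. c (s - t) * f (t, x, y)))"
      using dconv_reflect[of "(1,0,0)" c f "(0, x, y)" s for x] by simp
    finally show ?thesis
      by (simp add: h_def mult_ac flip: integral_mult_right_zero integral_mult_left_zero)
  qed
  have i1: "integrable lborel (\<lambda>p. LBINT t. h (t, p))" by (rule integral_lborel_pair(6)[OF ih])
  have "(LBINT w. h w) = (LBINT p. (LBINT t. h (t, p)))" by (rule integral_lborel_pair(2)[OF ih])
  also have "\<dots> = (LBINT y. (LBINT x. (LBINT t. h (t, x, y))))" by (rule integral_lborel_pair(2)[OF i1])
  finally show "(LBINT (t, x, y). f (t, x, y) * (a (z - x) * c (s - t) * b y))
       = (LBINT y. dconv (0, 1, 0) a (dconv (1, 0, 0) c f) (s, z, y) * b y)"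
    by (simp add: heq[symmetric] inner)
  show "integrable lborel (\<lambda>y. dconv (0, 1, 0) a (dconv (1, 0, 0) c f) (s, z, y) * b y)"
    unfolding inner by (rule integral_lborel_pair(6)[OF i1])
qed

text \<open>The gap \<open>\<delta>\<close> makes the reflected kernel \<rho>(s - t), as a function
  of t, vanish on a neighbourhood of t = 0 for each s < 0, however close to 0, which the weak
  equation demands of its time factor. One kernel serves for both \<open>t\<close> and
  \<open>x\<close>.\<close>

locale mollified_flow = half_plane_flow +
  fixes \<rho> :: "real \<Rightarrow> real" and \<delta> :: real
  assumes test_\<rho>: "test_fun \<rho>" and \<delta>: "0 < \<delta>" "\<And>x. x < \<delta> \<Longrightarrow> \<rho> x = 0"
begin

definition d\<rho> :: "nat \<Rightarrow> real \<Rightarrow> real" where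
  "d\<rho> k = (deriv ^^ k) \<rho>"

lemma d\<rho>_Suc: "d\<rho> (Suc k) = deriv (d\<rho> k)"
  by (simp add: d\<rho>_def)

lemma test_d\<rho>: "test_fun (d\<rho> k)"
  by (induction k) (use test_\<rho> in \<open>auto simp: d\<rho>_Suc d\<rho>_def intro: test_fun_deriv\<close>)

lemma d\<rho>_DERIV: "(d\<rho> k has_real_derivative d\<rho> (Suc k) x) (at x)"
  unfolding d\<rho>_Suc using smoothD(1) test_d\<rho> by (auto simp: test_fun_def)

lemma d\<rho>_eq_0: "x < \<delta> \<Longrightarrow> d\<rho> k x = 0"
proof (induction k arbitrary: x)
  case 0
  then show ?case using \<delta> by (simp add: d\<rho>_def)
next
  case (Suc k)
  show ?case
    by (rule DERIV_eq_on_open[of "{..<\<delta>}" x "d\<rho> k" _ "\<lambda>_. 0"]) (use Suc d\<rho>_DERIV in auto)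
qed

lemma d\<rho>_integrable: "integrable lborel (d\<rho> k)"
  by (rule test_fun_integrable[OF test_d\<rho>])

text \<open>\<open>cv k l f\<close> is the derivative of order \<open>k\<close> in \<open>x\<close> and \<open>l\<close> in \<open>t\<close> of the mollification of \<open>f\<close>; since \<open>\<rho>\<close> vanishes on \<open>(-\<infinity>, \<delta>)\<close>, only
  values of \<open>f\<close> at earlier times enter.\<close>

definition cv :: "nat \<Rightarrow> nat \<Rightarrow> (real \<times> real \<times> real \<Rightarrow> real) \<Rightarrow> real \<times> real \<times> real \<Rightarrow> real" where
  "cv k l f = dconv (0, 1, 0) (d\<rho> k) (dconv (1, 0, 0) (d\<rho> l) f)"

lemma slicewise_cv: "slicewise f \<Longrightarrow> slicewise (cv k l f)"
  unfolding cv_def by (intro slicewise_dconv d\<rho>_integrable)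

lemma cv_eq_0:
  assumes "\<And>t x y. y \<le> 0 \<Longrightarrow> f (t, x, y) = 0" "y \<le> 0"
  shows "cv k l f (t, x, y) = 0"
  using assms by (simp add: cv_def dconv_def)

lemma cv_u_eq_0: "y \<le> 0 \<Longrightarrow> cv k l u1 (t, x, y) = 0" "y \<le> 0 \<Longrightarrow> cv k l u2 (t, x, y) = 0"
  using u_eq_0 by (auto intro!: cv_eq_0)

lemma cv_x_primitive:
  assumes f: "slicewise f"
  shows "has_x_primitive (\<lambda>p. cv k l f (s, p)) (\<lambda>p. cv (Suc k) l f (s, p))"
  unfolding has_x_primitive_def
proof
  fix y
  let ?g = "dconv (1, 0, 0) (d\<rho> l) f"
  have g: "slicewise ?g" by (intro slicewise_dconv d\<rho>_integrable f)
  obtain K where K: "\<And>w. \<bar>?g w\<bar> \<le> K" using slicewise_bounded[OF g] by metis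
  obtain R where R: "\<And>x. R < \<bar>x\<bar> \<Longrightarrow> d\<rho> k x = 0" using test_d\<rho>[of k] by (auto simp: test_fun_def)
  obtain R' where R': "\<And>x. R' < \<bar>x\<bar> \<Longrightarrow> d\<rho> (Suc k) x = 0" using test_d\<rho>[of "Suc k"] unfolding test_fun_def by metis
  have c: "continuous_on UNIV (d\<rho> (Suc k))" using smoothD(3) test_d\<rho>[of "Suc k"] by (auto simp: test_fun_def)
  have "primitive (\<lambda>h. dconv (0, 1, 0) (d\<rho> k) ?g ((s, 0, y) + h *\<^sub>R (0, 1, 0)))
      (\<lambda>h. dconv (0, 1, 0) (d\<rho> (Suc k)) ?g ((s, 0, y) + h *\<^sub>R (0, 1, 0)))"
    by (rule dconv_primitive[OF d\<rho>_DERIV c, where R = "max R R'" and B = K])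
      (use R R' K slicewiseD(1)[OF g] d\<rho>_integrable in auto)
  then show "primitive (\<lambda>x. cv k l f (s, x, y)) (\<lambda>x. cv (Suc k) l f (s, x, y))"
    by (simp add: cv_def)
qed

text \<open>The time convolution is the inner one in \<open>cv\<close>, so the two convolutions are
  interchanged before differentiating.\<close>

lemma cv_t_primitive:
  assumes f: "slicewise f"
  shows "primitive (\<lambda>s. cv k l f (s, p)) (\<lambda>s. cv k (Suc l) f (s, p))"
proof -
  let ?g = "dconv (0, 1, 0) (d\<rho> k) f"
  have g: "slicewise ?g" by (intro slicewise_dconv d\<rho>_integrable f)
  obtain K where K: "\<And>w. \<bar>?g w\<bar> \<le> K" using slicewise_bounded[OF g] by metis
  obtain L where L: "\<And>w. \<bar>f w\<bar> \<le> L" using slicewise_bounded[OF f] by metis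
  obtain R where R: "\<And>x. R < \<bar>x\<bar> \<Longrightarrow> d\<rho> l x = 0" using test_d\<rho>[of l] by (auto simp: test_fun_def)
  obtain R' where R': "\<And>x. R' < \<bar>x\<bar> \<Longrightarrow> d\<rho> (Suc l) x = 0" using test_d\<rho>[of "Suc l"] unfolding test_fun_def by metis
  have c: "continuous_on UNIV (d\<rho> (Suc l))" using smoothD(3) test_d\<rho>[of "Suc l"] by (auto simp: test_fun_def)
  have e: "cv k j f = dconv (1, 0, 0) (d\<rho> j) ?g" for j
    unfolding cv_def by (rule dconv_commute[OF d\<rho>_integrable d\<rho>_integrable slicewiseD(1)[OF f] L])
  have "primitive (\<lambda>h. dconv (1, 0, 0) (d\<rho> l) ?g ((0, p) + h *\<^sub>R (1, 0, 0)))
      (\<lambda>h. dconv (1, 0, 0) (d\<rho> (Suc l)) ?g ((0, p) + h *\<^sub>R (1, 0, 0)))"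
    by (rule dconv_primitive[OF d\<rho>_DERIV c, where R = "max R R'" and B = K])
      (use R R' K slicewiseD(1)[OF g] d\<rho>_integrable in auto)
  then show ?thesis by (cases p) (simp add: e zero_prod_def)
qed

section \<open>The third order equation in \<open>y\<close> for the mollified flow\<close>

text \<open>\<open>P\<close> is the off-diagonal entry of u \<otimes> u, and \<open>D\<close> the
  difference of its diagonal entries. A divergence free test field sees nothing else of u \<otimes>
  u, since the trace is paired with the divergence.\<close>

definition P :: "real \<times> real \<times> real \<Rightarrow> real" where "P w = u1 w * u2 w"
definition D :: "real \<times> real \<times> real \<Rightarrow> real" where "D w = (u1 w)\<^sup>2 - (u2 w)\<^sup>2"

lemma slicewise_PD: "slicewise P" "slicewise D"
  unfolding P_def[abs_def] D_def[abs_def] power2_eq_square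
  by (intro slicewise_times slicewise_diff slicewise_u)+

lemma PD_eq_0: "y \<le> 0 \<Longrightarrow> P (t, x, y) = 0" "y \<le> 0 \<Longrightarrow> D (t, x, y) = 0"
  using u_eq_0 by (auto simp: P_def D_def)

text \<open>The coefficients of the equation in \<open>y\<close> for the first mollified component, and its solution as in
  \<open>weak_ode_regularity\<close>: \<open>V\<close> is the \<open>y\<close>-derivative of \<open>cv 0 0 u1\<close>. No \<open>y\<close>-derivative of \<open>u2\<close> is needed,
  as it is \<open>- cv 1 0 u1\<close> by incompressibility.\<close>

definition "H2 w = cv 1 0 u2 w + cv 0 0 P w"
definition "H1 w = - cv 0 1 u1 w + cv 2 0 u1 w - cv 1 0 D w"
definition "H0 w = - cv 1 1 u2 w + cv 3 0 u2 w - cv 2 0 P w"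
definition "G w = - cv 0 1 u2 w + cv 2 0 u2 w - cv 1 0 P w"
definition "A w = 3 * cv 0 0 u1 w - 2 * H2 w + H1 w"
definition "B w = - cv 0 0 u1 w + H2 w - H1 w + H0 w"
definition "R = dconv (0, 0, 1 :: real) exp_kernel"
definition "V w = indicator {0<..} (snd (snd w)) * (H2 w - 2 * cv 0 0 u1 w + R A w + R (R B) w)"
definition "N w = cv 0 0 u1 w - R A w - R (R B) w - R B w"

lemma slicewise_H: "slicewise H2" "slicewise H1" "slicewise H0" "slicewise G" "slicewise A" "slicewise B"
proof -
  show 2: "slicewise H2" and 1: "slicewise H1" and 0: "slicewise H0" and "slicewise G"
    unfolding H2_def[abs_def] H1_def[abs_def] H0_def[abs_def] G_def[abs_def]
    by (intro slicewise_add slicewise_diff slicewise_uminus slicewise_cv slicewise_u slicewise_PD)+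
  show "slicewise A" "slicewise B"
    unfolding A_def[abs_def] B_def[abs_def]
    by (intro slicewise_add slicewise_diff slicewise_uminus slicewise_cmult slicewise_cv slicewise_u 0 1 2)+
qed

lemma slicewise_R: "slicewise f \<Longrightarrow> slicewise (R f)"
  unfolding R_def by (intro slicewise_dconv exp_kernel)

lemma slicewise_VN: "slicewise V" "slicewise N"
proof -
  show "slicewise N"
    unfolding N_def[abs_def] by (intro slicewise_diff slicewise_cv slicewise_u slicewise_R slicewise_H)
  have s: "slicewise (\<lambda>w. H2 w - 2 * cv 0 0 u1 w + R A w + R (R B) w)"
    by (intro slicewise_add slicewise_diff slicewise_cmult slicewise_cv slicewise_u slicewise_R slicewise_H)
  show "slicewise V"
    unfolding V_def[abs_def] by (rule slicewise_bounded_times[OF s, of _ 1]) (auto simp: indicator_def)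
qed

lemma H_eq_0: "y \<le> 0 \<Longrightarrow> H2 (t, x, y) = 0" "y \<le> 0 \<Longrightarrow> H1 (t, x, y) = 0" "y \<le> 0 \<Longrightarrow> H0 (t, x, y) = 0"
  using cv_eq_0[of u1 y] cv_eq_0[of u2 y] cv_eq_0[of P y] cv_eq_0[of D y] u_eq_0 PD_eq_0
  by (auto simp: H2_def H1_def H0_def)

lemma weak_ode:
  assumes s: "s < 0" and b: "test_fun b" "\<And>x. (b has_real_derivative b1 x) (at x)"
      "\<And>x. (b1 has_real_derivative b2 x) (at x)" "\<And>x. (b2 has_real_derivative b3 x) (at x)" "b 0 = 0" "b1 0 = 0"
  shows "(LBINT y. cv 0 0 u1 (s, z, y) * b3 y + H2 (s, z, y) * b2 y + H1 (s, z, y) * b1 y + H0 (s, z, y) * b y) = 0"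
proof -
  define T where "T k l f g = (\<lambda>(t, x, y). f (t, x, y) * (d\<rho> k (z - x) * d\<rho> l (s - t) * g y))"
    for k l and f :: "real \<times> real \<times> real \<Rightarrow> real" and g :: "real \<Rightarrow> real"
  have db: "deriv b = b1" "deriv b1 = b2" "deriv b2 = b3"
    using DERIV_imp_deriv[OF b(2)] DERIV_imp_deriv[OF b(3)] DERIV_imp_deriv[OF b(4)] by (simp_all add: fun_eq_iff)
  have tb: "test_fun b1" "test_fun b2" "test_fun b3"
    using test_fun_deriv b(1) db by metis+
  have T: "integrable lborel (T k l f g)" "(LBINT w. T k l f g w) = (LBINT y. cv k l f (s, z, y) * g y)"
    "integrable lborel (\<lambda>y. cv k l f (s, z, y) * g y)" if f: "slicewise f" and g: "test_fun g" for k l f g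
  proof -
    obtain K where K: "\<And>w. \<bar>f w\<bar> \<le> K" using slicewise_bounded[OF f] by metis
    note t = integral_tensor_dconv[OF slicewiseD(1)[OF f] K d\<rho>_integrable[of k] d\<rho>_integrable[of l] test_fun_integrable[OF g], where z = z and s = s]
    show "integrable lborel (T k l f g)" "(LBINT w. T k l f g w) = (LBINT y. cv k l f (s, z, y) * g y)"
      "integrable lborel (\<lambda>y. cv k l f (s, z, y) * g y)"
      using t by (simp_all add: T_def cv_def)
  qed
  have da: "((\<lambda>x. d\<rho> k (z + (-1) * x)) has_real_derivative (-1) * d\<rho> (Suc k) (z + (-1) * x)) (at x)" for k z x
    by (rule DERIV_affine[OF d\<rho>_DERIV])
  \<comment> \<open>The test factors are \<rho>(z - x) and \<rho>(s - t). Each derivative of a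
    reflected kernel contributes a factor -1, which explains the signs in \<open>H2\<close>,
    \<open>H1\<close> and \<open>H0\<close>.\<close>
  have "(LBINT (t, x, y). u1 (t, x, y) * (d\<rho> 0 (z + (-1) * x) * ((-1) * d\<rho> 1 (s + (-1) * t)) * b1 y
          + d\<rho> 2 (z + (-1) * x) * d\<rho> 0 (s + (-1) * t) * b1 y + d\<rho> 0 (z + (-1) * x) * d\<rho> 0 (s + (-1) * t) * b3 y)
        - u2 (t, x, y) * (((-1) * d\<rho> 1 (z + (-1) * x)) * ((-1) * d\<rho> 1 (s + (-1) * t)) * b y
          + ((-1) * d\<rho> 3 (z + (-1) * x)) * d\<rho> 0 (s + (-1) * t) * b y + ((-1) * d\<rho> 1 (z + (-1) * x)) * d\<rho> 0 (s + (-1) * t) * b2 y)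
        + ((u1 (t, x, y))\<^sup>2 - (u2 (t, x, y))\<^sup>2) * (((-1) * d\<rho> 1 (z + (-1) * x)) * d\<rho> 0 (s + (-1) * t) * b1 y)
        + u1 (t, x, y) * u2 (t, x, y) * (d\<rho> 0 (z + (-1) * x) * d\<rho> 0 (s + (-1) * t) * b2 y - d\<rho> 2 (z + (-1) * x) * d\<rho> 0 (s + (-1) * t) * b y)) = 0"
  proof (rule weak_momentum)
    show "test_fun (\<lambda>x. d\<rho> 0 (z + (-1) * x))" "test_fun (\<lambda>t. d\<rho> 0 (s + (-1) * t))"
      by (rule test_fun_affine[OF test_d\<rho>]; simp)+
    \<comment> \<open>The kernel vanishes below \<open>\<delta>\<close>, so the time factor vanishes
      for t > s - \<delta>; half of the gap is enough to have it vanish from a negative time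
      on.\<close>
    show "s - \<delta> / 2 < 0" using s \<delta> by simp
    show "d\<rho> 0 (s + (-1) * t) = 0" if "s - \<delta> / 2 \<le> t" for t
      using that \<delta> by (intro d\<rho>_eq_0) (simp add: field_simps)
    show "((\<lambda>x. d\<rho> 0 (z + (-1) * x)) has_real_derivative (-1) * d\<rho> 1 (z + (-1) * x)) (at x)" for x
      using da[of 0 z x] by simp
    show "((\<lambda>t. d\<rho> 0 (s + (-1) * t)) has_real_derivative (-1) * d\<rho> 1 (s + (-1) * t)) (at t)" for t
      using da[of 0 s t] by simp
    show "((\<lambda>x. (-1) * d\<rho> 1 (z + (-1) * x)) has_real_derivative d\<rho> 2 (z + (-1) * x)) (at x)" for x
      using DERIV_cmult[OF da[of 1 z x], of "-1"] by (simp add: numeral_2_eq_2)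
    show "((\<lambda>x. d\<rho> 2 (z + (-1) * x)) has_real_derivative (-1) * d\<rho> 3 (z + (-1) * x)) (at x)" for x
      using da[of 2 z x] by (simp add: numeral_3_eq_3 numeral_2_eq_2)
  qed (use b in auto)
  also have "(\<lambda>(t, x, y). u1 (t, x, y) * (d\<rho> 0 (z + (-1) * x) * ((-1) * d\<rho> 1 (s + (-1) * t)) * b1 y
          + d\<rho> 2 (z + (-1) * x) * d\<rho> 0 (s + (-1) * t) * b1 y + d\<rho> 0 (z + (-1) * x) * d\<rho> 0 (s + (-1) * t) * b3 y)
        - u2 (t, x, y) * (((-1) * d\<rho> 1 (z + (-1) * x)) * ((-1) * d\<rho> 1 (s + (-1) * t)) * b y
          + ((-1) * d\<rho> 3 (z + (-1) * x)) * d\<rho> 0 (s + (-1) * t) * b y + ((-1) * d\<rho> 1 (z + (-1) * x)) * d\<rho> 0 (s + (-1) * t) * b2 y)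
        + ((u1 (t, x, y))\<^sup>2 - (u2 (t, x, y))\<^sup>2) * (((-1) * d\<rho> 1 (z + (-1) * x)) * d\<rho> 0 (s + (-1) * t) * b1 y)
        + u1 (t, x, y) * u2 (t, x, y) * (d\<rho> 0 (z + (-1) * x) * d\<rho> 0 (s + (-1) * t) * b2 y - d\<rho> 2 (z + (-1) * x) * d\<rho> 0 (s + (-1) * t) * b y))
      = (\<lambda>w. - T 0 1 u1 b1 w + T 2 0 u1 b1 w + T 0 0 u1 b3 w - T 1 1 u2 b w + T 3 0 u2 b w + T 1 0 u2 b2 w
          - T 1 0 D b1 w + T 0 0 P b2 w - T 2 0 P b w)"
    unfolding T_def P_def D_def by (rule ext) (clarsimp simp: algebra_simps)
  finally have "(LBINT w. - T 0 1 u1 b1 w + T 2 0 u1 b1 w + T 0 0 u1 b3 w - T 1 1 u2 b w + T 3 0 u2 b w + T 1 0 u2 b2 w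
          - T 1 0 D b1 w + T 0 0 P b2 w - T 2 0 P b w) = 0" .
  then have e: "- (LBINT y. cv 0 1 u1 (s, z, y) * b1 y) + (LBINT y. cv 2 0 u1 (s, z, y) * b1 y) + (LBINT y. cv 0 0 u1 (s, z, y) * b3 y)
     - (LBINT y. cv 1 1 u2 (s, z, y) * b y) + (LBINT y. cv 3 0 u2 (s, z, y) * b y) + (LBINT y. cv 1 0 u2 (s, z, y) * b2 y)
     - (LBINT y. cv 1 0 D (s, z, y) * b1 y) + (LBINT y. cv 0 0 P (s, z, y) * b2 y) - (LBINT y. cv 2 0 P (s, z, y) * b y) = 0"
    using T(1,2)[OF slicewise_u(1) tb(1)] T(1,2)[OF slicewise_u(1) tb(3)] T(1,2)[OF slicewise_u(2) b(1)] T(1,2)[OF slicewise_u(2) tb(2)]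
      T(1,2)[OF slicewise_PD(2) tb(1)] T(1,2)[OF slicewise_PD(1) tb(2)] T(1,2)[OF slicewise_PD(1) b(1)] by simp
  have "(\<lambda>y. cv 0 0 u1 (s, z, y) * b3 y + H2 (s, z, y) * b2 y + H1 (s, z, y) * b1 y + H0 (s, z, y) * b y)
    = (\<lambda>y. - (cv 0 1 u1 (s, z, y) * b1 y) + cv 2 0 u1 (s, z, y) * b1 y + cv 0 0 u1 (s, z, y) * b3 y
     - cv 1 1 u2 (s, z, y) * b y + cv 3 0 u2 (s, z, y) * b y + cv 1 0 u2 (s, z, y) * b2 y
     - cv 1 0 D (s, z, y) * b1 y + cv 0 0 P (s, z, y) * b2 y - cv 2 0 P (s, z, y) * b y)"
    by (simp add: H2_def H1_def H0_def algebra_simps)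
  then show ?thesis
    using e T(3)[OF slicewise_u(1) tb(1)] T(3)[OF slicewise_u(1) tb(3)] T(3)[OF slicewise_u(2) b(1)] T(3)[OF slicewise_u(2) tb(2)]
      T(3)[OF slicewise_PD(2) tb(1)] T(3)[OF slicewise_PD(1) tb(2)] T(3)[OF slicewise_PD(1) b(1)] by simp
qed

lemma R_slice: "dconv 1 exp_kernel (\<lambda>y. f (s, z, y)) = (\<lambda>y. R f (s, z, y))"
  by (simp add: R_def dconv_def fun_eq_iff)

lemma slice_y_measurable: "slicewise f \<Longrightarrow> (\<lambda>y. f (s, z, y)) \<in> borel_measurable borel"
  using slicewiseD(1)[of f] by measurable

text \<open>\<open>weak_ode_regularity\<close> on each vertical line, for every abscissa
  \<open>z\<close>. Restricted to such a line, \<open>R\<close> is the resolvent in one variable, so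
  the solution formulas of that lemma turn into \<open>V\<close> and \<open>N\<close>.\<close>

lemma y_primitives:
  assumes s: "s < 0"
  shows "has_y_primitive UNIV (\<lambda>p. cv 0 0 u1 (s, p)) (\<lambda>p. V (s, p))"
    and "has_y_primitive {0<..} (\<lambda>p. V (s, p) - H2 (s, p)) (\<lambda>p. N (s, p) - H1 (s, p))"
    and "has_y_primitive {0<..} (\<lambda>p. N (s, p)) (\<lambda>p. H0 (s, p))"
proof -
  obtain KU where KU: "\<And>w. \<bar>cv 0 0 u1 w\<bar> \<le> KU" "0 \<le> KU" using slicewise_bounded[OF slicewise_cv[OF slicewise_u(1)]] by metis
  obtain K2 where K2: "\<And>w. \<bar>H2 w\<bar> \<le> K2" "0 \<le> K2" using slicewise_bounded[OF slicewise_H(1)] by metis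
  obtain K1 where K1: "\<And>w. \<bar>H1 w\<bar> \<le> K1" "0 \<le> K1" using slicewise_bounded[OF slicewise_H(2)] by metis
  obtain K0 where K0: "\<And>w. \<bar>H0 w\<bar> \<le> K0" "0 \<le> K0" using slicewise_bounded[OF slicewise_H(3)] by metis
  define K where "K = KU + K2 + K1 + K0"
  have K: "\<bar>cv 0 0 u1 w\<bar> \<le> K" "\<bar>H2 w\<bar> \<le> K" "\<bar>H1 w\<bar> \<le> K" "\<bar>H0 w\<bar> \<le> K" for w
    unfolding K_def using KU(1)[of w] K2(1)[of w] K1(1)[of w] K0(1)[of w] KU(2) K2(2) K1(2) K0(2) by linarith+
  have U0: "cv 0 0 u1 (s, z, y) = 0" if "y \<le> 0" for z y
    by (rule cv_u_eq_0(1)[OF that])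
  have *: "has_primitive_on UNIV (\<lambda>y. cv 0 0 u1 (s, z, y)) (\<lambda>y. V (s, z, y)) \<and>
     has_primitive_on {0<..} (\<lambda>y. V (s, z, y) - H2 (s, z, y)) (\<lambda>y. N (s, z, y) - H1 (s, z, y)) \<and>
     has_primitive_on {0<..} (\<lambda>y. N (s, z, y)) (\<lambda>y. H0 (s, z, y))" for z
  proof -
    define U' H2' H1' H0' where "U' y = cv 0 0 u1 (s, z, y)" and "H2' y = H2 (s, z, y)" and "H1' y = H1 (s, z, y)"
      and "H0' y = H0 (s, z, y)" for y
    have eqA: "(\<lambda>y. 3 * U' y - 2 * H2' y + H1' y) = (\<lambda>y. A (s, z, y))"
      and eqB: "(\<lambda>y. - U' y + H2' y - H1' y + H0' y) = (\<lambda>y. B (s, z, y))"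
      by (simp_all add: A_def B_def U'_def H2'_def H1'_def H0'_def)
    have eqV: "(\<lambda>y. indicator {0<..} y * (H2' y - 2 * U' y + R A (s, z, y) + R (R B) (s, z, y))) = (\<lambda>y. V (s, z, y))"
      and eqN: "(\<lambda>y. U' y - R A (s, z, y) - R (R B) (s, z, y) - R B (s, z, y)) = (\<lambda>y. N (s, z, y))"
      by (simp_all add: V_def N_def U'_def H2'_def)
    have V1: "indicator {0<..} y * (H2' y - 2 * U' y + R A (s, z, y) + R (R B) (s, z, y)) = V (s, z, y)"
      and N1: "U' y - R A (s, z, y) - R (R B) (s, z, y) - R B (s, z, y) = N (s, z, y)" for y
      by (simp_all add: V_def N_def U'_def H2'_def)
    have m: "U' \<in> borel_measurable borel" "H2' \<in> borel_measurable borel" "H1' \<in> borel_measurable borel" "H0' \<in> borel_measurable borel"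
      unfolding U'_def[abs_def] H2'_def[abs_def] H1'_def[abs_def] H0'_def[abs_def]
      by (rule slice_y_measurable slicewise_cv slicewise_u slicewise_H)+
    have bd: "\<bar>U' y\<bar> \<le> K" "\<bar>H2' y\<bar> \<le> K" "\<bar>H1' y\<bar> \<le> K" "\<bar>H0' y\<bar> \<le> K" for y
      unfolding U'_def H2'_def H1'_def H0'_def by (rule K)+
    have z: "U' y = 0" "H2' y = 0" "H1' y = 0" "H0' y = 0" if "y \<le> 0" for y
      unfolding U'_def H2'_def H1'_def H0'_def by (rule U0[OF that] H_eq_0[OF that])+
    have weak: "(LBINT y. U' y * b3 y + H2' y * b2 y + H1' y * b1 y + H0' y * b y) = 0"
      if "test_fun b" "\<And>x. (b has_real_derivative b1 x) (at x)" "\<And>x. (b1 has_real_derivative b2 x) (at x)"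
        "\<And>x. (b2 has_real_derivative b3 x) (at x)" "b 0 = 0" "b1 0 = 0" for b b1 b2 b3
      unfolding U'_def H2'_def H1'_def H0'_def by (rule weak_ode[OF s that])
    have reg1: "has_primitive_on UNIV U' (\<lambda>y. indicator {0<..} y * (H2' y - 2 * U' y + dconv 1 exp_kernel (\<lambda>y. 3 * U' y - 2 * H2' y + H1' y) y + dconv 1 exp_kernel (dconv 1 exp_kernel (\<lambda>y. - U' y + H2' y - H1' y + H0' y)) y))"
      by (rule weak_ode_regularity(1)[where U = U' and ?H2.0 = H2' and ?H1.0 = H1' and ?H0.0 = H0' and K = K]) (assumption | rule m bd z | (rule weak; assumption))+
    have reg2: "has_primitive_on {0<..} (\<lambda>y. (indicator {0<..} y * (H2' y - 2 * U' y + dconv 1 exp_kernel (\<lambda>y. 3 * U' y - 2 * H2' y + H1' y) y + dconv 1 exp_kernel (dconv 1 exp_kernel (\<lambda>y. - U' y + H2' y - H1' y + H0' y)) y)) - H2' y) (\<lambda>y. (U' y - dconv 1 exp_kernel (\<lambda>y. 3 * U' y - 2 * H2' y + H1' y) y - dconv 1 exp_kernel (dconv 1 exp_kernel (\<lambda>y. - U' y + H2' y - H1' y + H0' y)) y - dconv 1 exp_kernel (\<lambda>y. - U' y + H2' y - H1' y + H0' y) y) - H1' y)"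
      by (rule weak_ode_regularity(2)[where U = U' and ?H2.0 = H2' and ?H1.0 = H1' and ?H0.0 = H0' and K = K]) (assumption | rule m bd z | (rule weak; assumption))+
    have reg3: "has_primitive_on {0<..} (\<lambda>y. (U' y - dconv 1 exp_kernel (\<lambda>y. 3 * U' y - 2 * H2' y + H1' y) y - dconv 1 exp_kernel (dconv 1 exp_kernel (\<lambda>y. - U' y + H2' y - H1' y + H0' y)) y - dconv 1 exp_kernel (\<lambda>y. - U' y + H2' y - H1' y + H0' y) y)) H0'"
      by (rule weak_ode_regularity(3)[where U = U' and ?H2.0 = H2' and ?H1.0 = H1' and ?H0.0 = H0' and K = K]) (assumption | rule m bd z | (rule weak; assumption))+
    note reg = reg1[unfolded eqA eqB R_slice[of A s z] R_slice[of B s z] R_slice[of "R B" s z] eqV]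
      reg2[unfolded eqA eqB R_slice[of A s z] R_slice[of B s z] R_slice[of "R B" s z] V1 N1]
      reg3[unfolded eqA eqB R_slice[of A s z] R_slice[of B s z] R_slice[of "R B" s z] eqN]
    show ?thesis using reg unfolding U'_def[abs_def] H2'_def H1'_def H0'_def[abs_def] by simp
  qed
  show "has_y_primitive UNIV (\<lambda>p. cv 0 0 u1 (s, p)) (\<lambda>p. V (s, p))"
    "has_y_primitive {0<..} (\<lambda>p. V (s, p) - H2 (s, p)) (\<lambda>p. N (s, p) - H1 (s, p))"
    "has_y_primitive {0<..} (\<lambda>p. N (s, p)) (\<lambda>p. H0 (s, p))"
    using * unfolding has_y_primitive_def by simp_all
qed

text \<open>The divergence equation admits test functions of \<open>y\<close> that do not vanish at
  the wall, which is what \<open>weak_primitive\<close> asks for; it yields the equation together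
  with the vanishing of the normal component at y = 0.\<close>

lemma cv_u2_y_primitive:
  assumes s: "s < 0"
  shows "has_y_primitive UNIV (\<lambda>p. cv k l u2 (s, p)) (\<lambda>p. - cv (Suc k) l u1 (s, p))"
  unfolding has_y_primitive_def
proof
  fix z
  obtain K2 where K2: "\<And>w. \<bar>cv k l u2 w\<bar> \<le> K2" "0 \<le> K2" using slicewise_bounded[OF slicewise_cv[OF slicewise_u(2)]] by metis
  obtain K1 where K1: "\<And>w. \<bar>cv (Suc k) l u1 w\<bar> \<le> K1" "0 \<le> K1" using slicewise_bounded[OF slicewise_cv[OF slicewise_u(1)]] by metis
  have weak: "(LBINT y. cv k l u2 (s, z, y) * deriv g y + (- cv (Suc k) l u1 (s, z, y)) * g y) = 0" if g: "test_fun g" for g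
  proof -
    define Q2 where "Q2 = (\<lambda>(t, x, y). u2 (t, x, y) * (d\<rho> k (z - x) * d\<rho> l (s - t) * deriv g y))"
    define Q1 where "Q1 = (\<lambda>(t, x, y). u1 (t, x, y) * (d\<rho> (Suc k) (z - x) * d\<rho> l (s - t) * g y))"
    note q2 = integral_tensor_dconv[OF slicewiseD(1)[OF slicewise_u(2)] u_le_1(2) d\<rho>_integrable[of k] d\<rho>_integrable[of l] test_fun_integrable[OF test_fun_deriv[OF g]],
        where z = z and s = s, folded Q2_def cv_def]
    note q1 = integral_tensor_dconv[OF slicewiseD(1)[OF slicewise_u(1)] u_le_1(1) d\<rho>_integrable[of "Suc k"] d\<rho>_integrable[of l] test_fun_integrable[OF g],
        where z = z and s = s, folded Q1_def cv_def]
    have da: "deriv (\<lambda>x. d\<rho> k (z + (-1) * x)) = (\<lambda>x. (-1) * d\<rho> (Suc k) (z + (-1) * x))"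
      using DERIV_imp_deriv[OF DERIV_affine[OF d\<rho>_DERIV[of k], of z "-1"]] by (simp add: fun_eq_iff)
    have "(LBINT (t, x, y). u1 (t, x, y) * (deriv (\<lambda>x. d\<rho> k (z + (-1) * x)) x * d\<rho> l (s + (-1) * t) * g y)
        + u2 (t, x, y) * (d\<rho> k (z + (-1) * x) * d\<rho> l (s + (-1) * t) * deriv g y)) = 0"
    proof (rule weak_divergence)
      show "test_fun (\<lambda>x. d\<rho> k (z + (-1) * x))" "test_fun (\<lambda>t. d\<rho> l (s + (-1) * t))"
        by (rule test_fun_affine[OF test_d\<rho>]; simp)+
      show "s - \<delta> / 2 < 0" using s \<delta> by simp
      show "d\<rho> l (s + (-1) * t) = 0" if "s - \<delta> / 2 \<le> t" for t
        using that \<delta> by (intro d\<rho>_eq_0) (simp add: field_simps)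
    qed (rule g)
    also have "(\<lambda>(t, x, y). u1 (t, x, y) * (deriv (\<lambda>x. d\<rho> k (z + (-1) * x)) x * d\<rho> l (s + (-1) * t) * g y)
        + u2 (t, x, y) * (d\<rho> k (z + (-1) * x) * d\<rho> l (s + (-1) * t) * deriv g y))
        = (\<lambda>w. Q2 w - Q1 w)"
      unfolding da Q2_def Q1_def by (rule ext) (clarsimp simp: algebra_simps)
    finally have "(LBINT w. Q2 w - Q1 w) = 0" .
    then have "(LBINT w. Q2 w) - (LBINT w. Q1 w) = 0" using q2(1) q1(1) by simp
    then show ?thesis using q2(2,3) q1(2,3) by simp
  qed
  obtain W where W: "primitive W (\<lambda>y. - cv (Suc k) l u1 (s, z, y))" "AE y in lborel. cv k l u2 (s, z, y) = W y"
  proof (rule weak_primitive[OF slice_y_measurable[OF slicewise_cv[OF slicewise_u(2)]] _ _ _ _ _ weak])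
    show "\<bar>cv k l u2 (s, z, y)\<bar> \<le> K1 + K2" for y using K2(1)[of "(s, z, y)"] K1(2) by linarith
    show "\<bar>- cv (Suc k) l u1 (s, z, y)\<bar> \<le> K1 + K2" for y using K1(1)[of "(s, z, y)"] K2(2) by linarith
    show "(\<lambda>y. - cv (Suc k) l u1 (s, z, y)) \<in> borel_measurable borel"
      using slice_y_measurable[OF slicewise_cv[OF slicewise_u(1)], of "Suc k" l s z] by measurable
    show "cv k l u2 (s, z, y) = 0" if "y \<le> 0" for y by (rule cv_u_eq_0(2)[OF that])
    show "- cv (Suc k) l u1 (s, z, y) = 0" if "y \<le> 0" for y using cv_u_eq_0(1)[OF that] by simp
  qed (assumption | rule that)+
  show "has_primitive_on UNIV (\<lambda>y. cv k l u2 (s, z, y)) (\<lambda>y. - cv (Suc k) l u1 (s, z, y))"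
    unfolding has_primitive_on_def
  proof (intro exI conjI, rule W(1))
    show "AE y in lborel. y \<in> UNIV \<longrightarrow> W y = cv k l u2 (s, z, y) \<and> - cv (Suc k) l u1 (s, z, y) = - cv (Suc k) l u1 (s, z, y)"
      using W(2) by eventually_elim simp
  qed
qed

end

section \<open>The flow at time \<open>s\<close> tested with the flow at time
  \<open>\<sigma>\<close>, and cancellation of the convective term\<close>

lemma has_primitive_on_mono: "has_primitive_on S f g \<Longrightarrow> T \<subseteq> S \<Longrightarrow> has_primitive_on T f g"
  unfolding has_primitive_on_def by (elim exE conjE, intro exI conjI, assumption) (auto elim: eventually_mono)

lemma has_primitive_on_add:
  assumes "has_primitive_on S f f'" "has_primitive_on S g g'"
  shows "has_primitive_on S (\<lambda>x. f x + g x) (\<lambda>x. f' x + g' x)"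
proof -
  obtain F F' where F: "primitive F F'" "AE y in lborel. y \<in> S \<longrightarrow> F y = f y \<and> F' y = f' y"
    using assms(1) by (auto simp: has_primitive_on_def)
  obtain G G' where G: "primitive G G'" "AE y in lborel. y \<in> S \<longrightarrow> G y = g y \<and> G' y = g' y"
    using assms(2) by (auto simp: has_primitive_on_def)
  show ?thesis
    unfolding has_primitive_on_def
  proof (intro exI conjI, rule primitive_add[OF F(1) G(1)])
    show "AE y in lborel. y \<in> S \<longrightarrow> F y + G y = f y + g y \<and> F' y + G' y = f' y + g' y"
      using F(2) G(2) by eventually_elim auto
  qed
qed

lemma has_primitive_on_mult:
  assumes "has_primitive_on S f f'" "has_primitive_on S g g'"
  shows "has_primitive_on S (\<lambda>x. f x * g x) (\<lambda>x. f' x * g x + f x * g' x)"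
proof -
  obtain F F' where F: "primitive F F'" "AE y in lborel. y \<in> S \<longrightarrow> F y = f y \<and> F' y = f' y"
    using assms(1) by (auto simp: has_primitive_on_def)
  obtain G G' where G: "primitive G G'" "AE y in lborel. y \<in> S \<longrightarrow> G y = g y \<and> G' y = g' y"
    using assms(2) by (auto simp: has_primitive_on_def)
  show ?thesis
    unfolding has_primitive_on_def
  proof (intro exI conjI, rule primitive_mult[OF F(1) G(1)])
    show "AE y in lborel. y \<in> S \<longrightarrow> F y * G y = f y * g y \<and> F' y * G y + F y * G' y = f' y * g y + f y * g' y"
      using F(2) G(2) by eventually_elim auto
  qed
qed

context mollified_flow
begin

lemma V_eq_0: "y \<le> 0 \<Longrightarrow> V (t, x, y) = 0"
  by (simp add: V_def)

lemma sq_cv: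
  "sq_integrable lborel (\<lambda>p. cv k l u1 (s, p))" "sq_integrable lborel (\<lambda>p. cv k l u2 (s, p))"
  "sq_integrable lborel (\<lambda>p. cv k l P (s, p))" "sq_integrable lborel (\<lambda>p. cv k l D (s, p))"
  "sq_integrable lborel (\<lambda>p. V (s, p))" "sq_integrable lborel (\<lambda>p. N (s, p))" "sq_integrable lborel (\<lambda>p. G (s, p))"
  "sq_integrable lborel (\<lambda>p. H2 (s, p))" "sq_integrable lborel (\<lambda>p. H1 (s, p))" "sq_integrable lborel (\<lambda>p. H0 (s, p))"
  by (rule slicewiseD(2), rule slicewise_cv slicewise_VN slicewise_H, (rule slicewise_u slicewise_PD)?)+

text \<open>By \<open>y_primitives\<close> the \<open>y\<close>-derivative of \<open>N\<close> is
  \<open>H0\<close> as well, so (N, G) is curl free. Formally it is the gradient of q +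
  \<open>cv 1 0 u1\<close> + r, where q and r are the mollifications of the pressure and of the
  square of \<open>u2\<close>.\<close>

lemma G_x_primitive: "has_x_primitive (\<lambda>p. G (s, p)) (\<lambda>p. H0 (s, p))"
  unfolding has_x_primitive_def
proof
  fix y
  have x: "primitive (\<lambda>x. cv k l f (s, x, y)) (\<lambda>x. cv (Suc k) l f (s, x, y))" if "slicewise f" for k l f
    using cv_x_primitive[OF that, of k l s] by (simp add: has_x_primitive_def)
  have "primitive (\<lambda>x. - cv 0 1 u2 (s, x, y) + cv 2 0 u2 (s, x, y) - cv 1 0 P (s, x, y))
     (\<lambda>x. - cv (Suc 0) 1 u2 (s, x, y) + cv (Suc 2) 0 u2 (s, x, y) - cv (Suc 1) 0 P (s, x, y))"
    by (intro primitive_diff primitive_add primitive_uminus x slicewise_u slicewise_PD)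
  then show "primitive (\<lambda>x. G (s, x, y)) (\<lambda>x. H0 (s, x, y))"
    by (simp add: G_def H0_def numeral_2_eq_2 numeral_3_eq_3)
qed

text \<open>The equation at time \<open>s\<close> is paired with the flow at time
  \<open>\<sigma>\<close>, of which one needs the gradient, incompressibility and the vanishing at
  the wall. As the \<open>y\<close>-derivative of the second component is
  \<open>- cv 1 0 u1\<close>, the Dirichlet form carries the coefficient 2 on
  \<open>cv 1 0 u1\<close>, and the flux enters through \<open>P\<close> and \<open>D\<close>
  only.\<close>

lemma bilinear_identity:
  assumes s: "s < 0" and \<sigma>: "\<sigma> < 0"
  shows "(LBINT p. cv 0 1 u1 (s, p) * cv 0 0 u1 (\<sigma>, p)) + (LBINT p. cv 0 1 u2 (s, p) * cv 0 0 u2 (\<sigma>, p))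
    = - (LBINT p. V (s, p) * V (\<sigma>, p)) - 2 * (LBINT p. cv 1 0 u1 (s, p) * cv 1 0 u1 (\<sigma>, p))
      - (LBINT p. cv 1 0 u2 (s, p) * cv 1 0 u2 (\<sigma>, p))
      + (LBINT p. cv 0 0 P (s, p) * V (\<sigma>, p)) + (LBINT p. cv 0 0 P (s, p) * cv 1 0 u2 (\<sigma>, p))
      + (LBINT p. cv 0 0 D (s, p) * cv 1 0 u1 (\<sigma>, p))"
proof -
  note i = sq_integrable_times
  have x: "(LBINT p. cv (Suc k) l f (s, p) * cv 0 0 g (\<sigma>, p)) = - (LBINT p. cv k l f (s, p) * cv (Suc 0) 0 g (\<sigma>, p))"
    if "slicewise f" "slicewise g" for k l f g
    by (rule by_parts_x) (use that slicewise_cv slicewiseD(2) cv_x_primitive in auto)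
  note sq = sq_cv
  \<comment> \<open>The viscous term in \<open>y\<close>. The equation provides a derivative of the
    combination \<open>V - H2\<close>, so this combination is what gets integrated by parts.\<close>
  have e1: "(LBINT p. V (\<sigma>, p) * (V (s, p) - H2 (s, p))) = - (LBINT p. cv 0 0 u1 (\<sigma>, p) * (N (s, p) - H1 (s, p)))"
    by (rule by_parts_y[OF _ _ y_primitives(1)[OF \<sigma>] _ _ _ _ y_primitives(2)[OF s]])
      (use sq sq_integrable_diff[OF sq(5) sq(8)] sq_integrable_diff[OF sq(6) sq(9)] cv_u_eq_0 V_eq_0 in auto)
  have e2: "(LBINT p. V (\<sigma>, p) * cv 1 0 u2 (s, p)) = - (LBINT p. cv 0 0 u1 (\<sigma>, p) * (- cv (Suc 1) 0 u1 (s, p)))"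
  proof (rule by_parts_y[OF _ _ y_primitives(1)[OF \<sigma>]])
    show "has_y_primitive {0<..} (\<lambda>p. cv 1 0 u2 (s, p)) (\<lambda>p. - cv (Suc 1) 0 u1 (s, p))"
      using cv_u2_y_primitive[OF s] unfolding has_y_primitive_def by (auto intro: has_primitive_on_mono)
  qed (use sq sq_integrable_uminus[OF sq(1)] cv_u_eq_0 V_eq_0 in auto)
  \<comment> \<open>The curl free field (N, G), which contains the pressure gradient, drops
    out.\<close>
  have e3: "(LBINT p. N (s, p) * cv 0 0 u1 (\<sigma>, p) + G (s, p) * cv 0 0 u2 (\<sigma>, p)) = 0"
  proof -
    obtain K where K: "\<And>w. \<bar>cv 0 0 u1 w\<bar> \<le> K" using slicewise_bounded[OF slicewise_cv[OF slicewise_u(1)]] by metis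
    obtain L where L: "\<And>w. \<bar>cv (Suc 0) 0 u1 w\<bar> \<le> L" using slicewise_bounded[OF slicewise_cv[OF slicewise_u(1)]] by metis
    show ?thesis
    proof (rule Helmholtz_orthogonality[where K = "max K L" and H = "\<lambda>p. H0 (s, p)" and U1x = "\<lambda>p. cv (Suc 0) 0 u1 (\<sigma>, p)"])
      show "\<bar>cv 0 0 u1 (\<sigma>, p)\<bar> \<le> max K L" "\<bar>cv (Suc 0) 0 u1 (\<sigma>, p)\<bar> \<le> max K L" for p
        using K L by (auto simp: le_max_iff_disj)
      show "(\<lambda>p. cv (Suc 0) 0 u1 (\<sigma>, p)) \<in> borel_measurable borel"
        using sq_integrableD(1)[OF sq(1)] by simp
      show "has_x_primitive (\<lambda>p. cv 0 0 u1 (\<sigma>, p)) (\<lambda>p. cv (Suc 0) 0 u1 (\<sigma>, p))"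
        by (rule cv_x_primitive[OF slicewise_u(1)])
      show "has_y_primitive UNIV (\<lambda>p. cv 0 0 u2 (\<sigma>, p)) (\<lambda>p. - cv (Suc 0) 0 u1 (\<sigma>, p))"
        by (rule cv_u2_y_primitive[OF \<sigma>])
      show "has_y_primitive {0<..} (\<lambda>p. N (s, p)) (\<lambda>p. H0 (s, p))" by (rule y_primitives(3)[OF s])
      show "has_x_primitive (\<lambda>p. G (s, p)) (\<lambda>p. H0 (s, p))" by (rule G_x_primitive)
    qed (use sq cv_u_eq_0 in auto)
  qed
  define I where "I f g = (LBINT p. f (s, p) * g (\<sigma>, p))" for f g :: "real \<times> real \<times> real \<Rightarrow> real"
  have I_comm: "(LBINT p. g (\<sigma>, p) * f (s, p)) = I f g" for f g
    by (simp add: I_def mult.commute)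
  have E1: "I V V - I H2 V = - I N (cv 0 0 u1) + I H1 (cv 0 0 u1)"
    using e1 i[OF sq(5)[of \<sigma>] sq(5)[of s]] i[OF sq(5)[of \<sigma>] sq(8)[of s]] i[OF sq(1)[of 0 0 \<sigma>] sq(6)[of s]] i[OF sq(1)[of 0 0 \<sigma>] sq(9)[of s]]
    by (simp add: right_diff_distrib I_comm)
  have E2: "I (cv 1 0 u2) V = I (cv 2 0 u1) (cv 0 0 u1)"
    using e2 by (simp add: I_comm numeral_2_eq_2)
  have E3: "I N (cv 0 0 u1) + I G (cv 0 0 u2) = 0"
    using e3 i[OF sq(6)[of s] sq(1)[of 0 0 \<sigma>]] i[OF sq(7)[of s] sq(2)[of 0 0 \<sigma>]] by (simp add: I_def)
  have E4: "I H2 V = I (cv 1 0 u2) V + I (cv 0 0 P) V"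
    using i[OF sq(2)[of 1 0 s] sq(5)[of \<sigma>]] i[OF sq(3)[of 0 0 s] sq(5)[of \<sigma>]]
    by (simp add: I_def H2_def distrib_right)
  have E5: "I H1 (cv 0 0 u1) = - I (cv 0 1 u1) (cv 0 0 u1) + I (cv 2 0 u1) (cv 0 0 u1) - I (cv 1 0 D) (cv 0 0 u1)"
    using i[OF sq(1)[of 0 1 s] sq(1)[of 0 0 \<sigma>]] i[OF sq(1)[of 2 0 s] sq(1)[of 0 0 \<sigma>]] i[OF sq(4)[of 1 0 s] sq(1)[of 0 0 \<sigma>]]
    by (simp add: I_def H1_def distrib_right left_diff_distrib)
  have E6: "I G (cv 0 0 u2) = - I (cv 0 1 u2) (cv 0 0 u2) + I (cv 2 0 u2) (cv 0 0 u2) - I (cv 1 0 P) (cv 0 0 u2)"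
    using i[OF sq(2)[of 0 1 s] sq(2)[of 0 0 \<sigma>]] i[OF sq(2)[of 2 0 s] sq(2)[of 0 0 \<sigma>]] i[OF sq(3)[of 1 0 s] sq(2)[of 0 0 \<sigma>]]
    by (simp add: I_def G_def distrib_right left_diff_distrib)
  have E7: "I (cv 2 0 u1) (cv 0 0 u1) = - I (cv 1 0 u1) (cv 1 0 u1)" "I (cv 2 0 u2) (cv 0 0 u2) = - I (cv 1 0 u2) (cv 1 0 u2)"
    "I (cv 1 0 D) (cv 0 0 u1) = - I (cv 0 0 D) (cv 1 0 u1)" "I (cv 1 0 P) (cv 0 0 u2) = - I (cv 0 0 P) (cv 1 0 u2)"
    using x[OF slicewise_u(1) slicewise_u(1), of 1 0] x[OF slicewise_u(2) slicewise_u(2), of 1 0]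
      x[OF slicewise_PD(2) slicewise_u(1), of 0 0] x[OF slicewise_PD(1) slicewise_u(2), of 0 0]
    by (simp_all add: I_def numeral_2_eq_2)
  show ?thesis
    using E1 E2 E3 E4 E5 E6 E7 unfolding I_def[symmetric] by linarith
qed

text \<open>With \<open>Q\<close> the square of the speed the sum is half the integral of U \<cdot>
  \<nabla>Q, which vanishes because U is divergence free and zero at the wall. The products here are
  those of the mollified components, in contrast to the mollified products in
  \<open>bilinear_identity\<close>.\<close>

lemma trilinear_eq_0:
  assumes s: "s < 0"
  shows "(LBINT p. cv 0 0 u1 (s, p) * cv 0 0 u2 (s, p) * V (s, p)) + (LBINT p. cv 0 0 u1 (s, p) * cv 0 0 u2 (s, p) * cv 1 0 u2 (s, p))
    + (LBINT p. ((cv 0 0 u1 (s, p))\<^sup>2 - (cv 0 0 u2 (s, p))\<^sup>2) * cv 1 0 u1 (s, p)) = 0"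
proof -
  define a b where "a p = cv 0 0 u1 (s, p)" and "b p = cv 0 0 u2 (s, p)" for p
  define ax bx v where "ax p = cv 1 0 u1 (s, p)" and "bx p = cv 1 0 u2 (s, p)" and "v p = V (s, p)" for p
  have slw: "slicewise (cv 0 0 u1)" "slicewise (cv 0 0 u2)" "slicewise (cv 1 0 u1)" "slicewise (cv 1 0 u2)" "slicewise V"
    by (intro slicewise_cv slicewise_u slicewise_VN)+
  have sq: "sq_integrable lborel a" "sq_integrable lborel b" "sq_integrable lborel ax" "sq_integrable lborel bx" "sq_integrable lborel v"
    unfolding a_def[abs_def] b_def[abs_def] ax_def[abs_def] bx_def[abs_def] v_def[abs_def] by (rule slicewiseD(2), rule slw)+
  have sq2: "sq_integrable lborel (\<lambda>p. f (s, p) * g (s, p))" if "slicewise f" "slicewise g" for f g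
    using slicewiseD(2)[OF slicewise_times[OF that]] .
  have px: "has_x_primitive a ax" "has_x_primitive b bx"
    using cv_x_primitive[OF slicewise_u(1), of 0 0 s] cv_x_primitive[OF slicewise_u(2), of 0 0 s]
    by (simp_all add: a_def[abs_def] b_def[abs_def] ax_def[abs_def] bx_def[abs_def])
  have py: "has_y_primitive UNIV a v" "has_y_primitive UNIV b (\<lambda>p. - ax p)"
    using y_primitives(1)[OF s] cv_u2_y_primitive[OF s, of 0 0]
    by (simp_all add: a_def[abs_def] b_def[abs_def] ax_def[abs_def] v_def[abs_def])
  define Q where "Q p = a p * a p + b p * b p" for p
  define Qx where "Qx p = (ax p * a p + a p * ax p) + (bx p * b p + b p * bx p)" for p
  define Qy where "Qy p = (v p * a p + a p * v p) + ((- ax p) * b p + b p * (- ax p))" for p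
  have Qpx: "has_x_primitive Q Qx"
    unfolding has_x_primitive_def Q_def Qx_def
    by (intro allI primitive_add primitive_mult px[unfolded has_x_primitive_def, rule_format])
  have Qpy: "has_y_primitive {0<..} Q Qy"
    unfolding has_y_primitive_def
  proof
    fix x
    have "has_primitive_on UNIV (\<lambda>y. Q (x, y)) (\<lambda>y. Qy (x, y))"
      unfolding Q_def Qy_def
      by (intro has_primitive_on_add has_primitive_on_mult py[unfolded has_y_primitive_def, rule_format])
    then show "has_primitive_on {0<..} (\<lambda>y. Q (x, y)) (\<lambda>y. Qy (x, y))" by (rule has_primitive_on_mono) simp
  qed
  have sQ: "sq_integrable lborel Q" "sq_integrable lborel Qx" "sq_integrable lborel Qy"
  proof -
    have m: "sq_integrable lborel (\<lambda>p. f p * g p)" if "f \<in> {a, b}" "g \<in> {a, b, ax, bx, v, \<lambda>p. - ax p}" for f g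
    proof -
      have "slicewise (\<lambda>w. - cv 1 0 u1 w)" by (rule slicewise_uminus[OF slw(3)])
      then show ?thesis using that sq2 slw
        unfolding a_def[abs_def] b_def[abs_def] ax_def[abs_def] bx_def[abs_def] v_def[abs_def] by auto
    qed
    have m': "sq_integrable lborel (\<lambda>p. g p * f p)" if "f \<in> {a, b}" "g \<in> {a, b, ax, bx, v, \<lambda>p. - ax p}" for f g
      using m[OF that] by (simp add: mult.commute)
    show "sq_integrable lborel Q" unfolding Q_def[abs_def] by (intro sq_integrable_add m) auto
    show "sq_integrable lborel Qx" unfolding Qx_def[abs_def]
      by (intro sq_integrable_add m[of a ax] m'[of a ax] m[of b bx] m'[of b bx]) auto
    show "sq_integrable lborel Qy" unfolding Qy_def[abs_def]
      by (intro sq_integrable_add m[of a v] m'[of a v] m[of b "\<lambda>p. - ax p"] m'[of b "\<lambda>p. - ax p"]) auto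
  qed
  have ex: "(LBINT p. ax p * Q p) = - (LBINT p. a p * Qx p)"
    by (rule by_parts_x[OF sq(1) sq(3) px(1) sQ(1,2) Qpx])
  have ey: "(LBINT p. - ax p * Q p) = - (LBINT p. b p * Qy p)"
    by (rule by_parts_y[OF sq(2) sq_integrable_uminus[OF sq(3)] py(2) _ _ sQ(1,3) Qpy])
      (use cv_u_eq_0 in \<open>auto simp: b_def ax_def\<close>)
  have "(LBINT p. a p * Qx p) + (LBINT p. b p * Qy p) = 0" using ex ey by simp
  then have "(LBINT p. a p * Qx p + b p * Qy p) = 0"
    using sq_integrable_times[OF sq(1) sQ(2)] sq_integrable_times[OF sq(2) sQ(3)] by simp
  also have "(\<lambda>p. a p * Qx p + b p * Qy p) = (\<lambda>p. 2 * (a p * b p * v p + a p * b p * bx p + ((a p)\<^sup>2 - (b p)\<^sup>2) * ax p))"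
    by (auto simp: Qx_def Qy_def power2_eq_square algebra_simps)
  finally have "(LBINT p. a p * b p * v p + a p * b p * bx p + ((a p)\<^sup>2 - (b p)\<^sup>2) * ax p) = 0"
    by (simp only: integral_mult_right_zero mult_eq_0_iff) simp
  moreover have "integrable lborel (\<lambda>p. a p * b p * v p)" "integrable lborel (\<lambda>p. a p * b p * bx p)"
    "integrable lborel (\<lambda>p. ((a p)\<^sup>2 - (b p)\<^sup>2) * ax p)"
  proof -
    have ab: "sq_integrable lborel (\<lambda>p. a p * b p)" unfolding a_def b_def by (rule sq2[OF slw(1,2)])
    have aabb: "sq_integrable lborel (\<lambda>p. (a p)\<^sup>2 - (b p)\<^sup>2)" unfolding a_def b_def power2_eq_square
      by (intro sq_integrable_diff sq2 slw)
    show "integrable lborel (\<lambda>p. a p * b p * v p)" "integrable lborel (\<lambda>p. a p * b p * bx p)"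
      "integrable lborel (\<lambda>p. ((a p)\<^sup>2 - (b p)\<^sup>2) * ax p)"
      by (rule sq_integrable_times[OF ab sq(5)] sq_integrable_times[OF ab sq(4)] sq_integrable_times[OF aabb sq(3)])+
  qed
  ultimately show ?thesis by (simp add: a_def b_def ax_def bx_def v_def)
qed

end

subsection \<open>Energy estimates\<close>

text \<open>Differentiation under the integral sign in integrated form; the uniform bound
  \<open>K\<close> supplies the integrability over space-time that Fubini needs.\<close>

lemma integral_time_primitive:
  fixes F F' :: "real \<times> 'a::euclidean_space \<Rightarrow> real"
  assumes p: "\<And>p. primitive (\<lambda>t. F (t, p)) (\<lambda>t. F' (t, p))"
    and m: "F' \<in> borel_measurable borel"
    and i: "\<And>t. integrable lborel (\<lambda>p. F (t, p))" "\<And>t. integrable lborel (\<lambda>p. F' (t, p))"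
    and K: "\<And>t. (LBINT p. \<bar>F' (t, p)\<bar>) \<le> K" and st: "s \<le> t"
  shows "(LBINT p. F (t, p)) - (LBINT p. F (s, p)) = (LBINT \<tau>. indicator {s..t} \<tau> * (LBINT p. F' (\<tau>, p)))"
proof -
  note [measurable] = m
  have i2: "integrable (lborel \<Otimes>\<^sub>M lborel) (\<lambda>(\<tau>, p). indicator {s..t} \<tau> * F' (\<tau>, p))"
  proof (rule lborel_pair.Fubini_integrable)
    show "(\<lambda>(\<tau>, p). indicator {s..t} \<tau> * F' (\<tau>, p)) \<in> borel_measurable (lborel \<Otimes>\<^sub>M lborel)"
      by measurable
    show "AE \<tau> in lborel. integrable lborel (\<lambda>p. case (\<tau>, p) of (\<tau>, p) \<Rightarrow> indicator {s..t} \<tau> * F' (\<tau>, p))"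
      using i(2) by simp
    show "integrable lborel (\<lambda>\<tau>. LBINT p. norm (case (\<tau>, p) of (\<tau>, p) \<Rightarrow> indicator {s..t} \<tau> * F' (\<tau>, p)))"
    proof (rule Bochner_Integration.integrable_bound)
      show "integrable lborel (\<lambda>\<tau>. indicator {s..t} \<tau> * K)" by (rule integrable_indicator_Icc_const)
      show "(\<lambda>\<tau>. LBINT p. norm (case (\<tau>, p) of (\<tau>, p) \<Rightarrow> indicator {s..t} \<tau> * F' (\<tau>, p))) \<in> borel_measurable lborel"
        by (rule lborel.borel_measurable_lebesgue_integral) measurable
      show "AE \<tau> in lborel. norm (LBINT p. norm (case (\<tau>, p) of (\<tau>, p) \<Rightarrow> indicator {s..t} \<tau> * F' (\<tau>, p))) \<le> norm (indicator {s..t} \<tau> * K)"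
        using K by (auto simp: indicator_def intro: order_trans[OF _ abs_ge_self])
    qed
  qed
  have "(LBINT p. F (t, p)) - (LBINT p. F (s, p)) = (LBINT p. F (t, p) - F (s, p))"
    using i(1) by simp
  also have "\<dots> = (LBINT p. (LBINT \<tau>. indicator {s..t} \<tau> * F' (\<tau>, p)))"
    using primitiveD(3)[OF p st] by simp
  also have "\<dots> = (LBINT \<tau>. (LBINT p. indicator {s..t} \<tau> * F' (\<tau>, p)))"
    by (rule lborel_pair.Fubini_integral[OF i2])
  finally show ?thesis by simp
qed

lemma slicewise_inner:
  assumes f: "slicewise f" and g: "slicewise g"
  shows "(\<lambda>t. LBINT p. f (t, p) * g (t, p)) \<in> borel_measurable borel"
    and "\<exists>K. \<forall>t. \<bar>LBINT p. f (t, p) * g (t, p)\<bar> \<le> K \<and> (LBINT p. \<bar>f (t, p) * g (t, p)\<bar>) \<le> K"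
    and "integrable lborel (\<lambda>\<tau>. indicator {a..b} \<tau> * (LBINT p. f (\<tau>, p) * g (\<tau>, p)))"
proof -
  note [measurable] = slicewiseD(1)[OF f] slicewiseD(1)[OF g]
  have "(\<lambda>(t, p). f (t, p) * g (t, p)) \<in> borel_measurable (borel \<Otimes>\<^sub>M lborel)" by measurable
  then show m: "(\<lambda>t. LBINT p. f (t, p) * g (t, p)) \<in> borel_measurable borel"
    by (rule lborel.borel_measurable_lebesgue_integral)
  obtain C where C: "\<And>t. (LBINT p. (f (t, p))\<^sup>2) \<le> C" "0 \<le> C" using slicewise_energy[OF f] by metis
  obtain D where D: "\<And>t. (LBINT p. (g (t, p))\<^sup>2) \<le> D" "0 \<le> D" using slicewise_energy[OF g] by metis
  have b: "(LBINT p. \<bar>f (t, p) * g (t, p)\<bar>) \<le> sqrt C * sqrt D" for t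
  proof -
    have "(LBINT p. \<bar>f (t, p) * g (t, p)\<bar>) \<le> sqrt (LBINT p. (f (t, p))\<^sup>2) * sqrt (LBINT p. (g (t, p))\<^sup>2)"
      by (rule Cauchy_Schwarz_integral_abs[OF slicewiseD(2)[OF f] slicewiseD(2)[OF g]])
    also have "\<dots> \<le> sqrt C * sqrt D" using C D by (intro mult_mono) auto
    finally show ?thesis .
  qed
  have b': "\<bar>LBINT p. f (t, p) * g (t, p)\<bar> \<le> sqrt C * sqrt D" for t
    using b[of t] integral_abs_bound[of lborel "\<lambda>p. f (t, p) * g (t, p)"] by linarith
  show "\<exists>K. \<forall>t. \<bar>LBINT p. f (t, p) * g (t, p)\<bar> \<le> K \<and> (LBINT p. \<bar>f (t, p) * g (t, p)\<bar>) \<le> K"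
    by (intro exI[of _ "sqrt C * sqrt D"] allI conjI b b')
  show "integrable lborel (\<lambda>\<tau>. indicator {a..b} \<tau> * (LBINT p. f (\<tau>, p) * g (\<tau>, p)))"
    by (rule integrable_indicator_Icc[OF m b'])
qed

lemma slicewise_energy_integrable:
  assumes f: "slicewise f"
  shows "integrable lborel (\<lambda>\<tau>. indicator {a..b} \<tau> * (LBINT p. (f (\<tau>, p))\<^sup>2))"
  using slicewise_inner(3)[OF f f] by (simp add: power2_eq_square)

lemma integral_mult_le_quarter:
  assumes f: "sq_integrable M f" and g: "sq_integrable M g" and "0 < \<mu>"
  shows "\<bar>\<integral>x. f x * g x \<partial>M\<bar> \<le> \<mu> * (\<integral>x. (f x)\<^sup>2 \<partial>M) + (\<integral>x. (g x)\<^sup>2 \<partial>M) / (4 * \<mu>)"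
proof -
  define a b where "a = sqrt (\<integral>x. (f x)\<^sup>2 \<partial>M)" and "b = sqrt (\<integral>x. (g x)\<^sup>2 \<partial>M)"
  have sq: "a\<^sup>2 = (\<integral>x. (f x)\<^sup>2 \<partial>M)" "b\<^sup>2 = (\<integral>x. (g x)\<^sup>2 \<partial>M)" by (auto simp: a_def b_def)
  have "0 \<le> (2 * \<mu> * a - b)\<^sup>2" by simp
  then have "4 * \<mu> * (a * b) \<le> 4 * \<mu>\<^sup>2 * a\<^sup>2 + b\<^sup>2" by (simp add: power2_diff power_mult_distrib algebra_simps)
  then have "a * b \<le> \<mu> * a\<^sup>2 + b\<^sup>2 / (4 * \<mu>)" using \<open>0 < \<mu>\<close> by (simp add: field_simps power2_eq_square)
  then show ?thesis using Cauchy_Schwarz_integral[OF f g] unfolding sq by (simp add: a_def b_def)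
qed

text \<open>A nonnegative kernel of mass one makes mollification a contraction both in the supremum
  norm and in mean square. The constant \<open>C\<close> bounds the original flow, so it can be
  fixed before \<open>\<rho>\<close> is chosen.\<close>

locale unit_mollified_flow = mollified_flow +
  fixes C :: real
  assumes \<rho>_nonneg: "\<And>x. 0 \<le> \<rho> x" and \<rho>_integral: "(LBINT x. \<rho> x) = 1"
    and \<rho>_supp: "\<And>x. 1 \<le> x \<Longrightarrow> \<rho> x = 0"
    and C: "\<And>t. (LBINT p. (u1 (t, p))\<^sup>2) \<le> C" "\<And>t. (LBINT p. (u2 (t, p))\<^sup>2) \<le> C"
begin

abbreviation "U1 \<equiv> cv 0 0 u1"
abbreviation "U2 \<equiv> cv 0 0 u2"
abbreviation "U1x \<equiv> cv 1 0 u1"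
abbreviation "U2x \<equiv> cv 1 0 u2"
abbreviation "PP \<equiv> cv 0 0 P"
abbreviation "DD \<equiv> cv 0 0 D"

lemma C_nonneg: "0 \<le> C"
  using C(1)[of 0] integral_square_nonneg[of lborel "\<lambda>p. u1 (0, p)"] by linarith

lemma d\<rho>0: "(LBINT x. \<bar>d\<rho> 0 x\<bar>) = 1"
  using \<rho>_nonneg \<rho>_integral by (simp add: d\<rho>_def)

lemma slicewise_flow: "slicewise U1" "slicewise U2" "slicewise U1x" "slicewise U2x" "slicewise PP" "slicewise DD" "slicewise V"
  by (intro slicewise_cv slicewise_u slicewise_PD slicewise_VN)+

lemma cv_le_1:
  assumes f: "f \<in> borel_measurable borel" "\<And>w. \<bar>f w\<bar> \<le> 1"
  shows "\<bar>cv 0 0 f w\<bar> \<le> 1"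
proof -
  have m: "dconv (1, 0, 0) (d\<rho> 0) f \<in> borel_measurable borel"
    using f(1) borel_measurable_integrable[OF d\<rho>_integrable[of 0]] by measurable
  have 1: "\<bar>dconv (1, 0, 0) (d\<rho> 0) f w\<bar> \<le> 1" for w
    using dconv_bound[OF d\<rho>_integrable[of 0] f, of "(1, 0, 0)" w] d\<rho>0 by simp
  show ?thesis
    unfolding cv_def using dconv_bound[OF d\<rho>_integrable[of 0] m 1, of "(0, 1, 0)" w] d\<rho>0 by simp
qed

lemma cv_energy_le:
  assumes f: "slicewise f" and c: "\<And>t. (LBINT p. (f (t, p))\<^sup>2) \<le> c"
  shows "(LBINT p. (cv 0 0 f (t, p))\<^sup>2) \<le> c"
proof -
  let ?g = "dconv (1, 0, 0) (d\<rho> 0) f"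
  have g: "slicewise ?g" by (rule slicewise_dconv[OF d\<rho>_integrable f])
  obtain K where K: "\<And>w. \<bar>f w\<bar> \<le> K" using slicewise_bounded[OF f] by metis
  obtain L where L: "\<And>w. \<bar>?g w\<bar> \<le> L" using slicewise_bounded[OF g] by metis
  have 1: "(LBINT p. (?g (t, p))\<^sup>2) \<le> c" for t
    using dconv_slice(2)[OF d\<rho>_integrable[of 0] slicewiseD(1)[OF f] K slicewiseD(2)[OF f] c, of "(1, 0, 0)" t] d\<rho>0 by simp
  show ?thesis
    unfolding cv_def
    using dconv_slice(2)[OF d\<rho>_integrable[of 0] slicewiseD(1)[OF g] L slicewiseD(2)[OF g] 1, of "(0, 1, 0)" t] d\<rho>0 by simp
qed

text \<open>\<open>residual\<close> measures how far mollification is from commuting with the products in the convective term.\<close>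

definition "energy t = (LBINT p. (U1 (t, p))\<^sup>2) + (LBINT p. (U2 (t, p))\<^sup>2)"
definition "dissipation t = (LBINT p. (V (t, p))\<^sup>2) + 2 * (LBINT p. (U1x (t, p))\<^sup>2) + (LBINT p. (U2x (t, p))\<^sup>2)"
definition "residual t = (LBINT p. (PP (t, p) - U1 (t, p) * U2 (t, p))\<^sup>2)
   + (LBINT p. (DD (t, p) - ((U1 (t, p))\<^sup>2 - (U2 (t, p))\<^sup>2))\<^sup>2)"

lemma slicewise_residual:
  "slicewise (\<lambda>w. PP w - U1 w * U2 w)" "slicewise (\<lambda>w. DD w - ((U1 w)\<^sup>2 - (U2 w)\<^sup>2))"
  unfolding power2_eq_square by (intro slicewise_diff slicewise_times slicewise_flow)+

lemma U_energy: "(LBINT p. (U1 (t, p))\<^sup>2) \<le> C" "(LBINT p. (U2 (t, p))\<^sup>2) \<le> C"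
  by (rule cv_energy_le[OF slicewise_u(1) C(1)] cv_energy_le[OF slicewise_u(2) C(2)])+

lemma energy_le: "energy t \<le> 2 * C" "0 \<le> energy t"
  using U_energy[of t] by (auto simp: energy_def)

lemma dissipation_nonneg: "0 \<le> dissipation t" by (simp add: dissipation_def)
lemma residual_nonneg: "0 \<le> residual t" by (simp add: residual_def)

lemma dissipation_integrable: "integrable lborel (\<lambda>\<tau>. indicator {a..b} \<tau> * dissipation \<tau>)"
proof -
  have "integrable lborel (\<lambda>\<tau>. indicator {a..b} \<tau> * (LBINT p. (V (\<tau>, p))\<^sup>2)
      + 2 * (indicator {a..b} \<tau> * (LBINT p. (U1x (\<tau>, p))\<^sup>2)) + indicator {a..b} \<tau> * (LBINT p. (U2x (\<tau>, p))\<^sup>2))"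
    by (intro Bochner_Integration.integrable_add integrable_mult_right slicewise_energy_integrable slicewise_flow)
  then show ?thesis by (simp add: dissipation_def algebra_simps)
qed

lemma residual_integrable: "integrable lborel (\<lambda>\<tau>. indicator {a..b} \<tau> * residual \<tau>)"
proof -
  have "integrable lborel (\<lambda>\<tau>. indicator {a..b} \<tau> * (LBINT p. (PP (\<tau>, p) - U1 (\<tau>, p) * U2 (\<tau>, p))\<^sup>2)
      + indicator {a..b} \<tau> * (LBINT p. (DD (\<tau>, p) - ((U1 (\<tau>, p))\<^sup>2 - (U2 (\<tau>, p))\<^sup>2))\<^sup>2))"
    by (intro Bochner_Integration.integrable_add slicewise_energy_integrable slicewise_residual)
  then show ?thesis by (simp add: residual_def distrib_left)
qed

text \<open>At equal times \<open>trilinear_eq_0\<close> can be subtracted from the flux terms. What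
  remains are products of a residual with a gradient, and Young's inequality absorbs the gradients
  into part of the dissipation.\<close>

lemma energy_rate:
  assumes t: "t < 0"
  shows "2 * ((LBINT p. cv 0 1 u1 (t, p) * U1 (t, p)) + (LBINT p. cv 0 1 u2 (t, p) * U2 (t, p))) \<le> - dissipation t + 4 * residual t"
proof -
  note sw = slicewise_flow slicewise_residual
  have i: "integrable lborel (\<lambda>p. f (t, p) * g (t, p))" if "slicewise f" "slicewise g" for f g
    by (rule sq_integrable_times[OF slicewiseD(2)[OF that(1)] slicewiseD(2)[OF that(2)]])
  have UU: "slicewise (\<lambda>w. U1 w * U2 w)" "slicewise (\<lambda>w. (U1 w)\<^sup>2 - (U2 w)\<^sup>2)"
    unfolding power2_eq_square by (intro slicewise_diff slicewise_times slicewise_flow)+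
  have s1: "(LBINT p. (PP (t, p) - U1 (t, p) * U2 (t, p)) * V (t, p)) = (LBINT p. PP (t, p) * V (t, p)) - (LBINT p. U1 (t, p) * U2 (t, p) * V (t, p))"
    using i[OF sw(5,7)] i[OF UU(1) sw(7)] by (simp add: left_diff_distrib)
  have s2: "(LBINT p. (PP (t, p) - U1 (t, p) * U2 (t, p)) * U2x (t, p)) = (LBINT p. PP (t, p) * U2x (t, p)) - (LBINT p. U1 (t, p) * U2 (t, p) * U2x (t, p))"
    using i[OF sw(5,4)] i[OF UU(1) sw(4)] by (simp add: left_diff_distrib)
  have s3: "(LBINT p. (DD (t, p) - ((U1 (t, p))\<^sup>2 - (U2 (t, p))\<^sup>2)) * U1x (t, p)) = (LBINT p. DD (t, p) * U1x (t, p)) - (LBINT p. ((U1 (t, p))\<^sup>2 - (U2 (t, p))\<^sup>2) * U1x (t, p))"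
    using i[OF sw(6,3)] i[OF UU(2) sw(3)] by (simp add: left_diff_distrib[of "DD _"])
  have b1: "\<bar>(LBINT p. PP (t, p) * V (t, p)) - (LBINT p. U1 (t, p) * U2 (t, p) * V (t, p))\<bar>
      \<le> (LBINT p. (PP (t, p) - U1 (t, p) * U2 (t, p))\<^sup>2) + (LBINT p. (V (t, p))\<^sup>2) / 4"
    unfolding s1[symmetric] using integral_mult_le_quarter[OF slicewiseD(2)[OF sw(8), of t] slicewiseD(2)[OF sw(7), of t], of 1] by simp
  have b2: "\<bar>(LBINT p. PP (t, p) * U2x (t, p)) - (LBINT p. U1 (t, p) * U2 (t, p) * U2x (t, p))\<bar>
      \<le> (LBINT p. (PP (t, p) - U1 (t, p) * U2 (t, p))\<^sup>2) + (LBINT p. (U2x (t, p))\<^sup>2) / 4"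
    unfolding s2[symmetric] using integral_mult_le_quarter[OF slicewiseD(2)[OF sw(8), of t] slicewiseD(2)[OF sw(4), of t], of 1] by simp
  have b3: "\<bar>(LBINT p. DD (t, p) * U1x (t, p)) - (LBINT p. ((U1 (t, p))\<^sup>2 - (U2 (t, p))\<^sup>2) * U1x (t, p))\<bar>
      \<le> (LBINT p. (DD (t, p) - ((U1 (t, p))\<^sup>2 - (U2 (t, p))\<^sup>2))\<^sup>2) + (LBINT p. (U1x (t, p))\<^sup>2) / 4"
    unfolding s3[symmetric] using integral_mult_le_quarter[OF slicewiseD(2)[OF sw(9), of t] slicewiseD(2)[OF sw(3), of t], of 1] by simp
  have arith: "2 * E \<le> - (a1 + 2 * a2 + a3) + 4 * (r1 + r2)"
    if "E = - a1 - 2 * a2 - a3 + pv + pu + du" "uv + uu + ud = 0" "\<bar>pv - uv\<bar> \<le> r1 + a1 / 4" "\<bar>pu - uu\<bar> \<le> r1 + a3 / 4"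
      "\<bar>du - ud\<bar> \<le> r2 + a2 / 4" "0 \<le> a1" "0 \<le> a2" "0 \<le> a3" "0 \<le> r1" "0 \<le> r2"
    for E a1 a2 a3 pv pu du uv uu ud r1 r2 :: real
  proof -
    have "pv - uv \<le> r1 + a1 / 4" "pu - uu \<le> r1 + a3 / 4" "du - ud \<le> r2 + a2 / 4"
      using that by (auto dest: abs_le_D1)
    then have "E \<le> - a1 - 2 * a2 - a3 + (2 * r1 + r2 + (a1 + a2 + a3) / 4)"
      using that(1,2) by (simp add: add_divide_distrib)
    then show ?thesis using that by (simp add: field_simps)
  qed
  show ?thesis
    unfolding dissipation_def residual_def
    by (rule arith[OF bilinear_identity[OF t t, folded power2_eq_square] trilinear_eq_0[OF t] b1 b2 b3]) simp_all
qed

lemma time_derivative_square: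
  assumes f: "slicewise f" and st: "s \<le> t"
  shows "(LBINT p. (cv 0 0 f (t, p))\<^sup>2) - (LBINT p. (cv 0 0 f (s, p))\<^sup>2)
    = (LBINT \<tau>. indicator {s..t} \<tau> * (2 * (LBINT p. cv 0 1 f (\<tau>, p) * cv 0 0 f (\<tau>, p))))"
proof -
  have sw: "slicewise (cv 0 0 f)" "slicewise (cv 0 1 f)" by (rule slicewise_cv[OF f])+
  obtain K where K: "\<And>t. (LBINT p. \<bar>cv 0 1 f (t, p) * cv 0 0 f (t, p)\<bar>) \<le> K"
    using slicewise_inner(2)[OF sw(2,1)] by metis
  have "(LBINT p. cv 0 0 f (t, p) * cv 0 0 f (t, p)) - (LBINT p. cv 0 0 f (s, p) * cv 0 0 f (s, p))
    = (LBINT \<tau>. indicator {s..t} \<tau> * (LBINT p. 2 * (cv 0 1 f (\<tau>, p) * cv 0 0 f (\<tau>, p))))"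
  proof (rule integral_time_primitive[where F = "\<lambda>w. cv 0 0 f w * cv 0 0 f w" and F' = "\<lambda>w. 2 * (cv 0 1 f w * cv 0 0 f w)" and K = "2 * K"])
    show "primitive (\<lambda>t. cv 0 0 f (t, p) * cv 0 0 f (t, p)) (\<lambda>t. 2 * (cv 0 1 f (t, p) * cv 0 0 f (t, p)))" for p
      using primitive_mult[OF cv_t_primitive[OF f, of 0 0 p] cv_t_primitive[OF f, of 0 0 p]] by (simp add: mult.commute)
    show "(\<lambda>w. 2 * (cv 0 1 f w * cv 0 0 f w)) \<in> borel_measurable borel"
      using slicewiseD(1)[OF sw(1)] slicewiseD(1)[OF sw(2)] by measurable
    show "integrable lborel (\<lambda>p. cv 0 0 f (t, p) * cv 0 0 f (t, p))" for t
      by (rule sq_integrable_times[OF slicewiseD(2)[OF sw(1)] slicewiseD(2)[OF sw(1)]])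
    show "integrable lborel (\<lambda>p. 2 * (cv 0 1 f (t, p) * cv 0 0 f (t, p)))" for t
      using sq_integrable_times[OF slicewiseD(2)[OF sw(2), of t] slicewiseD(2)[OF sw(1), of t]] by simp
    show "(LBINT p. \<bar>2 * (cv 0 1 f (t, p) * cv 0 0 f (t, p))\<bar>) \<le> 2 * K" for t
      using K[of t] by (simp add: abs_mult)
  qed (rule st)
  then show ?thesis by (simp add: power2_eq_square)
qed

lemma energy_inequality:
  assumes st: "s \<le> t" and t: "t < 0"
  shows "energy t + (LBINT \<tau>. indicator {s..t} \<tau> * dissipation \<tau>) \<le> energy s + 4 * (LBINT \<tau>. indicator {s..t} \<tau> * residual \<tau>)"
proof -
  define h where "h \<tau> = 2 * (LBINT p. cv 0 1 u1 (\<tau>, p) * U1 (\<tau>, p)) + 2 * (LBINT p. cv 0 1 u2 (\<tau>, p) * U2 (\<tau>, p))" for \<tau>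
  have ih1: "integrable lborel (\<lambda>\<tau>. indicator {s..t} \<tau> * (2 * (LBINT p. cv 0 1 u1 (\<tau>, p) * U1 (\<tau>, p))))"
    and ih2: "integrable lborel (\<lambda>\<tau>. indicator {s..t} \<tau> * (2 * (LBINT p. cv 0 1 u2 (\<tau>, p) * U2 (\<tau>, p))))"
    using integrable_mult_right[OF slicewise_inner(3)[OF slicewise_cv[OF slicewise_u(1), of 0 1] slicewise_flow(1)], of 2 s t]
      integrable_mult_right[OF slicewise_inner(3)[OF slicewise_cv[OF slicewise_u(2), of 0 1] slicewise_flow(2)], of 2 s t]
    by (simp_all add: mult.left_commute)
  have "energy t - energy s = (LBINT \<tau>. indicator {s..t} \<tau> * (2 * (LBINT p. cv 0 1 u1 (\<tau>, p) * U1 (\<tau>, p))))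
     + (LBINT \<tau>. indicator {s..t} \<tau> * (2 * (LBINT p. cv 0 1 u2 (\<tau>, p) * U2 (\<tau>, p))))"
    using time_derivative_square[OF slicewise_u(1) st] time_derivative_square[OF slicewise_u(2) st]
    by (simp add: energy_def)
  also have "\<dots> = (LBINT \<tau>. indicator {s..t} \<tau> * h \<tau>)"
    using ih1 ih2 by (simp add: h_def distrib_left)
  also have "\<dots> \<le> (LBINT \<tau>. 4 * (indicator {s..t} \<tau> * residual \<tau>) - indicator {s..t} \<tau> * dissipation \<tau>)"
  proof (rule integral_mono)
    show "integrable lborel (\<lambda>\<tau>. indicator {s..t} \<tau> * h \<tau>)"
      using Bochner_Integration.integrable_add[OF ih1 ih2] by (simp add: h_def distrib_left)
    show "integrable lborel (\<lambda>\<tau>. 4 * (indicator {s..t} \<tau> * residual \<tau>) - indicator {s..t} \<tau> * dissipation \<tau>)"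
      by (intro Bochner_Integration.integrable_diff integrable_mult_right residual_integrable dissipation_integrable)
    fix \<tau>
    show "indicator {s..t} \<tau> * h \<tau> \<le> 4 * (indicator {s..t} \<tau> * residual \<tau>) - indicator {s..t} \<tau> * dissipation \<tau>"
    proof (cases "\<tau> \<in> {s..t}")
      case True
      then show ?thesis using energy_rate[of \<tau>] t by (simp add: h_def)
    qed simp
  qed
  also have "\<dots> = 4 * (LBINT \<tau>. indicator {s..t} \<tau> * residual \<tau>) - (LBINT \<tau>. indicator {s..t} \<tau> * dissipation \<tau>)"
    using residual_integrable dissipation_integrable by simp
  finally show ?thesis by linarith
qed

section \<open>The correlation of the flow at two times\<close>

definition "correlation t s = (LBINT p. U1 (t, p) * U1 (s, p)) + (LBINT p. U2 (t, p) * U2 (s, p))"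

text \<open>\<open>Ladyzhenskaya\<close> with the energy bounded by \<open>C\<close>. Two dimensions
  give the dissipation to the first power, so the bound is integrable in time whenever the
  dissipation is.\<close>

lemma fourth_power_le:
  assumes t: "t < 0"
  shows "integrable lborel (\<lambda>p. U1 (t, p) ^ 4)" "(LBINT p. U1 (t, p) ^ 4) \<le> 4 * C * dissipation t"
    "integrable lborel (\<lambda>p. U2 (t, p) ^ 4)" "(LBINT p. U2 (t, p) ^ 4) \<le> 4 * C * dissipation t"
proof -
  have d: "sqrt (LBINT p. (V (t, p))\<^sup>2) \<le> sqrt (dissipation t)" "sqrt (LBINT p. (U1x (t, p))\<^sup>2) \<le> sqrt (dissipation t)"
    "sqrt (LBINT p. (U2x (t, p))\<^sup>2) \<le> sqrt (dissipation t)"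
    by (simp_all add: dissipation_def add_increasing add_increasing2)
  have x: "has_x_primitive (\<lambda>p. U1 (t, p)) (\<lambda>p. U1x (t, p))" "has_x_primitive (\<lambda>p. U2 (t, p)) (\<lambda>p. U2x (t, p))"
    using cv_x_primitive[OF slicewise_u(1), of 0 0 t] cv_x_primitive[OF slicewise_u(2), of 0 0 t] by simp_all
  have y: "has_y_primitive UNIV (\<lambda>p. U2 (t, p)) (\<lambda>p. - U1x (t, p))"
    using cv_u2_y_primitive[OF t, of 0 0] by simp
  note L1 = Ladyzhenskaya[OF slicewiseD(2)[OF slicewise_flow(1)] slicewiseD(2)[OF slicewise_flow(3)] x(1) slicewiseD(2)[OF slicewise_flow(7)] y_primitives(1)[OF t]]
  note L2 = Ladyzhenskaya[OF slicewiseD(2)[OF slicewise_flow(2)] slicewiseD(2)[OF slicewise_flow(4)] x(2) sq_integrable_uminus[OF slicewiseD(2)[OF slicewise_flow(3)]] y]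
  have key: "4 * a * sqrt b * sqrt c \<le> 4 * C * dissipation t"
    if "0 \<le> a" "a \<le> C" "0 \<le> b" "0 \<le> c" "sqrt b \<le> sqrt (dissipation t)" "sqrt c \<le> sqrt (dissipation t)" for a b c
  proof -
    have "sqrt b * sqrt c \<le> sqrt (dissipation t) * sqrt (dissipation t)"
      using that dissipation_nonneg by (intro mult_mono) auto
    then have "sqrt b * sqrt c \<le> dissipation t" using dissipation_nonneg by simp
    then have "a * (sqrt b * sqrt c) \<le> C * dissipation t"
      using that C_nonneg by (intro mult_mono) auto
    then show ?thesis by (simp add: mult.assoc)
  qed
  show "integrable lborel (\<lambda>p. U1 (t, p) ^ 4)" "integrable lborel (\<lambda>p. U2 (t, p) ^ 4)" by (rule L1 L2)+
  show "(LBINT p. U1 (t, p) ^ 4) \<le> 4 * C * dissipation t"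
    by (rule order_trans[OF L1(2) key]) (use U_energy d in auto)
  show "(LBINT p. U2 (t, p) ^ 4) \<le> 4 * C * dissipation t"
    by (rule order_trans[OF L2(2) key]) (use U_energy d in auto)
qed

text \<open>The factor 32 C is 2 * 2 * 8 C: splitting off the residual costs a factor 2, there are
  two flux functions, and each square is at most the sum of two fourth powers.\<close>

lemma flux_le:
  assumes t: "t < 0"
  shows "(LBINT p. (PP (t, p))\<^sup>2) + (LBINT p. (DD (t, p))\<^sup>2) \<le> 2 * residual t + 32 * C * dissipation t"
proof -
  note f4 = fourth_power_le[OF t]
  have UU: "slicewise (\<lambda>w. U1 w * U2 w)" "slicewise (\<lambda>w. (U1 w)\<^sup>2 - (U2 w)\<^sup>2)"
    unfolding power2_eq_square by (intro slicewise_diff slicewise_times slicewise_flow)+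
  have i4: "integrable lborel (\<lambda>p. U1 (t, p) ^ 4 + U2 (t, p) ^ 4)" using f4 by simp
  have le4: "(LBINT p. U1 (t, p) ^ 4 + U2 (t, p) ^ 4) \<le> 8 * C * dissipation t" using f4 by simp
  have sq4: "x ^ 4 = (x\<^sup>2)\<^sup>2" for x :: real by simp
  have "(LBINT p. (U1 (t, p) * U2 (t, p))\<^sup>2) \<le> (LBINT p. U1 (t, p) ^ 4 + U2 (t, p) ^ 4)"
  proof (rule integral_mono[OF sq_integrableD(2)[OF slicewiseD(2)[OF UU(1)]] i4])
    fix p
    have "2 * (U1 (t, p))\<^sup>2 * (U2 (t, p))\<^sup>2 \<le> ((U1 (t, p))\<^sup>2)\<^sup>2 + ((U2 (t, p))\<^sup>2)\<^sup>2" by (rule sum_squares_bound)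
    moreover have "0 \<le> (U1 (t, p))\<^sup>2 * (U2 (t, p))\<^sup>2" by simp
    ultimately show "(U1 (t, p) * U2 (t, p))\<^sup>2 \<le> U1 (t, p) ^ 4 + U2 (t, p) ^ 4"
      unfolding sq4 power_mult_distrib by linarith
  qed
  moreover have "(LBINT p. ((U1 (t, p))\<^sup>2 - (U2 (t, p))\<^sup>2)\<^sup>2) \<le> (LBINT p. U1 (t, p) ^ 4 + U2 (t, p) ^ 4)"
  proof (rule integral_mono[OF sq_integrableD(2)[OF slicewiseD(2)[OF UU(2)]] i4])
    show "((U1 (t, p))\<^sup>2 - (U2 (t, p))\<^sup>2)\<^sup>2 \<le> U1 (t, p) ^ 4 + U2 (t, p) ^ 4" for p
      unfolding sq4 power2_diff[of "(U1 (t, p))\<^sup>2"] by simp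
  qed
  moreover have "(LBINT p. ((PP (t, p) - U1 (t, p) * U2 (t, p)) + U1 (t, p) * U2 (t, p))\<^sup>2)
      \<le> 2 * (LBINT p. (PP (t, p) - U1 (t, p) * U2 (t, p))\<^sup>2) + 2 * (LBINT p. (U1 (t, p) * U2 (t, p))\<^sup>2)"
    by (rule integral_square_add_le[OF slicewiseD(2)[OF slicewise_residual(1)] slicewiseD(2)[OF UU(1)]])
  moreover have "(LBINT p. ((DD (t, p) - ((U1 (t, p))\<^sup>2 - (U2 (t, p))\<^sup>2)) + ((U1 (t, p))\<^sup>2 - (U2 (t, p))\<^sup>2))\<^sup>2)
      \<le> 2 * (LBINT p. (DD (t, p) - ((U1 (t, p))\<^sup>2 - (U2 (t, p))\<^sup>2))\<^sup>2) + 2 * (LBINT p. ((U1 (t, p))\<^sup>2 - (U2 (t, p))\<^sup>2)\<^sup>2)"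
    by (rule integral_square_add_le[OF slicewiseD(2)[OF slicewise_residual(2)] slicewiseD(2)[OF UU(2)]])
  ultimately show ?thesis using le4 unfolding residual_def by simp
qed

text \<open>Every term of \<open>bilinear_identity\<close> is a product of a quantity at
  \<open>\<tau>\<close> and a gradient at \<open>s\<close>. The weight \<open>l\<close> goes to the
  former, whose square is integrable in time up to the residual, and 1 / l to the latter, which will
  be small by the choice of \<open>s\<close>. As \<open>PP\<close> occurs in two terms, 64 C is 2 *
  32 C.\<close>

lemma correlation_rate:
  assumes \<tau>: "\<tau> < 0" and s: "s < 0" and l: "0 < l"
  shows "\<bar>(LBINT p. cv 0 1 u1 (\<tau>, p) * U1 (s, p)) + (LBINT p. cv 0 1 u2 (\<tau>, p) * U2 (s, p))\<bar>
    \<le> l * (4 * residual \<tau> + (64 * C + 2) * dissipation \<tau>) + dissipation s / l"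
proof -
  note sw = slicewise_flow
  have q: "\<bar>LBINT p. f (\<tau>, p) * g (s, p)\<bar> \<le> l * (LBINT p. (f (\<tau>, p))\<^sup>2) + (LBINT p. (g (s, p))\<^sup>2) / (4 * l)"
    if "slicewise f" "slicewise g" for f g
    by (rule integral_mult_le_quarter[OF slicewiseD(2)[OF that(1)] slicewiseD(2)[OF that(2)] l])
  define a1 a2 a3 where "a1 = (LBINT p. (V (\<tau>, p))\<^sup>2)" and "a2 = (LBINT p. (U1x (\<tau>, p))\<^sup>2)" and "a3 = (LBINT p. (U2x (\<tau>, p))\<^sup>2)"
  define b1 b2 b3 where "b1 = (LBINT p. (V (s, p))\<^sup>2)" and "b2 = (LBINT p. (U1x (s, p))\<^sup>2)" and "b3 = (LBINT p. (U2x (s, p))\<^sup>2)"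
  define f1 f2 where "f1 = (LBINT p. (PP (\<tau>, p))\<^sup>2)" and "f2 = (LBINT p. (DD (\<tau>, p))\<^sup>2)"
  have nn: "0 \<le> a1" "0 \<le> a2" "0 \<le> a3" "0 \<le> b1" "0 \<le> b2" "0 \<le> b3" "0 \<le> f1" "0 \<le> f2"
    by (simp_all add: a1_def a2_def a3_def b1_def b2_def b3_def f1_def f2_def)
  have qs: "\<bar>LBINT p. V (\<tau>, p) * V (s, p)\<bar> \<le> l * a1 + b1 / (4 * l)"
    "\<bar>LBINT p. U1x (\<tau>, p) * U1x (s, p)\<bar> \<le> l * a2 + b2 / (4 * l)"
    "\<bar>LBINT p. U2x (\<tau>, p) * U2x (s, p)\<bar> \<le> l * a3 + b3 / (4 * l)"
    "\<bar>LBINT p. PP (\<tau>, p) * V (s, p)\<bar> \<le> l * f1 + b1 / (4 * l)"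
    "\<bar>LBINT p. PP (\<tau>, p) * U2x (s, p)\<bar> \<le> l * f1 + b3 / (4 * l)"
    "\<bar>LBINT p. DD (\<tau>, p) * U1x (s, p)\<bar> \<le> l * f2 + b2 / (4 * l)"
    unfolding a1_def a2_def a3_def b1_def b2_def b3_def f1_def f2_def by (rule q sw)+
  have "\<bar>(LBINT p. cv 0 1 u1 (\<tau>, p) * U1 (s, p)) + (LBINT p. cv 0 1 u2 (\<tau>, p) * U2 (s, p))\<bar>
    \<le> (l * a1 + b1 / (4 * l)) + 2 * (l * a2 + b2 / (4 * l)) + (l * a3 + b3 / (4 * l)) + (l * f1 + b1 / (4 * l)) + (l * f1 + b3 / (4 * l)) + (l * f2 + b2 / (4 * l))"
  proof -
    have arith: "\<bar>- x1 - 2 * x2 - x3 + x4 + x5 + x6\<bar> \<le> y1 + 2 * y2 + y3 + y4 + y5 + y6"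
      if "\<bar>x1\<bar> \<le> y1" "\<bar>x2\<bar> \<le> y2" "\<bar>x3\<bar> \<le> y3" "\<bar>x4\<bar> \<le> y4" "\<bar>x5\<bar> \<le> y5" "\<bar>x6\<bar> \<le> y6"
      for x1 x2 x3 x4 x5 x6 y1 y2 y3 y4 y5 y6 :: real
      using that unfolding abs_le_iff by (elim conjE, intro conjI) linarith+
    show ?thesis unfolding bilinear_identity[OF \<tau> s] by (rule arith[OF qs])
  qed
  also have "\<dots> = l * (a1 + 2 * a2 + a3 + 2 * f1 + f2) + (2 * b1 + 3 * b2 + 2 * b3) / (4 * l)"
    by (simp add: add_divide_distrib algebra_simps)
  also have "\<dots> \<le> l * (4 * residual \<tau> + (64 * C + 2) * dissipation \<tau>) + dissipation s / l"
  proof (rule add_mono)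
    have "f1 + f2 \<le> 2 * residual \<tau> + 32 * C * dissipation \<tau>" unfolding f1_def f2_def by (rule flux_le[OF \<tau>])
    moreover have "dissipation \<tau> = a1 + 2 * a2 + a3" by (simp add: dissipation_def a1_def a2_def a3_def)
    ultimately have "a1 + 2 * a2 + a3 + 2 * f1 + f2 \<le> 4 * residual \<tau> + (64 * C + 2) * dissipation \<tau>"
      using nn dissipation_nonneg[of \<tau>] by (simp add: distrib_right)
    then show "l * (a1 + 2 * a2 + a3 + 2 * f1 + f2) \<le> l * (4 * residual \<tau> + (64 * C + 2) * dissipation \<tau>)"
      using l by (intro mult_left_mono) auto
    have "dissipation s = b1 + 2 * b2 + b3" by (simp add: dissipation_def b1_def b2_def b3_def)
    then have "2 * b1 + 3 * b2 + 2 * b3 \<le> 4 * dissipation s" using nn by linarith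
    then have "(2 * b1 + 3 * b2 + 2 * b3) / (4 * l) \<le> (4 * dissipation s) / (4 * l)"
      using l by (intro divide_right_mono) auto
    then show "(2 * b1 + 3 * b2 + 2 * b3) / (4 * l) \<le> dissipation s / l" by simp
  qed
  finally show ?thesis .
qed

lemma time_derivative_inner:
  assumes f: "slicewise f" and st: "s \<le> t" and g: "sq_integrable lborel g"
  shows "(LBINT p. cv 0 0 f (t, p) * g p) - (LBINT p. cv 0 0 f (s, p) * g p)
    = (LBINT \<tau>. indicator {s..t} \<tau> * (LBINT p. cv 0 1 f (\<tau>, p) * g p))"
    and "integrable lborel (\<lambda>\<tau>. indicator {a..b} \<tau> * (LBINT p. cv 0 1 f (\<tau>, p) * g p))"
proof -
  have sw: "slicewise (cv 0 0 f)" "slicewise (cv 0 1 f)" by (rule slicewise_cv[OF f])+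
  note [measurable] = slicewiseD(1)[OF sw(1)] slicewiseD(1)[OF sw(2)] sq_integrableD(1)[OF g, simplified]
  obtain c where c: "\<And>t. (LBINT p. (cv 0 1 f (t, p))\<^sup>2) \<le> c" "0 \<le> c" using slicewise_energy[OF sw(2)] by metis
  have K: "(LBINT p. \<bar>cv 0 1 f (t, p) * g p\<bar>) \<le> sqrt c * sqrt (LBINT p. (g p)\<^sup>2)" for t
  proof -
    have "(LBINT p. \<bar>cv 0 1 f (t, p) * g p\<bar>) \<le> sqrt (LBINT p. (cv 0 1 f (t, p))\<^sup>2) * sqrt (LBINT p. (g p)\<^sup>2)"
      by (rule Cauchy_Schwarz_integral_abs[OF slicewiseD(2)[OF sw(2)] g])
    also have "\<dots> \<le> sqrt c * sqrt (LBINT p. (g p)\<^sup>2)" using c by (intro mult_right_mono) auto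
    finally show ?thesis .
  qed
  have "(LBINT p. cv 0 0 f (t, p) * g (snd (t, p))) - (LBINT p. cv 0 0 f (s, p) * g (snd (s, p)))
    = (LBINT \<tau>. indicator {s..t} \<tau> * (LBINT p. cv 0 1 f (\<tau>, p) * g (snd (\<tau>, p))))"
  proof (rule integral_time_primitive[where F = "\<lambda>w. cv 0 0 f w * g (snd w)" and F' = "\<lambda>w. cv 0 1 f w * g (snd w)"
        and K = "sqrt c * sqrt (LBINT p. (g p)\<^sup>2)"])
    show "primitive (\<lambda>t. cv 0 0 f (t, p) * g (snd (t, p))) (\<lambda>t. cv 0 1 f (t, p) * g (snd (t, p)))" for p
      using primitive_cmult[OF cv_t_primitive[OF f, of 0 0 p], of "g p"] by (simp add: mult.commute)
    show "(\<lambda>w. cv 0 1 f w * g (snd w)) \<in> borel_measurable borel" by measurable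
    show "integrable lborel (\<lambda>p. cv 0 0 f (t, p) * g (snd (t, p)))" "integrable lborel (\<lambda>p. cv 0 1 f (t, p) * g (snd (t, p)))" for t
      using sq_integrable_times[OF slicewiseD(2)[OF sw(1)] g] sq_integrable_times[OF slicewiseD(2)[OF sw(2)] g] by simp_all
    show "(LBINT p. \<bar>cv 0 1 f (t, p) * g (snd (t, p))\<bar>) \<le> sqrt c * sqrt (LBINT p. (g p)\<^sup>2)" for t
      using K[of t] by simp
  qed (rule st)
  then show "(LBINT p. cv 0 0 f (t, p) * g p) - (LBINT p. cv 0 0 f (s, p) * g p)
    = (LBINT \<tau>. indicator {s..t} \<tau> * (LBINT p. cv 0 1 f (\<tau>, p) * g p))" by simp
  show "integrable lborel (\<lambda>\<tau>. indicator {a..b} \<tau> * (LBINT p. cv 0 1 f (\<tau>, p) * g p))"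
  proof (rule integrable_indicator_Icc)
    have "(\<lambda>(t, p). cv 0 1 f (t, p) * g p) \<in> borel_measurable (borel \<Otimes>\<^sub>M lborel)" by measurable
    then show "(\<lambda>\<tau>. LBINT p. cv 0 1 f (\<tau>, p) * g p) \<in> borel_measurable borel"
      by (rule lborel.borel_measurable_lebesgue_integral)
    show "\<bar>LBINT p. cv 0 1 f (\<tau>, p) * g p\<bar> \<le> sqrt c * sqrt (LBINT p. (g p)\<^sup>2)" for \<tau>
      using K[of \<tau>] integral_abs_bound[of lborel "\<lambda>p. cv 0 1 f (\<tau>, p) * g p"] by linarith
  qed
qed

text \<open>At t = s the correlation is the energy, so its rate is integrated from \<open>s\<close>
  to \<open>t\<close>. The factor t - s in the last term is the reason why
  \<open>(- s) * dissipation s\<close>, and not just \<open>dissipation s\<close>, has to be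
  small.\<close>

lemma energy_le_correlation:
  assumes st: "s \<le> t" and t: "t < 0" and l: "0 < l"
  shows "energy s \<le> correlation t s + l * (4 * (LBINT \<tau>. indicator {s..t} \<tau> * residual \<tau>) + (64 * C + 2) * (LBINT \<tau>. indicator {s..t} \<tau> * dissipation \<tau>))
    + (t - s) * dissipation s / l"
proof -
  have s: "s < 0" using st t by simp
  define h where "h \<tau> = (LBINT p. cv 0 1 u1 (\<tau>, p) * U1 (s, p)) + (LBINT p. cv 0 1 u2 (\<tau>, p) * U2 (s, p))" for \<tau>
  note T1 = time_derivative_inner[OF slicewise_u(1) st slicewiseD(2)[OF slicewise_flow(1), of s]]
  note T2 = time_derivative_inner[OF slicewise_u(2) st slicewiseD(2)[OF slicewise_flow(2), of s]]
  have ih: "integrable lborel (\<lambda>\<tau>. indicator {s..t} \<tau> * h \<tau>)"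
    using Bochner_Integration.integrable_add[OF T1(2) T2(2), of s t s t] by (simp add: h_def distrib_left)
  have "correlation t s - energy s = (LBINT \<tau>. indicator {s..t} \<tau> * h \<tau>)"
    using T1 T2 by (simp add: correlation_def energy_def h_def distrib_left power2_eq_square)
  then have "energy s - correlation t s \<le> (LBINT \<tau>. \<bar>indicator {s..t} \<tau> * h \<tau>\<bar>)"
    using integral_abs_bound[of lborel "\<lambda>\<tau>. indicator {s..t} \<tau> * h \<tau>"] by linarith
  also have "\<dots> \<le> (LBINT \<tau>. l * (4 * (indicator {s..t} \<tau> * residual \<tau>) + (64 * C + 2) * (indicator {s..t} \<tau> * dissipation \<tau>)) + indicator {s..t} \<tau> * (dissipation s / l))"
  proof (rule integral_mono)
    show "integrable lborel (\<lambda>\<tau>. \<bar>indicator {s..t} \<tau> * h \<tau>\<bar>)" using ih by (rule integrable_abs)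
    show "integrable lborel (\<lambda>\<tau>. l * (4 * (indicator {s..t} \<tau> * residual \<tau>) + (64 * C + 2) * (indicator {s..t} \<tau> * dissipation \<tau>)) + indicator {s..t} \<tau> * (dissipation s / l))"
      by (intro Bochner_Integration.integrable_add integrable_mult_right residual_integrable dissipation_integrable integrable_indicator_Icc_const)
    fix \<tau>
    show "\<bar>indicator {s..t} \<tau> * h \<tau>\<bar> \<le> l * (4 * (indicator {s..t} \<tau> * residual \<tau>) + (64 * C + 2) * (indicator {s..t} \<tau> * dissipation \<tau>)) + indicator {s..t} \<tau> * (dissipation s / l)"
      using correlation_rate[of \<tau> s l] t s l by (cases "\<tau> \<in> {s..t}") (auto simp: h_def)
  qed
  also have "\<dots> = l * (4 * (LBINT \<tau>. indicator {s..t} \<tau> * residual \<tau>) + (64 * C + 2) * (LBINT \<tau>. indicator {s..t} \<tau> * dissipation \<tau>)) + (t - s) * (dissipation s / l)"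
    using residual_integrable[of s t] dissipation_integrable[of s t] st integrable_indicator_Icc_const[of s t "dissipation s / l"] by simp
  finally show ?thesis by simp
qed

text \<open>The half plane is split at height \<open>L\<close>: above it the flow at time
  \<open>t\<close> is kept, below it the flow at time \<open>s\<close>, and the other factor is
  bounded by \<open>C\<close>. On the strip \<open>Poincare_strip\<close> applies to both
  components, the \<open>y\<close>-derivatives being \<open>V\<close> and
  \<open>- U1x\<close>.\<close>

lemma correlation_le:
  assumes s: "s < 0" and L: "0 \<le> L" and \<mu>: "0 < \<mu>"
  shows "correlation t s \<le> 4 * C * \<mu> + ((LBINT p. (indicator {L<..} (snd p) * U1 (t, p))\<^sup>2) + (LBINT p. (indicator {L<..} (snd p) * U2 (t, p))\<^sup>2)
      + L\<^sup>2 * dissipation s) / (4 * \<mu>)"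
proof -
  have key: "(LBINT p. f (t, p) * f (s, p)) \<le> 2 * C * \<mu> + ((LBINT p. (indicator {L<..} (snd p) * f (t, p))\<^sup>2) + (LBINT p. (indicator {..L} (snd p) * f (s, p))\<^sup>2)) / (4 * \<mu>)"
    if f: "slicewise f" and c: "\<And>t. (LBINT p. (f (t, p))\<^sup>2) \<le> C" for f
  proof -
    have m: "(\<lambda>p::real\<times>real. indicator {L<..} (snd p) :: real) \<in> borel_measurable lborel"
       "(\<lambda>p::real\<times>real. indicator {..L} (snd p) :: real) \<in> borel_measurable lborel" by measurable
    have b: "\<bar>indicator A x :: real\<bar> \<le> 1" for A :: "real set" and x by (simp add: indicator_def)
    note h1 = sq_integrable_bounded_times[OF slicewiseD(2)[OF f, of t] m(1) b]
    note h2 = sq_integrable_bounded_times[OF slicewiseD(2)[OF f, of s] m(2) b]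
    have e1: "\<bar>LBINT p. f (s, p) * (indicator {L<..} (snd p) * f (t, p))\<bar> \<le> \<mu> * (LBINT p. (f (s, p))\<^sup>2) + (LBINT p. (indicator {L<..} (snd p) * f (t, p))\<^sup>2) / (4 * \<mu>)"
      by (rule integral_mult_le_quarter[OF slicewiseD(2)[OF f] h1 \<mu>])
    have e2: "\<bar>LBINT p. f (t, p) * (indicator {..L} (snd p) * f (s, p))\<bar> \<le> \<mu> * (LBINT p. (f (t, p))\<^sup>2) + (LBINT p. (indicator {..L} (snd p) * f (s, p))\<^sup>2) / (4 * \<mu>)"
      by (rule integral_mult_le_quarter[OF slicewiseD(2)[OF f] h2 \<mu>])
    have "(\<lambda>p. f (t, p) * f (s, p)) = (\<lambda>p. f (s, p) * (indicator {L<..} (snd p) * f (t, p)) + f (t, p) * (indicator {..L} (snd p) * f (s, p)))"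
      by (auto simp: indicator_def fun_eq_iff)
    then have "(LBINT p. f (t, p) * f (s, p)) = (LBINT p. f (s, p) * (indicator {L<..} (snd p) * f (t, p))) + (LBINT p. f (t, p) * (indicator {..L} (snd p) * f (s, p)))"
      using sq_integrable_times[OF slicewiseD(2)[OF f, of s] h1] sq_integrable_times[OF slicewiseD(2)[OF f, of t] h2] by simp
    also have "\<dots> \<le> \<mu> * C + \<mu> * C + ((LBINT p. (indicator {L<..} (snd p) * f (t, p))\<^sup>2) + (LBINT p. (indicator {..L} (snd p) * f (s, p))\<^sup>2)) / (4 * \<mu>)"
      using e1 e2 mult_left_mono[OF c[of s], of \<mu>] mult_left_mono[OF c[of t], of \<mu>] \<mu> unfolding add_divide_distrib by linarith
    also have "\<mu> * C + \<mu> * C = 2 * C * \<mu>" by simp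
    finally show ?thesis .
  qed
  have P1: "(LBINT p. (indicator {..L} (snd p) * U1 (s, p))\<^sup>2) \<le> L\<^sup>2 * (LBINT p. (V (s, p))\<^sup>2)"
    by (rule Poincare_strip(2)[OF _ y_primitives(1)[OF s] _ slicewiseD(2)[OF slicewise_flow(7)] L])
      (use sq_integrableD(1)[OF slicewiseD(2)[OF slicewise_flow(1)]] cv_u_eq_0 in auto)
  have y: "has_y_primitive UNIV (\<lambda>p. U2 (s, p)) (\<lambda>p. - U1x (s, p))"
    using cv_u2_y_primitive[OF s, of 0 0] by simp
  have P2: "(LBINT p. (indicator {..L} (snd p) * U2 (s, p))\<^sup>2) \<le> L\<^sup>2 * (LBINT p. (- U1x (s, p))\<^sup>2)"
    by (rule Poincare_strip(2)[OF _ y _ sq_integrable_uminus[OF slicewiseD(2)[OF slicewise_flow(3)]] L])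
      (use sq_integrableD(1)[OF slicewiseD(2)[OF slicewise_flow(2)]] cv_u_eq_0 in auto)
  have "L\<^sup>2 * (LBINT p. (V (s, p))\<^sup>2) + L\<^sup>2 * (LBINT p. (U1x (s, p))\<^sup>2) \<le> L\<^sup>2 * dissipation s"
    unfolding distrib_left[symmetric] by (intro mult_left_mono) (simp_all add: dissipation_def)
  then have "(LBINT p. (indicator {..L} (snd p) * U1 (s, p))\<^sup>2) + (LBINT p. (indicator {..L} (snd p) * U2 (s, p))\<^sup>2) \<le> L\<^sup>2 * dissipation s"
    using P1 P2 by simp
  then have "((LBINT p. (indicator {..L} (snd p) * U1 (s, p))\<^sup>2) + (LBINT p. (indicator {..L} (snd p) * U2 (s, p))\<^sup>2)) / (4 * \<mu>) \<le> L\<^sup>2 * dissipation s / (4 * \<mu>)"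
    using \<mu> by (intro divide_right_mono) auto
  then show ?thesis
    using key[OF slicewise_flow(1) U_energy(1)] key[OF slicewise_flow(2) U_energy(2)]
    unfolding correlation_def add_divide_distrib by linarith
qed

end

subsection \<open>Approximation in the mean square\<close>

lemma dconv_L2:
  fixes h :: "'a::euclidean_space \<Rightarrow> real"
  assumes a: "integrable lborel a" and h: "sq_integrable lborel h" "\<And>w. \<bar>h w\<bar> \<le> K"
  shows "sq_integrable lborel (dconv v a h)"
    and "(LBINT w. (dconv v a h w)\<^sup>2) \<le> (LBINT r. \<bar>a r\<bar>)\<^sup>2 * (LBINT w. (h w)\<^sup>2)"
proof -
  have [measurable]: "h \<in> borel_measurable borel" using sq_integrableD(1)[OF h(1)] by simp
  have m: "(\<lambda>(r, w). h (w - r *\<^sub>R v)) \<in> borel_measurable borel"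
    unfolding case_prod_beta' by measurable
  have m2: "(\<lambda>w. (h w)\<^sup>2) \<in> borel_measurable borel" by measurable
  have s: "sq_integrable lborel (\<lambda>w. h (w - r *\<^sub>R v))" for r
    using integral_lborel_translate(2)[OF m2, of "r *\<^sub>R v"] sq_integrableD(2)[OF h(1)] by (simp add: sq_integrable_def)
  have k: "(LBINT w. (h (w - r *\<^sub>R v))\<^sup>2) \<le> (LBINT w. (h w)\<^sup>2)" for r
    using integral_lborel_translate(1)[OF m2, of "r *\<^sub>R v"] by simp
  from Minkowski_square_integral[OF a m h(2) s k]
  show "sq_integrable lborel (dconv v a h)"
    "(LBINT w. (dconv v a h w)\<^sup>2) \<le> (LBINT r. \<bar>a r\<bar>)\<^sup>2 * (LBINT w. (h w)\<^sup>2)"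
    by (simp_all add: dconv_def[abs_def])
qed

text \<open>Truncation in space is followed by approximation through continuous functions that
  converge to \<open>h\<close> almost everywhere. Clamping them to \<open>{-K..K}\<close> provides
  the bound for dominated convergence.\<close>

lemma continuous_approximation_L2:
  fixes h :: "'a::euclidean_space \<Rightarrow> real"
  assumes h: "sq_integrable lborel h" "\<And>w. \<bar>h w\<bar> \<le> K" and e: "0 < e"
  obtains g R where "continuous_on UNIV g" "\<And>w. R < norm w \<Longrightarrow> g w = 0" "\<And>w. \<bar>g w\<bar> \<le> K" "0 \<le> R"
    "sq_integrable lborel g" "(LBINT w. (h w - g w)\<^sup>2) \<le> e"
proof -
  have K0: "0 \<le> K" using h(2)[of 0] by linarith
  have [measurable]: "h \<in> borel_measurable borel" using sq_integrableD(1)[OF h(1)] by simp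
  define \<phi> where "\<phi> n w = max 0 (min 1 (real n + 1 - norm w))" for n and w :: 'a
  have \<phi>: "0 \<le> \<phi> n w" "\<phi> n w \<le> 1" "real n + 1 < norm w \<Longrightarrow> \<phi> n w = 0" "norm w \<le> real n \<Longrightarrow> \<phi> n w = 1" for n w
    by (auto simp: \<phi>_def)
  have \<phi>c: "continuous_on UNIV (\<phi> n)" for n unfolding \<phi>_def by (intro continuous_intros)
  have [measurable]: "\<phi> n \<in> borel_measurable borel" for n by (rule borel_measurable_continuous_onI[OF \<phi>c])
  have "(\<lambda>n. LBINT w. (h w - \<phi> n w * h w)\<^sup>2) \<longlonglongrightarrow> (\<integral>w. 0 \<partial>(lborel :: 'a measure))"
  proof (rule integral_dominated_convergence[where w="\<lambda>w. (h w)\<^sup>2"])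
    show "integrable lborel (\<lambda>w. (h w)\<^sup>2)" by (rule sq_integrableD(2)[OF h(1)])
    show "AE w in lborel. norm ((h w - \<phi> n w * h w)\<^sup>2) \<le> (h w)\<^sup>2" for n
    proof (rule AE_I2)
      fix w
      have "h w - \<phi> n w * h w = (1 - \<phi> n w) * h w" by (simp add: algebra_simps)
      moreover have "(1 - \<phi> n w)\<^sup>2 \<le> 1" using \<phi>(1,2)[of n w] by (simp add: power_le_one)
      ultimately show "norm ((h w - \<phi> n w * h w)\<^sup>2) \<le> (h w)\<^sup>2"
        by (simp add: power_mult_distrib mult_left_le_one_le)
    qed
    have "(\<lambda>n. (h w - \<phi> n w * h w)\<^sup>2) \<longlonglongrightarrow> 0" for w
    proof -
      obtain n0 where n0: "norm w \<le> real n0" using real_arch_simple by blast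
      show ?thesis
      proof (rule tendsto_eventually, rule eventually_sequentiallyI[of n0])
        fix n assume "n0 \<le> n"
        then have "\<phi> n w = 1" using n0 by (intro \<phi>(4)) (meson of_nat_le_iff order_trans)
        then show "(h w - \<phi> n w * h w)\<^sup>2 = 0" by simp
      qed
    qed
    then show "AE w in lborel. (\<lambda>n. (h w - \<phi> n w * h w)\<^sup>2) \<longlonglongrightarrow> 0" by simp
  qed measurable
  then have "\<forall>\<^sub>F n in sequentially. (LBINT w. (h w - \<phi> n w * h w)\<^sup>2) < e / 4"
    using e by (intro order_tendstoD(2)) auto
  then obtain m where m: "(LBINT w. (h w - \<phi> m w * h w)\<^sup>2) < e / 4"
    by (auto simp: eventually_sequentially)
  have "h \<in> borel_measurable lebesgue" by (rule measurable_completion) simp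
  then have "h measurable_on UNIV" by (rule lebesgue_measurable_imp_measurable_on) simp
  then obtain N G where N: "negligible N" "\<And>n. continuous_on UNIV (G n)" "\<And>x. x \<notin> N \<Longrightarrow> (\<lambda>n. G n x) \<longlonglongrightarrow> h x"
    unfolding measurable_on_def by auto
  define g where "g n w = \<phi> m w * max (- K) (min K (G n w))" for n w
  have gc: "continuous_on UNIV (g n)" for n
    unfolding g_def by (intro continuous_intros \<phi>c N(2))
  have [measurable]: "g n \<in> borel_measurable borel" for n by (rule borel_measurable_continuous_onI[OF gc])
  have gK: "\<bar>max (- K) (min K (G n w))\<bar> \<le> K" for n w using K0 by auto
  have g_le: "\<bar>g n w\<bar> \<le> K" for n w
    unfolding g_def abs_mult using \<phi>(1,2)[of m w] gK[of n w] by (intro mult_left_le_one_le[THEN order_trans]) auto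
  have g0: "g n w = 0" if "real m + 1 < norm w" for n w using \<phi>(3)[OF that] by (simp add: g_def)
  have ball: "integrable lborel (\<lambda>w::'a. indicator (cball 0 (real m + 1)) w * c)" for c :: real
    using emeasure_compact_finite[of "cball (0::'a) (real m + 1)"] by (intro integrable_mult_left) (auto simp: less_top)
  have sg: "sq_integrable lborel (g n)" for n
    unfolding sq_integrable_def
  proof
    show "integrable lborel (\<lambda>w. (g n w)\<^sup>2)"
    proof (rule Bochner_Integration.integrable_bound[OF ball[of "K\<^sup>2"]])
      have "(g n w)\<^sup>2 \<le> K\<^sup>2" for w using power_mono[OF g_le, of n w 2] by simp
      then show "AE w in lborel. norm ((g n w)\<^sup>2) \<le> norm (indicator (cball 0 (real m + 1)) w * K\<^sup>2)"
        using g0[of _ n] by (intro AE_I2) (auto simp: indicator_def)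
    qed measurable
  qed measurable
  have "(\<lambda>n. LBINT w. (\<phi> m w * h w - g n w)\<^sup>2) \<longlonglongrightarrow> (\<integral>w. 0 \<partial>(lborel :: 'a measure))"
  proof (rule integral_dominated_convergence[where w="\<lambda>w. indicator (cball 0 (real m + 1)) w * (2 * K)\<^sup>2"])
    show "integrable lborel (\<lambda>w::'a. indicator (cball 0 (real m + 1)) w * (2 * K)\<^sup>2)" by (rule ball)
    show "AE w in lborel. norm ((\<phi> m w * h w - g n w)\<^sup>2) \<le> indicator (cball 0 (real m + 1)) w * (2 * K)\<^sup>2" for n
    proof (rule AE_I2)
      fix w
      show "norm ((\<phi> m w * h w - g n w)\<^sup>2) \<le> indicator (cball 0 (real m + 1)) w * (2 * K)\<^sup>2"
      proof (cases "norm w \<le> real m + 1")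
        case True
        have "\<bar>\<phi> m w * h w\<bar> \<le> K"
          unfolding abs_mult using \<phi>(1,2)[of m w] h(2)[of w] by (intro mult_left_le_one_le[THEN order_trans]) auto
        then have "\<bar>\<phi> m w * h w - g n w\<bar> \<le> 2 * K" using g_le[of n w] by linarith
        then have "\<bar>\<phi> m w * h w - g n w\<bar>\<^sup>2 \<le> (2 * K)\<^sup>2" by (rule power_mono) simp
        then show ?thesis using True by simp
      next
        case False
        then show ?thesis using g0[of w n] \<phi>(3)[of m w] by simp
      qed
    qed
    have ae: "AE w in lborel. w \<notin> N"
      using N(1) AE_not_in[of N lebesgue] by (simp add: negligible_iff_null_sets AE_completion_iff)
    show "AE w in lborel. (\<lambda>n. (\<phi> m w * h w - g n w)\<^sup>2) \<longlonglongrightarrow> 0"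
      using ae
    proof eventually_elim
      case (elim w)
      have "(\<lambda>n. max (- K) (min K (G n w))) \<longlonglongrightarrow> max (- K) (min K (h w))"
        by (intro tendsto_intros N(3) elim)
      also have "max (- K) (min K (h w)) = h w" using h(2)[of w] by auto
      finally have "(\<lambda>n. (\<phi> m w * h w - g n w)\<^sup>2) \<longlonglongrightarrow> (\<phi> m w * h w - \<phi> m w * h w)\<^sup>2"
        unfolding g_def by (intro tendsto_intros)
      then show ?case by simp
    qed
  qed measurable
  then have "\<forall>\<^sub>F n in sequentially. (LBINT w. (\<phi> m w * h w - g n w)\<^sup>2) < e / 4"
    using e by (intro order_tendstoD(2)) auto
  then obtain n where n: "(LBINT w. (\<phi> m w * h w - g n w)\<^sup>2) < e / 4"
    by (auto simp: eventually_sequentially)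
  have s\<phi>h: "sq_integrable lborel (\<lambda>w. \<phi> m w * h w)"
    by (rule sq_integrable_bounded_times[OF h(1), of _ 1]) (use \<phi>(1,2) in auto)
  have "(LBINT w. ((h w - \<phi> m w * h w) + (\<phi> m w * h w - g n w))\<^sup>2)
      \<le> 2 * (LBINT w. (h w - \<phi> m w * h w)\<^sup>2) + 2 * (LBINT w. (\<phi> m w * h w - g n w)\<^sup>2)"
    by (rule integral_square_add_le[OF sq_integrable_diff[OF h(1) s\<phi>h] sq_integrable_diff[OF s\<phi>h sg]])
  then have "(LBINT w. (h w - g n w)\<^sup>2) \<le> e" using m n by simp
  then show thesis by (intro that[of "g n" "real m + 1"] gc g_le sg g0) auto
qed

text \<open>A continuous function of compact support is uniformly continuous, which gives the claim
  for it; passing from \<open>h\<close> to such a function costs an error that translation does not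
  change.\<close>

lemma translation_continuous_L2:
  fixes h :: "'a::euclidean_space \<Rightarrow> real"
  assumes h: "sq_integrable lborel h" "\<And>w. \<bar>h w\<bar> \<le> K" and e: "0 < e"
  obtains d where "0 < d" "\<And>r. \<bar>r\<bar> < d \<Longrightarrow> (LBINT w. (h (w - r *\<^sub>R v) - h w)\<^sup>2) \<le> e"
proof -
  have [measurable]: "h \<in> borel_measurable borel" using sq_integrableD(1)[OF h(1)] by simp
  \<comment> \<open>With tolerance e / 10 in each place, the two splittings below add up to 2 * (2 *
    e / 10 + 2 * e / 10) + 2 * e / 10 = e.\<close>
  obtain g R where g: "continuous_on UNIV g" "\<And>w. R < norm w \<Longrightarrow> g w = 0" "\<And>w. \<bar>g w\<bar> \<le> K" "0 \<le> R"
    "sq_integrable lborel g" "(LBINT w. (h w - g w)\<^sup>2) \<le> e / 10"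
    using continuous_approximation_L2[OF h, of "e / 10"] e by auto
  have [measurable]: "g \<in> borel_measurable borel" by (rule borel_measurable_continuous_onI[OF g(1)])
  let ?B = "cball (0 :: 'a) (R + 1)"
  have Bfin: "emeasure lborel ?B < \<infinity>" using emeasure_compact_finite[of ?B] by (auto simp: less_top)
  have ball: "integrable lborel (\<lambda>w::'a. indicator ?B w * c)" for c :: real
    using Bfin by (intro integrable_mult_left) auto
  define m where "m = measure lborel ?B"
  have m0: "0 \<le> m" by (simp add: m_def)
  define \<epsilon> where "\<epsilon> = sqrt (e / (10 * (m + 1)))"
  have \<epsilon>: "0 < \<epsilon>" "\<epsilon>\<^sup>2 * m \<le> e / 10"
  proof -
    show "0 < \<epsilon>" using e m0 by (simp add: \<epsilon>_def)
    have "\<epsilon>\<^sup>2 * m = e / 10 * (m / (m + 1))" using e m0 by (simp add: \<epsilon>_def field_simps)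
    also have "\<dots> \<le> e / 10 * 1" using e m0 by (intro mult_left_mono) auto
    finally show "\<epsilon>\<^sup>2 * m \<le> e / 10" by simp
  qed
  have "uniformly_continuous_on (cball 0 (R + 2)) g"
    by (rule compact_uniformly_continuous[OF continuous_on_subset[OF g(1)]]) auto
  then obtain d0 where d0: "0 < d0" "\<And>x y. x \<in> cball 0 (R + 2) \<Longrightarrow> y \<in> cball 0 (R + 2) \<Longrightarrow> dist y x < d0 \<Longrightarrow> dist (g y) (g x) < \<epsilon>"
    unfolding uniformly_continuous_on_def using \<epsilon>(1) by metis
  define d where "d = min 1 d0 / (norm v + 1)"
  have d: "0 < d" using d0(1) by (simp add: d_def add_nonneg_pos)
  have "(LBINT w. (h (w - r *\<^sub>R v) - h w)\<^sup>2) \<le> e" if r: "\<bar>r\<bar> < d" for r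
  proof -
    have nv: "norm (r *\<^sub>R v) < min 1 d0"
    proof -
      have "norm (r *\<^sub>R v) \<le> \<bar>r\<bar> * (norm v + 1)" by (simp add: algebra_simps)
      also have "\<dots> < d * (norm v + 1)" using r by (intro mult_strict_right_mono) (auto simp: add_nonneg_pos)
      also have "\<dots> = min 1 d0" by (simp add: d_def add_nonneg_eq_0_iff)
      finally show ?thesis .
    qed
    have tr: "sq_integrable lborel (\<lambda>w. f (w - r *\<^sub>R v))" "(LBINT w. (f (w - r *\<^sub>R v))\<^sup>2) = (LBINT w. (f w)\<^sup>2)"
      if f: "sq_integrable lborel f" for f :: "'a \<Rightarrow> real"
    proof -
      have [measurable]: "f \<in> borel_measurable borel" using sq_integrableD(1)[OF f] by simp
      have m2: "(\<lambda>w. (f w)\<^sup>2) \<in> borel_measurable borel" by measurable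
      show "sq_integrable lborel (\<lambda>w. f (w - r *\<^sub>R v))" "(LBINT w. (f (w - r *\<^sub>R v))\<^sup>2) = (LBINT w. (f w)\<^sup>2)"
        using integral_lborel_translate[OF m2, of "r *\<^sub>R v"] sq_integrableD(2)[OF f] by (simp_all add: sq_integrable_def)
    qed
    have shg: "sq_integrable lborel (\<lambda>w. h w - g w)" by (rule sq_integrable_diff[OF h(1) g(5)])
    have sgg: "sq_integrable lborel (\<lambda>w. g (w - r *\<^sub>R v) - g w)" by (rule sq_integrable_diff[OF tr(1)[OF g(5)] g(5)])
    have gg: "(LBINT w. (g (w - r *\<^sub>R v) - g w)\<^sup>2) \<le> e / 10"
    proof -
      have "(LBINT w. (g (w - r *\<^sub>R v) - g w)\<^sup>2) \<le> (LBINT w. indicator ?B w * \<epsilon>\<^sup>2)"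
      proof (rule integral_mono[OF sq_integrableD(2)[OF sgg] ball])
        fix w
        show "(g (w - r *\<^sub>R v) - g w)\<^sup>2 \<le> indicator ?B w * \<epsilon>\<^sup>2"
        proof (cases "w \<in> ?B")
          case True
          have "norm (w - r *\<^sub>R v) \<le> norm w + norm (r *\<^sub>R v)" by (rule norm_triangle_ineq4)
          then have "dist (g (w - r *\<^sub>R v)) (g w) < \<epsilon>"
            using True nv by (intro d0(2)) (auto simp: dist_norm norm_minus_commute)
          then have "\<bar>g (w - r *\<^sub>R v) - g w\<bar>\<^sup>2 \<le> \<epsilon>\<^sup>2" by (intro power_mono) (auto simp: dist_real_def)
          then show ?thesis using True by simp
        next
          case False
          then have "R + 1 < norm w" by simp
          moreover have "norm w \<le> norm (w - r *\<^sub>R v) + norm (r *\<^sub>R v)" by (metis diff_add_cancel norm_triangle_ineq)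
          ultimately have "g w = 0" "g (w - r *\<^sub>R v) = 0" using nv by (auto intro!: g(2))
          then show ?thesis using False by simp
        qed
      qed
      also have "\<dots> = m * \<epsilon>\<^sup>2" using Bfin by (simp add: m_def)
      also have "\<dots> \<le> e / 10" using \<epsilon>(2) by (simp add: mult.commute)
      finally show ?thesis .
    qed
    have 1: "(LBINT w. ((h (w - r *\<^sub>R v) - g (w - r *\<^sub>R v)) + (g (w - r *\<^sub>R v) - g w))\<^sup>2)
        \<le> 2 * (LBINT w. (h (w - r *\<^sub>R v) - g (w - r *\<^sub>R v))\<^sup>2) + 2 * (LBINT w. (g (w - r *\<^sub>R v) - g w)\<^sup>2)"
      by (rule integral_square_add_le[OF tr(1)[OF shg] sgg])
    have 2: "(LBINT w. ((h (w - r *\<^sub>R v) - g w) + - (h w - g w))\<^sup>2)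
        \<le> 2 * (LBINT w. (h (w - r *\<^sub>R v) - g w)\<^sup>2) + 2 * (LBINT w. (- (h w - g w))\<^sup>2)"
      by (rule integral_square_add_le[OF sq_integrable_diff[OF tr(1)[OF h(1)] g(5)] sq_integrable_uminus[OF shg]])
    have "(LBINT w. (- (h w - g w))\<^sup>2) = (LBINT w. (h w - g w)\<^sup>2)"
      by (simp only: power2_minus)
    then show ?thesis using 1 2 gg g(6) tr(2)[OF shg] e by simp
  qed
  then show thesis using d that by metis
qed

lemma dconv_approximation:
  fixes h :: "'a::euclidean_space \<Rightarrow> real"
  assumes h: "sq_integrable lborel h" "\<And>w. \<bar>h w\<bar> \<le> K"
    and d: "\<And>r. \<bar>r\<bar> < d \<Longrightarrow> (LBINT w. (h (w - r *\<^sub>R v) - h w)\<^sup>2) \<le> e"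
    and \<rho>: "integrable lborel \<rho>" "(LBINT r. \<rho> r) = 1" "(LBINT r. \<bar>\<rho> r\<bar>) = 1" "\<And>r. d \<le> \<bar>r\<bar> \<Longrightarrow> \<rho> r = 0" and e: "0 \<le> e"
  shows "(LBINT w. (dconv v \<rho> h w - h w)\<^sup>2) \<le> e"
proof -
  have [measurable]: "h \<in> borel_measurable borel" using sq_integrableD(1)[OF h(1)] by simp
  \<comment> \<open>As the kernel has mass one, the error is an average of differences of
    translates. Setting them to 0 for \<open>\<bar>r\<bar> \<ge> d\<close> changes nothing, since
    \<open>\<rho>\<close> vanishes there, and makes the bound \<open>e\<close> valid for all
    \<open>r\<close>.\<close>
  define g where "g r w = (if \<bar>r\<bar> < d then h (w - r *\<^sub>R v) - h w else 0)" for r w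
  have mg: "(\<lambda>(r, w). g r w) \<in> borel_measurable borel"
    unfolding g_def case_prod_beta' by measurable
  have m2: "(\<lambda>w. (h w)\<^sup>2) \<in> borel_measurable borel" by measurable
  have sh: "sq_integrable lborel (\<lambda>w. h (w - r *\<^sub>R v))" for r
    using integral_lborel_translate(2)[OF m2, of "r *\<^sub>R v"] sq_integrableD(2)[OF h(1)] by (simp add: sq_integrable_def)
  have gK: "\<bar>g r w\<bar> \<le> 2 * K" for r w
    using h(2)[of w] h(2)[of "w - r *\<^sub>R v"] unfolding g_def by (cases "\<bar>r\<bar> < d") auto
  have sg: "sq_integrable lborel (g r)" for r
    unfolding g_def[abs_def] using sq_integrable_diff[OF sh[of r] h(1)] by (cases "\<bar>r\<bar> < d") (auto simp: sq_integrable_def)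
  have ge: "(LBINT w. (g r w)\<^sup>2) \<le> e" for r
    using d[of r] e by (cases "\<bar>r\<bar> < d") (auto simp: g_def)
  have "dconv v \<rho> h w - h w = (LBINT r. \<rho> r * g r w)" for w
  proof -
    have "dconv v \<rho> h w - h w = (LBINT r. \<rho> r * h (w - r *\<^sub>R v)) - (LBINT r. \<rho> r * h w)"
      using \<rho>(2) by (simp add: dconv_def)
    also have "\<dots> = (LBINT r. \<rho> r * h (w - r *\<^sub>R v) - \<rho> r * h w)"
      using dconv_integrable[OF \<rho>(1), of h K w v] h(2) \<rho>(1) by simp
    also have "\<dots> = (LBINT r. \<rho> r * g r w)"
      using \<rho>(4) by (intro Bochner_Integration.integral_cong) (auto simp: g_def algebra_simps)
    finally show ?thesis .
  qed
  then show ?thesis using Minkowski_square_integral(2)[OF \<rho>(1) mg gK sg ge] \<rho>(3) by simp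
qed

subsection \<open>Vanishing of the flow\<close>

lemma slicewise_slab:
  assumes f: "slicewise f"
  shows "integrable lborel (\<lambda>w. indicator {a..b} (fst w) * (f w)\<^sup>2)"
    and "(LBINT w. indicator {a..b} (fst w) * (f w)\<^sup>2) = (LBINT \<tau>. indicator {a..b} \<tau> * (LBINT p. (f (\<tau>, p))\<^sup>2))"
    and "sq_integrable lborel (\<lambda>w. indicator {a..b} (fst w) * f w)"
    and "(LBINT w. (indicator {a..b} (fst w) * f w)\<^sup>2) = (LBINT \<tau>. indicator {a..b} \<tau> * (LBINT p. (f (\<tau>, p))\<^sup>2))"
proof -
  note [measurable] = slicewiseD(1)[OF f]
  have "integrable (lborel \<Otimes>\<^sub>M lborel) (\<lambda>(\<tau>, p). indicator {a..b} \<tau> * (f (\<tau>, p))\<^sup>2)"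
  proof (rule lborel_pair.Fubini_integrable)
    show "(\<lambda>(\<tau>, p). indicator {a..b} \<tau> * (f (\<tau>, p))\<^sup>2) \<in> borel_measurable (lborel \<Otimes>\<^sub>M lborel)" by measurable
    show "AE \<tau> in lborel. integrable lborel (\<lambda>p. case (\<tau>, p) of (\<tau>, p) \<Rightarrow> indicator {a..b} \<tau> * (f (\<tau>, p))\<^sup>2)"
      using sq_integrableD(2)[OF slicewiseD(2)[OF f]] by simp
    have "(\<lambda>\<tau>. LBINT p. norm (case (\<tau>, p) of (\<tau>, p) \<Rightarrow> indicator {a..b} \<tau> * (f (\<tau>, p))\<^sup>2)) = (\<lambda>\<tau>. indicator {a..b} \<tau> * (LBINT p. (f (\<tau>, p))\<^sup>2))"
      by (simp add: abs_mult)
    then show "integrable lborel (\<lambda>\<tau>. LBINT p. norm (case (\<tau>, p) of (\<tau>, p) \<Rightarrow> indicator {a..b} \<tau> * (f (\<tau>, p))\<^sup>2))"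
      using slicewise_energy_integrable[OF f, of a b] by simp
  qed
  then show i: "integrable lborel (\<lambda>w. indicator {a..b} (fst w) * (f w)\<^sup>2)"
    by (simp add: lborel_prod case_prod_beta')
  show e: "(LBINT w. indicator {a..b} (fst w) * (f w)\<^sup>2) = (LBINT \<tau>. indicator {a..b} \<tau> * (LBINT p. (f (\<tau>, p))\<^sup>2))"
    using integral_lborel_pair(1)[OF i] by simp
  have sq: "(\<lambda>w. (indicator {a..b} (fst w) * f w)\<^sup>2) = (\<lambda>w. indicator {a..b} (fst w) * (f w)\<^sup>2)"
    by (auto simp: indicator_def fun_eq_iff)
  show "sq_integrable lborel (\<lambda>w. indicator {a..b} (fst w) * f w)"
    using i by (simp add: sq_integrable_def sq)
  show "(LBINT w. (indicator {a..b} (fst w) * f w)\<^sup>2) = (LBINT \<tau>. indicator {a..b} \<tau> * (LBINT p. (f (\<tau>, p))\<^sup>2))"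
    using e by (simp add: sq)
qed

text \<open>The kernel reaches back in time by less than 1, so from a + 1 on the mollified function
  sees only the slab \<open>{a..b}\<close>. The truncation to the slab is square integrable over
  space-time, as the approximation results require.\<close>

lemma dconv_slab_cong:
  fixes f :: "real \<times> real \<times> real \<Rightarrow> real" and \<rho> :: "real \<Rightarrow> real" and a b t x y :: real
  assumes "\<And>r. r \<notin> {0<..<1} \<Longrightarrow> \<rho> r = 0" "t \<in> {a + 1..b}"
  shows "dconv (0, 1, 0) \<rho> (dconv (1, 0, 0) \<rho> f) (t, x, y)
    = dconv (0, 1, 0) \<rho> (dconv (1, 0, 0) \<rho> (\<lambda>w. indicator {a..b} (fst w) * f w)) (t, x, y)"
proof -
  have "\<rho> r * f (t - r, q, y) = \<rho> r * (indicator {a..b} (t - r) * f (t - r, q, y))" for r q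
    using assms(1)[of r] assms(2) by (cases "r \<in> {0<..<1}") auto
  then have "(LBINT r. \<rho> r * f (t - r, q, y)) = (LBINT r. \<rho> r * (indicator {a..b} (t - r) * f (t - r, q, y)))" for q
    by (intro Bochner_Integration.integral_cong refl)
  then show ?thesis unfolding dconv_def by simp
qed

text \<open>The distance \<open>d\<close> depends on \<open>f\<close>, \<open>S\<close> and
  \<open>e\<close> but not on the kernel, so one kernel can serve several functions at once. Time
  and \<open>x\<close> contribute an error e / 4 each, and adding the two squares doubles
  them.\<close>

lemma mollification_slab:
  assumes f: "slicewise f" and e: "0 < e"
  obtains d where "0 < d" "\<And>\<rho>. integrable lborel \<rho> \<Longrightarrow> (LBINT r. \<rho> r) = 1 \<Longrightarrow> (LBINT r. \<bar>\<rho> r\<bar>) = 1 \<Longrightarrow>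
      (\<And>r. r \<notin> {0<..<1} \<Longrightarrow> \<rho> r = 0) \<Longrightarrow> (\<And>r. d \<le> \<bar>r\<bar> \<Longrightarrow> \<rho> r = 0) \<Longrightarrow>
      (LBINT \<tau>. indicator {-S..0} \<tau> * (LBINT p. (dconv (0, 1, 0) \<rho> (dconv (1, 0, 0) \<rho> f) (\<tau>, p) - f (\<tau>, p))\<^sup>2)) \<le> e"
proof -
  define h where "h w = indicator {- S - 1..0} (fst w) * f w" for w
  have h: "sq_integrable lborel h" unfolding h_def[abs_def] by (rule slicewise_slab(3)[OF f])
  obtain K where K: "\<And>w. \<bar>f w\<bar> \<le> K" "0 \<le> K" using slicewise_bounded[OF f] by metis
  have hK: "\<bar>h w\<bar> \<le> K" for w using K by (auto simp: h_def indicator_def)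
  have mh [measurable]: "h \<in> borel_measurable borel" using sq_integrableD(1)[OF h] by simp
  obtain d1 where d1: "0 < d1" "\<And>r. \<bar>r\<bar> < d1 \<Longrightarrow> (LBINT w. (h (w - r *\<^sub>R (1, 0, 0)) - h w)\<^sup>2) \<le> e / 4"
    using translation_continuous_L2[OF h hK, where e="e / 4" and v="(1, 0, 0)"] e by auto
  obtain d2 where d2: "0 < d2" "\<And>r. \<bar>r\<bar> < d2 \<Longrightarrow> (LBINT w. (h (w - r *\<^sub>R (0, 1, 0)) - h w)\<^sup>2) \<le> e / 4"
    using translation_continuous_L2[OF h hK, where e="e / 4" and v="(0, 1, 0)"] e by auto
  show thesis
  proof (rule that[of "min d1 d2"])
    show "0 < min d1 d2" using d1 d2 by simp
    fix \<rho> :: "real \<Rightarrow> real"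
    assume \<rho>: "integrable lborel \<rho>" "(LBINT r. \<rho> r) = 1" "(LBINT r. \<bar>\<rho> r\<bar>) = 1"
      "\<And>r. r \<notin> {0<..<1} \<Longrightarrow> \<rho> r = 0" "\<And>r. min d1 d2 \<le> \<bar>r\<bar> \<Longrightarrow> \<rho> r = 0"
    let ?T = "dconv (1, 0, 0) \<rho>" and ?X = "dconv (0, 1, 0) \<rho>"
    have Th: "sq_integrable lborel (?T h)" by (rule dconv_L2[OF \<rho>(1) h hK])
    have ThK: "\<bar>?T h w\<bar> \<le> K" for w using dconv_bound[OF \<rho>(1) mh hK, where v="(1,0,0)" and w=w] \<rho>(3) by simp
    have mT [measurable]: "?T h \<in> borel_measurable borel" using sq_integrableD(1)[OF Th] by simp
    have a1: "(LBINT w. (?T h w - h w)\<^sup>2) \<le> e / 4"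
      by (rule dconv_approximation[OF h hK d1(2), of "min d1 d2"]) (use \<rho> e in auto)
    have a2: "(LBINT w. (?X h w - h w)\<^sup>2) \<le> e / 4"
      by (rule dconv_approximation[OF h hK d2(2), of "min d1 d2"]) (use \<rho> e in auto)
    have sk: "sq_integrable lborel (\<lambda>w. ?T h w - h w)" by (rule sq_integrable_diff[OF Th h])
    have kK: "\<bar>?T h w - h w\<bar> \<le> 2 * K" for w using ThK[of w] hK[of w] by linarith
    have Xk: "?X (?T h) w - ?X h w = ?X (\<lambda>w. ?T h w - h w) w" for w
      unfolding dconv_def[of "(0,1,0)" \<rho>]
      using dconv_integrable[OF \<rho>(1) mT ThK, where v="(0,1,0)" and w=w] dconv_integrable[OF \<rho>(1) mh hK, where v="(0,1,0)" and w=w]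
      by (simp add: right_diff_distrib)
    have Xs: "sq_integrable lborel (?X (\<lambda>w. ?T h w - h w))" by (rule dconv_L2[OF \<rho>(1) sk kK])
    have XTs: "sq_integrable lborel (\<lambda>w. ?X h w - h w)"
      by (rule sq_integrable_diff[OF dconv_L2(1)[OF \<rho>(1) h hK] h])
    have "(LBINT w. (?X (\<lambda>w. ?T h w - h w) w)\<^sup>2) \<le> e / 4"
      using dconv_L2(2)[OF \<rho>(1) sk kK, where v="(0,1,0)"] a1 \<rho>(3) by simp
    moreover have "(LBINT w. (?X (\<lambda>w. ?T h w - h w) w + (?X h w - h w))\<^sup>2)
        \<le> 2 * (LBINT w. (?X (\<lambda>w. ?T h w - h w) w)\<^sup>2) + 2 * (LBINT w. (?X h w - h w)\<^sup>2)"
      by (rule integral_square_add_le[OF Xs XTs])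
    ultimately have le: "(LBINT w. (?X (?T h) w - h w)\<^sup>2) \<le> e"
      using a2 by (simp add: Xk[symmetric])
    have sXT: "sq_integrable lborel (\<lambda>w. ?X (?T h) w - h w)"
      by (rule sq_integrable_diff[OF dconv_L2(1)[OF \<rho>(1) Th ThK] h])
    have swf: "slicewise (\<lambda>w. ?X (?T f) w - f w)"
      by (intro slicewise_diff slicewise_dconv \<rho> f)
    have "(LBINT \<tau>. indicator {-S..0} \<tau> * (LBINT p. (?X (?T f) (\<tau>, p) - f (\<tau>, p))\<^sup>2))
        = (LBINT w. indicator {-S..0} (fst w) * (?X (?T f) w - f w)\<^sup>2)"
      by (rule slicewise_slab(2)[OF swf, symmetric])
    also have "\<dots> \<le> (LBINT w. (?X (?T h) w - h w)\<^sup>2)"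
    proof (rule integral_mono[OF slicewise_slab(1)[OF swf] sq_integrableD(2)[OF sXT]])
      fix w :: "real \<times> real \<times> real"
      obtain t x y where w: "w = (t, x, y)" by (cases w)
      show "indicator {-S..0} (fst w) * (?X (?T f) w - f w)\<^sup>2 \<le> (?X (?T h) w - h w)\<^sup>2"
      proof (cases "t \<in> {-S..0}")
        case True
        then have "?X (?T f) w = ?X (?T h) w"
          unfolding w h_def[abs_def] by (intro dconv_slab_cong \<rho>(4)) auto
        then show ?thesis using True by (simp add: w h_def)
      qed (simp add: w)
    qed
    finally show "(LBINT \<tau>. indicator {-S..0} \<tau> * (LBINT p. (?X (?T f) (\<tau>, p) - f (\<tau>, p))\<^sup>2)) \<le> e"
      using le by linarith
  qed
qed

text \<open>Mollification leaves \<open>y\<close> alone, hence commutes with the restriction to y >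
  L, and as a contraction it does not enlarge the tail. The right-hand side is free of the kernel,
  so \<open>L\<close> can be fixed before the kernel.\<close>

lemma mollification_tail:
  assumes f: "slicewise f"
    and \<rho>: "integrable lborel \<rho>" "(LBINT r. \<bar>\<rho> r\<bar>) = 1" "\<And>r. r \<notin> {0<..<1} \<Longrightarrow> \<rho> r = 0"
  shows "(LBINT \<tau>. indicator {-2..-1} \<tau> * (LBINT p. (indicator {L<..} (snd p) * dconv (0, 1, 0) \<rho> (dconv (1, 0, 0) \<rho> f) (\<tau>, p))\<^sup>2))
    \<le> (LBINT w. (indicator {-3..0} (fst w) * (indicator {L<..} (snd (snd w)) * f w))\<^sup>2)"
proof -
  let ?T = "dconv (1, 0, 0) \<rho>" and ?X = "dconv (0, 1, 0) \<rho>"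
  have i1: "\<bar>indicator {L<..} x :: real\<bar> \<le> 1" for x by (simp add: indicator_def)
  define fL where "fL w = indicator {L<..} (snd (snd w)) * f w" for w
  have fL: "slicewise fL" unfolding fL_def[abs_def]
    by (rule slicewise_bounded_times[OF f _ i1]) measurable
  define h where "h w = indicator {-3..0} (fst w) * fL w" for w
  have h: "sq_integrable lborel h" unfolding h_def[abs_def] by (rule slicewise_slab(3)[OF fL])
  obtain K where K: "\<And>w. \<bar>fL w\<bar> \<le> K" "0 \<le> K" using slicewise_bounded[OF fL] by metis
  have hK: "\<bar>h w\<bar> \<le> K" for w using K by (auto simp: h_def indicator_def)
  have mh [measurable]: "h \<in> borel_measurable borel" using sq_integrableD(1)[OF h] by simp
  have Th: "sq_integrable lborel (?T h)" by (rule dconv_L2[OF \<rho>(1) h hK])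
  have ThK: "\<bar>?T h w\<bar> \<le> K" for w using dconv_bound[OF \<rho>(1) mh hK, where v="(1,0,0)" and w=w] \<rho>(2) by simp
  have XTh: "sq_integrable lborel (?X (?T h))" by (rule dconv_L2[OF \<rho>(1) Th ThK])
  have le: "(LBINT w. (?X (?T h) w)\<^sup>2) \<le> (LBINT w. (h w)\<^sup>2)"
    using dconv_L2(2)[OF \<rho>(1) h hK, where v="(1,0,0)"] dconv_L2(2)[OF \<rho>(1) Th ThK, where v="(0,1,0)"] \<rho>(2) by simp
  have sw: "slicewise (\<lambda>w. indicator {L<..} (snd (snd w)) * ?X (?T f) w)"
    by (rule slicewise_bounded_times[OF slicewise_dconv[OF \<rho>(1) slicewise_dconv[OF \<rho>(1) f]] _ i1]) measurable
  have "(LBINT \<tau>. indicator {-2..-1} \<tau> * (LBINT p. (indicator {L<..} (snd p) * ?X (?T f) (\<tau>, p))\<^sup>2))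
      = (LBINT w. indicator {-2..-1} (fst w) * (indicator {L<..} (snd (snd w)) * ?X (?T f) w)\<^sup>2)"
    using slicewise_slab(2)[OF sw, of "-2" "-1"] by simp
  also have "\<dots> \<le> (LBINT w. (?X (?T h) w)\<^sup>2)"
  proof (rule integral_mono[OF slicewise_slab(1)[OF sw] sq_integrableD(2)[OF XTh]])
    fix w :: "real \<times> real \<times> real"
    obtain t x y where w: "w = (t, x, y)" by (cases w)
    show "indicator {-2..-1} (fst w) * (indicator {L<..} (snd (snd w)) * ?X (?T f) w)\<^sup>2 \<le> (?X (?T h) w)\<^sup>2"
    proof (cases "t \<in> {-2..-1}")
      case True
      then have "?X (?T fL) w = ?X (?T h) w"
        unfolding w h_def[abs_def] by (intro dconv_slab_cong \<rho>(3)) auto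
      moreover have "?X (?T fL) w = indicator {L<..} y * ?X (?T f) w"
        by (simp add: w dconv_def fL_def mult.left_commute[of _ "indicator {L<..} y"])
      ultimately show ?thesis using True by (simp add: w)
    qed (simp add: w)
  qed
  finally show ?thesis using le by (simp add: h_def fL_def)
qed

lemma tail_tendsto_0:
  assumes f: "slicewise f"
  shows "(\<lambda>n. LBINT w. (indicator {-3..0} (fst w) * (indicator {real n<..} (snd (snd w)) * f w))\<^sup>2) \<longlonglongrightarrow> 0"
proof -
  note [measurable] = slicewiseD(1)[OF f]
  have "(\<lambda>n. LBINT w. (indicator {-3..0} (fst w) * (indicator {real n<..} (snd (snd w)) * f w))\<^sup>2) \<longlonglongrightarrow> (\<integral>w. 0 \<partial>(lborel :: (real \<times> real \<times> real) measure))"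
  proof (rule integral_dominated_convergence[where w="\<lambda>w. indicator {-3..0} (fst w) * (f w)\<^sup>2"])
    show "integrable lborel (\<lambda>w. indicator {-3..0} (fst w) * (f w)\<^sup>2)" by (rule slicewise_slab(1)[OF f])
    show "AE w in lborel. norm ((indicator {-3..0} (fst w) * (indicator {real n<..} (snd (snd w)) * f w))\<^sup>2) \<le> indicator {-3..0} (fst w) * (f w)\<^sup>2" for n
      by (rule AE_I2) (auto simp: indicator_def)
    have "(\<lambda>n. (indicator {-3..0} (fst w) * (indicator {real n<..} (snd (snd w)) * f w))\<^sup>2) \<longlonglongrightarrow> 0" for w
    proof -
      obtain n0 where n0: "snd (snd w) \<le> real n0" using real_arch_simple by blast
      show ?thesis
      proof (rule tendsto_eventually, rule eventually_sequentiallyI[of n0])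
        fix n assume "n0 \<le> n"
        then have "snd (snd w) \<le> real n" using n0 by (meson of_nat_le_iff order_trans)
        then show "(indicator {-3..0} (fst w) * (indicator {real n<..} (snd (snd w)) * f w))\<^sup>2 = 0" by simp
      qed
    qed
    then show "AE w in lborel. (\<lambda>n. (indicator {-3..0} (fst w) * (indicator {real n<..} (snd (snd w)) * f w))\<^sup>2) \<longlonglongrightarrow> 0" by simp
  qed measurable
  then show ?thesis by simp
qed

text \<open>The density of the smooth step, moved from \<open>{0..1}\<close> to
  \<open>{d / 2..d}\<close>. Keeping it away from 0 provides the gap \<open>\<delta>\<close> of
  \<open>mollified_flow\<close>.\<close>

lemma unit_kernel_exists:
  assumes "0 < d" "d \<le> 1"
  obtains \<rho> :: "real \<Rightarrow> real" where "test_fun \<rho>" "\<And>x. 0 \<le> \<rho> x" "(LBINT x. \<rho> x) = 1" "\<And>x. x < d / 2 \<Longrightarrow> \<rho> x = 0" "\<And>x. d \<le> x \<Longrightarrow> \<rho> x = 0"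
proof -
  obtain \<sigma> \<beta> :: "real \<Rightarrow> real" where \<sigma>: "smooth \<beta>" "\<And>x. (\<sigma> has_real_derivative \<beta> x) (at x)"
    "\<And>x. x \<le> 0 \<Longrightarrow> \<sigma> x = 0" "\<And>x. 1 \<le> x \<Longrightarrow> \<sigma> x = 1" "\<And>x. 0 \<le> \<beta> x" "\<And>x. x \<le> 0 \<Longrightarrow> \<beta> x = 0" "\<And>x. 1 \<le> x \<Longrightarrow> \<beta> x = 0"
    by (rule smooth_step_exists) metis
  have t: "test_fun \<beta>" unfolding test_fun_def
  proof (intro conjI \<sigma>(1) exI[of _ 1] allI impI)
    show "\<beta> x = 0" if "1 < \<bar>x\<bar>" for x using \<sigma>(6,7)[of x] that by linarith
  qed
  have "(LBINT x. indicator {0..1} x * \<beta> x) = \<sigma> 1 - \<sigma> 0"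
    using primitiveD(3)[OF primitive_DERIV[OF \<sigma>(2) smoothD(3)[OF \<sigma>(1)]], of 0 1] by simp
  moreover have "(\<lambda>x. indicator {0..1} x * \<beta> x) = \<beta>"
  proof
    show "indicator {0..1} x * \<beta> x = \<beta> x" for x
      using \<sigma>(6,7)[of x] by (cases "x \<le> 0 \<or> 1 \<le> x") (auto simp: indicator_def)
  qed
  ultimately have i: "(LBINT x. \<beta> x) = 1" using \<sigma>(3)[of 0] \<sigma>(4)[of 1] by simp
  define \<rho> where "\<rho> x = (2 / d) * \<beta> (- 1 + (2 / d) * x)" for x
  show thesis
  proof (rule that[of \<rho>])
    show "test_fun \<rho>"
      using test_fun_affine[OF t, of "2 / d" "-1"] assms smooth_cmult[of "\<lambda>x. \<beta> (- 1 + (2 / d) * x)" "2 / d"]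
      by (auto simp: test_fun_def \<rho>_def[abs_def])
    show "0 \<le> \<rho> x" for x using \<sigma>(5) assms by (simp add: \<rho>_def)
    show "(LBINT x. \<rho> x) = 1"
      using lborel_integral_real_affine[of "2 / d" \<beta> "-1"] assms i by (simp add: \<rho>_def)
    show "\<rho> x = 0" if "x < d / 2" for x using that assms \<sigma>(6)[of "- 1 + (2 / d) * x"] by (simp add: \<rho>_def field_simps)
    show "\<rho> x = 0" if "d \<le> x" for x using that assms \<sigma>(7)[of "- 1 + (2 / d) * x"] by (simp add: \<rho>_def field_simps)
  qed
qed

section \<open>Smallness of the energy and the choice of parameters\<close>

context unit_mollified_flow
begin

text \<open>Each summand compares one function with its own mollification, so
  \<open>mollification_slab\<close> applies to it directly. That is not so for
  \<open>residual\<close>, which compares mollified products with products of mollified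
  factors.\<close>

definition "defect t = (LBINT p. (U1 (t, p) - u1 (t, p))\<^sup>2) + (LBINT p. (U2 (t, p) - u2 (t, p))\<^sup>2)
    + (LBINT p. (PP (t, p) - P (t, p))\<^sup>2) + (LBINT p. (DD (t, p) - D (t, p))\<^sup>2)"

lemma slicewise_defect: "slicewise (\<lambda>w. U1 w - u1 w)" "slicewise (\<lambda>w. U2 w - u2 w)" "slicewise (\<lambda>w. PP w - P w)" "slicewise (\<lambda>w. DD w - D w)"
  by (intro slicewise_diff slicewise_flow slicewise_u slicewise_PD)+

lemma defect_integrable: "integrable lborel (\<lambda>\<tau>. indicator {a..b} \<tau> * defect \<tau>)"
  unfolding defect_def distrib_left
  by (intro Bochner_Integration.integrable_add slicewise_energy_integrable slicewise_defect)

text \<open>The original factors are exchanged for mollified ones one at a time, the accompanying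
  factors being bounded because all components are at most 1. The velocity defects receive the
  coefficient 3 + 3 * 4 = 15, rounded up to 16.\<close>

lemma residual_le: "residual t \<le> 16 * defect t"
proof -
  define a b c e where "a p = U1 (t, p) - u1 (t, p)" and "b p = U2 (t, p) - u2 (t, p)"
    and "c p = PP (t, p) - P (t, p)" and "e p = DD (t, p) - D (t, p)" for p
  have sq: "sq_integrable lborel a" "sq_integrable lborel b" "sq_integrable lborel c" "sq_integrable lborel e"
    unfolding a_def[abs_def] b_def[abs_def] c_def[abs_def] e_def[abs_def]
    using slicewiseD(2)[OF slicewise_defect(1)] slicewiseD(2)[OF slicewise_defect(2)]
      slicewiseD(2)[OF slicewise_defect(3)] slicewiseD(2)[OF slicewise_defect(4)] by auto
  note i = sq[THEN sq_integrableD(2)]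
  have three: "(x + y + z)\<^sup>2 \<le> 3 * (x\<^sup>2 + y\<^sup>2 + z\<^sup>2)" for x y z :: real
  proof -
    have "3 * (x\<^sup>2 + y\<^sup>2 + z\<^sup>2) - (x + y + z)\<^sup>2 = (x - y)\<^sup>2 + (y - z)\<^sup>2 + (x - z)\<^sup>2"
      by (simp add: power2_eq_square algebra_simps)
    then show ?thesis using zero_le_power2[of "x - y"] zero_le_power2[of "y - z"] zero_le_power2[of "x - z"] by linarith
  qed
  have U1: "\<bar>U1 w\<bar> \<le> 1" and U2: "\<bar>U2 w\<bar> \<le> 1" for w
    using cv_le_1[OF slicewiseD(1)[OF slicewise_u(1)] u_le_1(1)] cv_le_1[OF slicewiseD(1)[OF slicewise_u(2)] u_le_1(2)] by auto
  have mono: "(x * y)\<^sup>2 \<le> k\<^sup>2 * y\<^sup>2" if "\<bar>x\<bar> \<le> k" for x y k :: real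
    using power_mono[OF that, of 2] by (simp add: power_mult_distrib mult_right_mono)
  have p1: "(PP (t, p) - U1 (t, p) * U2 (t, p))\<^sup>2 \<le> 3 * ((c p)\<^sup>2 + (b p)\<^sup>2 + (a p)\<^sup>2)" for p
  proof -
    have "PP (t, p) - U1 (t, p) * U2 (t, p) = c p + (- u1 (t, p)) * b p + (- U2 (t, p)) * a p"
      by (simp add: a_def b_def c_def P_def algebra_simps)
    then have "(PP (t, p) - U1 (t, p) * U2 (t, p))\<^sup>2 \<le> 3 * ((c p)\<^sup>2 + ((- u1 (t, p)) * b p)\<^sup>2 + ((- U2 (t, p)) * a p)\<^sup>2)"
      by (simp only: three)
    also have "\<dots> \<le> 3 * ((c p)\<^sup>2 + 1\<^sup>2 * (b p)\<^sup>2 + 1\<^sup>2 * (a p)\<^sup>2)"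
      by (intro mult_left_mono add_mono mono order_refl) (use u_le_1 U2 in auto)
    finally show ?thesis by simp
  qed
  have p2: "(DD (t, p) - ((U1 (t, p))\<^sup>2 - (U2 (t, p))\<^sup>2))\<^sup>2 \<le> 3 * ((e p)\<^sup>2 + 4 * (a p)\<^sup>2 + 4 * (b p)\<^sup>2)" for p
  proof -
    have "DD (t, p) - ((U1 (t, p))\<^sup>2 - (U2 (t, p))\<^sup>2) = e p + (- (u1 (t, p) + U1 (t, p))) * a p + (u2 (t, p) + U2 (t, p)) * b p"
      by (simp add: a_def b_def e_def D_def power2_eq_square algebra_simps)
    then have "(DD (t, p) - ((U1 (t, p))\<^sup>2 - (U2 (t, p))\<^sup>2))\<^sup>2 \<le> 3 * ((e p)\<^sup>2 + ((- (u1 (t, p) + U1 (t, p))) * a p)\<^sup>2 + ((u2 (t, p) + U2 (t, p)) * b p)\<^sup>2)"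
      by (simp only: three)
    also have "\<dots> \<le> 3 * ((e p)\<^sup>2 + 2\<^sup>2 * (a p)\<^sup>2 + 2\<^sup>2 * (b p)\<^sup>2)"
    proof (intro mult_left_mono add_mono mono order_refl)
      show "\<bar>- (u1 (t, p) + U1 (t, p))\<bar> \<le> 2" "\<bar>u2 (t, p) + U2 (t, p)\<bar> \<le> 2"
        using u_le_1(1)[of "(t, p)"] U1[of "(t, p)"] u_le_1(2)[of "(t, p)"] U2[of "(t, p)"] by linarith+
    qed simp
    finally show ?thesis by simp
  qed
  have "(LBINT p. (PP (t, p) - U1 (t, p) * U2 (t, p))\<^sup>2) \<le> (LBINT p. 3 * ((c p)\<^sup>2 + (b p)\<^sup>2 + (a p)\<^sup>2))"
    by (rule integral_mono[OF sq_integrableD(2)[OF slicewiseD(2)[OF slicewise_residual(1)]] _ p1]) (use i in simp)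
  moreover have "(LBINT p. (DD (t, p) - ((U1 (t, p))\<^sup>2 - (U2 (t, p))\<^sup>2))\<^sup>2) \<le> (LBINT p. 3 * ((e p)\<^sup>2 + 4 * (a p)\<^sup>2 + 4 * (b p)\<^sup>2))"
    by (rule integral_mono[OF sq_integrableD(2)[OF slicewiseD(2)[OF slicewise_residual(2)]] _ p2]) (use i in simp)
  ultimately have "residual t \<le> 15 * (LBINT p. (a p)\<^sup>2) + 15 * (LBINT p. (b p)\<^sup>2) + 3 * (LBINT p. (c p)\<^sup>2) + 3 * (LBINT p. (e p)\<^sup>2)"
    using i unfolding residual_def by simp
  moreover have "defect t = (LBINT p. (a p)\<^sup>2) + (LBINT p. (b p)\<^sup>2) + (LBINT p. (c p)\<^sup>2) + (LBINT p. (e p)\<^sup>2)"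
    by (simp add: defect_def a_def b_def c_def e_def)
  moreover have "0 \<le> (LBINT p. (a p)\<^sup>2)" "0 \<le> (LBINT p. (b p)\<^sup>2)" "0 \<le> (LBINT p. (c p)\<^sup>2)" "0 \<le> (LBINT p. (e p)\<^sup>2)" by simp_all
  ultimately show ?thesis by linarith
qed

text \<open>Since \<open>dissipation\<close> is integrable on \<open>(-\<infinity>, 0)\<close> and \<open>1 / \<bar>s\<bar>\<close> is not, there are times at which the
  flow is small in the scale invariant sense.\<close>

lemma exists_small_dissipation:
  assumes K: "0 < K" and \<kappa>: "0 < \<kappa>" and S: "S = K * exp ((2 * C + 5) / \<kappa>)"
    and r: "4 * (LBINT \<tau>. indicator {-S..-K} \<tau> * residual \<tau>) \<le> 4"
  obtains s where "- S \<le> s" "s \<le> - K" "(- s) * dissipation s \<le> \<kappa>"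
proof -
  have SK: "K \<le> S" using K \<kappa> C_nonneg by (simp add: S)
  have "\<exists>s\<in>{-S..-K}. (- s) * dissipation s \<le> \<kappa>"
  proof (rule ccontr)
    assume "\<not> ?thesis"
    then have less: "\<kappa> < (- s) * dissipation s" if "s \<in> {-S..-K}" for s using that by force
    have cont: "isCont (\<lambda>s. \<kappa> / (- s)) x" if "x \<le> - K" for x using that K by (auto intro!: continuous_intros)
    have der: "((\<lambda>s. - \<kappa> * ln (- s)) has_real_derivative \<kappa> / (- x)) (at x)" if "x \<le> - K" for x
      using that K by (auto intro!: derivative_eq_intros simp: field_simps)
    \<comment> \<open>The choice of \<open>S\<close> makes \<kappa> ln (S / K) equal to 2 C + 5,
      more than the 2 C + 4 that the energy inequality leaves for the dissipation on the
      window.\<close>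
    have 1: "(LBINT s. (\<kappa> / (- s)) * indicator {-S..-K} s) = - \<kappa> * ln K - (- \<kappa> * ln S)"
      using integral_FTC_Icc_real[of "-S" "-K" "\<lambda>s. - \<kappa> * ln (- s)" "\<lambda>s. \<kappa> / (- s)"] SK der cont by simp
    have "(LBINT s. (\<kappa> / (- s)) * indicator {-S..-K} s) \<le> (LBINT \<tau>. indicator {-S..-K} \<tau> * dissipation \<tau>)"
    proof (rule integral_mono')
      show "integrable lborel (\<lambda>\<tau>. indicator {-S..-K} \<tau> * dissipation \<tau>)" by (rule dissipation_integrable)
      show "0 \<le> indicator {-S..-K} s * dissipation s" for s using dissipation_nonneg by simp
      show "(\<kappa> / (- s)) * indicator {-S..-K} s \<le> indicator {-S..-K} s * dissipation s" for s
      proof (cases "s \<in> {-S..-K}")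
        case True
        then have "0 < - s" using K by simp
        then have "\<kappa> / (- s) \<le> dissipation s" using less[OF True] by (subst pos_divide_le_eq) (auto simp: mult.commute)
        then show ?thesis using True by simp
      qed simp
    qed
    also have "\<dots> \<le> energy (- S) + 4"
      using energy_inequality[of "-S" "-K"] SK K r energy_le(2)[of "-K"] by simp
    also have "\<dots> \<le> 2 * C + 4" using energy_le(1)[of "-S"] by simp
    finally have "\<kappa> * (ln S - ln K) \<le> 2 * C + 4" using 1 by (simp add: algebra_simps)
    moreover have "ln S - ln K = (2 * C + 5) / \<kappa>" using K by (simp add: S ln_mult)
    ultimately show False using \<kappa> by simp
  qed
  then show thesis using that by auto
qed

text \<open>The selected time s lies in \<open>{-S..-K}\<close>, thus before \<open>t\<close> and,
  as 3 \<le> K, before the interval \<open>{-2..-1}\<close>. The estimate at s is averaged over that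
  interval because the tails are controlled only after integration in time. From s to
  \<open>t\<close> the energy grows by at most 4 * 16 \<epsilon>.\<close>

lemma energy_small:
  assumes K: "3 \<le> K" and \<kappa>: "0 < \<kappa>" and S: "S = K * exp ((2 * C + 5) / \<kappa>)"
    and r: "(LBINT \<tau>. indicator {-S..0} \<tau> * defect \<tau>) \<le> \<epsilon>" "16 * \<epsilon> \<le> 1"
    and \<mu>: "0 < \<mu>" and l: "0 < l" and L: "0 \<le> L"
    and tail: "(LBINT \<tau>. indicator {-2..-1} \<tau> * (LBINT p. (indicator {L<..} (snd p) * U1 (\<tau>, p))\<^sup>2)) \<le> T1"
      "(LBINT \<tau>. indicator {-2..-1} \<tau> * (LBINT p. (indicator {L<..} (snd p) * U2 (\<tau>, p))\<^sup>2)) \<le> T2"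
    and t: "- K \<le> t" "t < 0"
  shows "energy t \<le> 4 * C * \<mu> + (T1 + T2 + L\<^sup>2 * \<kappa>) / (4 * \<mu>) + l * (4 + (64 * C + 2) * (2 * C + 4)) + \<kappa> / l + 64 * \<epsilon>"
proof -
  have K0: "0 < K" using K by simp
  have SK: "K \<le> S" using K0 \<kappa> C_nonneg by (simp add: S)
  have rr: "(LBINT \<tau>. indicator {a..b} \<tau> * residual \<tau>) \<le> 16 * \<epsilon>" if "- S \<le> a" "b \<le> 0" for a b
  proof -
    have "(LBINT \<tau>. indicator {a..b} \<tau> * residual \<tau>) \<le> (LBINT \<tau>. 16 * (indicator {-S..0} \<tau> * defect \<tau>))"
    proof (rule integral_mono[OF residual_integrable integrable_mult_right[OF defect_integrable]])
      fix \<tau>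
      have "0 \<le> defect \<tau>" using residual_le[of \<tau>] residual_nonneg[of \<tau>] by linarith
      then show "indicator {a..b} \<tau> * residual \<tau> \<le> 16 * (indicator {-S..0} \<tau> * defect \<tau>)"
        using that residual_le[of \<tau>] by (cases "\<tau> \<in> {a..b}") auto
    qed
    also have "\<dots> \<le> 16 * \<epsilon>" using r(1) by simp
    finally show ?thesis .
  qed
  have "4 * (LBINT \<tau>. indicator {-S..-K} \<tau> * residual \<tau>) \<le> 4"
    using rr[of "-S" "-K"] r(2) K0 by simp
  then obtain s where s: "- S \<le> s" "s \<le> - K" "(- s) * dissipation s \<le> \<kappa>"
    using exists_small_dissipation[OF K0 \<kappa> S] by metis
  have s0: "s < 0" using s K by linarith
  have ds: "dissipation s \<le> \<kappa>"
  proof -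
    have "1 * dissipation s \<le> (- s) * dissipation s" using s K dissipation_nonneg by (intro mult_right_mono) auto
    then show ?thesis using s(3) by simp
  qed
  define B where "B = 4 * C * \<mu> + L\<^sup>2 * \<kappa> / (4 * \<mu>) + l * (4 + (64 * C + 2) * (2 * C + 4)) + \<kappa> / l"
  define \<theta>1 \<theta>2 where "\<theta>1 \<tau> = (LBINT p. (indicator {L<..} (snd p) * U1 (\<tau>, p))\<^sup>2)"
    and "\<theta>2 \<tau> = (LBINT p. (indicator {L<..} (snd p) * U2 (\<tau>, p))\<^sup>2)" for \<tau>
  \<comment> \<open>The dissipation between \<open>s\<close> and \<open>\<tau>\<close> is at most 2
    C + 4 by the energy inequality and is multiplied by the small \<open>l\<close>; the large 1 / l
    only meets \<open>\<kappa>\<close>.\<close>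
  have key: "energy s \<le> B + (\<theta>1 \<tau> + \<theta>2 \<tau>) / (4 * \<mu>)" if \<tau>: "\<tau> \<in> {-2..-1}" for \<tau>
  proof -
    have st: "s \<le> \<tau>" and \<tau>0: "\<tau> < 0" using \<tau> s K by auto
    define I J where "I = (LBINT \<tau>'. indicator {s..\<tau>} \<tau>' * residual \<tau>')" and "J = (LBINT \<tau>'. indicator {s..\<tau>} \<tau>' * dissipation \<tau>')"
    have I: "I \<le> 1" unfolding I_def using rr[of s \<tau>] s \<tau>0 r(2) by simp
    have "energy \<tau> + J \<le> energy s + 4 * I" unfolding I_def J_def by (rule energy_inequality[OF st \<tau>0])
    then have J: "J \<le> 2 * C + 4" using energy_le(1)[of s] energy_le(2)[of \<tau>] I by linarith
    have "energy s \<le> correlation \<tau> s + l * (4 * I + (64 * C + 2) * J) + (\<tau> - s) * dissipation s / l"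
      unfolding I_def J_def by (rule energy_le_correlation[OF st \<tau>0 l])
    moreover have "l * (4 * I + (64 * C + 2) * J) \<le> l * (4 + (64 * C + 2) * (2 * C + 4))"
      using I J l C_nonneg by (intro mult_left_mono add_mono) auto
    moreover have "(\<tau> - s) * dissipation s / l \<le> \<kappa> / l"
    proof (intro divide_right_mono)
      have "(\<tau> - s) * dissipation s \<le> (- s) * dissipation s" using \<tau>0 dissipation_nonneg by (intro mult_right_mono) auto
      then show "(\<tau> - s) * dissipation s \<le> \<kappa>" using s(3) by linarith
    qed (use l in simp)
    moreover have "correlation \<tau> s \<le> 4 * C * \<mu> + (\<theta>1 \<tau> + \<theta>2 \<tau> + L\<^sup>2 * dissipation s) / (4 * \<mu>)"
      unfolding \<theta>1_def \<theta>2_def by (rule correlation_le[OF s0 L \<mu>])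
    moreover have "L\<^sup>2 * dissipation s / (4 * \<mu>) \<le> L\<^sup>2 * \<kappa> / (4 * \<mu>)"
      using ds \<mu> by (intro divide_right_mono mult_left_mono) auto
    ultimately show ?thesis unfolding B_def add_divide_distrib by linarith
  qed
  have m: "slicewise (\<lambda>w. indicator {L<..} (snd (snd w)) * U1 w)" "slicewise (\<lambda>w. indicator {L<..} (snd (snd w)) * U2 w)"
    by (rule slicewise_bounded_times[OF slicewise_flow(1), of _ 1] slicewise_bounded_times[OF slicewise_flow(2), of _ 1];
        (measurable | simp add: indicator_def))+
  have i\<theta>: "integrable lborel (\<lambda>\<tau>. indicator {-2..-1} \<tau> * \<theta>1 \<tau>)" "integrable lborel (\<lambda>\<tau>. indicator {-2..-1} \<tau> * \<theta>2 \<tau>)"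
    using slicewise_energy_integrable[OF m(1), of "-2" "-1"] slicewise_energy_integrable[OF m(2), of "-2" "-1"] by (simp_all add: \<theta>1_def \<theta>2_def)
  \<comment> \<open>The interval has length 1, so averaging over it is integrating over it.\<close>
  have "energy s = (LBINT \<tau>. indicator {-2..-1::real} \<tau> * energy s)" by simp
  also have "\<dots> \<le> (LBINT \<tau>. indicator {-2..-1} \<tau> * B + (indicator {-2..-1} \<tau> * \<theta>1 \<tau> + indicator {-2..-1} \<tau> * \<theta>2 \<tau>) / (4 * \<mu>))"
  proof (rule integral_mono)
    show "integrable lborel (\<lambda>\<tau>. indicator {-2..-1} \<tau> * B + (indicator {-2..-1} \<tau> * \<theta>1 \<tau> + indicator {-2..-1} \<tau> * \<theta>2 \<tau>) / (4 * \<mu>))"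
      by (intro Bochner_Integration.integrable_add integrable_divide integrable_indicator_Icc_const i\<theta>)
    show "indicator {-2..-1} \<tau> * energy s \<le> indicator {-2..-1} \<tau> * B + (indicator {-2..-1} \<tau> * \<theta>1 \<tau> + indicator {-2..-1} \<tau> * \<theta>2 \<tau>) / (4 * \<mu>)" for \<tau> :: real
      using key[of \<tau>] by (cases "\<tau> \<in> {-2..-1}") auto
  qed (rule integrable_indicator_Icc_const)
  also have "\<dots> = B + ((LBINT \<tau>. indicator {-2..-1} \<tau> * \<theta>1 \<tau>) + (LBINT \<tau>. indicator {-2..-1} \<tau> * \<theta>2 \<tau>)) / (4 * \<mu>)"
    using i\<theta> integrable_indicator_Icc_const[of "-2" "-1" B] by simp
  also have "\<dots> \<le> B + (T1 + T2) / (4 * \<mu>)"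
    using tail \<mu> unfolding \<theta>1_def[symmetric] \<theta>2_def[symmetric] by (intro add_left_mono divide_right_mono) auto
  finally have "energy s \<le> B + (T1 + T2) / (4 * \<mu>)" .
  moreover have "energy t \<le> energy s + 64 * \<epsilon>"
  proof -
    have st: "s \<le> t" using s t by linarith
    have "0 \<le> (LBINT \<tau>. indicator {s..t} \<tau> * dissipation \<tau>)" using dissipation_nonneg by simp
    then show ?thesis using energy_inequality[OF st t(2)] rr[of s t] s t by linarith
  qed
  ultimately show ?thesis unfolding B_def add_divide_distrib by linarith
qed

lemma flow_le:
  assumes E: "\<And>t. - K \<le> t \<Longrightarrow> t < 0 \<Longrightarrow> energy t \<le> e" and K: "0 \<le> K"
    and r: "(LBINT \<tau>. indicator {-K..0} \<tau> * defect \<tau>) \<le> \<epsilon>"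
  shows "(LBINT \<tau>. indicator {-K..0} \<tau> * ((LBINT p. (u1 (\<tau>, p))\<^sup>2) + (LBINT p. (u2 (\<tau>, p))\<^sup>2))) \<le> 2 * K * e + 2 * \<epsilon>"
proof -
  have le: "(LBINT p. (u1 (\<tau>, p))\<^sup>2) + (LBINT p. (u2 (\<tau>, p))\<^sup>2) \<le> 2 * energy \<tau> + 2 * defect \<tau>" for \<tau>
  proof -
    have 1: "(LBINT p. (- (U1 (\<tau>, p) - u1 (\<tau>, p)) + U1 (\<tau>, p))\<^sup>2) \<le> 2 * (LBINT p. (- (U1 (\<tau>, p) - u1 (\<tau>, p)))\<^sup>2) + 2 * (LBINT p. (U1 (\<tau>, p))\<^sup>2)"
      by (rule integral_square_add_le[OF sq_integrable_uminus[OF slicewiseD(2)[OF slicewise_defect(1)]] slicewiseD(2)[OF slicewise_flow(1)]])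
    have 2: "(LBINT p. (- (U2 (\<tau>, p) - u2 (\<tau>, p)) + U2 (\<tau>, p))\<^sup>2) \<le> 2 * (LBINT p. (- (U2 (\<tau>, p) - u2 (\<tau>, p)))\<^sup>2) + 2 * (LBINT p. (U2 (\<tau>, p))\<^sup>2)"
      by (rule integral_square_add_le[OF sq_integrable_uminus[OF slicewiseD(2)[OF slicewise_defect(2)]] slicewiseD(2)[OF slicewise_flow(2)]])
    have 3: "0 \<le> (LBINT p. (PP (\<tau>, p) - P (\<tau>, p))\<^sup>2)" "0 \<le> (LBINT p. (DD (\<tau>, p) - D (\<tau>, p))\<^sup>2)" by simp_all
    have 4: "- (x - y) + x = y" for x y :: real by simp
    have 5: "x + y \<le> 2 * (b + d) + 2 * (a + c + p + q)" if "x \<le> 2 * a + 2 * b" "y \<le> 2 * c + 2 * d" "0 \<le> p" "0 \<le> q" for x y a b c d p q :: real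
      using that by simp
    show ?thesis unfolding defect_def energy_def
      by (rule 5[OF 1[unfolded power2_minus 4] 2[unfolded power2_minus 4] 3])
  qed
  have "(LBINT \<tau>. indicator {-K..0} \<tau> * ((LBINT p. (u1 (\<tau>, p))\<^sup>2) + (LBINT p. (u2 (\<tau>, p))\<^sup>2)))
      \<le> (LBINT \<tau>. indicator {-K..0} \<tau> * (2 * e) + 2 * (indicator {-K..0} \<tau> * defect \<tau>))"
  proof (rule integral_mono_AE)
    show "integrable lborel (\<lambda>\<tau>. indicator {-K..0} \<tau> * ((LBINT p. (u1 (\<tau>, p))\<^sup>2) + (LBINT p. (u2 (\<tau>, p))\<^sup>2)))"
      unfolding distrib_left by (intro Bochner_Integration.integrable_add slicewise_energy_integrable slicewise_u)
    show "integrable lborel (\<lambda>\<tau>. indicator {-K..0} \<tau> * (2 * e) + 2 * (indicator {-K..0} \<tau> * defect \<tau>))"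
      by (intro Bochner_Integration.integrable_add integrable_indicator_Icc_const integrable_mult_right defect_integrable)
    show "AE \<tau> in lborel. indicator {-K..0} \<tau> * ((LBINT p. (u1 (\<tau>, p))\<^sup>2) + (LBINT p. (u2 (\<tau>, p))\<^sup>2))
        \<le> indicator {-K..0} \<tau> * (2 * e) + 2 * (indicator {-K..0} \<tau> * defect \<tau>)"
      using AE_lborel_singleton[of "0::real"]
    proof eventually_elim
      case (elim \<tau>)
      then show ?case using le[of \<tau>] E[of \<tau>] by (cases "\<tau> \<in> {-K..0}") auto
    qed
  qed
  also have "\<dots> = 2 * K * e + 2 * (LBINT \<tau>. indicator {-K..0} \<tau> * defect \<tau>)"
    using defect_integrable integrable_indicator_Icc_const[of "-K" 0 "2 * e"] K by simp
  finally show ?thesis using r by simp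
qed

end

context half_plane_flow
begin

text \<open>The dependence of the constants dictates the order of choices: \<open>\<mu>\<close> and
  \<open>l\<close> come from \<open>\<eta>\<close>, the height \<open>L\<close> from
  \<open>\<mu>\<close>, then \<open>\<kappa>\<close> from \<open>L\<close> and \<open>l\<close>, the
  depth \<open>S\<close> of the window from \<open>\<kappa>\<close>, and the kernel last, so as to
  make the defect small on the entire window. Each of the five terms in \<open>energy_small\<close>
  is then at most \<open>\<eta>\<close>.\<close>

lemma slab_energy_small:
  assumes K: "3 \<le> K" and \<eta>: "0 < \<eta>" "\<eta> \<le> 1"
  shows "(LBINT \<tau>. indicator {-K..0} \<tau> * ((LBINT p. (u1 (\<tau>, p))\<^sup>2) + (LBINT p. (u2 (\<tau>, p))\<^sup>2))) \<le> (10 * K + 2) * \<eta>"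
proof -
  obtain Ca where Ca: "\<And>t. (LBINT p. (u1 (t, p))\<^sup>2) \<le> Ca" "0 \<le> Ca" using slicewise_energy[OF slicewise_u(1)] by metis
  obtain Cb where Cb: "\<And>t. (LBINT p. (u2 (t, p))\<^sup>2) \<le> Cb" "0 \<le> Cb" using slicewise_energy[OF slicewise_u(2)] by metis
  define C where "C = Ca + Cb"
  have C0: "0 \<le> C" using Ca Cb by (simp add: C_def)
  have C: "(LBINT p. (u1 (t, p))\<^sup>2) \<le> C" "(LBINT p. (u2 (t, p))\<^sup>2) \<le> C" for t
    using Ca(1)[of t] Cb(1)[of t] Ca(2) Cb(2) unfolding C_def by linarith+
  define M where "M = 4 + (64 * C + 2) * (2 * C + 4)"
  have M: "0 < M" unfolding M_def using C0 by (intro add_pos_nonneg mult_nonneg_nonneg) auto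
  define \<mu> where "\<mu> = \<eta> / (4 * C + 1)"
  define l where "l = \<eta> / M"
  have \<mu>: "0 < \<mu>" "4 * C * \<mu> \<le> \<eta>"
    using \<eta> C0 by (auto simp: \<mu>_def field_simps intro!: divide_pos_pos)
  have l: "0 < l" "l * M = \<eta>" using \<eta> M by (auto simp: l_def)
  define \<epsilon> where "\<epsilon> = \<eta> / 64"
  have \<epsilon>: "0 < \<epsilon> / 4" "16 * \<epsilon> \<le> 1" "64 * \<epsilon> = \<eta>" "2 * \<epsilon> \<le> \<eta>" using \<eta> by (auto simp: \<epsilon>_def)
  define tl where "tl f n = (LBINT w. (indicator {-3..0} (fst w) * (indicator {real n<..} (snd (snd w)) * f w))\<^sup>2)"
    for f :: "real \<times> real \<times> real \<Rightarrow> real" and n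
  have T: "0 < \<mu> * \<eta>" using \<mu> \<eta> by simp
  have "eventually (\<lambda>n. tl u1 n < \<mu> * \<eta> \<and> tl u2 n < \<mu> * \<eta>) sequentially"
    unfolding tl_def
    by (intro eventually_conj order_tendstoD(2)[OF tail_tendsto_0[OF slicewise_u(1)] T] order_tendstoD(2)[OF tail_tendsto_0[OF slicewise_u(2)] T])
  then obtain n where n: "tl u1 n < \<mu> * \<eta>" "tl u2 n < \<mu> * \<eta>" by (auto simp: eventually_sequentially)
  define L where "L = real n"
  \<comment> \<open>The first bound makes L^2 \<kappa> no larger than the allowance 2 \<mu> \<eta>
    for the two tails together, the second makes \<kappa> / l at most \<open>\<eta>\<close>.\<close>
  define \<kappa> where "\<kappa> = min (2 * \<mu> * \<eta> / (L\<^sup>2 + 1)) (\<eta> * l)"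
  have L1: "0 < L\<^sup>2 + 1" by (intro add_nonneg_pos) auto
  have \<kappa>: "0 < \<kappa>" "L\<^sup>2 * \<kappa> \<le> 2 * \<mu> * \<eta>" "\<kappa> / l \<le> \<eta>"
  proof -
    show k: "0 < \<kappa>" unfolding \<kappa>_def using \<mu> \<eta> l L1 by auto
    have "\<kappa> \<le> 2 * \<mu> * \<eta> / (L\<^sup>2 + 1)" by (simp add: \<kappa>_def)
    then have "\<kappa> * (L\<^sup>2 + 1) \<le> 2 * \<mu> * \<eta>" using L1 by (simp only: pos_le_divide_eq)
    then show "L\<^sup>2 * \<kappa> \<le> 2 * \<mu> * \<eta>" using k by (simp add: algebra_simps)
    have "\<kappa> \<le> \<eta> * l" by (simp add: \<kappa>_def)
    then show "\<kappa> / l \<le> \<eta>" using l by (simp only: pos_divide_le_eq)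
  qed
  define S where "S = K * exp ((2 * C + 5) / \<kappa>)"
  define close where "close f d \<longleftrightarrow> (\<forall>\<rho>. integrable lborel \<rho> \<longrightarrow> (LBINT r. \<rho> r) = 1 \<longrightarrow> (LBINT r. \<bar>\<rho> r\<bar>) = 1 \<longrightarrow>
      (\<forall>r. r \<notin> {0<..<1} \<longrightarrow> \<rho> r = 0) \<longrightarrow> (\<forall>r. d \<le> \<bar>r\<bar> \<longrightarrow> \<rho> r = 0) \<longrightarrow>
      (LBINT \<tau>. indicator {-S..0} \<tau> * (LBINT p. (dconv (0, 1, 0) \<rho> (dconv (1, 0, 0) \<rho> f) (\<tau>, p) - f (\<tau>, p))\<^sup>2)) \<le> \<epsilon> / 4)"
    for f :: "real \<times> real \<times> real \<Rightarrow> real" and d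
  have ex: "\<exists>d>0. close f d" if f: "slicewise f" for f
  proof -
    obtain d where "0 < d" "\<And>\<rho>. integrable lborel \<rho> \<Longrightarrow> (LBINT r. \<rho> r) = 1 \<Longrightarrow> (LBINT r. \<bar>\<rho> r\<bar>) = 1 \<Longrightarrow>
      (\<And>r. r \<notin> {0<..<1} \<Longrightarrow> \<rho> r = 0) \<Longrightarrow> (\<And>r. d \<le> \<bar>r\<bar> \<Longrightarrow> \<rho> r = 0) \<Longrightarrow>
      (LBINT \<tau>. indicator {-S..0} \<tau> * (LBINT p. (dconv (0, 1, 0) \<rho> (dconv (1, 0, 0) \<rho> f) (\<tau>, p) - f (\<tau>, p))\<^sup>2)) \<le> \<epsilon> / 4"
      by (rule mollification_slab[OF f \<epsilon>(1)]) blast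
    then show ?thesis unfolding close_def by blast
  qed
  note PD = slicewise_times[OF slicewise_u] slicewise_diff[OF slicewise_times[OF slicewise_u(1) slicewise_u(1)] slicewise_times[OF slicewise_u(2) slicewise_u(2)]]
  obtain d1 d2 d3 d4 where d: "0 < d1" "0 < d2" "0 < d3" "0 < d4" "close u1 d1" "close u2 d2"
      "close (\<lambda>w. u1 w * u2 w) d3" "close (\<lambda>w. u1 w * u1 w - u2 w * u2 w) d4"
    using ex[OF slicewise_u(1)] ex[OF slicewise_u(2)] ex[OF PD(1)] ex[OF PD(2)] by auto
  \<comment> \<open>One kernel has to serve both components and both flux functions; the cap 1 keeps
    its reach in time below 1.\<close>
  define d where "d = Min {d1, d2, d3, d4, 1}"
  have dd: "0 < d" "d \<le> 1" "d \<le> d1" "d \<le> d2" "d \<le> d3" "d \<le> d4" using d by (auto simp: d_def)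
  obtain \<rho> :: "real \<Rightarrow> real" where \<rho>: "test_fun \<rho>" "\<And>x. 0 \<le> \<rho> x" "(LBINT x. \<rho> x) = 1"
      "\<And>x. x < d / 2 \<Longrightarrow> \<rho> x = 0" "\<And>x. d \<le> x \<Longrightarrow> \<rho> x = 0"
    using unit_kernel_exists[OF dd(1,2)] by metis
  have abs\<rho>: "(LBINT x. \<bar>\<rho> x\<bar>) = 1" using \<rho>(2,3) by simp
  have supp: "\<rho> r = 0" if "r \<notin> {0<..<1}" for r
    using \<rho>(4)[of r] \<rho>(5)[of r] that dd(1,2) by (cases "r \<le> 0") auto
  have supp': "\<rho> r = 0" if "d \<le> \<bar>r\<bar>" for r
    using \<rho>(4)[of r] \<rho>(5)[of r] that dd(1,2) by (cases "r \<le> 0") auto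
  have close_d: "(LBINT \<tau>. indicator {-S..0} \<tau> * (LBINT p. (dconv (0, 1, 0) \<rho> (dconv (1, 0, 0) \<rho> f) (\<tau>, p) - f (\<tau>, p))\<^sup>2)) \<le> \<epsilon> / 4"
    if "close f d'" "d \<le> d'" for f d'
    using that(1)[unfolded close_def, rule_format, OF test_fun_integrable[OF \<rho>(1)] \<rho>(3) abs\<rho> supp supp'] that(2) by simp
  interpret M: unit_mollified_flow u1 u2 \<rho> "d / 2" C
  proof
    show "\<rho> x = 0" if "1 \<le> x" for x using \<rho>(5) that dd by simp
  qed (use \<rho> C dd in auto)
  have cv0: "M.cv 0 0 f = dconv (0, 1, 0) \<rho> (dconv (1, 0, 0) \<rho> f)" for f by (simp add: M.cv_def M.d\<rho>_def)
  have PDe: "M.P = (\<lambda>w. u1 w * u2 w)" "M.D = (\<lambda>w. u1 w * u1 w - u2 w * u2 w)"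
    by (auto simp: fun_eq_iff M.P_def M.D_def power2_eq_square)
  have defect: "(LBINT \<tau>. indicator {-S..0} \<tau> * M.defect \<tau>) \<le> \<epsilon>"
  proof -
    have "(LBINT \<tau>. indicator {-S..0} \<tau> * M.defect \<tau>)
      = (LBINT \<tau>. indicator {-S..0} \<tau> * (LBINT p. (M.U1 (\<tau>, p) - u1 (\<tau>, p))\<^sup>2))
      + (LBINT \<tau>. indicator {-S..0} \<tau> * (LBINT p. (M.U2 (\<tau>, p) - u2 (\<tau>, p))\<^sup>2))
      + (LBINT \<tau>. indicator {-S..0} \<tau> * (LBINT p. (M.PP (\<tau>, p) - M.P (\<tau>, p))\<^sup>2))
      + (LBINT \<tau>. indicator {-S..0} \<tau> * (LBINT p. (M.DD (\<tau>, p) - M.D (\<tau>, p))\<^sup>2))"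
      using M.slicewise_defect[THEN slicewise_energy_integrable, of "-S" 0] unfolding M.defect_def distrib_left by simp
    also have "\<dots> \<le> \<epsilon> / 4 + \<epsilon> / 4 + \<epsilon> / 4 + \<epsilon> / 4"
      unfolding cv0 PDe by (intro add_mono close_d[OF d(5) dd(3)] close_d[OF d(6) dd(4)] close_d[OF d(7) dd(5)] close_d[OF d(8) dd(6)])
    finally show ?thesis by simp
  qed
  have tail: "(LBINT \<tau>. indicator {-2..-1} \<tau> * (LBINT p. (indicator {L<..} (snd p) * M.cv 0 0 f (\<tau>, p))\<^sup>2)) \<le> \<mu> * \<eta>"
    if "slicewise f" "tl f n < \<mu> * \<eta>" for f
    using mollification_tail[OF that(1) test_fun_integrable[OF \<rho>(1)] abs\<rho> supp, of L] that(2)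
    unfolding cv0 tl_def L_def by linarith
  have E: "M.energy t \<le> 5 * \<eta>" if "- K \<le> t" "t < 0" for t
  proof -
    have "M.energy t \<le> 4 * C * \<mu> + (\<mu> * \<eta> + \<mu> * \<eta> + L\<^sup>2 * \<kappa>) / (4 * \<mu>) + l * M + \<kappa> / l + 64 * \<epsilon>"
      unfolding M_def
      by (rule M.energy_small[OF K \<kappa>(1) S_def defect \<epsilon>(2) \<mu>(1) l(1) _ tail[OF slicewise_u(1) n(1)] tail[OF slicewise_u(2) n(2)] that])
        (simp add: L_def)
    moreover have "(\<mu> * \<eta> + \<mu> * \<eta> + L\<^sup>2 * \<kappa>) / (4 * \<mu>) \<le> (4 * \<mu> * \<eta>) / (4 * \<mu>)"
      using \<kappa>(2) \<mu>(1) by (intro divide_right_mono) (simp_all add: mult.assoc mult.commute)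
    moreover have "(4 * \<mu> * \<eta>) / (4 * \<mu>) = \<eta>" using \<mu>(1) by simp
    ultimately show ?thesis using \<mu>(2) l(2) \<kappa>(3) \<epsilon>(3) by linarith
  qed
  have KS: "K \<le> S"
  proof -
    have "K * 1 \<le> K * exp ((2 * C + 5) / \<kappa>)" using K C0 \<kappa>(1) by (intro mult_left_mono) auto
    then show ?thesis by (simp add: S_def)
  qed
  have "(LBINT \<tau>. indicator {-K..0} \<tau> * M.defect \<tau>) \<le> (LBINT \<tau>. indicator {-S..0} \<tau> * M.defect \<tau>)"
  proof (rule integral_mono[OF M.defect_integrable M.defect_integrable])
    show "indicator {-K..0} \<tau> * M.defect \<tau> \<le> indicator {-S..0} \<tau> * M.defect \<tau>" for \<tau>
      using KS M.residual_le[of \<tau>] M.residual_nonneg[of \<tau>] by (auto simp: indicator_def)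
  qed
  then have "(LBINT \<tau>. indicator {-K..0} \<tau> * M.defect \<tau>) \<le> \<epsilon>" using defect by linarith
  then have "(LBINT \<tau>. indicator {-K..0} \<tau> * ((LBINT p. (u1 (\<tau>, p))\<^sup>2) + (LBINT p. (u2 (\<tau>, p))\<^sup>2))) \<le> 2 * K * (5 * \<eta>) + 2 * \<epsilon>"
    using K by (intro M.flow_le E) auto
  then show ?thesis using \<epsilon>(4) \<eta>(1) by (simp add: algebra_simps)
qed

text \<open>On each slab \<open>{-K..0}\<close> the bound of \<open>slab_energy_small\<close> holds
  with arbitrarily small \<open>\<eta>\<close>; countably many slabs exhaust the past.\<close>

lemma flow_eq_0: "AE w in lborel. fst w \<le> 0 \<longrightarrow> u1 w = 0 \<and> u2 w = 0"
proof -
  have slab: "AE w in lborel. fst w \<in> {- K..0} \<longrightarrow> u1 w = 0 \<and> u2 w = 0" if K: "3 \<le> K" for K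
  proof -
    let ?I = "\<lambda>f. LBINT w. indicator {-K..0} (fst w) * (f w)\<^sup>2"
    have e: "?I u1 + ?I u2 = (LBINT \<tau>. indicator {-K..0} \<tau> * ((LBINT p. (u1 (\<tau>, p))\<^sup>2) + (LBINT p. (u2 (\<tau>, p))\<^sup>2)))"
      using slicewise_u[THEN slicewise_energy_integrable, of "-K" 0]
      unfolding slicewise_slab(2)[OF slicewise_u(1)] slicewise_slab(2)[OF slicewise_u(2)] distrib_left by simp
    have "?I u1 + ?I u2 \<le> 0 + x" if "0 < x" for x
    proof -
      define \<eta> where "\<eta> = min 1 (x / (10 * K + 2))"
      have "0 < \<eta>" "\<eta> \<le> 1" using that K by (auto simp: \<eta>_def)
      then have "?I u1 + ?I u2 \<le> (10 * K + 2) * \<eta>" unfolding e by (rule slab_energy_small[OF K])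
      also have "\<dots> \<le> (10 * K + 2) * (x / (10 * K + 2))" using K by (intro mult_left_mono) (auto simp: \<eta>_def)
      finally show ?thesis using K by simp
    qed
    then have "?I u1 + ?I u2 \<le> 0" by (rule field_le_epsilon)
    moreover have "0 \<le> ?I u1" "0 \<le> ?I u2" by (intro Bochner_Integration.integral_nonneg, simp)+
    ultimately have "?I u1 = 0" "?I u2 = 0" by linarith+
    then have "AE w in lborel. indicator {-K..0} (fst w) * (u1 w)\<^sup>2 = 0" "AE w in lborel. indicator {-K..0} (fst w) * (u2 w)\<^sup>2 = 0"
      using integral_nonneg_eq_0_iff_AE[OF slicewise_slab(1)[OF slicewise_u(1)]] integral_nonneg_eq_0_iff_AE[OF slicewise_slab(1)[OF slicewise_u(2)]]
      by simp_all
    then show ?thesis by eventually_elim auto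
  qed
  have "AE w in lborel. \<forall>n. fst w \<in> {- real (n + 3)..0} \<longrightarrow> u1 w = 0 \<and> u2 w = 0"
    by (subst AE_all_countable) (intro allI slab, simp)
  then show ?thesis
  proof eventually_elim
    case (elim w)
    obtain n where "- fst w \<le> real n" using real_arch_simple by blast
    then show ?case using elim[rule_format, of n] by auto
  qed
qed

end

subsection \<open>Transfer to space-time\<close>

text \<open>Such a map only renames coordinates, so preimages of boxes are boxes with the same side
  lengths, and these determine Lebesgue measure.\<close>

lemma distr_lborel_basis_map:
  fixes f :: "'a::euclidean_space \<Rightarrow> 'b::euclidean_space"
  assumes f: "linear f" "bij_betw f Basis Basis"
  shows "distr lborel borel f = lborel"
proof (rule lborel_eqI[symmetric])
  have mf [measurable]: "f \<in> borel_measurable borel"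
    using linear_continuous_on[OF linear_conv_bounded_linear[THEN iffD1, OF f(1)]] by (rule borel_measurable_continuous_onI)
  have inner: "f x \<bullet> f b = x \<bullet> b" if b: "b \<in> Basis" for x b
  proof -
    have "f x = (\<Sum>i\<in>Basis. (x \<bullet> i) *\<^sub>R f i)"
      by (subst euclidean_representation[of x, symmetric]) (simp add: linear_sum[OF f(1)] linear_cmul[OF f(1)])
    then have "f x \<bullet> f b = (\<Sum>i\<in>Basis. (x \<bullet> i) * (f i \<bullet> f b))" by (simp add: inner_sum_left)
    also have "\<dots> = (\<Sum>i\<in>Basis. if i = b then x \<bullet> i else 0)"
    proof (rule sum.cong[OF refl])
      fix i :: 'a assume i: "i \<in> Basis"
      have "f i \<in> Basis" "f b \<in> Basis" "f i = f b \<longleftrightarrow> i = b"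
        using f(2) i b by (auto simp: bij_betw_def inj_on_def)
      then show "(x \<bullet> i) * (f i \<bullet> f b) = (if i = b then x \<bullet> i else 0)" by (simp add: inner_Basis)
    qed
    also have "\<dots> = x \<bullet> b" using b by simp
    finally show ?thesis .
  qed
  fix l u :: 'b assume lu: "\<And>b. b \<in> Basis \<Longrightarrow> l \<bullet> b \<le> u \<bullet> b"
  define g where "g y = (\<Sum>b\<in>Basis. (y \<bullet> f b) *\<^sub>R b)" for y
  have g: "g y \<bullet> b = y \<bullet> f b" if "b \<in> Basis" for y b using that by (simp add: g_def)
  have B: "(\<forall>b\<in>Basis. Q b) \<longleftrightarrow> (\<forall>b\<in>Basis. Q (f b))" for Q
    using f(2) unfolding bij_betw_def by (metis (no_types, lifting) image_iff)
  have "f -` box l u = box (g l) (g u)"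
    unfolding set_eq_iff vimage_eq mem_box B using inner g by simp
  then have "emeasure (distr lborel borel f) (box l u) = emeasure lborel (box (g l) (g u))"
    by (simp add: emeasure_distr)
  also have "\<dots> = (\<Prod>b\<in>Basis. (g u - g l) \<bullet> b)"
    by (rule emeasure_lborel_box) (use bij_betw_apply[OF f(2)] in \<open>simp add: g lu\<close>)
  also have "(\<Prod>b\<in>Basis. (g u - g l) \<bullet> b) = (\<Prod>b\<in>Basis. (u - l) \<bullet> f b)" by (intro prod.cong refl) (simp add: g inner_diff_left)
  also have "\<dots> = (\<Prod>b\<in>Basis. (u - l) \<bullet> b)" by (rule prod.reindex_bij_betw[OF f(2)])
  finally show "emeasure (distr lborel borel f) (box l u) = (\<Prod>b\<in>Basis. (u - l) \<bullet> b)" .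
qed simp

text \<open>Relabelling between ((x, y), t) and (t, x, y). With time in front, a slice at fixed time
  is a function of the remaining pair, to which the product structure of the measure
  applies.\<close>

definition point :: "real \<times> real \<Rightarrow> real^2" where "point p = vector [fst p, snd p]"
definition event :: "real \<times> real \<times> real \<Rightarrow> (real^2) \<times> real" where "event w = (point (snd w), fst w)"
definition coords :: "real^2 \<Rightarrow> real \<times> real" where "coords x = (x $ 1, x $ 2)"
definition event_coords :: "(real^2) \<times> real \<Rightarrow> real \<times> real \<times> real" where "event_coords z = (snd z, coords (fst z))"

lemma point_coords [simp]: "point (coords x) = x" "coords (point p) = p" "event (event_coords z) = z" "event_coords (event w) = w"
  by (auto simp: point_def coords_def event_def event_coords_def prod_eq_iff vec_eq_iff forall_2)

lemma Basis_real2: "(Basis :: (real^2) set) = {axis 1 1, axis 2 1}"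
  by (auto simp: Basis_vec_def UNIV_2)

lemma distr_lborel_coords:
  "distr lborel borel point = lborel" "distr lborel borel event = lborel" "distr lborel borel coords = lborel" "distr lborel borel event_coords = lborel"
proof -
  have e: "point (1, 0) = axis 1 1" "point (0, 1) = axis 2 1" "coords (axis 1 1) = (1, 0)" "coords (axis 2 1) = (0, 1)"
    by (auto simp: point_def coords_def axis_def vec_eq_iff forall_2)
  have l: "linear point" "linear coords"
    by (auto intro!: linearI simp: point_def coords_def vec_eq_iff forall_2)
  have l2: "linear event" "linear event_coords"
    by (auto intro!: linearI simp: event_def event_coords_def point_def coords_def vec_eq_iff forall_2)
  have z: "point (0, 0) = 0" "coords 0 = 0" using linear_0[OF l(1)] linear_0[OF l(2)] by (simp_all add: zero_prod_def)
  show "distr lborel borel point = lborel"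
    by (intro distr_lborel_basis_map l bij_betw_byWitness[where f'=coords])
      (auto simp: Basis_real2 Basis_prod_def e)
  show "distr lborel borel coords = lborel"
    by (intro distr_lborel_basis_map l bij_betw_byWitness[where f'=point])
      (auto simp: Basis_real2 Basis_prod_def e)
  show "distr lborel borel event = lborel"
    by (intro distr_lborel_basis_map l2 bij_betw_byWitness[where f'=event_coords])
      (auto simp: Basis_real2 Basis_prod_def e z event_def event_coords_def zero_prod_def)
  show "distr lborel borel event_coords = lborel"
    by (intro distr_lborel_basis_map l2 bij_betw_byWitness[where f'=event])
      (auto simp: Basis_real2 Basis_prod_def e z event_def event_coords_def zero_prod_def)
qed

lemma measurable_coords [measurable]:
  "point \<in> borel_measurable borel" "event \<in> borel_measurable borel" "coords \<in> borel_measurable borel" "event_coords \<in> borel_measurable borel"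
proof -
  have *: "f \<in> borel_measurable borel" if "linear f" for f :: "'a::euclidean_space \<Rightarrow> 'b::euclidean_space"
    using linear_continuous_on[OF linear_conv_bounded_linear[THEN iffD1, OF that]] by (rule borel_measurable_continuous_onI)
  show "point \<in> borel_measurable borel" "event \<in> borel_measurable borel" "coords \<in> borel_measurable borel" "event_coords \<in> borel_measurable borel"
    by (auto intro!: * linearI simp: point_def coords_def event_def event_coords_def vec_eq_iff forall_2)
qed

section \<open>Tensor products as test functions\<close>

lemma Ck_on_add:
  "Ck_on k UNIV f \<Longrightarrow> Ck_on k UNIV g \<Longrightarrow> Ck_on k UNIV (\<lambda>x. f x + g x)"
proof (induction k arbitrary: f g)
  case (Suc k)
  have d: "f differentiable at x" "g differentiable at x" for x using Suc.prems by auto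
  have "frechet_derivative (\<lambda>x. f x + g x) (at x) = (\<lambda>v. frechet_derivative f (at x) v + frechet_derivative g (at x) v)" for x
    by (rule frechet_derivative_at[symmetric]) (intro has_derivative_add frechet_derivative_works[THEN iffD1] d)
  then show ?case using Suc d by (auto intro: differentiable_add)
qed (auto intro: continuous_intros)

text \<open>The time factor will be carried by the vector \<open>w\<close>, so that spatial
  derivatives act on \<open>a\<close> and \<open>b\<close> only and lead to sums of terms of the
  same form.\<close>

definition tensor :: "(real \<Rightarrow> real) \<Rightarrow> (real \<Rightarrow> real) \<Rightarrow> 'b::real_normed_vector \<Rightarrow> real^2 \<Rightarrow> 'b" where
  "tensor a b w x = (a (x $ 1) * b (x $ 2)) *\<^sub>R w"

text \<open>The derivative in a direction is a sum of three such terms, each with one factor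
  differentiated and a coordinate of the direction absorbed into \<open>w\<close>; hence the
  induction with all factors arbitrary.\<close>

lemma Ck_on_tensor:
  assumes "smooth a" "smooth b" "smooth c"
  shows "Ck_on k UNIV (\<lambda>z. tensor a b (c (snd z) *\<^sub>R w) (fst z))"
  using assms
proof (induction k arbitrary: a b c w)
  case 0
  have "continuous_on UNIV (\<lambda>z :: (real^2) \<times> real. a (fst z $ 1))" "continuous_on UNIV (\<lambda>z :: (real^2) \<times> real. b (fst z $ 2))"
    "continuous_on UNIV (\<lambda>z :: (real^2) \<times> real. c (snd z))"
    by (rule continuous_on_compose2[OF smoothD(3)[OF 0(1)]] continuous_on_compose2[OF smoothD(3)[OF 0(2)]]
        continuous_on_compose2[OF smoothD(3)[OF 0(3)]]; (intro continuous_intros | simp))+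
  then show ?case by (simp add: tensor_def) (intro continuous_on_scaleR continuous_on_mult continuous_on_const)
next
  case (Suc k)
  have l: "bounded_linear (\<lambda>z :: (real^2) \<times> real. fst z $ i)" for i
    by (rule bounded_linear_compose[OF bounded_linear_vec_nth bounded_linear_fst])
  note D = DERIV_compose_FDERIV[OF smoothD(1) bounded_linear_imp_has_derivative]
  have der: "((\<lambda>z. tensor a b (c (snd z) *\<^sub>R w) (fst z)) has_derivative
      (\<lambda>v. tensor (deriv a) b (c (snd z) *\<^sub>R fst v $ 1 *\<^sub>R w) (fst z) + tensor a (deriv b) (c (snd z) *\<^sub>R fst v $ 2 *\<^sub>R w) (fst z)
        + tensor a b (deriv c (snd z) *\<^sub>R snd v *\<^sub>R w) (fst z))) (at z)" for z
    unfolding tensor_def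
    by (rule has_derivative_eq_rhs)
      (rule has_derivative_scaleR has_derivative_mult has_derivative_const D[OF Suc.prems(1) l] D[OF Suc.prems(2) l] D[OF Suc.prems(3) bounded_linear_snd]
      | simp add: fun_eq_iff algebra_simps)+
  have "frechet_derivative (\<lambda>z. tensor a b (c (snd z) *\<^sub>R w) (fst z)) (at z) v
      = tensor (deriv a) b (c (snd z) *\<^sub>R fst v $ 1 *\<^sub>R w) (fst z) + tensor a (deriv b) (c (snd z) *\<^sub>R fst v $ 2 *\<^sub>R w) (fst z)
        + tensor a b (deriv c (snd z) *\<^sub>R snd v *\<^sub>R w) (fst z)" for z v
    unfolding frechet_derivative_at[OF der, symmetric] by simp
  then show ?case
    unfolding Ck_on.simps using der by (simp only:) (intro conjI allI ballI Ck_on_add Suc.IH smoothD(2) Suc.prems, blast intro: differentiableI)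
qed

text \<open>Two summands suffice for a rotated gradient, whose two components have different
  factors. The bound \<open>R < 0\<close> keeps the support away from t = 0 and so compact inside
  \<open>Qm\<close>.\<close>

lemma test_function_tensor:
  fixes a b c a' b' c' :: "real \<Rightarrow> real"
  assumes t: "test_fun a" "test_fun b" "test_fun c" "test_fun a'" "test_fun b'" "test_fun c'"
    and R: "R < 0" "\<And>t. R \<le> t \<Longrightarrow> c t = 0" "\<And>t. R \<le> t \<Longrightarrow> c' t = 0"
  shows "test_function Qm (\<lambda>z. tensor a b (c (snd z) *\<^sub>R w) (fst z) + tensor a' b' (c' (snd z) *\<^sub>R w') (fst z))"
proof -
  let ?f = "\<lambda>z. tensor a b (c (snd z) *\<^sub>R w) (fst z) + tensor a' b' (c' (snd z) *\<^sub>R w') (fst z)"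
  have "\<exists>A. \<forall>x. A < \<bar>x\<bar> \<longrightarrow> f x = 0" if "test_fun f" for f using that by (simp add: test_fun_def)
  then obtain A where A: "\<And>f x. test_fun f \<Longrightarrow> A f < \<bar>x\<bar> \<Longrightarrow> f x = 0" by metis
  define M where "M = Max {A a, A b, A c, A a', A b', A c'}"
  have M: "\<bar>x\<bar> \<le> M" if "f \<in> {a, b, c, a', b', c'}" "f x \<noteq> 0" for f x
  proof -
    have "\<bar>x\<bar> \<le> A f" using A[of f x] that t by force
    also have "A f \<le> M" unfolding M_def using that(1) by (intro Max_ge) auto
    finally show ?thesis .
  qed
  define S :: "((real^2) \<times> real) set" where "S = cbox (\<chi> i. - M) (\<chi> i. M) \<times> {- M..R}"
  have S: "compact S" unfolding S_def by (intro compact_Times compact_cbox compact_Icc)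
  have "?f z = 0" if "z \<notin> S" for z
  proof -
    obtain x s where z: "z = (x, s)" by (cases z)
    have "M < \<bar>x $ 1\<bar> \<or> M < \<bar>x $ 2\<bar> \<or> M < \<bar>s\<bar> \<or> R \<le> s"
      using that by (auto simp: z S_def mem_box_cart forall_2)
    moreover have "tensor a b (c s *\<^sub>R w) x = 0 \<and> tensor a' b' (c' s *\<^sub>R w') x = 0"
      if "M < \<bar>x $ 1\<bar> \<or> M < \<bar>x $ 2\<bar> \<or> M < \<bar>s\<bar> \<or> R \<le> s"
      using that
    proof (elim disjE)
      assume "M < \<bar>x $ 1\<bar>"
      then have "a (x $ 1) = 0" "a' (x $ 1) = 0" using M[of a] M[of a'] by force+
      then show ?thesis by (simp add: tensor_def)
    next
      assume "M < \<bar>x $ 2\<bar>"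
      then have "b (x $ 2) = 0" "b' (x $ 2) = 0" using M[of b] M[of b'] by force+
      then show ?thesis by (simp add: tensor_def)
    next
      assume "M < \<bar>s\<bar>"
      then have "c s = 0" "c' s = 0" using M[of c] M[of c'] by force+
      then show ?thesis by (simp add: tensor_def)
    qed (simp add: tensor_def R)
    ultimately show ?thesis by (auto simp: z)
  qed
  then have "closure {z. ?f z \<noteq> 0} \<subseteq> S" by (intro closure_minimal compact_imp_closed[OF S]) auto
  moreover have "S \<subseteq> Qm" using R by (auto simp: S_def Qm_def)
  moreover have "compact (closure {z. ?f z \<noteq> 0})"
    using compact_Int_closed[OF S closed_closure[of "{z. ?f z \<noteq> 0}"]] calculation(1) by (simp add: Int_absorb1)
  ultimately show ?thesis
    using t by (auto simp: test_function_def test_fun_def intro!: Ck_on_add Ck_on_tensor)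
qed

lemma partial_tensor:
  assumes "\<And>x. (a has_real_derivative a1 x) (at x)" "\<And>y. (b has_real_derivative b1 y) (at y)"
    "\<And>x. (a' has_real_derivative a1' x) (at x)" "\<And>y. (b' has_real_derivative b1' y) (at y)"
  shows "partial 1 (\<lambda>x. tensor a b w x + tensor a' b' w' x) = (\<lambda>x. tensor a1 b w x + tensor a1' b' w' x)"
    and "partial 2 (\<lambda>x. tensor a b w x + tensor a' b' w' x) = (\<lambda>x. tensor a b1 w x + tensor a' b1' w' x)"
proof -
  note D = DERIV_compose_FDERIV[OF _ bounded_linear_imp_has_derivative[OF bounded_linear_vec_nth]]
  have "((\<lambda>x. tensor a b w x + tensor a' b' w' x) has_derivative
      (\<lambda>v. (a1 (x $ 1) * v $ 1 * b (x $ 2) + a (x $ 1) * b1 (x $ 2) * v $ 2) *\<^sub>R w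
        + (a1' (x $ 1) * v $ 1 * b' (x $ 2) + a' (x $ 1) * b1' (x $ 2) * v $ 2) *\<^sub>R w')) (at x)" for x
    unfolding tensor_def
    by (rule has_derivative_eq_rhs)
      (rule has_derivative_add has_derivative_scaleR has_derivative_mult has_derivative_const D[OF assms(1)] D[OF assms(2)] D[OF assms(3)] D[OF assms(4)]
      | simp add: fun_eq_iff algebra_simps)+
  note d = frechet_derivative_at[OF this, symmetric]
  show "partial 1 (\<lambda>x. tensor a b w x + tensor a' b' w' x) = (\<lambda>x. tensor a1 b w x + tensor a1' b' w' x)"
    "partial 2 (\<lambda>x. tensor a b w x + tensor a' b' w' x) = (\<lambda>x. tensor a b1 w x + tensor a' b1' w' x)"
    unfolding partial_def[abs_def] d by (auto simp: fun_eq_iff axis_def tensor_def)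
qed

section \<open>Integrals and Borel representatives in the new coordinates\<close>

lemma QmPlus_lebesgue: "QmPlus \<in> sets borel" "QmPlus \<inter> space lebesgue \<in> sets lebesgue"
proof -
  have "open {x :: real^2. 0 < x $ 2}" by (intro open_Collect_less continuous_intros)
  then show b: "QmPlus \<in> sets borel" unfolding QmPlus_def half_plane_def by (intro borel_open open_Times) auto
  then show "QmPlus \<inter> space lebesgue \<in> sets lebesgue" by simp
qed

lemma event_components: "event (t, x $ 1, x $ 2) = (x, t)"
  by (simp add: event_def point_def vec_eq_iff forall_2)

lemma AE_lebesgue_on_QmPlus: "(AE z in lebesgue_on QmPlus. P z) \<longleftrightarrow> (AE z in lborel. z \<in> QmPlus \<longrightarrow> P z)"
  by (simp only: AE_restrict_space_iff[OF QmPlus_lebesgue(2)] AE_completion_iff)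

text \<open>\<open>F\<close> is known only up to null sets; by completeness of Lebesgue measure it
  inherits measurability from the Borel function \<open>G\<close>.\<close>

lemma set_integral_QmPlus:
  fixes F :: "(real^2) \<times> real \<Rightarrow> real"
  assumes "G \<in> borel_measurable borel"
    and "AE z in lborel. indicator QmPlus z * F z = G (event_coords z)"
  shows "(LINT z:QmPlus|lebesgue. F z) = (LBINT w. G w)"
proof -
  have m: "(\<lambda>z. G (event_coords z)) \<in> borel_measurable borel" using assms(1) by measurable
  have ae: "AE z in lebesgue. G (event_coords z) = indicator QmPlus z * F z"
    using AE_completion[OF assms(2)] by eventually_elim simp
  have ml: "(\<lambda>z. G (event_coords z)) \<in> borel_measurable lebesgue" by (rule measurable_completion) (use m in simp)
  have "(LINT z:QmPlus|lebesgue. F z) = (\<integral>z. G (event_coords z) \<partial>lebesgue)"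
    unfolding set_lebesgue_integral_def real_scaleR_def
    by (rule integral_cong_AE[OF borel_measurable_AE[OF ml ae] ml]) (use ae in eventually_elim, simp)
  also have "\<dots> = (LBINT z. G (event_coords z))" by (rule integral_completion) (use m in simp)
  also have "\<dots> = (\<integral>z. G (event_coords z) \<partial>distr lborel borel event)" by (simp add: distr_lborel_coords)
  also have "\<dots> = (LBINT w. G w)" by (subst integral_distr) (use m in auto)
  finally show ?thesis .
qed

text \<open>The bounds on \<open>f\<close> hold almost everywhere, whereas \<open>slicewise\<close>
  asks for all points and times. A Borel version is clamped to \<open>{-1..1}\<close> and set to 0
  off \<open>QmPlus\<close> and at the exceptional times at which the energy exceeds
  \<open>C\<close>.\<close>

lemma slicewise_representative:
  fixes f :: "(real^2) \<times> real \<Rightarrow> real"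
  assumes f: "f \<in> borel_measurable (lebesgue_on QmPlus)" "AE z in lebesgue_on QmPlus. \<bar>f z\<bar> \<le> 1"
    and C: "AE t in lebesgue_on {..<0}. (\<integral>\<^sup>+ x\<in>half_plane. ennreal ((f (x, t))\<^sup>2) \<partial>lebesgue) \<le> ennreal C" "0 \<le> C"
  obtains v where "slicewise v" "\<And>w. \<bar>v w\<bar> \<le> 1" "\<And>t x y. y \<le> 0 \<Longrightarrow> v (t, x, y) = 0"
    "AE z in lborel. v (event_coords z) = indicator QmPlus z * f z"
proof -
  define g where "g z = indicator QmPlus z * f z" for z
  have "g \<in> borel_measurable lebesgue"
    using f(1) borel_measurable_restrict_space_iff[OF QmPlus_lebesgue(2), of f] by (simp add: g_def[abs_def])
  then obtain h where h: "h \<in> borel_measurable lborel" "AE z in lborel. g z = h z"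
    using completion_ex_borel_measurable_real by blast
  have [measurable]: "h \<in> borel_measurable borel" using h(1) by simp
  define k where "k w = indicator {0<..} (snd (snd w)) * (indicator {..<0} (fst w) * max (- 1) (min 1 (h (event w))))" for w
  have k [measurable]: "k \<in> borel_measurable borel" unfolding k_def[abs_def] by measurable
  have k1: "\<bar>k w\<bar> \<le> 1" for w by (auto simp: k_def indicator_def)
  have kg: "AE z in lborel. k (event_coords z) = g z"
    using h(2) f(2)[unfolded AE_lebesgue_on_QmPlus]
  proof eventually_elim
    case (elim z)
    show ?case
    proof (cases "z \<in> QmPlus")
      case True
      then have "\<bar>h z\<bar> \<le> 1" using elim by (simp add: g_def)
      then have "max (- 1) (min 1 (h z)) = h z" by linarith
      then show ?thesis using True elim
        by (cases z) (simp add: k_def QmPlus_def half_plane_def event_coords_def coords_def event_components)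
    next
      case False
      then show ?thesis by (cases z) (auto simp: k_def g_def QmPlus_def half_plane_def event_coords_def coords_def)
    qed
  qed
  \<comment> \<open>The good times, a Borel set because the energy of a slice depends measurably on
    time. Almost every negative time belongs to it, so discarding the rest changes the function on a
    null set only.\<close>
  define T where "T = {t. (\<integral>\<^sup>+ p. ennreal ((k (t, p))\<^sup>2) \<partial>lborel) \<le> ennreal C}"
  have "(\<lambda>t. \<integral>\<^sup>+ p. ennreal ((k (t, p))\<^sup>2) \<partial>lborel) \<in> borel_measurable borel"
    by measurable
  then have [measurable]: "T \<in> sets borel" unfolding T_def by measurable
  define v where "v w = indicator T (fst w) * k w" for w
  have v [measurable]: "v \<in> borel_measurable borel" unfolding v_def[abs_def] by measurable
  have v1: "\<bar>v w\<bar> \<le> 1" for w using k1[of w] by (auto simp: v_def indicator_def)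
  have "sq_integrable lborel (\<lambda>p. v (t, p)) \<and> (LBINT p. (v (t, p))\<^sup>2) \<le> C" for t
  proof -
    have m: "(\<lambda>p. v (t, p)) \<in> borel_measurable lborel" by measurable
    have n: "(\<integral>\<^sup>+ p. ennreal ((v (t, p))\<^sup>2) \<partial>lborel) \<le> ennreal C"
      by (cases "t \<in> T") (auto simp: v_def T_def)
    have i: "integrable lborel (\<lambda>p. (v (t, p))\<^sup>2)"
      using m n by (intro integrableI_nonneg) (auto intro: le_less_trans)
    then show ?thesis using m n by (simp add: sq_integrable_def nn_integral_eq_integral C(2))
  qed
  then have "slicewise v" unfolding slicewise_def using v v1 by blast
  moreover have "v (t, x, y) = 0" if "y \<le> 0" for t x y using that by (simp add: v_def k_def)
  moreover have "AE z in lborel. v (event_coords z) = g z"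
  proof -
    have "AE w in lborel. k (event_coords (event w)) = g (event w)"
      by (rule AE_distrD[of event lborel borel]) (measurable, unfold distr_lborel_coords, rule kg)
    then have "AE w in lborel \<Otimes>\<^sub>M lborel. k w = g (event w)" unfolding lborel_prod by simp
    then have "AE t in lborel. AE p in lborel. k (t, p) = g (event (t, p))" by (rule lborel_pair.AE_pair)
    moreover have "AE t in lborel. t < 0 \<longrightarrow> (\<integral>\<^sup>+ x\<in>half_plane. ennreal ((f (x, t))\<^sup>2) \<partial>lebesgue) \<le> ennreal C"
      using C(1) by (subst (asm) AE_restrict_space_iff) (auto simp: AE_completion_iff)
    ultimately have "AE t in lborel. t < 0 \<longrightarrow> t \<in> T"
    proof eventually_elim
      case (elim t)
      show ?case
      proof
        assume t: "t < 0"
        have ae: "AE x in lborel. k (t, coords x) = g (x, t)"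
          using AE_distrD[of coords lborel borel "\<lambda>p. k (t, p) = g (event (t, p))"] elim(1)
          unfolding distr_lborel_coords by (simp add: event_def)
        have "(\<integral>\<^sup>+ p. ennreal ((k (t, p))\<^sup>2) \<partial>lborel) = (\<integral>\<^sup>+ p. ennreal ((k (t, p))\<^sup>2) \<partial>distr lborel borel coords)"
          by (simp add: distr_lborel_coords)
        also have "\<dots> = (\<integral>\<^sup>+ x. ennreal ((k (t, coords x))\<^sup>2) \<partial>lborel)"
          by (subst nn_integral_distr) auto
        also have "\<dots> = (\<integral>\<^sup>+ x. ennreal ((g (x, t))\<^sup>2) \<partial>lborel)"
          by (intro nn_integral_cong_AE) (use ae in eventually_elim, simp)
        also have "\<dots> = (\<integral>\<^sup>+ x\<in>half_plane. ennreal ((f (x, t))\<^sup>2) \<partial>lebesgue)"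
          unfolding nn_integral_completion using t
          by (intro nn_integral_cong) (auto simp: g_def QmPlus_def indicator_def)
        finally show "t \<in> T" using elim(2) t by (simp add: T_def)
      qed
    qed
    then have "AE w in lborel. fst w < 0 \<longrightarrow> fst (w :: real \<times> real \<times> real) \<in> T"
      by (intro AE_lborel_pairI(1)) auto
    then have "AE z in lborel. snd z < 0 \<longrightarrow> snd (z :: (real^2) \<times> real) \<in> T"
      using AE_distrD[of event_coords lborel borel "\<lambda>w. fst w < 0 \<longrightarrow> fst w \<in> T"] unfolding distr_lborel_coords by (simp add: event_coords_def)
    with kg show ?thesis
    proof eventually_elim
      case (elim z)
      then show ?case by (cases z) (auto simp: v_def k_def g_def QmPlus_def event_coords_def indicator_def)
    qed
  qed
  ultimately show thesis using that v1 unfolding g_def by blast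
qed

theorem theorem1p1:
  fixes u :: "(real^2) \<times> real \<Rightarrow> real^2"
  assumes "mild_bounded_ancient_solution u"
    and "L2_infty u"
  shows "AE z in lebesgue_on QmPlus. u z = 0"
proof -
  obtain p where u: "u \<in> borel_measurable (lebesgue_on QmPlus)" "AE z in lebesgue_on QmPlus. norm (u z) \<le> 1"
    and p: "weak_navier_stokes u p"
    using assms(1) unfolding mild_bounded_ancient_solution_def by blast
  define E where "E t = (\<integral>\<^sup>+ x\<in>half_plane. ennreal ((norm (u (x, t)))\<^sup>2) \<partial>lebesgue)" for t
  have "esssup (lebesgue_on {..<0}) E < \<infinity>" using assms(2) by (simp add: L2_infty_def E_def[abs_def])
  then obtain C where C: "0 \<le> C" "esssup (lebesgue_on {..<0}) E = ennreal C"
    by (cases "esssup (lebesgue_on {..<0}) E") auto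
  have rep: "\<exists>v. slicewise v \<and> (\<forall>w. \<bar>v w\<bar> \<le> 1) \<and> (\<forall>t x y. y \<le> 0 \<longrightarrow> v (t, x, y) = 0) \<and>
    (AE z in lborel. v (event_coords z) = indicator QmPlus z * u z $ i)" for i
  proof -
    have m: "(\<lambda>z. u z $ i) \<in> borel_measurable (lebesgue_on QmPlus)"
      by (rule measurable_compose[OF u(1)]) (intro borel_measurable_continuous_onI continuous_intros)
    have le: "AE z in lebesgue_on QmPlus. \<bar>u z $ i\<bar> \<le> 1"
      using u(2) by eventually_elim (rule order_trans[OF component_le_norm_cart])
    have e: "AE t in lebesgue_on {..<0}. (\<integral>\<^sup>+ x\<in>half_plane. ennreal ((u (x, t) $ i)\<^sup>2) \<partial>lebesgue) \<le> ennreal C"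
      using esssup_AE[of E "lebesgue_on {..<0}"]
    proof eventually_elim
      case (elim t)
      have "(\<integral>\<^sup>+ x\<in>half_plane. ennreal ((u (x, t) $ i)\<^sup>2) \<partial>lebesgue) \<le> E t" unfolding E_def
        by (intro nn_integral_mono mult_right_mono ennreal_leI) (auto simp: component_le_norm_cart abs_le_square_iff[symmetric])
      then show ?case using elim C(2) by simp
    qed
    show ?thesis by (rule slicewise_representative[OF m le e C(1)]) blast
  qed
  obtain v1 where "slicewise v1 \<and> (\<forall>w. \<bar>v1 w\<bar> \<le> 1) \<and> (\<forall>t x y. y \<le> 0 \<longrightarrow> v1 (t, x, y) = 0) \<and>
    (AE z in lborel. v1 (event_coords z) = indicator QmPlus z * u z $ 1)"
    using rep[of 1] by (elim exE) (rule that)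
  then have v1: "slicewise v1" "\<And>w. \<bar>v1 w\<bar> \<le> 1" "\<And>t x y. y \<le> 0 \<Longrightarrow> v1 (t, x, y) = 0"
      "AE z in lborel. v1 (event_coords z) = indicator QmPlus z * u z $ 1" by blast+
  obtain v2 where "slicewise v2 \<and> (\<forall>w. \<bar>v2 w\<bar> \<le> 1) \<and> (\<forall>t x y. y \<le> 0 \<longrightarrow> v2 (t, x, y) = 0) \<and>
    (AE z in lborel. v2 (event_coords z) = indicator QmPlus z * u z $ 2)"
    using rep[of 2] by (elim exE) (rule that)
  then have v2: "slicewise v2" "\<And>w. \<bar>v2 w\<bar> \<le> 1" "\<And>t x y. y \<le> 0 \<Longrightarrow> v2 (t, x, y) = 0"
      "AE z in lborel. v2 (event_coords z) = indicator QmPlus z * u z $ 2" by blast+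
  note [measurable] = slicewiseD(1)[OF v1(1)] slicewiseD(1)[OF v2(1)]
  interpret half_plane_flow v1 v2
  proof
    fix a b c :: "real \<Rightarrow> real" and R :: real
    assume t: "test_fun a" "test_fun c" "test_fun b" and R: "R < 0" "\<And>t. R \<le> t \<Longrightarrow> c t = 0"
    note D = smoothD(1)[OF conjunct1[OF t(1)[unfolded test_fun_def]]] smoothD(1)[OF conjunct1[OF t(3)[unfolded test_fun_def]]]
    have [measurable]: "a \<in> borel_measurable borel" "b \<in> borel_measurable borel" "c \<in> borel_measurable borel"
      "deriv a \<in> borel_measurable borel" "deriv b \<in> borel_measurable borel"
      using t by (auto intro!: test_fun_measurable test_fun_deriv)
    \<comment> \<open>The second summand is zero; it merely brings \<open>q\<close> into the form
      treated by \<open>test_function_tensor\<close>.\<close>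
    define q :: "(real^2) \<times> real \<Rightarrow> real" where "q z = tensor a b (c (snd z) *\<^sub>R 1) (fst z) + tensor a b (c (snd z) *\<^sub>R 0) (fst z)" for z
    have q: "test_function Qm q" unfolding q_def[abs_def] by (rule test_function_tensor[OF t(1,3,2,1,3,2) R R(2)])
    have g: "u (x, t) \<bullet> grad (\<lambda>y. q (y, t)) x = u (x, t) $ 1 * (deriv a (x $ 1) * c t * b (x $ 2)) + u (x, t) $ 2 * (a (x $ 1) * c t * deriv b (x $ 2))" for x t
      unfolding q_def[abs_def] fst_conv snd_conv inner_vec_def grad_def
      by (simp add: sum_2 partial_tensor[OF D D]) (simp add: tensor_def)
    have "0 = (LINT (x, t):QmPlus|lebesgue. u (x, t) \<bullet> grad (\<lambda>y. q (y, t)) x)"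
      by (rule p[unfolded weak_navier_stokes_def, THEN conjunct2, THEN conjunct2, rule_format, OF q, symmetric])
    also have "\<dots> = (LBINT w. (case w of (t, x, y) \<Rightarrow> v1 (t, x, y) * (deriv a x * c t * b y) + v2 (t, x, y) * (a x * c t * deriv b y)))"
    proof (rule set_integral_QmPlus)
      show "AE z in lborel. indicator QmPlus z * (case z of (x, t) \<Rightarrow> u (x, t) \<bullet> grad (\<lambda>y. q (y, t)) x)
        = (case event_coords z of (t, x, y) \<Rightarrow> v1 (t, x, y) * (deriv a x * c t * b y) + v2 (t, x, y) * (a x * c t * deriv b y))"
        using v1(4) v2(4)
        by eventually_elim (auto simp: g event_coords_def coords_def indicator_def split: prod.splits)
    qed measurable
    finally show "(LBINT (t, x, y). v1 (t, x, y) * (deriv a x * c t * b y) + v2 (t, x, y) * (a x * c t * deriv b y)) = 0" by simp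
  next
    fix a a1 a2 a3 c c1 b b1 b2 b3 :: "real \<Rightarrow> real" and R :: real
    assume t: "test_fun a" "test_fun c" "test_fun b" and R: "R < 0" "\<And>t. R \<le> t \<Longrightarrow> c t = 0"
      and da: "\<And>x. (a has_real_derivative a1 x) (at x)" "\<And>x. (a1 has_real_derivative a2 x) (at x)" "\<And>x. (a2 has_real_derivative a3 x) (at x)"
      and dc: "\<And>x. (c has_real_derivative c1 x) (at x)"
      and db: "\<And>y. (b has_real_derivative b1 y) (at y)" "\<And>y. (b1 has_real_derivative b2 y) (at y)" "\<And>y. (b2 has_real_derivative b3 y) (at y)"
      and b0: "b 0 = 0" "b1 0 = 0"
    have T: "test_fun g" if "test_fun f" "\<And>x. (f has_real_derivative g x) (at x)" for f g
    proof -
      have "g = deriv f" using DERIV_imp_deriv[OF that(2)] by (simp add: fun_eq_iff)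
      then show ?thesis using test_fun_deriv[OF that(1)] by simp
    qed
    have t': "test_fun a1" "test_fun a2" "test_fun a3" "test_fun c1" "test_fun b1" "test_fun b2" "test_fun b3"
      using T[OF t(1) da(1)] T[OF T[OF t(1) da(1)] da(2)] T[OF T[OF T[OF t(1) da(1)] da(2)] da(3)] T[OF t(2) dc]
        T[OF t(3) db(1)] T[OF T[OF t(3) db(1)] db(2)] T[OF T[OF T[OF t(3) db(1)] db(2)] db(3)] by simp_all
    note [measurable] = test_fun_measurable[OF t(1)] test_fun_measurable[OF t(2)] test_fun_measurable[OF t(3)]
      t'[THEN test_fun_measurable]
    \<comment> \<open>Being built from \<open>b1\<close> in the first component and \<open>b\<close>
      in the second, the field vanishes at the wall exactly by the two conditions at 0 in
      \<open>b0\<close>.\<close>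
    define \<phi> :: "(real^2) \<times> real \<Rightarrow> real^2" where
      "\<phi> z = tensor a b1 (c (snd z) *\<^sub>R axis 1 1) (fst z) + tensor a1 b (c (snd z) *\<^sub>R - axis 2 1) (fst z)" for z
    define M where "M w = (case w of (t, x, y) \<Rightarrow> v1 (t, x, y) * (a x * c1 t * b1 y + a2 x * c t * b1 y + a x * c t * b3 y)
        - v2 (t, x, y) * (a1 x * c1 t * b y + a3 x * c t * b y + a1 x * c t * b2 y)
        + ((v1 (t, x, y))\<^sup>2 - (v2 (t, x, y))\<^sup>2) * (a1 x * c t * b1 y)
        + v1 (t, x, y) * v2 (t, x, y) * (a x * c t * b2 y - a2 x * c t * b y))" for w
    have q: "test_function Qm \<phi>" unfolding \<phi>_def[abs_def] by (rule test_function_tensor[OF t(1) t'(5) t(2) t'(1) t(3) t(2) R R(2)])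
    have \<phi>0: "\<phi> (x, s) = 0" if "x $ 2 = 0" for x s using that b0 by (simp add: \<phi>_def tensor_def)
    have pd: "partial 1 (\<lambda>y. \<phi> (y, s)) = (\<lambda>x. tensor a1 b1 (c s *\<^sub>R axis 1 1) x + tensor a2 b (c s *\<^sub>R - axis 2 1) x)"
      "partial 2 (\<lambda>y. \<phi> (y, s)) = (\<lambda>x. tensor a b2 (c s *\<^sub>R axis 1 1) x + tensor a1 b1 (c s *\<^sub>R - axis 2 1) x)" for s
      unfolding \<phi>_def fst_conv snd_conv using da db by (auto intro!: partial_tensor)
    have pdd: "partial 1 (partial 1 (\<lambda>y. \<phi> (y, s))) = (\<lambda>x. tensor a2 b1 (c s *\<^sub>R axis 1 1) x + tensor a3 b (c s *\<^sub>R - axis 2 1) x)"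
      "partial 2 (partial 2 (\<lambda>y. \<phi> (y, s))) = (\<lambda>x. tensor a b3 (c s *\<^sub>R axis 1 1) x + tensor a1 b2 (c s *\<^sub>R - axis 2 1) x)" for s
      unfolding pd using da db by (auto intro!: partial_tensor)
    have dt: "vector_derivative (\<lambda>s. \<phi> (x, s)) (at s) = tensor a b1 (c1 s *\<^sub>R axis 1 1) x + tensor a1 b (c1 s *\<^sub>R - axis 2 1) x" for x s
      unfolding \<phi>_def fst_conv snd_conv tensor_def
      by (intro vector_derivative_at has_vector_derivative_add bounded_linear.has_vector_derivative[OF bounded_linear_scaleR_right]
          bounded_linear.has_vector_derivative[OF bounded_linear_scaleR_left] dc[unfolded has_real_derivative_iff_has_vector_derivative])
    \<comment> \<open>The two terms of the divergence, a1 b1 c and - a1 b1 c, cancel. In the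
      quadratic part the diagonal entries meet the same two terms, which leaves the difference of
      the squares.\<close>
    have g: "u (x, s) \<bullet> (vector_derivative (\<lambda>s. \<phi> (x, s)) (at s) + laplacian (\<lambda>y. \<phi> (y, s)) x)
           + (\<Sum>i\<in>UNIV. \<Sum>j\<in>UNIV. u (x, s) $ i * u (x, s) $ j * partial j (\<lambda>y. \<phi> (y, s)) x $ i)
           + p (x, s) * divergence (\<lambda>y. \<phi> (y, s)) x
      = u (x, s) $ 1 * (a (x $ 1) * c1 s * b1 (x $ 2) + a2 (x $ 1) * c s * b1 (x $ 2) + a (x $ 1) * c s * b3 (x $ 2))
        - u (x, s) $ 2 * (a1 (x $ 1) * c1 s * b (x $ 2) + a3 (x $ 1) * c s * b (x $ 2) + a1 (x $ 1) * c s * b2 (x $ 2))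
        + ((u (x, s) $ 1)\<^sup>2 - (u (x, s) $ 2)\<^sup>2) * (a1 (x $ 1) * c s * b1 (x $ 2))
        + u (x, s) $ 1 * u (x, s) $ 2 * (a (x $ 1) * c s * b2 (x $ 2) - a2 (x $ 1) * c s * b (x $ 2))" for x s
      unfolding laplacian_def divergence_def sum_2 dt pdd unfolding pd
      by (simp add: inner_vec_def sum_2 tensor_def axis_def power2_eq_square algebra_simps)
    have "0 = (LINT (x, t):QmPlus|lebesgue. u (x, t) \<bullet> (vector_derivative (\<lambda>s. \<phi> (x, s)) (at t) + laplacian (\<lambda>y. \<phi> (y, t)) x)
           + (\<Sum>i\<in>UNIV. \<Sum>j\<in>UNIV. u (x, t) $ i * u (x, t) $ j * partial j (\<lambda>y. \<phi> (y, t)) x $ i)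
           + p (x, t) * divergence (\<lambda>y. \<phi> (y, t)) x)"
      by (rule p[unfolded weak_navier_stokes_def, THEN conjunct2, THEN conjunct1, rule_format, symmetric]) (use q \<phi>0 in auto)
    also have "\<dots> = (LBINT w. M w)"
    proof (rule set_integral_QmPlus)
      show "AE z in lborel. indicator QmPlus z * (case z of (x, t) \<Rightarrow> u (x, t) \<bullet> (vector_derivative (\<lambda>s. \<phi> (x, s)) (at t) + laplacian (\<lambda>y. \<phi> (y, t)) x)
           + (\<Sum>i\<in>UNIV. \<Sum>j\<in>UNIV. u (x, t) $ i * u (x, t) $ j * partial j (\<lambda>y. \<phi> (y, t)) x $ i)
           + p (x, t) * divergence (\<lambda>y. \<phi> (y, t)) x) = M (event_coords z)"
        using v1(4) v2(4) unfolding g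
        by eventually_elim (auto simp: M_def event_coords_def coords_def indicator_def split: prod.splits)
      show "M \<in> borel_measurable borel" unfolding M_def[abs_def] by measurable
    qed
    finally show "(LBINT (t, x, y). v1 (t, x, y) * (a x * c1 t * b1 y + a2 x * c t * b1 y + a x * c t * b3 y)
        - v2 (t, x, y) * (a1 x * c1 t * b y + a3 x * c t * b y + a1 x * c t * b2 y)
        + ((v1 (t, x, y))\<^sup>2 - (v2 (t, x, y))\<^sup>2) * (a1 x * c t * b1 y)
        + v1 (t, x, y) * v2 (t, x, y) * (a x * c t * b2 y - a2 x * c t * b y)) = 0"
      by (simp add: M_def[abs_def])
  qed (use v1(1-3) v2(1-3) in auto)
  have "AE z in lborel. fst (event_coords z) \<le> 0 \<longrightarrow> v1 (event_coords z) = 0 \<and> v2 (event_coords z) = 0"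
    by (rule AE_distrD[of event_coords lborel borel]) (measurable, unfold distr_lborel_coords, rule flow_eq_0)
  then have "AE z in lborel. z \<in> QmPlus \<longrightarrow> u z = 0"
    using v1(4) v2(4)
    by eventually_elim (auto simp: QmPlus_def event_coords_def indicator_def vec_eq_iff forall_2)
  then show ?thesis by (simp only: AE_lebesgue_on_QmPlus)
qed

end
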